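(* For every $\alpha\in\mathcal A_M^\ell$, the solution component $u=u(\cdot,\cdot;\alpha)$ of the Fokker--Planck--Darcy system satisfies $$u(x,t)\ge c_0:=b\,e^{-\Lambda_2T}\qquad\text{for all }x\in\Omega\text{ and }t\in[0,T],$$ where $c_0>0$ and $\Lambda_2=\frac1a(M\Lambda_1+C_\infty)$ is the constant defined in the context (an upper bound for $\|\Delta\varphi\|_{L^\infty(0,T;L^\infty(\Omega))}$, uniform over $\alpha\in\mathcal A_M^\ell$).
   Context: Let $d\in\{1,2,3\}$, let $\Omega\subset\mathbb R^d$ be a bounded domain with $\mathcal C^\infty$ boundary and outward unit normal $\nu$, let $\sigma>0$, let $a,b,B,M>0$, and let $\ell\ge4$ be an integer. The admissible set of permittivities is $$\mathcal A_M^\ell=\{\alpha\in W^{\ell,\infty}(\Omega)\colon\alpha\ge a,\ \|\alpha\|_{W^{\ell,\infty}(\Omega)}\le M\}$$ ($W^{k,\infty}$ norms normalized so that $\|\nabla g\|_{L^\infty(\Omega)}\le\|g\|_{W^{k,\infty}(\Omega)}$ for $k\ge1$). The initial datum $u_0\in\mathcal C^\infty(\bar\Omega)$ satisfies $b\le u_0\le B$ on $\bar\Omega$ and $\|u_0\|_{L^1(\Omega)}=1$. For $\alpha\in\mathcal A_M^\ell$, $(u,\varphi)$ is the unique weak solution of the Fokker--Planck--Darcy system $$\partial_t u=\sigma^2\Delta u+\nabla\cdot(u\nabla\varphi),\qquad -\nabla\cdot(\alpha\nabla\varphi)=u\qquad\text{in }\Omega\times(0,T),$$ $$\sigma^2\frac{\partial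 u}{\partial\nu}+u\frac{\partial\varphi}{\partial\nu}=0,\qquad\varphi=0\qquad\text{on }\partial\Omega\times(0,T),\qquad u(\cdot,0)=u_0\ \text{in }\Omega,$$ with $u\in L^\infty(0,T;L^2(\Omega))\cap L^2(0,T;H^1(\Omega))$, $\varphi\in L^\infty(0,T;H^2(\Omega))\cap L^2(0,T;H^3(\Omega))$, $u\ge0$ and $\|u(\cdot,t)\|_{L^1(\Omega)}=1$; $u$ is identified with its continuous representative. Throughout $0<T\le T^*$, where $T^*>0$ depends only on $\|u_0\|_{L^2(\Omega)},a,M,\sigma,\Omega,d$ and is the existence time from the fixed-point construction of the solution: for every $\alpha\in\mathcal A_M^\ell$ the solution exists on $[0,T^*]$ and for $T\le T^*$ it satisfies $\|u\|_{L^4(0,T;L^2(\Omega))}\le2\|u_0\|_{L^2(\Omega)}$. Constants: $C_\infty>0$ and $\Lambda_1>0$ are constants, independent of $\alpha\in\mathcal A_M^\ell$ and depending only on $a,b,B,M,\sigma,T,\Omega,u_0$, such that $\|u\|_{L^\infty(0,T;L^\infty(\Omega))}\le C_\infty$ and $\|\varphi\|_{L^\infty(0,T;W^{1,\infty}(\Omega))}\le\Lambda_1$ for all $\alpha\in\mathcal A_M^\ell$. With $\Lambda_2:=\frac1a(M\Lambda_1+C_\infty)$ one has $\|\Delta\varphi\|_{L^\infty(0,T;L^\infty(\Omega))}\le\Lambda_2$. *)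

theory Defs
  imports "HOL-Analysis.Analysis" "HOL-Probability.Essential_Supremum"
begin

section \<open>Smooth functions and smooth domains\<close>

text \<open>Iterated partial derivatives. A multi-index is represented by a list of coordinate
  directions, i.e. of elements of \<^term>\<open>Basis\<close>.\<close>

fun pderivs :: "'a::euclidean_space list \<Rightarrow> ('a \<Rightarrow> real) \<Rightarrow> 'a \<Rightarrow> real" where
  "pderivs [] f = f"
| "pderivs (i # ds) f = (\<lambda>x. frechet_derivative (pderivs ds f) (at x) i)"

text \<open>Meant for open \<^term>\<open>S\<close> only: there, differentiability of all iterated partial derivatives
  is the same as being of class \<open>C\<^sup>\<infinity>\<close>.\<close>

definition smooth_on :: "'a::euclidean_space set \<Rightarrow> ('a \<Rightarrow> real) \<Rightarrow> bool" where
  "smooth_on S f \<longleftrightarrow> (\<forall>ds\<in>lists Basis. \<forall>x\<in>S. pderivs ds f differentiable (at x))"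

text \<open>The space \<open>C\<^sup>\<infinity>\<close> of the closure of an open set: all derivatives taken in the open set extend
  continuously to the closure.\<close>

definition smooth_up_to_boundary :: "'a::euclidean_space set \<Rightarrow> ('a \<Rightarrow> real) \<Rightarrow> bool" where
  "smooth_up_to_boundary \<Omega> f \<longleftrightarrow>
     continuous_on (closure \<Omega>) f \<and> smooth_on \<Omega> f \<and>
     (\<forall>ds\<in>lists Basis. \<exists>g. continuous_on (closure \<Omega>) g \<and> (\<forall>x\<in>\<Omega>. g x = pderivs ds f x))"

text \<open>Near each boundary point the set is, after a rotation taking the last coordinate axis to
  \<^term>\<open>e\<close>, the strict supergraph of a smooth function \<^term>\<open>\<gamma>\<close> of the other coordinates.\<close>

definition smooth_boundary :: "'a::euclidean_space set \<Rightarrow> bool" where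
  "smooth_boundary \<Omega> \<longleftrightarrow>
     (\<forall>p\<in>frontier \<Omega>. \<exists>r>0. \<exists>e \<gamma>. norm e = 1 \<and> smooth_on UNIV \<gamma> \<and>
        (\<forall>x s. \<gamma> (x + s *\<^sub>R e) = \<gamma> x) \<and>
        \<Omega> \<inter> ball p r = {x \<in> ball p r. x \<bullet> e > \<gamma> x})"

definition test_functions :: "'a::euclidean_space set \<Rightarrow> ('a \<Rightarrow> real) set" where
  "test_functions \<Omega> =
     {\<zeta>. smooth_on UNIV \<zeta> \<and> (\<exists>K. compact K \<and> K \<subseteq> \<Omega> \<and> (\<forall>x. x \<notin> K \<longrightarrow> \<zeta> x = 0))}"


section \<open>Lebesgue and Sobolev spaces\<close>

text \<open>Elements of function spaces are functions, not equivalence classes; all notions below are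
  invariant under changes on null sets.\<close>

definition Lp_space :: "ennreal \<Rightarrow> 'b measure \<Rightarrow> ('b \<Rightarrow> real) set" where
  "Lp_space p M =
     (if p = \<infinity> then {f \<in> borel_measurable M. esssup M (\<lambda>x. ereal \<bar>f x\<bar>) < \<infinity>}
      else {f \<in> borel_measurable M. integrable M (\<lambda>x. \<bar>f x\<bar> powr enn2real p)})"

text \<open>Only meaningful for members of \<^const>\<open>Lp_space\<close>.\<close>

definition Lp_norm :: "ennreal \<Rightarrow> 'b measure \<Rightarrow> ('b \<Rightarrow> real) \<Rightarrow> real" where
  "Lp_norm p M f =
     (if p = \<infinity> then real_of_ereal (esssup M (\<lambda>x. ereal \<bar>f x\<bar>))
      else (LINT x|M. \<bar>f x\<bar> powr enn2real p) powr (1 / enn2real p))"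

definition locally_integrable :: "'a::euclidean_space set \<Rightarrow> ('a \<Rightarrow> real) \<Rightarrow> bool" where
  "locally_integrable \<Omega> f \<longleftrightarrow> (\<forall>K. compact K \<and> K \<subseteq> \<Omega> \<longrightarrow> set_integrable lebesgue K f)"

definition has_weak_deriv ::
    "'a::euclidean_space set \<Rightarrow> 'a list \<Rightarrow> ('a \<Rightarrow> real) \<Rightarrow> ('a \<Rightarrow> real) \<Rightarrow> bool" where
  "has_weak_deriv \<Omega> ds f g \<longleftrightarrow>
     locally_integrable \<Omega> f \<and> locally_integrable \<Omega> g \<and>
     (\<forall>\<zeta>\<in>test_functions \<Omega>.
        (LINT x|lebesgue_on \<Omega>. f x * pderivs ds \<zeta> x)
          = (-1) ^ length ds * (LINT x|lebesgue_on \<Omega>. g x * \<zeta> x))"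

text \<open>Determined up to a null set when a weak derivative exists.\<close>

definition weak_deriv ::
    "'a::euclidean_space set \<Rightarrow> 'a list \<Rightarrow> ('a \<Rightarrow> real) \<Rightarrow> 'a \<Rightarrow> real" where
  "weak_deriv \<Omega> ds f = (SOME g. has_weak_deriv \<Omega> ds f g)"

definition wgrad :: "'a::euclidean_space set \<Rightarrow> ('a \<Rightarrow> real) \<Rightarrow> 'a \<Rightarrow> 'a" where
  "wgrad \<Omega> f x = (\<Sum>i\<in>Basis. weak_deriv \<Omega> [i] f x *\<^sub>R i)"

definition sobolev :: "nat \<Rightarrow> ennreal \<Rightarrow> 'a::euclidean_space set \<Rightarrow> ('a \<Rightarrow> real) set" where
  "sobolev k p \<Omega> =
     {f. \<forall>ds\<in>lists Basis. length ds \<le> k \<longrightarrow>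
           (\<exists>g\<in>Lp_space p (lebesgue_on \<Omega>). has_weak_deriv \<Omega> ds f g)}"

text \<open>Pointwise Euclidean norm of the tensor of all weak derivatives of order \<^term>\<open>j\<close>.\<close>

definition deriv_norm :: "'a::euclidean_space set \<Rightarrow> nat \<Rightarrow> ('a \<Rightarrow> real) \<Rightarrow> 'a \<Rightarrow> real" where
  "deriv_norm \<Omega> j f x = sqrt (\<Sum>ds\<in>{ds \<in> lists Basis. length ds = j}. (weak_deriv \<Omega> ds f x)\<^sup>2)"

definition sobolev_norm ::
    "nat \<Rightarrow> ennreal \<Rightarrow> 'a::euclidean_space set \<Rightarrow> ('a \<Rightarrow> real) \<Rightarrow> real" where
  "sobolev_norm k p \<Omega> f = (\<Sum>j\<le>k. Lp_norm p (lebesgue_on \<Omega>) (deriv_norm \<Omega> j f))"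

text \<open>With this normalization the norm of \<open>W\<^sup>k\<^sup>,\<^sup>\<infinity>\<close>, \<open>k \<ge> 1\<close>, dominates the
  supremum norm of the gradient.\<close>

lemma Lp_norm_nonneg: "0 \<le> Lp_norm p M f"
proof (cases "p = \<infinity> \<and> (\<lambda>x. ereal \<bar>f x\<bar>) \<in> borel_measurable M \<and> ae_filter M \<noteq> bot")
  case True
  then have "0 \<le> esssup M (\<lambda>x. ereal \<bar>f x\<bar>)"
    unfolding esssup_def by (auto intro!: le_Limsup)
  then show ?thesis
    using True by (simp add: Lp_norm_def real_of_ereal_pos)
qed (auto simp: Lp_norm_def esssup_def top_ereal_def bot_ereal_def)

lemma norm_wgrad: "norm (wgrad \<Omega> f x) = deriv_norm \<Omega> 1 f x"
proof -
  have lists1: "{ds \<in> lists Basis. length ds = 1} = (\<lambda>i. [i]) ` (Basis :: 'a set)"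
    by (auto simp: length_Suc_conv)
  have "norm (wgrad \<Omega> f x) = sqrt (\<Sum>i\<in>Basis. (wgrad \<Omega> f x \<bullet> i)\<^sup>2)"
    by (simp add: euclidean_dist_l2[of _ 0, simplified] norm_conv_dist L2_set_def)
  also have "\<dots> = sqrt (\<Sum>i\<in>Basis. (weak_deriv \<Omega> [i] f x)\<^sup>2)"
    by (simp add: wgrad_def inner_sum_left_Basis)
  also have "\<dots> = deriv_norm \<Omega> 1 f x"
    unfolding deriv_norm_def lists1 by (subst sum.reindex) (auto simp: inj_on_def)
  finally show ?thesis .
qed

lemma norm_wgrad_le_sobolev_norm:
  assumes "k \<ge> 1"
  shows "Lp_norm \<infinity> (lebesgue_on \<Omega>) (\<lambda>x. norm (wgrad \<Omega> f x)) \<le> sobolev_norm k \<infinity> \<Omega> f"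
  unfolding sobolev_norm_def norm_wgrad
  by (rule member_le_sum[where f = "\<lambda>j. Lp_norm \<infinity> (lebesgue_on \<Omega>) (deriv_norm \<Omega> j f)"])
    (use assms in \<open>auto intro: Lp_norm_nonneg\<close>)

abbreviation H_space :: "nat \<Rightarrow> 'a::euclidean_space set \<Rightarrow> ('a \<Rightarrow> real) set" where
  "H_space k \<Omega> \<equiv> sobolev k 2 \<Omega>"

definition H10 :: "'a::euclidean_space set \<Rightarrow> ('a \<Rightarrow> real) set" where
  "H10 \<Omega> = {f \<in> H_space 1 \<Omega>. \<exists>\<zeta>. (\<forall>n. \<zeta> n \<in> test_functions \<Omega>) \<and>
              (\<lambda>n. sobolev_norm 1 2 \<Omega> (\<lambda>x. \<zeta> n x - f x)) \<longlonglongrightarrow> 0}"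


section \<open>Functions of time with values in a function space\<close>

text \<open>Throughout, \<^term>\<open>X\<close> is a function space with norm \<^term>\<open>N\<close>, and \<^term>\<open>v t\<close> is the
  function \<open>v(\<cdot>, t)\<close>.\<close>

definition strongly_measurable ::
    "real \<Rightarrow> ('a \<Rightarrow> real) set \<Rightarrow> (('a \<Rightarrow> real) \<Rightarrow> real) \<Rightarrow> (real \<Rightarrow> 'a \<Rightarrow> real) \<Rightarrow> bool" where
  "strongly_measurable T X N v \<longleftrightarrow>
     (\<exists>s :: nat \<Rightarrow> real \<Rightarrow> 'a \<Rightarrow> real.
        (\<forall>n. simple_function (lebesgue_on {0..T}) (s n) \<and> s n ` {0..T} \<subseteq> X) \<and>
        (AE t in lebesgue_on {0..T}. (\<lambda>n. N (\<lambda>x. s n t x - v t x)) \<longlonglongrightarrow> 0))"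

text \<open>Finiteness of the norm of \<open>L\<^sup>p(0,T;X)\<close>, without strong measurability into \<^term>\<open>X\<close>; the
  bounds in \<open>L\<^sup>\<infinity>(0,T;X)\<close> for nonseparable \<^term>\<open>X\<close> are understood in this sense.\<close>

definition time_Lp ::
    "ennreal \<Rightarrow> real \<Rightarrow> ('a \<Rightarrow> real) set \<Rightarrow> (('a \<Rightarrow> real) \<Rightarrow> real) \<Rightarrow> (real \<Rightarrow> 'a \<Rightarrow> real) set" where
  "time_Lp p T X N =
     {v. (AE t in lebesgue_on {0..T}. v t \<in> X) \<and>
         (\<lambda>t. N (v t)) \<in> Lp_space p (lebesgue_on {0..T})}"

definition time_Lp_norm ::
    "ennreal \<Rightarrow> real \<Rightarrow> (('a \<Rightarrow> real) \<Rightarrow> real) \<Rightarrow> (real \<Rightarrow> 'a \<Rightarrow> real) \<Rightarrow> real" where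
  "time_Lp_norm p T N v = Lp_norm p (lebesgue_on {0..T}) (\<lambda>t. N (v t))"

definition bochner_Lp ::
    "ennreal \<Rightarrow> real \<Rightarrow> ('a \<Rightarrow> real) set \<Rightarrow> (('a \<Rightarrow> real) \<Rightarrow> real) \<Rightarrow> (real \<Rightarrow> 'a \<Rightarrow> real) set" where
  "bochner_Lp p T X N = {v \<in> time_Lp p T X N. strongly_measurable T X N v}"


section \<open>The Fokker--Planck--Darcy system\<close>

definition admissible_set ::
    "'a::euclidean_space set \<Rightarrow> real \<Rightarrow> real \<Rightarrow> nat \<Rightarrow> ('a \<Rightarrow> real) set" where
  "admissible_set \<Omega> a M l =
     {\<alpha> \<in> sobolev l \<infinity> \<Omega>. (AE x in lebesgue_on \<Omega>. \<alpha> x \<ge> a) \<and> sobolev_norm l \<infinity> \<Omega> \<alpha> \<le> M}"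

text \<open>The Dirichlet condition on \<open>\<phi>\<close> is membership in \<^const>\<open>H10\<close>. The no-flux condition on \<open>u\<close> is
  natural: the spatial test functions \<open>w\<close> range over all of \<open>H\<^sup>1\<close>. The last conjunct says
  that, tested against \<open>w\<close>, the time derivative of \<open>u\<close> in the sense of distributions with values in
  the dual of \<open>H\<^sup>1\<close> is minus the flux term, with initial value \<open>u\<^sub>0\<close>.\<close>

definition weak_solution ::
    "'a::euclidean_space set \<Rightarrow> real \<Rightarrow> ('a \<Rightarrow> real) \<Rightarrow> ('a \<Rightarrow> real) \<Rightarrow> real \<Rightarrow>
     (real \<Rightarrow> 'a \<Rightarrow> real) \<Rightarrow> (real \<Rightarrow> 'a \<Rightarrow> real) \<Rightarrow> bool" where
  "weak_solution \<Omega> \<sigma> \<alpha> u\<^sub>0 T u \<phi> \<longleftrightarrow>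
     u \<in> bochner_Lp \<infinity> T (Lp_space 2 (lebesgue_on \<Omega>)) (Lp_norm 2 (lebesgue_on \<Omega>)) \<and>
     u \<in> bochner_Lp 2 T (H_space 1 \<Omega>) (sobolev_norm 1 2 \<Omega>) \<and>
     \<phi> \<in> bochner_Lp \<infinity> T (H_space 2 \<Omega>) (sobolev_norm 2 2 \<Omega>) \<and>
     \<phi> \<in> bochner_Lp 2 T (H_space 3 \<Omega>) (sobolev_norm 3 2 \<Omega>) \<and>
     (AE t in lebesgue_on {0..T}.
        (AE x in lebesgue_on \<Omega>. u t x \<ge> 0) \<and> Lp_norm 1 (lebesgue_on \<Omega>) (u t) = 1) \<and>
     (AE t in lebesgue_on {0..T}. \<phi> t \<in> H10 \<Omega> \<and>
        (\<forall>w\<in>H10 \<Omega>. (LINT x|lebesgue_on \<Omega>. \<alpha> x * (wgrad \<Omega> (\<phi> t) x \<bullet> wgrad \<Omega> w x))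
                    = (LINT x|lebesgue_on \<Omega>. u t x * w x))) \<and>
     (\<forall>w\<in>H_space 1 \<Omega>. \<forall>\<eta>. smooth_on UNIV \<eta> \<and> (\<exists>s<T. \<forall>t\<ge>s. \<eta> t = 0) \<longrightarrow>
        - (LINT t|lebesgue_on {0..T}. (LINT x|lebesgue_on \<Omega>. u t x * w x) * deriv \<eta> t)
        + (LINT t|lebesgue_on {0..T}.
             (LINT x|lebesgue_on \<Omega>.
                (\<sigma>\<^sup>2 *\<^sub>R wgrad \<Omega> (u t) x + u t x *\<^sub>R wgrad \<Omega> (\<phi> t) x) \<bullet> wgrad \<Omega> w x) * \<eta> t)
        = (LINT x|lebesgue_on \<Omega>. u\<^sub>0 x * w x) * \<eta> 0)"

definition existence_time ::
    "'a::euclidean_space set \<Rightarrow> real \<Rightarrow> real \<Rightarrow> real \<Rightarrow> nat \<Rightarrow> ('a \<Rightarrow> real) \<Rightarrow> real \<Rightarrow> bool" where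
  "existence_time \<Omega> \<sigma> a M l u\<^sub>0 Tstar \<longleftrightarrow>
     Tstar > 0 \<and>
     (\<forall>\<alpha>\<in>admissible_set \<Omega> a M l.
        (\<exists>u \<phi>. weak_solution \<Omega> \<sigma> \<alpha> u\<^sub>0 Tstar u \<phi>) \<and>
        (\<forall>T u \<phi>. 0 < T \<and> T \<le> Tstar \<and> weak_solution \<Omega> \<sigma> \<alpha> u\<^sub>0 T u \<phi> \<longrightarrow>
           u \<in> bochner_Lp 4 T (Lp_space 2 (lebesgue_on \<Omega>)) (Lp_norm 2 (lebesgue_on \<Omega>)) \<and>
           time_Lp_norm 4 T (Lp_norm 2 (lebesgue_on \<Omega>)) u
             \<le> 2 * Lp_norm 2 (lebesgue_on \<Omega>) u\<^sub>0))"

definition uniform_bounds ::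
    "'a::euclidean_space set \<Rightarrow> real \<Rightarrow> real \<Rightarrow> real \<Rightarrow> nat \<Rightarrow> ('a \<Rightarrow> real) \<Rightarrow> real \<Rightarrow>
     real \<Rightarrow> real \<Rightarrow> bool" where
  "uniform_bounds \<Omega> \<sigma> a M l u\<^sub>0 T Cinf \<Lambda>\<^sub>1 \<longleftrightarrow>
     (\<forall>\<alpha>\<in>admissible_set \<Omega> a M l. \<forall>u \<phi>. weak_solution \<Omega> \<sigma> \<alpha> u\<^sub>0 T u \<phi> \<longrightarrow>
        u \<in> time_Lp \<infinity> T (Lp_space \<infinity> (lebesgue_on \<Omega>)) (Lp_norm \<infinity> (lebesgue_on \<Omega>)) \<and>
        time_Lp_norm \<infinity> T (Lp_norm \<infinity> (lebesgue_on \<Omega>)) u \<le> Cinf \<and>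
        \<phi> \<in> time_Lp \<infinity> T (sobolev 1 \<infinity> \<Omega>) (sobolev_norm 1 \<infinity> \<Omega>) \<and>
        time_Lp_norm \<infinity> T (sobolev_norm 1 \<infinity> \<Omega>) \<phi> \<le> \<Lambda>\<^sub>1)"

end

theory Submission
  imports Defs
begin

text \<open>
  The function \<open>c(t) = b exp (- \<Lambda>\<^sub>2 t)\<close> is a spatially constant subsolution. Formally, the second
  equation gives \<open>- \<Delta> \<phi> = (u + \<nabla>\<alpha> \<bullet> \<nabla>\<phi>) / \<alpha> \<le> \<Lambda>\<^sub>2\<close>, and the first one reads
  \<open>\<partial>\<^sub>t u = \<sigma>\<^sup>2 \<Delta> u + \<nabla>u \<bullet> \<nabla>\<phi> + u \<Delta> \<phi>\<close>, so that a spatial minimum of \<open>u\<close> decreases at relative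
  rate at most \<open>\<Lambda>\<^sub>2\<close>. For weak solutions the comparison is done with the energy
  \<open>\<integral> Y\<^sup>3 / 3\<close> of the deficit \<open>Y = max 0 (c - u)\<close>. Testing the equation with \<open>Y\<^sup>2\<close>, for which
  \<open>\<nabla>(Y\<^sup>2) = - 2 Y \<nabla>u\<close> and \<open>u \<nabla>(Y\<^sup>2) = \<nabla>g\<close> with \<open>g = c Y\<^sup>2 - (2/3) Y\<^sup>3 \<ge> 0\<close>, one finds

  \<open>d/dt \<integral> Y\<^sup>3 / 3 = - \<Lambda>\<^sub>2 \<integral> c Y\<^sup>2 - 2 \<sigma>\<^sup>2 \<integral> Y \<bar>\<nabla>u\<bar>\<^sup>2 + \<integral> \<nabla>\<phi> \<bullet> \<nabla>g \<le> \<Lambda>\<^sub>2 \<integral> (g - c Y\<^sup>2) \<le> 0\<close>.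

  The energy starts from \<open>0\<close> because \<open>u\<^sub>0 \<ge> b\<close>, so it stays \<open>0\<close>, and continuity of \<open>u\<close> turns the
  resulting almost everywhere inequality into one at every point.

  Three points need care. The inequality \<open>\<integral> \<nabla>\<phi> \<bullet> \<nabla>g \<le> \<Lambda>\<^sub>2 \<integral> g\<close> is required for functions \<open>g\<close> that do
  not vanish on the boundary, although the equation for \<open>\<phi>\<close> may be tested only with functions that
  do; the missing boundary term has the right sign because \<open>\<phi>\<close> is nonnegative, and
  \<open>elliptic_gradient_inequality\<close> captures this by testing with \<open>(g / \<alpha>) h(\<phi>)\<close>.
  Next, \<open>u\<close> has no integrable time derivative. It is replaced by its Steklov averages; the
  commutator between averaging and the nonlinear drift is absorbed by diffusion up to the variance of \<open>u\<close> over the averaging window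
  (\<open>averaged_flux_estimate\<close>), which tends to \<open>0\<close> by continuity and boundedness of \<open>u\<close>
  (\<open>above_barrier_before_end\<close>). Finally, weak gradients are chosen separately at each time, so that
  Fubini's theorem becomes available only after strong measurability has supplied jointly measurable
  representatives (\<open>jointly_measurable_gradient\<close>).

  The product and chain rules for weak gradients that these computations use are derived from local
  mollification (\<open>weak_gradient_approx\<close>).
\<close>

section \<open>Smooth bumps\<close>

text \<open>The functions \<open>exp (- 1 / s) / s ^ k\<close>, extended by \<open>0\<close>, come as a family because the derivative of
each is a combination of two others; iterated derivatives of a bump then never leave the class
\<open>bumps\<close> below.\<close>

definition flat :: "nat \<Rightarrow> real \<Rightarrow> real" where
  "flat k s = (if s > 0 then exp (- 1 / s) / s ^ k else 0)"

lemma flat_tendsto_0: "(flat k \<longlongrightarrow> 0) (at 0)"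
proof -
  have "((\<lambda>s. (inverse s) ^ k / exp (inverse s)) \<longlongrightarrow> 0) (at_right (0::real))"
    by (rule filterlim_compose[OF tendsto_power_div_exp_0 filterlim_inverse_at_top_right])
  moreover have "eventually (\<lambda>s. (inverse s) ^ k / exp (inverse s) = flat k s) (at_right (0::real))"
    by (rule eventually_mono[OF eventually_at_right_less])
      (simp add: flat_def field_simps exp_minus)
  ultimately have "(flat k \<longlongrightarrow> 0) (at_right 0)"
    by (rule Lim_transform_eventually)
  moreover have "(flat k \<longlongrightarrow> 0) (at_left 0)"
    by (rule tendsto_eventually, rule eventually_mono[OF eventually_at_left_real[of "-1"]])
      (auto simp: flat_def)
  ultimately show ?thesis
    by (simp add: filterlim_split_at)
qed

lemma DERIV_flat: "(flat k has_real_derivative flat (k + 2) s - real k * flat (k + 1) s) (at s)"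
proof -
  consider "s > 0" | "s < 0" | "s = 0" by linarith
  then show ?thesis
  proof cases
    case 1
    have "((\<lambda>s. exp (- 1 / s) / s ^ k) has_real_derivative
        exp (- 1 / s) / s ^ (k + 2) - real k * (exp (- 1 / s) / s ^ (k + 1))) (at s)"
      using 1 by (cases k; auto intro!: derivative_eq_intros; simp add: divide_simps; simp add: algebra_simps)
        (case_tac nat; simp)
    then have "((\<lambda>s. exp (- 1 / s) / s ^ k) has_real_derivative flat (k + 2) s - real k * flat (k + 1) s) (at s)"
      using 1 by (simp add: flat_def)
    then show ?thesis
      by (rule has_field_derivative_transform_within_open[of _ _ _ "{0<..}"])
        (use 1 in \<open>auto simp: flat_def\<close>)
  next
    case 2
    have "((\<lambda>s. 0) has_real_derivative flat (k + 2) s - real k * flat (k + 1) s) (at s)"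
      using 2 by (simp add: flat_def)
    then show ?thesis
      by (rule has_field_derivative_transform_within_open[of _ _ _ "{..<0}"])
        (use 2 in \<open>auto simp: flat_def\<close>)
  next
    case 3
    have "((\<lambda>h. (flat k (0 + h) - flat k 0) / h) \<longlongrightarrow> 0) (at 0)"
      by (rule Lim_transform_eventually[OF flat_tendsto_0[of "k+1"]])
        (auto simp: flat_def eventually_at_filter field_simps)
    then show ?thesis
      using 3 by (simp add: DERIV_def flat_def)
  qed
qed

definition has_C1_gradient :: "('a::euclidean_space \<Rightarrow> real) \<Rightarrow> ('a \<Rightarrow> 'a) \<Rightarrow> bool" where
  "has_C1_gradient f D \<longleftrightarrow>
     (\<forall>x. (f has_derivative (\<lambda>h. D x \<bullet> h)) (at x)) \<and> continuous_on UNIV D"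

text \<open>A set of functions that contains the standard bump, consists of functions vanishing outside a fixed
ball, and is stable under partial derivatives. It reduces smoothness in the sense of iterated
\<^const>\<open>pderivs\<close> to a single differentiation.\<close>

inductive_set bumps :: "real \<Rightarrow> ('a::euclidean_space \<Rightarrow> real) set" for r :: real where
  flat: "(\<lambda>x. flat k (r - x \<bullet> x)) \<in> bumps r"
| add: "f \<in> bumps r \<Longrightarrow> g \<in> bumps r \<Longrightarrow> (\<lambda>x. f x + g x) \<in> bumps r"
| scale: "f \<in> bumps r \<Longrightarrow> (\<lambda>x. c * f x) \<in> bumps r"
| coord: "f \<in> bumps r \<Longrightarrow> (\<lambda>x. (x \<bullet> i) * f x) \<in> bumps r"

lemma bumps_gradient:
  assumes "f \<in> bumps r"
  shows "\<exists>D. (\<forall>x. (f has_derivative (\<lambda>h. D x \<bullet> h)) (at x)) \<and> (\<forall>i. (\<lambda>x. D x \<bullet> i) \<in> bumps r)"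
  using assms
proof induction
  case (flat k)
  define D :: "'a \<Rightarrow> 'a" where
    "D = (\<lambda>x. (-2 * (flat (k + 2) (r - x \<bullet> x) - real k * flat (k + 1) (r - x \<bullet> x))) *\<^sub>R x)"
  have "((\<lambda>x. flat k (r - x \<bullet> x)) has_derivative (\<lambda>h. D x \<bullet> h)) (at x)" for x
  proof -
    have "((\<lambda>x. r - x \<bullet> x) has_derivative (\<lambda>h. - (2 * (x \<bullet> h)))) (at x)"
      by (auto intro!: derivative_eq_intros simp: inner_commute)
    from has_derivative_compose[OF this DERIV_flat[unfolded has_field_derivative_def]]
    show ?thesis
      by (rule has_derivative_eq_rhs) (auto simp: D_def fun_eq_iff algebra_simps)
  qed
  moreover have "(\<lambda>x. D x \<bullet> i) \<in> bumps r" for i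
  proof -
    have "(\<lambda>x. (-2) * ((x \<bullet> i) * (flat (k + 2) (r - x \<bullet> x) + (- real k) * flat (k + 1) (r - x \<bullet> x)))) \<in> bumps r"
      by (intro bumps.intros)
    then show ?thesis by (simp add: D_def algebra_simps)
  qed
  ultimately show ?case by blast
next
  case (add f g)
  then obtain D E where
    D: "\<forall>x. (f has_derivative (\<lambda>h. D x \<bullet> h)) (at x)" "\<forall>i. (\<lambda>x. D x \<bullet> i) \<in> bumps r" and
    E: "\<forall>x. (g has_derivative (\<lambda>h. E x \<bullet> h)) (at x)" "\<forall>i. (\<lambda>x. E x \<bullet> i) \<in> bumps r"
    by blast
  show ?case
  proof (intro exI conjI allI)
    show "((\<lambda>x. f x + g x) has_derivative (\<lambda>h. (D x + E x) \<bullet> h)) (at x)" for x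
      unfolding inner_add_left by (intro has_derivative_add D(1)[rule_format] E(1)[rule_format])
    show "(\<lambda>x. (D x + E x) \<bullet> i) \<in> bumps r" for i
      unfolding inner_add_left by (intro bumps.add D(2)[rule_format] E(2)[rule_format])
  qed
next
  case (scale f c)
  then obtain D where
    D: "\<forall>x. (f has_derivative (\<lambda>h. D x \<bullet> h)) (at x)" "\<forall>i. (\<lambda>x. D x \<bullet> i) \<in> bumps r"
    by blast
  show ?case
  proof (intro exI conjI allI)
    show "((\<lambda>x. c * f x) has_derivative (\<lambda>h. (c *\<^sub>R D x) \<bullet> h)) (at x)" for x
      unfolding inner_scaleR_left by (intro has_derivative_mult_right D(1)[rule_format])
    show "(\<lambda>x. (c *\<^sub>R D x) \<bullet> i) \<in> bumps r" for i
      unfolding inner_scaleR_left by (intro bumps.scale D(2)[rule_format])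
  qed
next
  case (coord f j)
  then obtain D where
    D: "\<forall>x. (f has_derivative (\<lambda>h. D x \<bullet> h)) (at x)" "\<forall>i. (\<lambda>x. D x \<bullet> i) \<in> bumps r"
    by blast
  show ?case
  proof (intro exI conjI allI)
    show "((\<lambda>x. (x \<bullet> j) * f x) has_derivative (\<lambda>h. (f x *\<^sub>R j + (x \<bullet> j) *\<^sub>R D x) \<bullet> h)) (at x)" for x
      by (rule has_derivative_eq_rhs, rule has_derivative_mult[OF _ D(1)[rule_format]])
        (auto intro!: derivative_intros simp: inner_add_left inner_add_right inner_commute)
    have "(\<lambda>x. (j \<bullet> i) * f x + (x \<bullet> j) * (D x \<bullet> i)) \<in> bumps r" for i
      by (intro bumps.intros D(2)[rule_format] coord.hyps)
    then show "(\<lambda>x. (f x *\<^sub>R j + (x \<bullet> j) *\<^sub>R D x) \<bullet> i) \<in> bumps r" for i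
      by (simp add: inner_add_left mult.commute)
  qed
qed

lemma bumps_eq_0: "f \<in> bumps r \<Longrightarrow> r \<le> x \<bullet> x \<Longrightarrow> f x = 0"
  by (induction rule: bumps.induct) (auto simp: flat_def)

lemma bumps_continuous: "f \<in> bumps r \<Longrightarrow> continuous_on S f"
  by (meson bumps_gradient continuous_at_imp_continuous_on has_derivative_continuous)

lemma bumps_bounded:
  assumes "f \<in> bumps r"
  shows "\<exists>C>0. \<forall>x. \<bar>f x\<bar> \<le> C"
proof -
  have "bounded (f ` cball 0 (sqrt \<bar>r\<bar>))"
    by (intro compact_imp_bounded compact_continuous_image bumps_continuous[OF assms] compact_cball)
  then obtain C where C: "\<forall>x\<in>cball 0 (sqrt \<bar>r\<bar>). \<bar>f x\<bar> \<le> C"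
    unfolding bounded_iff by auto
  have "\<bar>f x\<bar> \<le> max C 1" for x
  proof (cases "norm x \<le> sqrt \<bar>r\<bar>")
    case False
    then have "r \<le> x \<bullet> x"
      using real_sqrt_le_iff[of "\<bar>r\<bar>" "x \<bullet> x"] by (simp add: norm_eq_sqrt_inner)
    then show ?thesis using bumps_eq_0[OF assms] by simp
  qed (use C in \<open>auto simp: le_max_iff_disj\<close>)
  then show ?thesis by (intro exI[of _ "max C 1"]) auto
qed

lemma bumps_uniformly_continuous:
  assumes "f \<in> bumps r"
  shows "uniformly_continuous_on UNIV f"
proof -
  obtain D where D: "\<And>x. (f has_derivative (\<lambda>h. D x \<bullet> h)) (at x)" "\<And>i. (\<lambda>x. D x \<bullet> i) \<in> bumps r"
    using bumps_gradient[OF assms] by blast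
  obtain B where B: "\<And>i x. i \<in> Basis \<Longrightarrow> \<bar>D x \<bullet> i\<bar> \<le> B i"
    using bumps_bounded[OF D(2)] by metis
  define C where "C = (\<Sum>i\<in>Basis. B i)"
  have C: "norm (D x) \<le> C" for x
    unfolding C_def by (rule order_trans[OF norm_le_l1 sum_mono]) (use B in auto)
  have on: "onorm (\<lambda>h. D x \<bullet> h) \<le> C" for x
    by (rule onorm_le) (metis C Cauchy_Schwarz_ineq2 mult_right_mono norm_ge_zero order_trans real_norm_def)
  have "norm (f x - f y) \<le> C * norm (x - y)" for x y
    by (rule differentiable_bound[of UNIV f "\<lambda>x h. D x \<bullet> h"]) (use D(1) on in auto)
  moreover have "C \<ge> 0" using C[of 0] norm_ge_zero order_trans by blast
  ultimately have "C-lipschitz_on UNIV f"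
    by (auto simp: lipschitz_on_def dist_norm)
  then show ?thesis by (rule lipschitz_on_uniformly_continuous)
qed

lemma bumps_C1:
  assumes "f \<in> bumps r"
  shows "\<exists>D. has_C1_gradient f D \<and> (\<forall>i. (\<lambda>x. D x \<bullet> i) \<in> bumps r) \<and>
    uniformly_continuous_on UNIV D \<and> bounded (range D)"
proof -
  obtain D where D: "\<And>x. (f has_derivative (\<lambda>h. D x \<bullet> h)) (at x)" "\<And>i. (\<lambda>x. D x \<bullet> i) \<in> bumps r"
    using bumps_gradient[OF assms] by blast
  have eq: "D = (\<lambda>x. \<Sum>i\<in>Basis. (D x \<bullet> i) *\<^sub>R i)"
    by (simp add: euclidean_representation)
  have "uniformly_continuous_on UNIV (\<lambda>x. \<Sum>i\<in>Basis. (D x \<bullet> i) *\<^sub>R i)"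
    by (intro uniformly_continuous_on_sum bounded_linear.uniformly_continuous_on[OF bounded_linear_scaleR_left] bumps_uniformly_continuous[OF D(2)])
  then have uc: "uniformly_continuous_on UNIV D" using eq by simp
  obtain B where B: "\<And>i x. i \<in> Basis \<Longrightarrow> \<bar>D x \<bullet> i\<bar> \<le> B i"
    using bumps_bounded[OF D(2)] by metis
  have "norm (D x) \<le> (\<Sum>i\<in>Basis. B i)" for x
    by (rule order_trans[OF norm_le_l1 sum_mono]) (use B in auto)
  then have "bounded (range D)" by (auto simp: bounded_iff)
  with D uc uniformly_continuous_imp_continuous[OF uc] show ?thesis
    by (auto simp: has_C1_gradient_def intro!: exI[of _ D])
qed

section \<open>Convolution with a bump\<close>

lemma integrable_bounded_scaleR:
  fixes f :: "'b \<Rightarrow> 'c::{banach, second_countable_topology}"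
  assumes "integrable M f" "g \<in> borel_measurable M" "AE x in M. \<bar>g x\<bar> \<le> C"
  shows "integrable M (\<lambda>x. g x *\<^sub>R f x)"
proof (rule Bochner_Integration.integrable_bound)
  show "integrable M (\<lambda>x. C *\<^sub>R f x)" using assms(1) by simp
  show "AE x in M. norm (g x *\<^sub>R f x) \<le> norm (C *\<^sub>R f x)"
    using assms(3) by eventually_elim (auto intro!: mult_right_mono)
qed (use assms in measurable)

lemma integrable_bounded_mult:
  fixes f :: "'b \<Rightarrow> real"
  assumes "integrable M f" "g \<in> borel_measurable M" "AE x in M. \<bar>g x\<bar> \<le> C"
  shows "integrable M (\<lambda>x. g x * f x)"
  using integrable_bounded_scaleR[OF assms] by simp

lemma integrable_scaleR_bounded:
  fixes D :: "'b \<Rightarrow> 'c::{banach, second_countable_topology}" and f :: "'b \<Rightarrow> real"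
  assumes "integrable N f" "D \<in> borel_measurable N" "\<And>y. norm (D y) \<le> B"
  shows "integrable N (\<lambda>y. f y *\<^sub>R D y)"
proof (rule Bochner_Integration.integrable_bound)
  show "integrable N (\<lambda>y. B * f y)" using assms(1) by simp
  show "AE y in N. norm (f y *\<^sub>R D y) \<le> norm (B * f y)"
    by (intro AE_I2) (simp add: abs_mult, subst mult.commute, rule mult_right_mono, rule order_trans[OF assms(3) abs_ge_self], simp)
qed (use assms(1,2) in measurable)

lemma integrable_bounded_inner:
  fixes V W :: "'b \<Rightarrow> 'c::euclidean_space"
  assumes "V \<in> borel_measurable N" "AE x in N. norm (V x) \<le> B" "integrable N W"
  shows "integrable N (\<lambda>x. V x \<bullet> W x)"
proof (rule Bochner_Integration.integrable_bound)
  show "integrable N (\<lambda>x. B * norm (W x))" using assms(3) by simp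
  show "AE x in N. norm (V x \<bullet> W x) \<le> norm (B * norm (W x))"
    using assms(2)
  proof eventually_elim
    case (elim x)
    have "norm (V x \<bullet> W x) \<le> norm (V x) * norm (W x)" unfolding real_norm_def by (rule Cauchy_Schwarz_ineq2)
    also have "\<dots> \<le> B * norm (W x)" by (intro mult_right_mono elim) simp
    finally show ?case by simp
  qed
qed (use assms(1) borel_measurable_integrable[OF assms(3)] in measurable)

lemma (in finite_measure) integrable_of_square_integrable:
  fixes f :: "'a \<Rightarrow> 'b::{banach, second_countable_topology}"
  assumes "f \<in> borel_measurable M" "integrable M (\<lambda>x. (norm (f x))\<^sup>2)"
  shows "integrable M f"
proof (rule Bochner_Integration.integrable_bound)
  show "integrable M (\<lambda>x. 1 + (norm (f x))\<^sup>2)" using assms(2) by simp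
  show "AE x in M. norm (f x) \<le> norm (1 + (norm (f x))\<^sup>2)"
  proof (rule AE_I2)
    fix x
    have "0 \<le> (norm (f x) - 1)\<^sup>2 + (norm (f x))\<^sup>2" by simp
    then have "norm (f x) \<le> 1 + (norm (f x))\<^sup>2" by (simp add: power2_diff)
    then show "norm (f x) \<le> norm (1 + (norm (f x))\<^sup>2)" by simp
  qed
qed (rule assms(1))

lemma continuous_imp_measurable_lebesgue_on:
  fixes f :: "'a::euclidean_space \<Rightarrow> 'b::topological_space"
  shows "continuous_on UNIV f \<Longrightarrow> f \<in> borel_measurable (lebesgue_on S)"
  by (intro measurable_restrict_space1 measurable_completion) (simp add: borel_measurable_continuous_onI)

definition conv :: "'a set \<Rightarrow> ('a \<Rightarrow> real) \<Rightarrow> ('a \<Rightarrow> real) \<Rightarrow> 'a::euclidean_space \<Rightarrow> real" where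
  "conv \<Omega> k f x = (LINT y|lebesgue_on \<Omega>. k (x - y) * f y)"

lemma has_C1_gradient_continuous: "has_C1_gradient f D \<Longrightarrow> continuous_on S f"
  by (meson has_C1_gradient_def continuous_at_imp_continuous_on has_derivative_continuous)

text \<open>The mean value inequality turns uniform continuity of the gradient into a remainder estimate that is
uniform in the base point, as differentiation under the integral sign requires.\<close>

lemma C1_uniform_remainder:
  assumes "has_C1_gradient k D" "uniformly_continuous_on UNIV D" "e > 0"
  shows "\<exists>d>0. \<forall>z h. norm h < d \<longrightarrow> \<bar>k (z + h) - k z - D z \<bullet> h\<bar> \<le> e * norm h"
proof -
  obtain d where d: "d > 0" "\<And>x y. dist x y < d \<Longrightarrow> dist (D x) (D y) < e"
    using assms(2,3) unfolding uniformly_continuous_on_def by (metis UNIV_I)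
  have "\<bar>k (z + h) - k z - D z \<bullet> h\<bar> \<le> e * norm h" if h: "norm h < d" for z h
  proof -
    have "norm ((\<lambda>w. k w - D z \<bullet> w) (z + h) - (\<lambda>w. k w - D z \<bullet> w) z) \<le> e * norm (z + h - z)"
    proof (rule differentiable_bound[of "ball z d"])
      show "((\<lambda>w. k w - D z \<bullet> w) has_derivative (\<lambda>h. (D w - D z) \<bullet> h)) (at w within ball z d)" for w
        unfolding inner_diff_left
        by (intro has_derivative_diff has_derivative_at_withinI[where s="ball z d"])
          (use assms(1) in \<open>auto simp: has_C1_gradient_def intro!: derivative_intros\<close>)
      show "onorm (\<lambda>h. (D w - D z) \<bullet> h) \<le> e" if "w \<in> ball z d" for w
      proof (rule onorm_le)
        fix h
        have "norm (D w - D z) \<le> e" using d(2)[of w z] that by (simp add: dist_commute dist_norm)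
        then show "norm ((D w - D z) \<bullet> h) \<le> e * norm h"
          by (metis Cauchy_Schwarz_ineq2 mult_right_mono norm_ge_zero order_trans real_norm_def)
      qed
    qed (use h d in \<open>auto simp: dist_norm\<close>)
    then show ?thesis by (simp add: inner_add_right algebra_simps)
  qed
  then show ?thesis using d(1) by blast
qed

text \<open>Differentiation under the integral sign: after division by \<open>norm h\<close> the remainder of the integrand
is at most a small multiple of \<open>\<bar>f y\<bar>\<close>, uniformly in \<open>y\<close>.\<close>

lemma conv_C1:
  fixes k :: "'a::euclidean_space \<Rightarrow> real"
  assumes k: "has_C1_gradient k D" "uniformly_continuous_on UNIV D" "bounded (range D)"
      "\<And>x. \<bar>k x\<bar> \<le> C"
    and f: "integrable (lebesgue_on \<Omega>) f"
  shows "has_C1_gradient (conv \<Omega> k f) (\<lambda>x. LINT y|lebesgue_on \<Omega>. f y *\<^sub>R D (x - y))"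
proof -
  define M where "M = lebesgue_on \<Omega>"
  define G where "G x = (LINT y|M. f y *\<^sub>R D (x - y))" for x
  define I where "I = (LINT y|M. \<bar>f y\<bar>)"
  have I: "I \<ge> 0" unfolding I_def by simp
  have fM: "integrable M f" using f by (simp add: M_def)
  have contk: "continuous_on UNIV k" by (rule has_C1_gradient_continuous[OF k(1)])
  have contD: "continuous_on UNIV D" using k(2) uniformly_continuous_imp_continuous by blast
  obtain B where B: "\<And>x. norm (D x) \<le> B" using k(3) by (auto simp: bounded_iff)
  have mk: "(\<lambda>y. k (x - y)) \<in> borel_measurable M" and mD: "(\<lambda>y. D (x - y)) \<in> borel_measurable M" for x
    unfolding M_def by (intro continuous_imp_measurable_lebesgue_on
      continuous_on_compose2[OF contk] continuous_on_compose2[OF contD] continuous_intros; simp)+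
  have ik: "integrable M (\<lambda>y. k (x - y) * f y)" for x
    by (rule integrable_bounded_mult[OF fM mk]) (use k(4) in auto)
  have iD: "integrable M (\<lambda>y. f y *\<^sub>R D (x - y))" for x
    by (rule integrable_scaleR_bounded[OF fM mD B])
  have der: "(conv \<Omega> k f has_derivative (\<lambda>h. G x \<bullet> h)) (at x)" for x
    unfolding has_derivative_at_alt
  proof (intro conjI allI impI)
    show "bounded_linear (\<lambda>h. G x \<bullet> h)" by (rule bounded_linear_inner_right)
    fix e :: real assume e: "e > 0"
    define e' where "e' = e / (I + 1)"
    have e': "e' > 0" "e' * I \<le> e" using e I by (auto simp: e'_def field_simps)
    obtain d where d: "d > 0" "\<And>z h. norm h < d \<Longrightarrow> \<bar>k (z + h) - k z - D z \<bullet> h\<bar> \<le> e' * norm h"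
      using C1_uniform_remainder[OF k(1,2) e'(1)] by blast
    have "norm (conv \<Omega> k f y - conv \<Omega> k f x - G x \<bullet> (y - x)) \<le> e * norm (y - x)"
      if y: "norm (y - x) < d" for y
    proof -
      have iDx: "integrable M (\<lambda>t. (f t *\<^sub>R D (x - t)) \<bullet> (y - x))"
        by (intro integrable_inner_left iD)
      have eq: "conv \<Omega> k f y - conv \<Omega> k f x - G x \<bullet> (y - x)
        = (LINT t|M. k (y - t) * f t - k (x - t) * f t - (f t *\<^sub>R D (x - t)) \<bullet> (y - x))"
        unfolding conv_def G_def M_def[symmetric]
        by (subst Bochner_Integration.integral_diff[OF Bochner_Integration.integrable_diff[OF ik ik] iDx],
            subst Bochner_Integration.integral_diff[OF ik ik],
            subst integral_inner_left[OF iD]) (rule refl)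
      have "norm (conv \<Omega> k f y - conv \<Omega> k f x - G x \<bullet> (y - x)) \<le> (LINT t|M. e' * norm (y - x) * \<bar>f t\<bar>)"
        unfolding eq
      proof (rule Bochner_Integration.integral_norm_bound_integral)
        fix t
        have "k (y - t) * f t - k (x - t) * f t - (f t *\<^sub>R D (x - t)) \<bullet> (y - x)
          = (k (x - t + (y - x)) - k (x - t) - D (x - t) \<bullet> (y - x)) * f t"
          by (simp add: algebra_simps)
        then show "norm (k (y - t) * f t - k (x - t) * f t - (f t *\<^sub>R D (x - t)) \<bullet> (y - x))
          \<le> e' * norm (y - x) * \<bar>f t\<bar>"
          using d(2)[OF y, of "x - t"] by (simp only: real_norm_def abs_mult) (rule mult_right_mono, auto)
      qed (intro Bochner_Integration.integrable_diff ik iDx integrable_mult_right integrable_abs fM)+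
      also have "\<dots> = (e' * I) * norm (y - x)" by (simp add: I_def)
      also have "\<dots> \<le> e * norm (y - x)" by (intro mult_right_mono e') auto
      finally show ?thesis .
    qed
    with d(1) show "\<exists>d>0. \<forall>y. norm (y - x) < d \<longrightarrow>
        norm (conv \<Omega> k f y - conv \<Omega> k f x - G x \<bullet> (y - x)) \<le> e * norm (y - x)" by blast
  qed
  have "continuous_on UNIV G"
    unfolding continuous_on_iff
  proof (intro ballI allI impI)
    fix x and e :: real assume e: "e > 0"
    define e' where "e' = e / (I + 1)"
    have e': "e' > 0" "e' * I < e" using e I by (auto simp: e'_def field_simps)
    obtain d where d: "d > 0" "\<And>x y. dist x y < d \<Longrightarrow> dist (D x) (D y) < e'"
      using k(2) e'(1) unfolding uniformly_continuous_on_def by (metis UNIV_I)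
    have "dist (G y) (G x) < e" if "dist y x < d" for y
    proof -
      have "norm (G y - G x) = norm (LINT t|M. f t *\<^sub>R D (y - t) - f t *\<^sub>R D (x - t))"
        unfolding G_def by (simp add: Bochner_Integration.integral_diff[OF iD iD])
      also have "\<dots> \<le> (LINT t|M. e' * \<bar>f t\<bar>)"
      proof (rule Bochner_Integration.integral_norm_bound_integral)
        fix t
        have "norm (D (y - t) - D (x - t)) \<le> e'"
          using d(2)[of "y - t" "x - t"] that by (simp add: dist_norm)
        then have "\<bar>f t\<bar> * norm (D (y - t) - D (x - t)) \<le> \<bar>f t\<bar> * e'"
          by (rule mult_left_mono) simp
        then show "norm (f t *\<^sub>R D (y - t) - f t *\<^sub>R D (x - t)) \<le> e' * \<bar>f t\<bar>"
          by (metis mult.commute norm_scaleR scaleR_diff_right)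
      qed (intro Bochner_Integration.integrable_diff iD integrable_mult_right integrable_abs fM)+
      also have "\<dots> < e" using e'(2) by (simp add: I_def)
      finally show ?thesis by (simp add: dist_norm)
    qed
    with d(1) show "\<exists>d>0. \<forall>x'\<in>UNIV. dist x' x < d \<longrightarrow> dist (G x') (G x) < e" by blast
  qed
  with der show ?thesis by (simp add: has_C1_gradient_def G_def M_def)
qed

lemma conv_gradient_component:
  fixes D :: "'a::euclidean_space \<Rightarrow> 'a"
  assumes "continuous_on UNIV D" "bounded (range D)" "integrable (lebesgue_on \<Omega>) f"
  shows "(LINT y|lebesgue_on \<Omega>. f y *\<^sub>R D (x - y)) \<bullet> i = conv \<Omega> (\<lambda>z. D z \<bullet> i) f x"
proof -
  obtain B where B: "\<And>x. norm (D x) \<le> B" using assms(2) by (auto simp: bounded_iff)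
  have mD: "(\<lambda>y. D (x - y)) \<in> borel_measurable (lebesgue_on \<Omega>)"
    by (intro continuous_imp_measurable_lebesgue_on continuous_on_compose2[OF assms(1)] continuous_intros) simp
  have iD: "integrable (lebesgue_on \<Omega>) (\<lambda>y. f y *\<^sub>R D (x - y))"
    by (rule integrable_scaleR_bounded[OF assms(3) mD B])
  show ?thesis
    unfolding conv_def by (subst integral_inner_left[symmetric, OF iD]) (simp add: mult.commute)
qed

text \<open>A partial derivative falls on the kernel, and \<^const>\<open>bumps\<close> is stable under partial derivatives.\<close>

lemma pderivs_conv:
  assumes "k \<in> bumps r" "integrable (lebesgue_on \<Omega>) f"
  shows "\<exists>k'\<in>bumps r. pderivs ds (conv \<Omega> k f) = conv \<Omega> k' f"
proof (induction ds)
  case Nil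
  then show ?case using assms by auto
next
  case (Cons i ds)
  then obtain k' where k': "k' \<in> bumps r" "pderivs ds (conv \<Omega> k f) = conv \<Omega> k' f" by blast
  obtain D where D: "has_C1_gradient k' D" "\<And>i. (\<lambda>x. D x \<bullet> i) \<in> bumps r"
    "uniformly_continuous_on UNIV D" "bounded (range D)"
    using bumps_C1[OF k'(1)] by auto
  obtain C where C: "\<And>x. \<bar>k' x\<bar> \<le> C" using bumps_bounded[OF k'(1)] by blast
  have "pderivs (i # ds) (conv \<Omega> k f) = conv \<Omega> (\<lambda>x. D x \<bullet> i) f"
  proof
    fix x
    have "(conv \<Omega> k' f has_derivative (\<lambda>h. (LINT y|lebesgue_on \<Omega>. f y *\<^sub>R D (x - y)) \<bullet> h)) (at x)"
      using conv_C1[OF D(1,3,4) C assms(2)] by (simp add: has_C1_gradient_def)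
    then show "pderivs (i # ds) (conv \<Omega> k f) x = conv \<Omega> (\<lambda>x. D x \<bullet> i) f x"
      using conv_gradient_component[OF uniformly_continuous_imp_continuous[OF D(3)] D(4) assms(2)]
      by (simp add: k'(2) frechet_derivative_at[symmetric])
  qed
  then show ?case using D(2) by auto
qed

lemma smooth_on_conv:
  assumes "k \<in> bumps r" "integrable (lebesgue_on \<Omega>) f"
  shows "smooth_on S (conv \<Omega> k f)"
  unfolding smooth_on_def
proof (intro ballI)
  fix ds x
  obtain k' where k': "k' \<in> bumps r" "pderivs ds (conv \<Omega> k f) = conv \<Omega> k' f"
    using pderivs_conv[OF assms] by blast
  obtain D where D: "has_C1_gradient k' D" "uniformly_continuous_on UNIV D" "bounded (range D)"
    using bumps_C1[OF k'(1)] by auto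
  obtain C where C: "\<And>x. \<bar>k' x\<bar> \<le> C" using bumps_bounded[OF k'(1)] by blast
  show "pderivs ds (conv \<Omega> k f) differentiable (at x)"
    using conv_C1[OF D C assms(2)] unfolding k'(2) has_C1_gradient_def differentiable_def by blast
qed

text \<open>A total derivative is linear, hence determined by its values on the basis.\<close>

lemma smooth_on_UNIV_C1:
  assumes "smooth_on UNIV \<zeta>"
  shows "has_C1_gradient \<zeta> (\<lambda>x. \<Sum>i\<in>Basis. pderivs [i] \<zeta> x *\<^sub>R i)"
  unfolding has_C1_gradient_def
proof (intro conjI allI)
  have d: "pderivs ds \<zeta> differentiable (at x)" if "ds \<in> lists Basis" for ds x
    using assms that by (auto simp: smooth_on_def)
  show "continuous_on UNIV (\<lambda>x. \<Sum>i\<in>Basis. pderivs [i] \<zeta> x *\<^sub>R i)"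
    by (intro continuous_on_sum continuous_on_scaleR continuous_on_const continuous_at_imp_continuous_on ballI
        differentiable_imp_continuous_within d) auto
  fix x
  have "(\<zeta> has_derivative frechet_derivative \<zeta> (at x)) (at x)"
    using d[of "[]" x] by (simp add: frechet_derivative_works)
  moreover have "frechet_derivative \<zeta> (at x) = (\<lambda>h. (\<Sum>i\<in>Basis. pderivs [i] \<zeta> x *\<^sub>R i) \<bullet> h)"
  proof
    fix h
    have "linear (frechet_derivative \<zeta> (at x))"
      using d[of "[]" x] by (simp add: linear_frechet_derivative)
    then have "frechet_derivative \<zeta> (at x) (\<Sum>i\<in>Basis. (h \<bullet> i) *\<^sub>R i)
      = (\<Sum>i\<in>Basis. (h \<bullet> i) *\<^sub>R frechet_derivative \<zeta> (at x) i)"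
      by (simp add: linear_sum linear_scale)
    moreover have "(\<Sum>i\<in>Basis. pderivs [i] \<zeta> x *\<^sub>R i) \<bullet> h
      = (\<Sum>i\<in>Basis. (h \<bullet> i) *\<^sub>R frechet_derivative \<zeta> (at x) i)"
      unfolding inner_sum_left by (rule sum.cong) (auto simp: mult.commute inner_commute)
    ultimately show "frechet_derivative \<zeta> (at x) h = (\<Sum>i\<in>Basis. pderivs [i] \<zeta> x *\<^sub>R i) \<bullet> h"
      unfolding euclidean_representation by simp
  qed
  ultimately show "(\<zeta> has_derivative (\<lambda>h. (\<Sum>i\<in>Basis. pderivs [i] \<zeta> x *\<^sub>R i) \<bullet> h)) (at x)" by (rule has_derivative_eq_rhs)
qed

section \<open>Almost everywhere statements and density in \<open>L\<^sup>1\<close>\<close>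

text \<open>Lebesgue measure is complete: changing a preimage inside a null set keeps it measurable.\<close>

lemma measurable_AE_cong_lebesgue:
  fixes f g :: "'a::euclidean_space \<Rightarrow> 'b::topological_space"
  assumes S: "S \<in> sets lebesgue" and f: "f \<in> borel_measurable (lebesgue_on S)"
    and eq: "AE x in lebesgue_on S. f x = g x"
  shows "g \<in> borel_measurable (lebesgue_on S)"
proof (rule measurableI)
  fix A :: "'b set" assume A: "A \<in> sets borel"
  from AE_E[OF eq] obtain N where N: "{x \<in> space (lebesgue_on S). f x \<noteq> g x} \<subseteq> N"
      "emeasure (lebesgue_on S) N = 0" "N \<in> sets (lebesgue_on S)" by auto
  then have "N \<in> null_sets (lebesgue_on S)" by (simp add: null_setsI)
  then have N0: "N \<in> null_sets lebesgue" using S by (simp add: null_sets_restrict_space)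
  have "g -` A \<inter> S \<inter> N \<in> null_sets lebesgue"
    by (rule completion.complete2[OF _ N0]) auto
  then have 1: "g -` A \<inter> S \<inter> N \<in> sets lebesgue" by auto
  have "f -` A \<inter> space (lebesgue_on S) \<in> sets (lebesgue_on S)"
    using measurable_sets[OF f A] .
  then have "f -` A \<inter> S \<in> sets lebesgue"
    using S by (auto simp: sets_restrict_space_iff)
  moreover have "N \<in> sets lebesgue" using N0 by auto
  ultimately have 2: "(f -` A \<inter> S - N) \<union> (g -` A \<inter> S \<inter> N) \<in> sets lebesgue"
    using 1 by blast
  have "g -` A \<inter> S = (f -` A \<inter> S - N) \<union> (g -` A \<inter> S \<inter> N)"
    using N(1) by auto
  with 2 show "g -` A \<inter> space (lebesgue_on S) \<in> sets (lebesgue_on S)"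
    using S by (auto simp: sets_restrict_space_iff)
qed simp

lemma integrable_AE_cong_lebesgue:
  fixes f g :: "'a::euclidean_space \<Rightarrow> 'b::{banach, second_countable_topology}"
  assumes S: "S \<in> sets lebesgue" and f: "integrable (lebesgue_on S) f"
    and eq: "AE x in lebesgue_on S. f x = g x"
  shows "integrable (lebesgue_on S) g"
  using integrable_cong_AE[OF _ measurable_AE_cong_lebesgue[OF S _ eq] eq] f by auto

text \<open>No measurability is assumed. By completeness, either both functions are measurable or neither is, and
in the latter case both integrals have the default value \<open>0\<close>. This makes it possible to replace
\<^const>\<open>wgrad\<close> by a representative in the weak formulation without further checks.\<close>

lemma integral_AE_cong_lebesgue:
  fixes f g :: "'a::euclidean_space \<Rightarrow> 'b::{banach, second_countable_topology}"
  assumes S: "S \<in> sets lebesgue" and eq: "AE x in lebesgue_on S. f x = g x"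
  shows "integral\<^sup>L (lebesgue_on S) f = integral\<^sup>L (lebesgue_on S) g"
proof (cases "f \<in> borel_measurable (lebesgue_on S)")
  case True
  then show ?thesis
    by (intro integral_cong_AE measurable_AE_cong_lebesgue[OF S _ eq] eq)
next
  case False
  have "AE x in lebesgue_on S. g x = f x" using eq by eventually_elim simp
  then have "g \<notin> borel_measurable (lebesgue_on S)"
    using False measurable_AE_cong_lebesgue[OF S] by blast
  with False show ?thesis
    by (simp add: not_integrable_integral_eq borel_measurable_integrable integrable_iff_bounded)
qed

text \<open>A null set has empty interior.\<close>

lemma AE_lebesgue_on_dense:
  assumes S: "open S" and P: "AE x in lebesgue_on S. P x" and x: "x \<in> S" and e: "e > 0"
  shows "\<exists>y\<in>S. dist y x < e \<and> P y"
proof (rule ccontr)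
  assume "\<not> ?thesis"
  then have no: "\<And>y. y \<in> S \<inter> ball x e \<Longrightarrow> \<not> P y" by (auto simp: dist_commute)
  have op: "open (S \<inter> ball x e)" and ne: "S \<inter> ball x e \<noteq> {}" using S x e by auto
  have "AE y in lebesgue. y \<in> S \<longrightarrow> P y"
    using P S by (subst (asm) AE_restrict_space_iff) (auto simp: borel_open)
  then have "AE y in lebesgue. y \<notin> S \<inter> ball x e"
    by eventually_elim (use no in auto)
  then have "S \<inter> ball x e \<in> null_sets lebesgue"
    by (simp add: completion.null_sets_iff_AE)
  then show False
    using open_not_negligible[OF op ne] negligible_iff_null_sets by blast
qed

lemma AE_continuous_imp_everywhere:
  fixes f :: "'a::euclidean_space \<Rightarrow> real"
  assumes S: "open S" and f: "continuous_on S f" and C: "closed C"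
    and ae: "AE x in lebesgue_on S. f x \<in> C" and x: "x \<in> S"
  shows "f x \<in> C"
proof (rule ccontr)
  assume "f x \<notin> C"
  then obtain e where e: "e > 0" "ball (f x) e \<subseteq> - C"
    using C by (meson ComplI open_Compl open_contains_ball)
  obtain d where d: "d > 0" "\<And>y. y \<in> S \<Longrightarrow> dist y x < d \<Longrightarrow> dist (f y) (f x) < e"
    using f x e(1) unfolding continuous_on_iff by metis
  from AE_lebesgue_on_dense[OF S ae x d(1)] obtain y where "y \<in> S" "dist y x < d" "f y \<in> C" by blast
  with d(2)[of y] e(2) show False by (auto simp: subset_iff dist_commute)
qed

lemma integral_norm_le_AE:
  fixes f :: "'b \<Rightarrow> 'c::{banach, second_countable_topology}"
  assumes "integrable M f" "integrable M g" "AE x in M. norm (f x) \<le> g x"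
  shows "norm (integral\<^sup>L M f) \<le> integral\<^sup>L M g"
  by (rule order_trans[OF integral_norm_bound integral_mono_AE]) (use assms in auto)

text \<open>A measurable function is an almost everywhere limit of continuous ones. Truncating both at a height
\<open>N\<close> supplies a dominating constant, and truncation changes an integrable function little in
\<open>L\<^sup>1\<close> when \<open>N\<close> is large.\<close>

lemma continuous_L1_approximation:
  fixes f :: "'a::euclidean_space \<Rightarrow> real"
  assumes S: "S \<in> lmeasurable" and f: "integrable (lebesgue_on S) f" and e: "e > 0"
  shows "\<exists>g C. continuous_on UNIV g \<and> (\<forall>x. \<bar>g x\<bar> \<le> C) \<and> (LINT x|lebesgue_on S. \<bar>f x - g x\<bar>) < e"
proof -
  define M where "M = lebesgue_on S"
  interpret finite_measure M
    unfolding M_def using S by (intro finite_measure_lebesgue_on)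
  have SL: "S \<in> sets lebesgue" using S by auto
  define t where "t N y = max (- real N) (min (real N) y)" for N y
  have t_bd: "\<bar>t N y\<bar> \<le> real N" and t_le: "\<bar>y - t N y\<bar> \<le> \<bar>y\<bar>" for N y by (auto simp: t_def)
  have t_cont: "continuous_on UNIV (t N)" for N unfolding t_def by (intro continuous_intros)
  then have t_isCont: "isCont (t N) y" for N y by (simp add: continuous_on_eq_continuous_at)
  have [measurable]: "t N \<in> borel_measurable borel" for N by (rule borel_measurable_continuous_onI[OF t_cont])
  have fM: "integrable M f" and [measurable]: "f \<in> borel_measurable M" using f by (auto simp: M_def)
  have "(\<lambda>N. LINT x|M. \<bar>f x - t N (f x)\<bar>) \<longlonglongrightarrow> (LINT x|M. 0)"
  proof (rule integral_dominated_convergence[where w = "\<lambda>x. \<bar>f x\<bar>"])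
    show "AE x in M. (\<lambda>N. \<bar>f x - t N (f x)\<bar>) \<longlonglongrightarrow> 0"
    proof (rule AE_I2, rule tendsto_eventually)
      fix x
      obtain N0 :: nat where "\<bar>f x\<bar> \<le> real N0" using real_arch_simple by blast
      then show "\<forall>\<^sub>F N in sequentially. \<bar>f x - t N (f x)\<bar> = 0"
        by (intro eventually_sequentiallyI[of N0]) (auto simp: t_def)
    qed
  qed (use fM t_le in auto)
  then have "eventually (\<lambda>N. (LINT x|M. \<bar>f x - t N (f x)\<bar>) < e / 2) sequentially"
    using e by (intro order_tendstoD(2)) auto
  then obtain N where N: "(LINT x|M. \<bar>f x - t N (f x)\<bar>) < e / 2"
    by (meson eventually_happens sequentially_bot)
  have "f measurable_on S"
    using f SL by (simp add: measurable_on_iff_borel_measurable)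
  then obtain Z g where Z: "negligible Z" and g: "\<And>n. continuous_on UNIV (g n)"
    and lim: "\<And>x. x \<notin> Z \<Longrightarrow> (\<lambda>n. g n x) \<longlonglongrightarrow> (if x \<in> S then f x else 0)"
    unfolding measurable_on_def by blast
  have gc: "continuous_on UNIV (\<lambda>x. t N (g n x))" for n
    by (rule continuous_on_compose2[OF t_cont g]) simp
  then have gm [measurable]: "(\<lambda>x. t N (g n x)) \<in> borel_measurable M" for n
    unfolding M_def by (rule continuous_imp_measurable_lebesgue_on)
  have AEZ: "AE x in M. x \<notin> Z \<and> x \<in> S"
    unfolding M_def using Z SL
    by (subst AE_restrict_space_iff) (auto simp: negligible_iff_null_sets intro: AE_not_in eventually_mono)
  have "(\<lambda>n. LINT x|M. \<bar>t N (f x) - t N (g n x)\<bar>) \<longlonglongrightarrow> (LINT x|M. 0)"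
  proof (rule integral_dominated_convergence[where w = "\<lambda>x. 2 * real N"])
    show "AE x in M. (\<lambda>n. \<bar>t N (f x) - t N (g n x)\<bar>) \<longlonglongrightarrow> 0"
      using AEZ
    proof eventually_elim
      case (elim x)
      then have "(\<lambda>n. g n x) \<longlonglongrightarrow> f x" using lim[of x] by simp
      then have "(\<lambda>n. t N (g n x)) \<longlonglongrightarrow> t N (f x)" by (rule isCont_tendsto_compose[OF t_isCont])
      then have "(\<lambda>n. \<bar>t N (f x) - t N (g n x)\<bar>) \<longlonglongrightarrow> \<bar>t N (f x) - t N (f x)\<bar>"
        by (intro tendsto_intros)
      then show ?case by simp
    qed
    show "AE x in M. norm \<bar>t N (f x) - t N (g n x)\<bar> \<le> 2 * real N" for n
      using t_bd by (intro AE_I2) (smt (verit) real_norm_def)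
  qed auto
  then have "eventually (\<lambda>n. (LINT x|M. \<bar>t N (f x) - t N (g n x)\<bar>) < e / 2) sequentially"
    using e by (intro order_tendstoD(2)) auto
  then obtain n where n: "(LINT x|M. \<bar>t N (f x) - t N (g n x)\<bar>) < e / 2"
    by (meson eventually_happens sequentially_bot)
  have itf: "integrable M (\<lambda>x. t N (f x))" and itg: "integrable M (\<lambda>x. t N (g n x))"
    using t_bd by (auto intro!: integrable_const_bound[where B = "real N"])
  have "(LINT x|M. \<bar>f x - t N (g n x)\<bar>) \<le> (LINT x|M. \<bar>f x - t N (f x)\<bar> + \<bar>t N (f x) - t N (g n x)\<bar>)"
    by (intro integral_mono) (use fM itf itg in auto)
  also have "\<dots> = (LINT x|M. \<bar>f x - t N (f x)\<bar>) + (LINT x|M. \<bar>t N (f x) - t N (g n x)\<bar>)"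
    by (intro Bochner_Integration.integral_add) (use fM itf itg in auto)
  also have "\<dots> < e" using N n by linarith
  finally show ?thesis
    using gc[of n] t_bd[of N] by (intro exI[of _ "\<lambda>x. t N (g n x)"] exI[of _ "real N"]) (auto simp: M_def)
qed

section \<open>Mollification on a bounded open set\<close>

definition bump :: "nat \<Rightarrow> 'a::euclidean_space \<Rightarrow> real" where
  "bump n x = flat 0 ((1 / real (Suc n))\<^sup>2 - x \<bullet> x)"

definition moll :: "nat \<Rightarrow> 'a::euclidean_space \<Rightarrow> real" where
  "moll n x = bump n x / (LINT y|lborel. bump n (y :: 'a))"

lemma bump_bumps: "bump n \<in> bumps ((1 / real (Suc n))\<^sup>2)"
  unfolding bump_def[abs_def] by (rule bumps.flat)

lemma moll_bumps: "moll n \<in> bumps ((1 / real (Suc n))\<^sup>2)"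
  using bumps.scale[OF bump_bumps[where n=n], of "1 / (LINT y|lborel. bump n (y :: 'a))"]
  by (simp add: moll_def[abs_def])

lemma bump_nonneg: "bump n x \<ge> 0" by (simp add: bump_def flat_def)

lemma bumps_integrable:
  fixes f :: "'a::euclidean_space \<Rightarrow> real"
  assumes "f \<in> bumps r"
  shows "integrable lborel f"
proof -
  obtain C where C: "\<And>x. \<bar>f x\<bar> \<le> C" using bumps_bounded[OF assms] by blast
  have m: "f \<in> borel_measurable lborel"
    using bumps_continuous[OF assms] by (simp add: borel_measurable_continuous_onI)
  show ?thesis
  proof (rule Bochner_Integration.integrable_bound[OF _ m])
    show "integrable lborel (\<lambda>x. C * indicator (cball (0::'a) (sqrt \<bar>r\<bar>)) x :: real)"
      by (intro integrable_mult_right integrable_real_indicator) (use emeasure_lborel_cball_finite[of "0::'a" "sqrt \<bar>r\<bar>"] in auto)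
    show "AE x in lborel. norm (f x) \<le> norm (C * indicator (cball 0 (sqrt \<bar>r\<bar>)) x)"
    proof (rule AE_I2)
      fix x
      show "norm (f x) \<le> norm (C * indicator (cball 0 (sqrt \<bar>r\<bar>)) x)"
      proof (cases "norm x \<le> sqrt \<bar>r\<bar>")
        case False
        then have "r \<le> x \<bullet> x"
          using real_sqrt_le_iff[of "\<bar>r\<bar>" "x \<bullet> x"] by (simp add: norm_eq_sqrt_inner)
        then show ?thesis using bumps_eq_0[OF assms] by simp
      qed (use C[of x] in auto)
    qed
  qed
qed

lemma bump_integral_pos: "(LINT y|lborel. bump n (y :: 'a::euclidean_space)) > 0"
proof -
  have "(LINT y|lborel. bump n (y :: 'a)) \<noteq> 0"
  proof
    assume "(LINT y|lborel. bump n (y :: 'a)) = 0"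
    then have "AE y in lborel. bump n (y :: 'a) = 0"
      by (subst (asm) integral_nonneg_eq_0_iff_AE[OF bumps_integrable[OF bump_bumps]])
        (auto simp: bump_nonneg)
    then have "AE y in lebesgue_on UNIV. bump n (y :: 'a) = 0"
      unfolding lebesgue_on_UNIV_eq by (rule AE_completion)
    from AE_lebesgue_on_dense[OF open_UNIV this UNIV_I[of 0], of "1 / real (Suc n)"]
    obtain y :: 'a where y: "norm y < 1 / real (Suc n)" "bump n y = 0"
      by (auto simp: dist_norm)
    have "y \<bullet> y < (1 / real (Suc n))\<^sup>2"
      using power_strict_mono[OF y(1) norm_ge_zero, of 2] by (simp add: power2_norm_eq_inner)
    with y(2) show False by (simp add: bump_def flat_def)
  qed
  moreover have "(LINT y|lborel. bump n (y :: 'a)) \<ge> 0"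
    by (simp add: bump_nonneg)
  ultimately show ?thesis by linarith
qed

lemma moll_nonneg: "moll n x \<ge> 0"
  using bump_integral_pos[where n=n and 'a='a] by (simp add: moll_def bump_nonneg)

lemma moll_integral: "(LINT y|lborel. moll n (y :: 'a::euclidean_space)) = 1"
  using bump_integral_pos[where n=n and 'a='a] by (simp add: moll_def[abs_def])

lemma moll_eq_0: 
  assumes "norm x \<ge> 1 / real (Suc n)"
  shows "moll n x = 0"
  using power_mono[OF assms, of 2] by (intro bumps_eq_0[OF moll_bumps]) (simp add: power2_norm_eq_inner)

lemma moll_continuous: "continuous_on S (moll n)"
  by (rule bumps_continuous[OF moll_bumps])

lemma moll_diff_continuous: "continuous_on S (\<lambda>y. moll n (x - y))"
  by (rule continuous_on_compose2[OF moll_continuous[of UNIV n]]) (auto intro!: continuous_intros)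

lemma moll_minus: "moll n (x - y) = moll n (y - x)"
  by (simp add: moll_def bump_def inner_diff algebra_simps)

lemma moll_integral_translate:
  fixes x :: "'a::euclidean_space"
  shows "integrable lborel (\<lambda>y. moll n (x - y))" "(LINT y|lborel. moll n (x - y)) = 1"
proof -
  have d: "lborel = distr lborel borel ((+) (- x))" by (simp only: lborel_distr_plus)
  have i: "integrable (distr lborel borel ((+) (- x))) (moll n)"
    using bumps_integrable[OF moll_bumps[where n=n and 'a='a]] by (simp only: lborel_distr_plus)
  show "integrable lborel (\<lambda>y. moll n (x - y))"
    using i by (subst (asm) integrable_distr_eq)
      (auto simp: moll_minus[of n x] borel_measurable_continuous_onI moll_continuous)
  have "(LINT y|distr lborel borel ((+) (- x)). moll n y) = (LINT y|lborel. moll n (- x + y))"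
    by (intro integral_distr) (auto simp: borel_measurable_continuous_onI moll_continuous)
  then show "(LINT y|lborel. moll n (x - y)) = 1"
    by (simp add: lborel_distr_plus moll_integral moll_minus[of n x])
qed

text \<open>Any gradient will do; the choice avoids carrying the explicit formula.\<close>

definition moll_grad :: "nat \<Rightarrow> 'a::euclidean_space \<Rightarrow> 'a" where
  "moll_grad n = (SOME D. has_C1_gradient (moll n) D \<and> uniformly_continuous_on UNIV D \<and> bounded (range D))"

lemma moll_grad:
  shows moll_grad_C1: "has_C1_gradient (moll n :: 'a::euclidean_space \<Rightarrow> real) (moll_grad n)"
    and moll_grad_uniformly_continuous: "uniformly_continuous_on UNIV (moll_grad n :: 'a \<Rightarrow> 'a)"
    and moll_grad_bounded: "bounded (range (moll_grad n :: 'a \<Rightarrow> 'a))"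
proof -
  have "\<exists>D. has_C1_gradient (moll n :: 'a \<Rightarrow> real) D \<and> uniformly_continuous_on UNIV D \<and> bounded (range D)"
    using bumps_C1[OF moll_bumps] by blast
  from someI_ex[OF this] show "has_C1_gradient (moll n :: 'a \<Rightarrow> real) (moll_grad n)"
    "uniformly_continuous_on UNIV (moll_grad n :: 'a \<Rightarrow> 'a)" "bounded (range (moll_grad n :: 'a \<Rightarrow> 'a))"
    unfolding moll_grad_def by auto
qed

lemma moll_grad_continuous: "continuous_on UNIV (moll_grad n)"
  using moll_grad_uniformly_continuous uniformly_continuous_imp_continuous by blast

locale bounded_open_set =
  fixes \<Omega> :: "'a::euclidean_space set"
  assumes open_Omega: "open \<Omega>" and bounded_Omega: "bounded \<Omega>"
begin

abbreviation M :: "'a measure" where "M \<equiv> lebesgue_on \<Omega>"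

lemma Omega_lmeasurable: "\<Omega> \<in> lmeasurable"
  using open_Omega bounded_Omega lmeasurable_open by blast

lemma Omega_lebesgue [simp, intro]: "\<Omega> \<in> sets lebesgue"
  using Omega_lmeasurable by auto

sublocale finite_measure M
  by (rule finite_measure_lebesgue_on[OF Omega_lmeasurable])

sublocale pair_sigma_finite M M ..

lemma id_measurable [measurable]: "(\<lambda>x. x) \<in> M \<rightarrow>\<^sub>M borel"
  by (intro continuous_imp_measurable_lebesgue_on continuous_on_id)

lemma moll_borel [measurable]: "moll n \<in> borel_measurable borel"
  by (rule borel_measurable_continuous_onI[OF moll_continuous])

lemma integrable_bounded:
  fixes f :: "'a \<Rightarrow> 'c::{banach, second_countable_topology}"
  assumes "f \<in> borel_measurable M" "AE x in M. norm (f x) \<le> C"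
  shows "integrable M f"
  using integrable_const_bound[OF assms(2,1)] .

text \<open>Near the boundary part of the mass of the kernel lies outside \<open>\<Omega>\<close>. The upper bound is what makes
mollification a contraction up to the boundary; the exact value is available only inside.\<close>

lemma moll_M_integral:
  shows moll_M_integrable: "integrable M (\<lambda>y. moll n (x - y))"
    and moll_M_integral_le: "(LINT y|M. moll n (x - y)) \<le> 1"
    and moll_M_integral_eq: "ball x (1 / real (Suc n)) \<subseteq> \<Omega> \<Longrightarrow> (LINT y|M. moll n (x - y)) = 1"
proof -
  have c: "continuous_on UNIV (\<lambda>y. moll n (x - y))" by (rule moll_diff_continuous)
  then have m: "(\<lambda>y. moll n (x - y)) \<in> borel_measurable lborel"
    by (simp add: borel_measurable_continuous_onI)
  have i: "integrable lebesgue (\<lambda>y. moll n (x - y))"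
    using moll_integral_translate(1) by (simp add: integrable_completion[OF m])
  have I: "(LINT y|lebesgue. moll n (x - y)) = 1"
    using moll_integral_translate(2) by (simp add: integral_completion[OF m])
  have eq: "(LINT y|M. moll n (x - y)) = (LINT y|lebesgue. indicator \<Omega> y * moll n (x - y))"
    by (subst integral_restrict_space) auto
  have i2: "integrable lebesgue (\<lambda>y. indicator \<Omega> y * moll n (x - y))"
    by (rule integrable_bounded_mult[OF i borel_measurable_indicator[OF Omega_lebesgue] AE_I2, where C = 1])
      (auto split: split_indicator)
  show "integrable M (\<lambda>y. moll n (x - y))"
    using i2 by (subst integrable_restrict_space) auto
  show "(LINT y|M. moll n (x - y)) \<le> 1"
    unfolding eq I[symmetric] by (intro integral_mono i2 i) (auto simp: indicator_def moll_nonneg)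
  show "(LINT y|M. moll n (x - y)) = 1" if "ball x (1 / real (Suc n)) \<subseteq> \<Omega>"
    unfolding eq I[symmetric]
  proof (rule Bochner_Integration.integral_cong)
    fix y show "indicator \<Omega> y * moll n (x - y) = moll n (x - y)"
      using that by (cases "y \<in> \<Omega>") (auto simp: dist_norm intro!: moll_eq_0 simp: subset_iff not_less)
  qed simp
qed

abbreviation mollify :: "nat \<Rightarrow> ('a \<Rightarrow> real) \<Rightarrow> 'a \<Rightarrow> real" where
  "mollify n f \<equiv> conv \<Omega> (moll n) f"

lemma mollify_integrand_integrable:
  assumes "integrable M f"
  shows "integrable M (\<lambda>y. moll n (x - y) * f y)"
proof -
  obtain C where "\<And>x :: 'a. \<bar>moll n x\<bar> \<le> C" using bumps_bounded[OF moll_bumps] by blast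
  then show ?thesis
    by (intro integrable_bounded_mult[OF assms] AE_I2 borel_measurable_integrable[OF moll_M_integrable]) auto
qed

lemma mollify_C1:
  assumes "integrable M f"
  shows "has_C1_gradient (mollify n f) (\<lambda>x. LINT y|M. f y *\<^sub>R moll_grad n (x - y))"
proof -
  obtain C where "\<And>x :: 'a. \<bar>moll n x\<bar> \<le> C" using bumps_bounded[OF moll_bumps] by blast
  from conv_C1[OF moll_grad(1,2,3) this assms] show ?thesis .
qed

lemma mollify_continuous: "integrable M f \<Longrightarrow> continuous_on S (mollify n f)"
  using mollify_C1 has_C1_gradient_continuous by blast

lemma mollify_measurable: "integrable M f \<Longrightarrow> mollify n f \<in> borel_measurable M"
  by (intro continuous_imp_measurable_lebesgue_on mollify_continuous)

lemma mollify_bound: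
  assumes f: "integrable M f" "AE x in M. \<bar>f x\<bar> \<le> C" and C: "C \<ge> 0"
  shows "\<bar>mollify n f x\<bar> \<le> C"
proof -
  have "norm (mollify n f x) \<le> (LINT y|M. moll n (x - y) * C)"
    unfolding conv_def
  proof (rule integral_norm_le_AE)
    show "AE y in M. norm (moll n (x - y) * f y) \<le> moll n (x - y) * C"
      using f(2) by eventually_elim (auto simp: abs_mult moll_nonneg intro!: mult_left_mono)
  qed (intro mollify_integrand_integrable f(1) integrable_mult_left moll_M_integrable)+
  also have "\<dots> = (LINT y|M. moll n (x - y)) * C" by simp
  also have "\<dots> \<le> 1 * C" by (intro mult_right_mono moll_M_integral_le C)
  finally show ?thesis by simp
qed

lemma mollify_diff:
  assumes "integrable M f" "integrable M g"
  shows "mollify n (\<lambda>x. f x - g x) x = mollify n f x - mollify n g x"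
  unfolding conv_def
  by (simp add: right_diff_distrib Bochner_Integration.integral_diff[OF mollify_integrand_integrable[OF assms(1)] mollify_integrand_integrable[OF assms(2)]])

lemma mollify_pointwise:
  assumes f: "integrable M f" and x: "x \<in> \<Omega>" and cont: "continuous (at x) f"
  shows "(\<lambda>n. mollify n f x) \<longlonglongrightarrow> f x"
proof (rule LIMSEQ_I)
  fix e :: real assume e: "e > 0"
  obtain d where d: "d > 0" "\<And>y. dist y x < d \<Longrightarrow> \<bar>f y - f x\<bar> < e / 2"
    using cont e unfolding continuous_at_eps_delta by (metis dist_real_def half_gt_zero dist_norm)
  obtain r where r: "r > 0" "ball x r \<subseteq> \<Omega>" using open_Omega x open_contains_ball by blast
  obtain N where N: "1 / real (Suc N) < min d r"
    using nat_approx_posE[of "min d r"] d r by auto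
  have "norm (mollify n f x - f x) < e" if n: "n \<ge> N" for n
  proof -
    have le: "1 / real (Suc n) \<le> 1 / real (Suc N)" using n by (simp add: frac_le)
    then have sub: "ball x (1 / real (Suc n)) \<subseteq> \<Omega>" using N r(2) by (auto simp: subset_iff)
    have i1: "integrable M (\<lambda>y. moll n (x - y) * f x)" by (intro integrable_mult_left moll_M_integrable)
    have "mollify n f x - f x = mollify n f x - (LINT y|M. moll n (x - y)) * f x"
      using moll_M_integral_eq[OF sub] by simp
    also have "\<dots> = (LINT y|M. moll n (x - y) * f y - moll n (x - y) * f x)"
      unfolding conv_def by (subst Bochner_Integration.integral_diff[OF mollify_integrand_integrable[OF f] i1]) simp
    finally have "norm (mollify n f x - f x) = norm (LINT y|M. moll n (x - y) * f y - moll n (x - y) * f x)"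
      by simp
    also have "\<dots> \<le> (LINT y|M. moll n (x - y) * (e / 2))"
    proof (rule Bochner_Integration.integral_norm_bound_integral)
      fix y
      show "norm (moll n (x - y) * f y - moll n (x - y) * f x) \<le> moll n (x - y) * (e / 2)"
      proof (cases "norm (x - y) \<ge> 1 / real (Suc n)")
        case False
        then have "\<bar>f y - f x\<bar> < e / 2" using N le by (intro d(2)) (simp add: dist_norm norm_minus_commute)
        then show ?thesis
          by (simp add: right_diff_distrib[symmetric] abs_mult moll_nonneg mult_left_mono del: times_divide_eq_right)
      qed (simp add: moll_eq_0)
    qed (intro Bochner_Integration.integrable_diff i1 mollify_integrand_integrable f integrable_mult_left moll_M_integrable)+
    also have "\<dots> = (LINT y|M. moll n (x - y)) * (e / 2)" by simp
    also have "\<dots> \<le> 1 * (e / 2)" using e by (intro mult_right_mono moll_M_integral_le) auto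
    also have "\<dots> < e" using e by simp
    finally show ?thesis .
  qed
  then show "\<exists>no. \<forall>n\<ge>no. norm (mollify n f x - f x) < e" by blast
qed

text \<open>Fubini together with the symmetry of the kernel.\<close>

lemma mollify_L1_contraction:
  assumes f: "integrable M f"
  shows "(LINT x|M. \<bar>mollify n f x\<bar>) \<le> (LINT x|M. \<bar>f x\<bar>)"
proof -
  obtain C where C: "\<And>x :: 'a. \<bar>moll n x\<bar> \<le> C" using bumps_bounded[OF moll_bumps] by blast
  have [measurable]: "f \<in> borel_measurable M" using f by auto
  have fp: "integrable (M \<Otimes>\<^sub>M M) (\<lambda>p. \<bar>f (snd p)\<bar>)"
    by (rule Fubini_integrable) (use f in \<open>auto\<close>)
  have ip: "integrable (M \<Otimes>\<^sub>M M) (\<lambda>p. moll n (fst p - snd p) * \<bar>f (snd p)\<bar>)"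
    by (rule integrable_bounded_mult[OF fp]) (use C in auto)
  then have ip': "integrable (M \<Otimes>\<^sub>M M) (\<lambda>(x, y). moll n (x - y) * \<bar>f y\<bar>)"
    by (simp add: case_prod_beta')
  have "(LINT x|M. \<bar>mollify n f x\<bar>) \<le> (LINT x|M. LINT y|M. moll n (x - y) * \<bar>f y\<bar>)"
  proof (rule integral_mono_AE)
    show "integrable M (\<lambda>x. LINT y|M. moll n (x - y) * \<bar>f y\<bar>)"
      using integrable_fst'[OF ip'] by simp
    show "AE x in M. \<bar>mollify n f x\<bar> \<le> (LINT y|M. moll n (x - y) * \<bar>f y\<bar>)"
      unfolding conv_def
      by (intro AE_I2 order_trans[OF integral_abs_bound]) (simp add: abs_mult moll_nonneg)
    show "integrable M (\<lambda>x. \<bar>mollify n f x\<bar>)"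
      by (rule Bochner_Integration.integrable_bound[OF integrable_fst'[OF ip']])
        (use mollify_measurable[OF f] in \<open>auto simp: conv_def abs_mult moll_nonneg intro!: AE_I2 order_trans[OF integral_abs_bound]\<close>)
  qed
  also have "\<dots> = (LINT y|M. LINT x|M. moll n (x - y) * \<bar>f y\<bar>)"
    using Fubini_integral[OF ip'] by simp
  also have "\<dots> \<le> (LINT y|M. \<bar>f y\<bar>)"
  proof (rule integral_mono)
    show "integrable M (\<lambda>y. LINT x|M. moll n (x - y) * \<bar>f y\<bar>)"
      using integrable_snd[OF ip'] by simp
    fix y
    have "(LINT x|M. moll n (x - y) * \<bar>f y\<bar>) = (LINT x|M. moll n (y - x)) * \<bar>f y\<bar>"
      by (simp add: moll_minus[of n y])
    also have "\<dots> \<le> 1 * \<bar>f y\<bar>" by (intro mult_right_mono moll_M_integral_le) auto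
    finally show "(LINT x|M. moll n (x - y) * \<bar>f y\<bar>) \<le> \<bar>f y\<bar>" by simp
  qed (use f in auto)
  finally show ?thesis .
qed

lemma mollify_integrable: "integrable M f \<Longrightarrow> integrable M (mollify n f)"
proof -
  assume f: "integrable M f"
  obtain C where C: "\<And>x :: 'a. \<bar>moll n x\<bar> \<le> C" using bumps_bounded[OF moll_bumps] by blast
  show ?thesis
  proof (rule integrable_bounded[OF mollify_measurable[OF f]])
    have "norm (mollify n f x) \<le> (LINT y|M. C * \<bar>f y\<bar>)" for x
      unfolding conv_def
      by (intro integral_norm_le_AE mollify_integrand_integrable f integrable_mult_right integrable_abs AE_I2)
        (use C in \<open>auto simp: abs_mult intro!: mult_right_mono\<close>)
    then show "AE x in M. norm (mollify n f x) \<le> (LINT y|M. C * \<bar>f y\<bar>)" by simp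
  qed
qed

text \<open>For bounded continuous functions this is dominated convergence; those functions are dense in
\<open>L\<^sup>1\<close>, and mollification is a contraction there.\<close>

lemma mollify_L1:
  assumes f: "integrable M f"
  shows "(\<lambda>n. LINT x|M. \<bar>mollify n f x - f x\<bar>) \<longlonglongrightarrow> 0"
proof (rule LIMSEQ_I)
  fix e :: real assume e: "e > 0"
  obtain g C where g: "continuous_on UNIV g" "\<And>x. \<bar>g x\<bar> \<le> C" "(LINT x|M. \<bar>f x - g x\<bar>) < e / 3"
    using continuous_L1_approximation[OF Omega_lmeasurable f, of "e / 3"] e by auto
  have C: "C \<ge> 0" using g(2)[of undefined] by linarith
  have gi: "integrable M g"
    by (rule integrable_bounded[OF continuous_imp_measurable_lebesgue_on[OF g(1)]]) (use g(2) in auto)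
  have "(\<lambda>n. LINT x|M. \<bar>mollify n g x - g x\<bar>) \<longlonglongrightarrow> (LINT x|M. 0)"
  proof (rule integral_dominated_convergence[where w = "\<lambda>x. 2 * C"])
    show "AE x in M. (\<lambda>n. \<bar>mollify n g x - g x\<bar>) \<longlonglongrightarrow> 0"
    proof (rule AE_I2)
      fix x assume "x \<in> space M"
      then have "(\<lambda>n. mollify n g x) \<longlonglongrightarrow> g x"
        using g(1) by (intro mollify_pointwise gi) (auto simp: continuous_on_eq_continuous_at)
      then have "(\<lambda>n. \<bar>mollify n g x - g x\<bar>) \<longlonglongrightarrow> \<bar>g x - g x\<bar>" by (intro tendsto_intros)
      then show "(\<lambda>n. \<bar>mollify n g x - g x\<bar>) \<longlonglongrightarrow> 0" by simp
    qed
    show "AE x in M. norm \<bar>mollify n g x - g x\<bar> \<le> 2 * C" for n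
    proof (rule AE_I2)
      fix x
      have "\<bar>mollify n g x\<bar> \<le> C" using mollify_bound[OF gi _ C] g(2) by auto
      then show "norm \<bar>mollify n g x - g x\<bar> \<le> 2 * C" using g(2)[of x] by auto
    qed
  qed (use gi mollify_measurable[OF gi] in auto)
  then have "eventually (\<lambda>n. (LINT x|M. \<bar>mollify n g x - g x\<bar>) < e / 3) sequentially"
    using e by (intro order_tendstoD(2)) auto
  then obtain N where N: "\<And>n. n \<ge> N \<Longrightarrow> (LINT x|M. \<bar>mollify n g x - g x\<bar>) < e / 3"
    unfolding eventually_sequentially by blast
  have "norm ((LINT x|M. \<bar>mollify n f x - f x\<bar>) - 0) < e" if n: "n \<ge> N" for n
  proof -
    have i: "integrable M (mollify n f)" "integrable M (mollify n g)"
      "integrable M (mollify n (\<lambda>x. f x - g x))"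
      using f gi by (auto intro!: mollify_integrable)
    have "(LINT x|M. \<bar>mollify n f x - f x\<bar>) \<le>
       (LINT x|M. \<bar>mollify n (\<lambda>x. f x - g x) x\<bar> + (\<bar>mollify n g x - g x\<bar> + \<bar>f x - g x\<bar>))"
      by (rule integral_mono) (use i f gi in \<open>auto simp: mollify_diff[OF f gi]\<close>)
    also have "\<dots> = (LINT x|M. \<bar>mollify n (\<lambda>x. f x - g x) x\<bar>) + ((LINT x|M. \<bar>mollify n g x - g x\<bar>) + (LINT x|M. \<bar>f x - g x\<bar>))"
      by (subst Bochner_Integration.integral_add, (use i f gi in auto)[2], subst Bochner_Integration.integral_add) (use i f gi in auto)
    also have "(LINT x|M. \<bar>mollify n (\<lambda>x. f x - g x) x\<bar>) \<le> (LINT x|M. \<bar>f x - g x\<bar>)"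
      by (rule mollify_L1_contraction) (use f gi in auto)
    finally have "(LINT x|M. \<bar>mollify n f x - f x\<bar>) < e" using N[OF n] g(3) by linarith
    then show ?thesis by simp
  qed
  then show "\<exists>no. \<forall>n\<ge>no. norm ((LINT x|M. \<bar>mollify n f x - f x\<bar>) - 0) < e" by blast
qed

end

section \<open>Continuously differentiable test functions\<close>

lemma has_C1_gradient_unique:
  assumes "has_C1_gradient f D" "has_C1_gradient f E"
  shows "D = E"
proof
  fix x
  have "(\<lambda>h. D x \<bullet> h) = (\<lambda>h. E x \<bullet> h)"
    using assms has_derivative_unique unfolding has_C1_gradient_def by blast
  then show "D x = E x" by (metis vector_eq_rdot inner_commute)
qed

lemma has_C1_gradient_zero:
  assumes "has_C1_gradient f D" "open U" "\<And>y. y \<in> U \<Longrightarrow> f y = 0" "x \<in> U"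
  shows "D x = 0"
proof -
  have "((\<lambda>y. 0) has_derivative (\<lambda>h. D x \<bullet> h)) (at x)"
    by (rule has_derivative_transform_within_open[OF _ assms(2,4), of f])
      (use assms(1,3) in \<open>auto simp: has_C1_gradient_def\<close>)
  then have "(\<lambda>h. D x \<bullet> h) = (\<lambda>h. 0)"
    using has_derivative_unique has_derivative_const by blast
  then have "D x \<bullet> D x = 0" by metis
  then show ?thesis by simp
qed

lemma has_C1_gradient_mult:
  assumes "has_C1_gradient f D" "has_C1_gradient g E"
  shows "has_C1_gradient (\<lambda>x. f x * g x) (\<lambda>x. f x *\<^sub>R E x + g x *\<^sub>R D x)"
  unfolding has_C1_gradient_def
proof (intro conjI allI)
  show "continuous_on UNIV (\<lambda>x. f x *\<^sub>R E x + g x *\<^sub>R D x)"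
    using assms by (intro continuous_intros has_C1_gradient_continuous[OF assms(1)] has_C1_gradient_continuous[OF assms(2)])
      (auto simp: has_C1_gradient_def)
  fix x
  show "((\<lambda>x. f x * g x) has_derivative (\<lambda>h. (f x *\<^sub>R E x + g x *\<^sub>R D x) \<bullet> h)) (at x)"
    by (rule has_derivative_eq_rhs, rule has_derivative_mult)
      (use assms in \<open>auto simp: has_C1_gradient_def inner_add_left\<close>)
qed

lemma has_C1_gradient_compose:
  assumes f: "has_C1_gradient f D" and b: "\<And>s. (b has_real_derivative b' s) (at s)" "continuous_on UNIV b'"
  shows "has_C1_gradient (\<lambda>x. b (f x)) (\<lambda>x. b' (f x) *\<^sub>R D x)"
  unfolding has_C1_gradient_def
proof (intro conjI allI)
  show "continuous_on UNIV (\<lambda>x. b' (f x) *\<^sub>R D x)"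
    using f by (intro continuous_intros continuous_on_compose2[OF b(2)] has_C1_gradient_continuous[OF f])
      (auto simp: has_C1_gradient_def)
  fix x
  have "((\<lambda>x. b (f x)) has_derivative (\<lambda>h. (D x \<bullet> h) * b' (f x))) (at x)"
    by (rule has_derivative_eq_rhs, rule has_derivative_compose[OF _ b(1)[unfolded has_field_derivative_def]])
      (use f in \<open>auto simp: has_C1_gradient_def mult.commute\<close>)
  then show "((\<lambda>x. b (f x)) has_derivative (\<lambda>h. (b' (f x) *\<^sub>R D x) \<bullet> h)) (at x)"
    by (simp add: mult.commute)
qed

lemma has_C1_gradient_reflect:
  assumes "has_C1_gradient f D"
  shows "has_C1_gradient (\<lambda>y. f (x - y)) (\<lambda>y. - D (x - y))"
  unfolding has_C1_gradient_def
proof (intro conjI allI)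
  show "continuous_on UNIV (\<lambda>y. - D (x - y))"
    by (rule continuous_on_minus, rule continuous_on_compose2[of UNIV D UNIV "\<lambda>y. x - y"])
      (use assms in \<open>auto simp: has_C1_gradient_def intro!: continuous_intros\<close>)
  fix y
  have "((\<lambda>y. x - y) has_derivative (\<lambda>h. - h)) (at y)" by (auto intro!: derivative_eq_intros)
  from has_derivative_compose[OF this, of f "\<lambda>h. D (x - y) \<bullet> h"] assms
  show "((\<lambda>y. f (x - y)) has_derivative (\<lambda>h. (- D (x - y)) \<bullet> h)) (at y)"
    by (simp add: has_C1_gradient_def)
qed

text \<open>The gradient automatically vanishes outside a compact set on whose complement the function does
(\<open>C1_testI\<close>); both facts are recorded because every use needs them together.\<close>

definition C1_test :: "'a::euclidean_space set \<Rightarrow> ('a \<Rightarrow> real) \<Rightarrow> ('a \<Rightarrow> 'a) \<Rightarrow> bool" where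
  "C1_test \<Omega> \<psi> D \<longleftrightarrow> has_C1_gradient \<psi> D \<and>
     (\<exists>K. compact K \<and> K \<subseteq> \<Omega> \<and> (\<forall>x. x \<notin> K \<longrightarrow> \<psi> x = 0 \<and> D x = 0))"

lemma C1_testI:
  assumes "has_C1_gradient \<psi> D" "compact K" "K \<subseteq> \<Omega>" "\<And>x. x \<notin> K \<Longrightarrow> \<psi> x = 0"
  shows "C1_test \<Omega> \<psi> D"
proof -
  have "D x = 0" if "x \<notin> K" for x
    by (rule has_C1_gradient_zero[OF assms(1), of "- K"]) (use assms that compact_imp_closed in auto)
  with assms show ?thesis unfolding C1_test_def by blast
qed

lemma C1_test_C1: "C1_test \<Omega> \<psi> D \<Longrightarrow> has_C1_gradient \<psi> D"
  by (simp add: C1_test_def)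

lemma C1_test_bounded:
  assumes "C1_test \<Omega> \<psi> D"
  shows "\<exists>C\<ge>0. \<forall>x. \<bar>\<psi> x\<bar> \<le> C \<and> norm (D x) \<le> C"
proof -
  from assms obtain K where K: "compact K" "\<And>x. x \<notin> K \<Longrightarrow> \<psi> x = 0 \<and> D x = 0"
    unfolding C1_test_def by blast
  have "bounded (\<psi> ` K)" "bounded (D ` K)"
    using assms by (auto intro!: compact_imp_bounded compact_continuous_image K has_C1_gradient_continuous[of \<psi> D]
      simp: C1_test_def has_C1_gradient_def intro: continuous_on_subset)
  then obtain A B where "\<forall>x\<in>K. \<bar>\<psi> x\<bar> \<le> A" "\<forall>x\<in>K. norm (D x) \<le> B"
    unfolding bounded_iff by auto
  then show ?thesis
    using K(2) by (intro exI[of _ "max 0 (max A B)"]) (metis abs_zero linorder_le_cases max.cobounded1 max.coboundedI2 norm_zero max.cobounded2 le_max_iff_disj)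
qed

lemma C1_test_mult:
  assumes "C1_test \<Omega> \<psi> D" "has_C1_gradient f E"
  shows "C1_test \<Omega> (\<lambda>x. f x * \<psi> x) (\<lambda>x. f x *\<^sub>R D x + \<psi> x *\<^sub>R E x)"
proof -
  from assms obtain K where K: "compact K" "K \<subseteq> \<Omega>" "\<And>x. x \<notin> K \<Longrightarrow> \<psi> x = 0 \<and> D x = 0"
    unfolding C1_test_def by blast
  show ?thesis
    by (rule C1_testI[OF has_C1_gradient_mult[OF assms(2) C1_test_C1[OF assms(1)]] K(1,2)]) (simp add: K(3))
qed

text \<open>The one passage to the limit behind the product, chain and divergence rules: a factor that converges
boundedly and almost everywhere may be multiplied with a factor that converges in \<open>L\<^sup>1\<close>.\<close>

lemma bilinear_convergence:
  fixes bil :: "'b::{banach, second_countable_topology} \<Rightarrow> 'c::{banach, second_countable_topology} \<Rightarrow> 'd::{banach, second_countable_topology}"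
  assumes bil: "bounded_bilinear bil"
    and a: "\<And>n. a n \<in> borel_measurable N" "a0 \<in> borel_measurable N"
      "AE x in N. \<forall>n. norm (a n x) \<le> C" "AE x in N. (\<lambda>n. a n x) \<longlonglongrightarrow> a0 x"
    and b: "\<And>n. integrable N (b n)" "integrable N b0" "(\<lambda>n. LINT x|N. norm (b n x - b0 x)) \<longlonglongrightarrow> 0"
  shows "(\<lambda>n. LINT x|N. bil (a n x) (b n x)) \<longlonglongrightarrow> (LINT x|N. bil (a0 x) (b0 x))"
proof -
  interpret bounded_bilinear bil by (rule bil)
  obtain K where K: "K > 0" "\<And>x y. norm (bil x y) \<le> norm x * norm y * K" using pos_bounded by blast
  have cont: "continuous_on UNIV (\<lambda>p. bil (fst p) (snd p))"
    by (intro continuous_on continuous_intros)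
  have m: "(\<lambda>x. bil (f x) (g x)) \<in> borel_measurable N" if "f \<in> borel_measurable N" "g \<in> borel_measurable N" for f g
    by (rule borel_measurable_continuous_Pair[OF that cont])
  have bm: "b n \<in> borel_measurable N" "b0 \<in> borel_measurable N" for n using b by auto
  have bd: "AE x in N. norm (bil (a n x) (c x)) \<le> \<bar>C\<bar> * K * norm (c x)" for n and c :: "_ \<Rightarrow> 'c"
    using a(3)
  proof eventually_elim
    case (elim x)
    have "norm (bil (a n x) (c x)) \<le> norm (a n x) * norm (c x) * K" by (rule K)
    also have "\<dots> \<le> \<bar>C\<bar> * norm (c x) * K"
      using elim K(1) by (intro mult_right_mono) (auto intro: order_trans[OF _ abs_ge_self])
    finally show ?case by (simp add: mult_ac)
  qed
  have i: "integrable N (\<lambda>x. bil (a n x) (c x))" if c: "integrable N c" for n c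
  proof (rule Bochner_Integration.integrable_bound)
    show "integrable N (\<lambda>x. \<bar>C\<bar> * K * norm (c x))" using c by simp
    show "AE x in N. norm (bil (a n x) (c x)) \<le> norm (\<bar>C\<bar> * K * norm (c x))"
      using bd[of n c] by eventually_elim (use K(1) in auto)
  qed (use m a(1) c in auto)
  have 1: "(\<lambda>n. LINT x|N. bil (a n x) (b n x - b0 x)) \<longlonglongrightarrow> 0"
  proof (rule Lim_null_comparison)
    show "(\<lambda>n. \<bar>C\<bar> * K * (LINT x|N. norm (b n x - b0 x))) \<longlonglongrightarrow> 0"
      using tendsto_mult_left[OF b(3), of "\<bar>C\<bar> * K"] by simp
    show "\<forall>\<^sub>F n in sequentially. norm (LINT x|N. bil (a n x) (b n x - b0 x)) \<le> \<bar>C\<bar> * K * (LINT x|N. norm (b n x - b0 x))"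
    proof (intro always_eventually allI)
      fix n
      have "norm (LINT x|N. bil (a n x) (b n x - b0 x)) \<le> (LINT x|N. \<bar>C\<bar> * K * norm (b n x - b0 x))"
        by (rule integral_norm_le_AE[OF i _ bd]) (use b in auto)
      then show "norm (LINT x|N. bil (a n x) (b n x - b0 x)) \<le> \<bar>C\<bar> * K * (LINT x|N. norm (b n x - b0 x))" by simp
    qed
  qed
  have 2: "(\<lambda>n. LINT x|N. bil (a n x) (b0 x)) \<longlonglongrightarrow> (LINT x|N. bil (a0 x) (b0 x))"
  proof (rule integral_dominated_convergence[where w = "\<lambda>x. \<bar>C\<bar> * K * norm (b0 x)"])
    show "AE x in N. (\<lambda>n. bil (a n x) (b0 x)) \<longlonglongrightarrow> bil (a0 x) (b0 x)"
      using a(4) by eventually_elim (intro tendsto tendsto_const)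
  qed (use bd m a bm b in auto)
  have "(\<lambda>n. (LINT x|N. bil (a n x) (b n x - b0 x)) + (LINT x|N. bil (a n x) (b0 x))) \<longlonglongrightarrow> 0 + (LINT x|N. bil (a0 x) (b0 x))"
    by (rule tendsto_add[OF 1 2])
  moreover have "(LINT x|N. bil (a n x) (b n x - b0 x)) + (LINT x|N. bil (a n x) (b0 x)) = (LINT x|N. bil (a n x) (b n x))" for n
    by (subst Bochner_Integration.integral_add[symmetric]) (use i b in \<open>auto simp: diff_right\<close>)
  ultimately show ?thesis by simp
qed

context bounded_open_set
begin

lemma C1_test_measurable:
  assumes "C1_test \<Omega> \<psi> D"
  shows "\<psi> \<in> borel_measurable M" "D \<in> borel_measurable M" "integrable M \<psi>" "integrable M D"
proof -
  show m: "\<psi> \<in> borel_measurable M" "D \<in> borel_measurable M"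
    using assms by (auto intro!: continuous_imp_measurable_lebesgue_on has_C1_gradient_continuous[of \<psi> D]
      simp: C1_test_def has_C1_gradient_def)
  obtain C where "\<forall>x. \<bar>\<psi> x\<bar> \<le> C \<and> norm (D x) \<le> C" using C1_test_bounded[OF assms] by blast
  then show "integrable M \<psi>" "integrable M D" by (auto intro!: integrable_bounded[where C = C] m)
qed

text \<open>Difference quotients have integral \<open>0\<close> by translation invariance; they are bounded by a multiple of
the indicator of a compact set and converge to the partial derivative.\<close>

lemma C1_test_integral_gradient:
  assumes \<psi>: "C1_test \<Omega> \<psi> D"
  shows "(LINT x|M. D x) = 0"
proof (rule euclidean_eqI)
  fix i :: 'a assume i: "i \<in> Basis"
  from \<psi> obtain K where K: "compact K" "K \<subseteq> \<Omega>" "\<And>x. x \<notin> K \<Longrightarrow> \<psi> x = 0 \<and> D x = 0"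
    unfolding C1_test_def by blast
  obtain C where C: "C \<ge> 0" "\<And>x. norm (D x) \<le> C" "\<And>x. \<bar>\<psi> x\<bar> \<le> C" using C1_test_bounded[OF \<psi>] by blast
  have der: "(\<psi> has_derivative (\<lambda>h. D x \<bullet> h)) (at x)" for x
    using \<psi> by (simp add: C1_test_def has_C1_gradient_def)
  have c\<psi>: "continuous_on UNIV \<psi>" and cD: "continuous_on UNIV D"
    using \<psi> by (auto simp: C1_test_def has_C1_gradient_def intro!: has_C1_gradient_continuous[of \<psi> D])
  define K' where "K' = (\<Union>x\<in>K. cball x 1)"
  have K': "compact K'" unfolding K'_def by (rule compact_minkowski_sum_cball[OF K(1)])
  have fin: "integrable lborel (\<lambda>x. C * indicator K' x :: real)"
    using emeasure_compact_finite[OF K'] borel_compact[OF K']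
    by (intro integrable_mult_right integrable_real_indicator) auto
  have m\<psi>: "\<psi> \<in> borel_measurable borel" and mD: "(\<lambda>x. D x \<bullet> i) \<in> borel_measurable borel"
    using c\<psi> cD by (auto intro!: borel_measurable_continuous_onI continuous_intros)
  define t where "t n = 1 / real (Suc n)" for n
  have t: "t n > 0" "t n \<le> 1" for n by (auto simp: t_def)
  have t0: "t \<longlonglongrightarrow> 0" unfolding t_def by (rule LIMSEQ_Suc[OF lim_1_over_n])
  define q where "q n x = (\<psi> (x + t n *\<^sub>R i) - \<psi> x) / t n" for n x
  have m\<psi>': "(\<lambda>x. \<psi> (x + c)) \<in> borel_measurable borel" for c
    by (intro borel_measurable_continuous_onI continuous_on_compose2[OF c\<psi>] continuous_intros) auto
  have lip: "\<bar>\<psi> x - \<psi> y\<bar> \<le> C * norm (x - y)" for x y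
  proof -
    have "norm (\<psi> x - \<psi> y) \<le> C * norm (x - y)"
    proof (rule differentiable_bound[of UNIV \<psi> "\<lambda>x h. D x \<bullet> h"])
      show "onorm (\<lambda>h. D x \<bullet> h) \<le> C" for x
        by (rule onorm_le) (metis C(2) Cauchy_Schwarz_ineq2 mult_right_mono norm_ge_zero order_trans real_norm_def)
    qed (use der in auto)
    then show ?thesis by simp
  qed
  have "(\<lambda>n. LINT x|lborel. q n x) \<longlonglongrightarrow> (LINT x|lborel. D x \<bullet> i)"
  proof (rule integral_dominated_convergence[OF _ _ fin])
    show "AE x in lborel. (\<lambda>n. q n x) \<longlonglongrightarrow> D x \<bullet> i"
    proof (rule AE_I2)
      fix x
      have "((\<lambda>s. \<psi> (x + s *\<^sub>R i)) has_derivative (\<lambda>s. D x \<bullet> (s *\<^sub>R i))) (at 0)"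
        by (rule has_derivative_compose[of "\<lambda>s. x + s *\<^sub>R i" "\<lambda>s. s *\<^sub>R i"])
          (use der[of x] in \<open>auto intro!: derivative_eq_intros\<close>)
      then have "((\<lambda>s. \<psi> (x + s *\<^sub>R i)) has_real_derivative (D x \<bullet> i)) (at 0)"
        by (simp add: has_field_derivative_def mult_commute_abs)
      then have "((\<lambda>h. (\<psi> (x + h *\<^sub>R i) - \<psi> x) / h) \<longlongrightarrow> D x \<bullet> i) (at 0)"
        by (simp add: DERIV_def)
      moreover have "filterlim t (at 0) sequentially"
        using t0 t(1) by (auto simp: filterlim_at less_imp_neq[symmetric])
      ultimately show "(\<lambda>n. q n x) \<longlonglongrightarrow> D x \<bullet> i"
        unfolding q_def by (rule filterlim_compose)
    qed
    show "AE x in lborel. norm (q n x) \<le> C * indicator K' x" for n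
    proof (rule AE_I2)
      fix x
      show "norm (q n x) \<le> C * indicator K' x"
      proof (cases "x \<in> K'")
        case True
        have "\<bar>\<psi> (x + t n *\<^sub>R i) - \<psi> x\<bar> \<le> C * norm (t n *\<^sub>R i)" using lip[of "x + t n *\<^sub>R i" x] by simp
        then show ?thesis using True t(1)[of n] i by (simp add: q_def divide_le_eq)
      next
        case False
        have "x \<notin> K" using False by (force simp: K'_def)
        moreover have "x + t n *\<^sub>R i \<notin> K"
        proof
          assume "x + t n *\<^sub>R i \<in> K"
          moreover have "x \<in> cball (x + t n *\<^sub>R i) 1" using t[of n] i by (simp add: dist_norm)
          ultimately show False using False unfolding K'_def by blast
        qed
        ultimately show ?thesis using K(3) by (simp add: q_def False)
      qed
    qed
  qed (use m\<psi> mD m\<psi>' in \<open>auto simp: q_def\<close>)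
  moreover have "(LINT x|lborel. q n x) = 0" for n
  proof -
    have i0: "integrable lborel \<psi>"
    proof (rule Bochner_Integration.integrable_bound[OF fin])
      show "AE x in lborel. norm (\<psi> x) \<le> norm (C * indicator K' x)"
      proof (rule AE_I2)
        fix x show "norm (\<psi> x) \<le> norm (C * indicator K' x)"
          using C(1) C(3)[of x] K(3)[of x] by (cases "x \<in> K'") (force simp: K'_def)+
      qed
    qed (use m\<psi> in simp)
    have eqd: "distr lborel borel ((+) (t n *\<^sub>R i)) = lborel" by (rule lborel_distr_plus)
    have i1: "integrable lborel (\<lambda>x. \<psi> (x + t n *\<^sub>R i))"
      using i0 integrable_distr_eq[of "(+) (t n *\<^sub>R i)" lborel borel \<psi>] m\<psi>
      by (simp add: eqd add.commute)
    have "(LINT x|lborel. \<psi> (x + t n *\<^sub>R i)) = (LINT x|lborel. \<psi> x)"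
      using integral_distr[of "(+) (t n *\<^sub>R i)" lborel borel \<psi>] m\<psi>
      by (simp add: eqd add.commute)
    then show ?thesis unfolding q_def using i0 i1 by simp
  qed
  ultimately have 0: "(LINT x|lborel. D x \<bullet> i) = 0"
    by (simp add: LIMSEQ_const_iff)
  have Dout: "D x = 0" if "x \<notin> \<Omega>" for x using K(2) K(3)[of x] that by blast
  have "(LINT x|M. D x) \<bullet> i = (LINT x|M. D x \<bullet> i)"
    using C1_test_measurable[OF \<psi>] by simp
  also have "\<dots> = (LINT x|lebesgue. indicator \<Omega> x *\<^sub>R (D x \<bullet> i))"
    by (subst integral_restrict_space) auto
  also have "\<dots> = (LINT x|lebesgue. D x \<bullet> i)"
    by (intro Bochner_Integration.integral_cong) (use Dout in \<open>auto split: split_indicator\<close>)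
  also have "\<dots> = 0" using 0 mD by (simp add: integral_completion)
  finally show "(LINT x|M. D x) \<bullet> i = 0 \<bullet> i" by simp
qed

lemma moll_C1_test:
  assumes Dm: "has_C1_gradient (moll n) Dm" and sub: "cball x (1 / real (Suc n)) \<subseteq> \<Omega>"
  shows "C1_test \<Omega> (\<lambda>y. moll n (x - y)) (\<lambda>y. - Dm (x - y))"
proof (rule C1_testI[OF has_C1_gradient_reflect[OF Dm] compact_cball sub])
  fix y assume "y \<notin> cball x (1 / real (Suc n))"
  then show "moll n (x - y) = 0" by (intro moll_eq_0) (simp add: dist_norm)
qed

lemma measurable_reflected_translate:
  assumes "continuous_on UNIV (Dm :: 'a \<Rightarrow> 'a)"
  shows "(\<lambda>y. Dm (x - y)) \<in> borel_measurable M"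
  by (rule continuous_imp_measurable_lebesgue_on, rule continuous_on_compose2[OF assms])
    (auto intro!: continuous_intros)

lemma moll_scaleR_integrable:
  assumes "integrable M V"
  shows "integrable M (\<lambda>y. moll n (x - y) *\<^sub>R (V y :: 'a))"
proof -
  obtain C where "\<And>x :: 'a. \<bar>moll n x\<bar> \<le> C" using bumps_bounded[OF moll_bumps] by blast
  then show ?thesis
    by (intro integrable_bounded_scaleR[OF assms] AE_I2 borel_measurable_integrable[OF moll_M_integrable]) auto
qed

lemma moll_scaleR_inner:
  assumes "integrable M V"
  shows "(LINT y|M. moll n (x - y) *\<^sub>R (V y :: 'a)) \<bullet> i = mollify n (\<lambda>y. V y \<bullet> i) x"
  unfolding conv_def by (subst integral_inner_left[symmetric, OF moll_scaleR_integrable[OF assms]]) simp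

text \<open>The shift \<open>N\<close> of the index keeps the radius of the kernel below the distance from the support of
\<open>f\<close> to the boundary.\<close>

lemma mollify_test_function:
  assumes f: "integrable M f" and K: "compact K" "K \<subseteq> \<Omega>" "\<And>x. x \<notin> K \<Longrightarrow> f x = 0"
  shows "\<exists>N K'. compact K' \<and> K' \<subseteq> \<Omega> \<and>
    (\<forall>n. mollify (n + N) f \<in> test_functions \<Omega> \<and> (\<forall>x. x \<notin> K' \<longrightarrow> mollify (n + N) f x = 0))"
proof -
  obtain r where r: "r > 0" "(\<Union>x\<in>K. cball x r) \<subseteq> \<Omega>"
    using compact_subset_open_imp_cball_epsilon_subset[OF K(1) open_Omega K(2)] by blast
  obtain N where N: "1 / real (Suc N) < r" using nat_approx_posE[OF r(1)] by auto
  define K' where "K' = (\<Union>x\<in>K. cball x r)"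
  have K': "compact K'" "K' \<subseteq> \<Omega>" using compact_minkowski_sum_cball[OF K(1)] r(2) by (auto simp: K'_def)
  have supp: "mollify (n + N) f x = 0" if x: "x \<notin> K'" for n x
  proof -
    have "moll (n + N) (x - y) * f y = 0" for y
    proof (cases "y \<in> K")
      case True
      then have "norm (x - y) > r" using x by (force simp: K'_def dist_norm norm_minus_commute)
      moreover have "1 / real (Suc (n + N)) \<le> 1 / real (Suc N)" by (simp add: frac_le)
      ultimately show ?thesis using N moll_eq_0[of "n + N" "x - y"] by simp
    qed (simp add: K(3))
    then have "(\<lambda>y. moll (n + N) (x - y) * f y) = (\<lambda>y. 0)" by (intro ext)
    then show ?thesis by (simp only: conv_def) simp
  qed
  have "mollify (n + N) f \<in> test_functions \<Omega>" for n
    unfolding test_functions_def using smooth_on_conv[OF moll_bumps f] K' supp by blast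
  with K' supp show ?thesis by blast
qed

text \<open>Smooth test functions may be replaced by continuously differentiable ones: on functions with compact
support, mollification commutes with the gradient.\<close>

lemma C1_test_approx:
  assumes \<psi>: "C1_test \<Omega> \<psi> D"
  shows "\<exists>\<zeta> Z C. (\<forall>n. \<zeta> n \<in> test_functions \<Omega> \<and> C1_test \<Omega> (\<zeta> n) (Z n)) \<and>
    (\<forall>n x. \<bar>\<zeta> n x\<bar> \<le> C \<and> norm (Z n x) \<le> C) \<and>
    (\<forall>x\<in>\<Omega>. (\<lambda>n. \<zeta> n x) \<longlonglongrightarrow> \<psi> x \<and> (\<lambda>n. Z n x) \<longlonglongrightarrow> D x)"
proof -
  from \<psi> obtain K where K: "compact K" "K \<subseteq> \<Omega>" "\<And>x. x \<notin> K \<Longrightarrow> \<psi> x = 0 \<and> D x = 0"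
    unfolding C1_test_def by blast
  obtain C where C: "C \<ge> 0" "\<And>x. norm (D x) \<le> C" "\<And>x. \<bar>\<psi> x\<bar> \<le> C" using C1_test_bounded[OF \<psi>] by blast
  note m = C1_test_measurable[OF \<psi>]
  obtain N K' where K': "compact K'" "K' \<subseteq> \<Omega>" and
    NK: "\<And>n. mollify (n + N) \<psi> \<in> test_functions \<Omega>" "\<And>n x. x \<notin> K' \<Longrightarrow> mollify (n + N) \<psi> x = 0"
    using mollify_test_function[OF m(3) K(1,2)] K(3) by blast
  define E where "E n x = (LINT y|M. \<psi> y *\<^sub>R moll_grad n (x - y))" for n x
  have EC1: "has_C1_gradient (mollify n \<psi>) (E n)" for n
    unfolding E_def[abs_def] by (rule mollify_C1[OF m(3)])
  \<comment> \<open>no boundary terms: the gradient may be moved onto the compactly supported factor\<close>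
  have Eeq: "E n x = (LINT y|M. moll n (x - y) *\<^sub>R D y)" for n x
  proof -
    have t: "C1_test \<Omega> (\<lambda>y. moll n (x - y) * \<psi> y) (\<lambda>y. moll n (x - y) *\<^sub>R D y + \<psi> y *\<^sub>R (- moll_grad n (x - y)))"
      by (rule C1_test_mult[OF \<psi> has_C1_gradient_reflect[OF moll_grad_C1]])
    obtain B where B: "\<And>y :: 'a. norm (moll_grad n y) \<le> B" using moll_grad_bounded[where n=n and 'a='a] unfolding bounded_iff by blast
    have i: "integrable M (\<lambda>y. \<psi> y *\<^sub>R (- moll_grad n (x - y)))"
      by (rule integrable_scaleR_bounded[OF m(3), where B = B])
        (use B measurable_reflected_translate[OF moll_grad_continuous] in auto)
    have "0 = (LINT y|M. moll n (x - y) *\<^sub>R D y + \<psi> y *\<^sub>R (- moll_grad n (x - y)))"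
      using C1_test_integral_gradient[OF t] by simp
    also have "\<dots> = (LINT y|M. moll n (x - y) *\<^sub>R D y) + (LINT y|M. \<psi> y *\<^sub>R (- moll_grad n (x - y)))"
      by (rule Bochner_Integration.integral_add[OF moll_scaleR_integrable[OF m(4)] i])
    also have "(LINT y|M. \<psi> y *\<^sub>R (- moll_grad n (x - y))) = - E n x" by (simp add: E_def)
    finally show ?thesis by simp
  qed
  have nE: "norm (E n x) \<le> C" for n x
  proof -
    have "norm (E n x) \<le> (LINT y|M. moll n (x - y) * C)"
      unfolding Eeq
      by (rule Bochner_Integration.integral_norm_bound_integral[OF moll_scaleR_integrable[OF m(4)]])
        (use C in \<open>auto simp: moll_nonneg moll_M_integrable intro!: mult_left_mono\<close>)
    also have "\<dots> = (LINT y|M. moll n (x - y)) * C" by simp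
    also have "\<dots> \<le> 1 * C" by (intro mult_right_mono moll_M_integral_le C)
    finally show ?thesis by simp
  qed
  show ?thesis
  proof (intro exI[of _ "\<lambda>n. mollify (n + N) \<psi>"] exI[of _ "\<lambda>n. E (n + N)"] exI[of _ C] conjI allI ballI)
    show "mollify (n + N) \<psi> \<in> test_functions \<Omega>" for n
      by (rule NK)
    show "C1_test \<Omega> (mollify (n + N) \<psi>) (E (n + N))" for n
      by (rule C1_testI[OF EC1 K' NK(2)])
    show "\<bar>mollify (n + N) \<psi> x\<bar> \<le> C" for n x
      by (rule mollify_bound[OF m(3)]) (use C in auto)
    show "norm (E (n + N) x) \<le> C" for n x by (rule nE)
    show "(\<lambda>n. mollify (n + N) \<psi> x) \<longlonglongrightarrow> \<psi> x" if "x \<in> \<Omega>" for x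
      using has_C1_gradient_continuous[OF C1_test_C1[OF \<psi>], of UNIV]
      by (intro LIMSEQ_ignore_initial_segment mollify_pointwise m that) (simp add: continuous_on_eq_continuous_at)
    show "(\<lambda>n. E (n + N) x) \<longlonglongrightarrow> D x" if "x \<in> \<Omega>" for x
    proof (subst tendsto_componentwise_iff, intro ballI LIMSEQ_ignore_initial_segment)
      fix i :: 'a
      have "continuous_on UNIV (\<lambda>y. D y \<bullet> i)"
        using C1_test_C1[OF \<psi>] by (auto simp: has_C1_gradient_def intro!: continuous_intros)
      then have "(\<lambda>n. mollify n (\<lambda>y. D y \<bullet> i) x) \<longlonglongrightarrow> D x \<bullet> i"
        by (intro mollify_pointwise that integrable_inner_left m) (simp add: continuous_on_eq_continuous_at)
      then show "(\<lambda>n. E n x \<bullet> i) \<longlonglongrightarrow> D x \<bullet> i"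
        unfolding Eeq moll_scaleR_inner[OF m(4)] .
    qed
  qed
qed

section \<open>Weak gradients\<close>

text \<open>Weak differentiability tested against continuously differentiable functions instead of smooth ones.
Products of a test function with a \<open>C\<^sup>1\<close> function, and compositions with \<open>C\<^sup>1\<close> functions,
are then admissible. Lemmas \<open>weak_gradientI\<close> and \<open>weak_gradient_has_weak_deriv\<close> give the
equivalence with \<^const>\<open>has_weak_deriv\<close> for integrable functions.\<close>

definition weak_gradient :: "('a \<Rightarrow> real) \<Rightarrow> ('a \<Rightarrow> 'a) \<Rightarrow> bool" where
  "weak_gradient f V \<longleftrightarrow> integrable M f \<and> integrable M V \<and>
     (\<forall>\<psi> D. C1_test \<Omega> \<psi> D \<longrightarrow> (LINT x|M. f x *\<^sub>R D x) = - (LINT x|M. \<psi> x *\<^sub>R V x))"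

lemma weak_gradientD:
  assumes "weak_gradient f V"
  shows "integrable M f" "integrable M V"
    "C1_test \<Omega> \<psi> D \<Longrightarrow> (LINT x|M. f x *\<^sub>R D x) = - (LINT x|M. \<psi> x *\<^sub>R V x)"
  using assms by (auto simp: weak_gradient_def)

text \<open>Friedrichs' local approximation. On a compact subset, as soon as the radius of the kernel is below the
distance to the boundary, the translated kernel is a test function, so that the gradient of a
mollification is the mollification of the weak gradient. Passing to a subsequence adds almost
everywhere convergence.\<close>

lemma weak_gradient_approx:
  assumes w: "weak_gradient f V" and K: "compact K" "K \<subseteq> \<Omega>"
  shows "\<exists>F G. (\<forall>n. has_C1_gradient (F n) (G n) \<and> integrable M (F n) \<and> integrable M (\<lambda>x. indicator K x *\<^sub>R G n x)) \<and>
    (AE x in M. (\<lambda>n. F n x) \<longlonglongrightarrow> f x) \<and> (\<lambda>n. LINT x|M. norm (F n x - f x)) \<longlonglongrightarrow> 0 \<and>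
    (\<lambda>n. LINT x|M. norm (indicator K x *\<^sub>R G n x - indicator K x *\<^sub>R V x)) \<longlonglongrightarrow> 0 \<and>
    (\<forall>C\<ge>0. (AE x in M. \<bar>f x\<bar> \<le> C) \<longrightarrow> (\<forall>n x. \<bar>F n x\<bar> \<le> C))"
proof -
  note wD = weak_gradientD[OF w]
  have [measurable]: "V \<in> borel_measurable M" using wD by auto
  have [measurable]: "K \<in> sets M" using K by (auto simp: sets_restrict_space_iff compact_imp_closed borel_closed)
  obtain r where r: "r > 0" "(\<Union>x\<in>K. cball x r) \<subseteq> \<Omega>"
    using compact_subset_open_imp_cball_epsilon_subset[OF K(1) open_Omega K(2)] by blast
  obtain N where N: "1 / real (Suc N) < r" using nat_approx_posE[OF r(1)] by auto
  define E where "E n x = (LINT y|M. f y *\<^sub>R moll_grad n (x - y))" for n x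
  have EC1: "has_C1_gradient (mollify n f) (E n)" for n
    unfolding E_def[abs_def] by (rule mollify_C1[OF wD(1)])
  have Eeq: "E n x = (LINT y|M. moll n (x - y) *\<^sub>R V y)" if "n \<ge> N" "x \<in> K" for n x
  proof -
    have le: "1 / real (Suc n) \<le> 1 / real (Suc N)" using that(1) by (simp add: frac_le)
    then have "cball x (1 / real (Suc n)) \<subseteq> cball x r" using N by (intro subset_cball) linarith
    also have "\<dots> \<subseteq> \<Omega>" using r(2) that(2) by blast
    finally have "C1_test \<Omega> (\<lambda>y. moll n (x - y)) (\<lambda>y. - moll_grad n (x - y))"
      by (rule moll_C1_test[OF moll_grad_C1])
    from wD(3)[OF this] show ?thesis by (simp add: E_def)
  qed
  obtain s where s: "strict_mono s" "AE x in M. (\<lambda>n. mollify (s n) f x - f x) \<longlonglongrightarrow> 0"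
    using tendsto_L1_AE_subseq[of M "\<lambda>n x. mollify n f x - f x"] mollify_L1[OF wD(1)]
      mollify_integrable[OF wD(1)] wD(1) by auto
  define F where "F n = mollify (s (n + N)) f" for n
  define G where "G n = E (s (n + N))" for n
  have sN: "s (n + N) \<ge> N" for n using seq_suble[OF s(1), of "n + N"] by simp
  have shift: "filterlim (\<lambda>n. s (n + N)) at_top sequentially"
    by (rule filterlim_compose[OF filterlim_subseq[OF s(1)] filterlim_add_const_nat_at_top])
  have cG: "continuous_on UNIV (G n)" for n using EC1 by (simp add: G_def has_C1_gradient_def)
  have Gm [measurable]: "G n \<in> borel_measurable M" for n
    by (rule continuous_imp_measurable_lebesgue_on[OF cG])
  have Gi: "integrable M (\<lambda>x. indicator K x *\<^sub>R G n x)" for n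
  proof -
    have "bounded (G n ` K)" by (intro compact_imp_bounded compact_continuous_image continuous_on_subset[OF cG] K) auto
    then obtain B where "\<forall>x\<in>K. norm (G n x) \<le> B" unfolding bounded_iff by auto
    then have "norm (indicator K x *\<^sub>R G n x) \<le> max 0 B" for x
      by (auto split: split_indicator simp: le_max_iff_disj)
    then show ?thesis by (intro integrable_bounded) auto
  qed
  have GV: "(\<lambda>n. LINT x|M. norm (indicator K x *\<^sub>R G n x - indicator K x *\<^sub>R V x)) \<longlonglongrightarrow> 0"
  proof (rule tendsto_sandwich[OF _ _ tendsto_const])
    have "(\<lambda>n. \<Sum>i\<in>Basis. LINT x|M. \<bar>mollify n (\<lambda>y. V y \<bullet> i) x - V x \<bullet> i\<bar>) \<longlonglongrightarrow> (\<Sum>i\<in>(Basis :: 'a set). 0)"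
      by (intro tendsto_sum mollify_L1 integrable_inner_left wD)
    then show "(\<lambda>n. \<Sum>i\<in>Basis. LINT x|M. \<bar>mollify (s (n + N)) (\<lambda>y. V y \<bullet> i) x - V x \<bullet> i\<bar>) \<longlonglongrightarrow> 0"
      using filterlim_compose[OF _ shift] by simp
    show "\<forall>\<^sub>F n in sequentially. (LINT x|M. norm (indicator K x *\<^sub>R G n x - indicator K x *\<^sub>R V x))
       \<le> (\<Sum>i\<in>Basis. LINT x|M. \<bar>mollify (s (n + N)) (\<lambda>y. V y \<bullet> i) x - V x \<bullet> i\<bar>)"
    proof (intro always_eventually allI)
      fix n
      have im: "integrable M (\<lambda>x. \<bar>mollify (s (n + N)) (\<lambda>y. V y \<bullet> i) x - V x \<bullet> i\<bar>)" for i
        by (intro integrable_abs Bochner_Integration.integrable_diff mollify_integrable integrable_inner_left wD)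
      have "(LINT x|M. norm (indicator K x *\<^sub>R G n x - indicator K x *\<^sub>R V x))
        \<le> (LINT x|M. (\<Sum>i\<in>Basis. \<bar>mollify (s (n + N)) (\<lambda>y. V y \<bullet> i) x - V x \<bullet> i\<bar>))"
      proof (rule integral_mono)
        show "integrable M (\<lambda>x. norm (indicator K x *\<^sub>R G n x - indicator K x *\<^sub>R V x))"
          by (intro integrable_norm Bochner_Integration.integrable_diff Gi integrable_bounded_scaleR[where C = 1] wD)
            (auto split: split_indicator)
        fix x
        show "norm (indicator K x *\<^sub>R G n x - indicator K x *\<^sub>R V x) \<le> (\<Sum>i\<in>Basis. \<bar>mollify (s (n + N)) (\<lambda>y. V y \<bullet> i) x - V x \<bullet> i\<bar>)"
        proof (cases "x \<in> K")
          case True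
          have "norm (G n x - V x) \<le> (\<Sum>i\<in>Basis. \<bar>(G n x - V x) \<bullet> i\<bar>)" by (rule norm_le_l1)
          also have "\<dots> = (\<Sum>i\<in>Basis. \<bar>mollify (s (n + N)) (\<lambda>y. V y \<bullet> i) x - V x \<bullet> i\<bar>)"
            by (simp add: inner_diff_left G_def Eeq[OF sN True] moll_scaleR_inner[OF wD(2)])
          finally show ?thesis using True by simp
        qed (simp add: sum_nonneg)
      qed (use im in \<open>auto intro!: Bochner_Integration.integrable_sum\<close>)
      also have "\<dots> = (\<Sum>i\<in>Basis. LINT x|M. \<bar>mollify (s (n + N)) (\<lambda>y. V y \<bullet> i) x - V x \<bullet> i\<bar>)"
        by (rule Bochner_Integration.integral_sum[OF im])
      finally show "(LINT x|M. norm (indicator K x *\<^sub>R G n x - indicator K x *\<^sub>R V x))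
        \<le> (\<Sum>i\<in>Basis. LINT x|M. \<bar>mollify (s (n + N)) (\<lambda>y. V y \<bullet> i) x - V x \<bullet> i\<bar>)" .
    qed
  qed (auto intro!: always_eventually)
  show ?thesis
  proof (intro exI[of _ F] exI[of _ G] conjI allI impI GV Gi)
    show "has_C1_gradient (F n) (G n)" "integrable M (F n)" for n
      using EC1 mollify_integrable[OF wD(1)] by (auto simp: F_def G_def)
    show "AE x in M. (\<lambda>n. F n x) \<longlonglongrightarrow> f x"
      using s(2)
    proof eventually_elim
      case (elim x)
      from LIMSEQ_ignore_initial_segment[OF this, of N] show ?case by (simp add: F_def LIM_zero_iff)
    qed
    show "(\<lambda>n. LINT x|M. norm (F n x - f x)) \<longlonglongrightarrow> 0"
      using filterlim_compose[OF mollify_L1[OF wD(1)] shift] by (simp add: F_def)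
    show "\<bar>F n x\<bar> \<le> C" if "C \<ge> 0" "AE x in M. \<bar>f x\<bar> \<le> C" for n x C
      unfolding F_def by (rule mollify_bound[OF wD(1) that(2,1)])
  qed
qed

lemma test_function_C1_test:
  assumes "\<zeta> \<in> test_functions \<Omega>"
  shows "C1_test \<Omega> \<zeta> (\<lambda>x. \<Sum>i\<in>Basis. pderivs [i] \<zeta> x *\<^sub>R i)"
proof -
  from assms obtain K where K: "smooth_on UNIV \<zeta>" "compact K" "K \<subseteq> \<Omega>" "\<And>x. x \<notin> K \<Longrightarrow> \<zeta> x = 0"
    by (auto simp: test_functions_def)
  show ?thesis by (rule C1_testI[OF smooth_on_UNIV_C1[OF K(1)] K(2,3,4)])
qed

lemma integrable_indicator_compact:
  assumes "locally_integrable \<Omega> d" "compact K" "K \<subseteq> \<Omega>"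
  shows "integrable M (\<lambda>x. indicator K x * d x)"
proof -
  have "integrable lebesgue (\<lambda>x. indicator K x *\<^sub>R d x)"
    using assms by (auto simp: locally_integrable_def set_integrable_def)
  moreover have "(\<lambda>x. indicator \<Omega> x *\<^sub>R (indicator K x * d x)) = (\<lambda>x. indicator K x *\<^sub>R d x)"
    using assms(3) by (auto simp: fun_eq_iff split: split_indicator)
  ultimately show ?thesis by (subst integrable_restrict_space) auto
qed

lemma locally_integrableI:
  assumes "integrable M f"
  shows "locally_integrable \<Omega> f"
  unfolding locally_integrable_def
proof (intro allI impI)
  fix K assume K: "compact K \<and> K \<subseteq> \<Omega>"
  have "set_integrable lebesgue \<Omega> f" using assms by (subst set_integrable_eq) auto
  then show "set_integrable lebesgue K f"
    by (rule set_integrable_subset) (use K in \<open>auto simp: compact_imp_closed borel_closed\<close>)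
qed

text \<open>The test functions are mollifications of the indicator of the part of \<open>K\<close> where \<open>d\<close> is positive;
in the limit the integral of the positive part of \<open>d\<close> over \<open>K\<close> is \<open>0\<close>.\<close>

lemma orthogonal_to_test_functions_le:
  assumes d: "locally_integrable \<Omega> d" "\<And>\<zeta>. \<zeta> \<in> test_functions \<Omega> \<Longrightarrow> (LINT x|M. d x * \<zeta> x) = 0"
    and K: "compact K" "K \<subseteq> \<Omega>"
  shows "AE x in M. x \<in> K \<longrightarrow> d x \<le> 0"
proof -
  have Kd: "integrable M (\<lambda>x. indicator K x * d x)" by (rule integrable_indicator_compact[OF d(1) K])
  then have [measurable]: "(\<lambda>x. indicator K x * d x) \<in> borel_measurable M" by auto
  define f where "f x = (if indicator K x * d x > 0 then 1 else 0 :: real)" for x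
  have [measurable]: "f \<in> borel_measurable M" unfolding f_def by measurable
  have f01: "\<bar>f x\<bar> \<le> 1" "x \<notin> K \<Longrightarrow> f x = 0" for x by (auto simp: f_def)
  have fi: "integrable M f" by (rule integrable_bounded[where C = 1]) (use f01 in auto)
  obtain N K' where K': "compact K'" "K' \<subseteq> \<Omega>" and
    NK: "\<And>n. mollify (n + N) f \<in> test_functions \<Omega>" "\<And>n x. x \<notin> K' \<Longrightarrow> mollify (n + N) f x = 0"
    using mollify_test_function[OF fi K f01(2)] by blast
  have K'd: "integrable M (\<lambda>x. indicator (K \<union> K') x * d x)"
    by (rule integrable_indicator_compact[OF d(1)]) (use K K' in auto)
  have "(\<lambda>n. LINT x|M. norm (mollify (n + N) f x - f x)) \<longlonglongrightarrow> 0"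
    using LIMSEQ_ignore_initial_segment[OF mollify_L1[OF fi]] by simp
  then obtain r where r: "strict_mono r" "AE x in M. (\<lambda>n. mollify (r n + N) f x - f x) \<longlonglongrightarrow> 0"
    using tendsto_L1_AE_subseq[of M "\<lambda>n x. mollify (n + N) f x - f x"] mollify_integrable[OF fi] fi by auto
  have "(\<lambda>n. LINT x|M. mollify (r n + N) f x * (indicator (K \<union> K') x * d x)) \<longlonglongrightarrow> (LINT x|M. f x * (indicator (K \<union> K') x * d x))"
  proof (rule bilinear_convergence[OF bounded_bilinear_mult, where C = 1])
    show "AE x in M. (\<lambda>n. mollify (r n + N) f x) \<longlonglongrightarrow> f x"
      using r(2) by eventually_elim (simp add: LIM_zero_iff)
    have "\<bar>mollify n f x\<bar> \<le> 1" for n x by (rule mollify_bound[OF fi]) (use f01 in auto)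
    then show "AE x in M. \<forall>n. norm (mollify (r n + N) f x) \<le> 1" by simp
  qed (use K'd mollify_measurable[OF fi] in auto)
  moreover have "(LINT x|M. mollify (r n + N) f x * (indicator (K \<union> K') x * d x)) = 0" for n
  proof -
    have "(\<lambda>x. mollify (r n + N) f x * (indicator (K \<union> K') x * d x)) = (\<lambda>x. d x * mollify (r n + N) f x)"
      using NK(2) by (auto split: split_indicator)
    then show ?thesis using d(2)[OF NK(1)] by simp
  qed
  ultimately have "(LINT x|M. f x * (indicator (K \<union> K') x * d x)) = 0"
    by (simp add: LIMSEQ_const_iff)
  moreover have feq: "f x * (indicator (K \<union> K') x * d x) = max 0 (indicator K x * d x)" for x
    by (auto simp: f_def split: split_indicator)
  ultimately have "(LINT x|M. max 0 (indicator K x * d x)) = 0" by simp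
  then have "AE x in M. max 0 (indicator K x * d x) = 0"
    by (subst (asm) integral_nonneg_eq_0_iff_AE) (use Kd in auto)
  then show ?thesis by eventually_elim (auto simp: max_def split: if_splits)
qed

lemma orthogonal_to_test_functions:
  assumes d: "locally_integrable \<Omega> d" "\<And>\<zeta>. \<zeta> \<in> test_functions \<Omega> \<Longrightarrow> (LINT x|M. d x * \<zeta> x) = 0"
  shows "AE x in M. d x = 0"
proof -
  obtain C :: "nat \<Rightarrow> 'a set" where C: "\<And>n. compact (C n)" "\<And>n. C n \<subseteq> \<Omega>" "\<Union>(range C) = \<Omega>"
    using open_Union_compact_subsets[OF open_Omega] by metis
  have d': "locally_integrable \<Omega> (\<lambda>x. - d x)"
    using d(1) by (auto simp: locally_integrable_def set_integrable_def)
  have "AE x in M. \<forall>n. (x \<in> C n \<longrightarrow> d x \<le> 0) \<and> (x \<in> C n \<longrightarrow> - d x \<le> 0)"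
    unfolding AE_all_countable
    by (intro allI AE_conjI orthogonal_to_test_functions_le d d' C) (use d(2) in auto)
  moreover have "AE x in M. x \<in> \<Omega>" by (auto intro!: AE_I2)
  ultimately show ?thesis
  proof eventually_elim
    case (elim x)
    then obtain n where "x \<in> C n" using C(3) by blast
    then show ?case using elim(1) by (metis antisym neg_le_0_iff_le)
  qed
qed

lemma integral_locally_integrable_test:
  assumes "locally_integrable \<Omega> g" "\<zeta> \<in> test_functions \<Omega>"
  shows "integrable M (\<lambda>x. g x * \<zeta> x)"
proof -
  from assms obtain K where K: "compact K" "K \<subseteq> \<Omega>" "\<And>x. x \<notin> K \<Longrightarrow> \<zeta> x = 0"
    by (auto simp: test_functions_def)
  obtain B where B: "\<And>x. \<bar>\<zeta> x\<bar> \<le> B" using C1_test_bounded[OF test_function_C1_test[OF assms(2)]] by blast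
  have "integrable M (\<lambda>x. \<zeta> x * (indicator K x * g x))"
    by (rule integrable_bounded_mult[OF integrable_indicator_compact[OF assms(1) K(1,2)], where C = B])
      (use B C1_test_measurable[OF test_function_C1_test[OF assms(2)]] in auto)
  moreover have "(\<lambda>x. \<zeta> x * (indicator K x * g x)) = (\<lambda>x. g x * \<zeta> x)"
    using K(3) by (auto split: split_indicator)
  ultimately show ?thesis by simp
qed

lemma has_weak_deriv_unique:
  assumes "has_weak_deriv \<Omega> ds f g" "has_weak_deriv \<Omega> ds f h"
  shows "AE x in M. g x = h x"
proof -
  have l: "locally_integrable \<Omega> g" "locally_integrable \<Omega> h" using assms by (auto simp: has_weak_deriv_def)
  have "AE x in M. g x - h x = 0"
  proof (rule orthogonal_to_test_functions)
    show "locally_integrable \<Omega> (\<lambda>x. g x - h x)"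
      using l by (auto simp: locally_integrable_def set_integrable_def right_diff_distrib)
    fix \<zeta> assume z: "\<zeta> \<in> test_functions \<Omega>"
    have "(-1) ^ length ds * (LINT x|M. g x * \<zeta> x) = (-1) ^ length ds * (LINT x|M. h x * \<zeta> x)"
      using assms z by (auto simp: has_weak_deriv_def)
    then have "(LINT x|M. g x * \<zeta> x) = (LINT x|M. h x * \<zeta> x)" by simp
    then show "(LINT x|M. (g x - h x) * \<zeta> x) = 0"
      using integral_locally_integrable_test[OF l(1) z] integral_locally_integrable_test[OF l(2) z]
      by (simp add: left_diff_distrib)
  qed
  then show ?thesis by eventually_elim simp
qed

lemma weak_gradientI:
  assumes f: "integrable M f" and V: "integrable M V"
    and d: "\<And>i. i \<in> Basis \<Longrightarrow> has_weak_deriv \<Omega> [i] f (\<lambda>x. V x \<bullet> i)"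
  shows "weak_gradient f V"
  unfolding weak_gradient_def
proof (intro conjI f V allI impI)
  fix \<psi> D assume \<psi>: "C1_test \<Omega> \<psi> D"
  obtain \<zeta> Z C where z: "\<And>n. \<zeta> n \<in> test_functions \<Omega>" "\<And>n. C1_test \<Omega> (\<zeta> n) (Z n)"
    "\<And>n x. \<bar>\<zeta> n x\<bar> \<le> C" "\<And>n x. norm (Z n x) \<le> C"
    "\<And>x. x \<in> \<Omega> \<Longrightarrow> (\<lambda>n. \<zeta> n x) \<longlonglongrightarrow> \<psi> x" "\<And>x. x \<in> \<Omega> \<Longrightarrow> (\<lambda>n. Z n x) \<longlonglongrightarrow> D x"
    using C1_test_approx[OF \<psi>] by blast
  have Zeq: "Z n = (\<lambda>x. \<Sum>i\<in>Basis. pderivs [i] (\<zeta> n) x *\<^sub>R i)" for n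
    by (rule has_C1_gradient_unique[OF C1_test_C1[OF z(2)] C1_test_C1[OF test_function_C1_test[OF z(1)]]])
  note mz = C1_test_measurable[OF z(2)] and m\<psi> = C1_test_measurable[OF \<psi>]
  have s: "integrable M (\<lambda>x. f x *\<^sub>R Z n x)" for n
    by (rule integrable_scaleR_bounded[OF f mz(2) z(4)])
  have s': "integrable M (\<lambda>x. \<zeta> n x *\<^sub>R V x)" for n
    by (rule integrable_bounded_scaleR[OF V mz(1)]) (use z(3) in auto)
  have eq: "(LINT x|M. f x *\<^sub>R Z n x) = - (LINT x|M. \<zeta> n x *\<^sub>R V x)" for n
  proof (rule euclidean_eqI)
    fix i :: 'a assume i: "i \<in> Basis"
    have "(LINT x|M. f x *\<^sub>R Z n x) \<bullet> i = (LINT x|M. f x * (Z n x \<bullet> i))"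
      using integral_inner_left[OF s[of n], of i] by simp
    also have "\<dots> = (LINT x|M. f x * pderivs [i] (\<zeta> n) x)"
      using i by (simp add: Zeq inner_sum_left_Basis del: pderivs.simps)
    also have "\<dots> = - (LINT x|M. (V x \<bullet> i) * \<zeta> n x)"
      using d[OF i] z(1)[of n] by (auto simp: has_weak_deriv_def)
    also have "\<dots> = - (LINT x|M. \<zeta> n x *\<^sub>R V x) \<bullet> i"
      using integral_inner_left[OF s'[of n], of i] by (simp add: mult.commute)
    finally show "(LINT x|M. f x *\<^sub>R Z n x) \<bullet> i = - (LINT x|M. \<zeta> n x *\<^sub>R V x) \<bullet> i" .
  qed
  have "(\<lambda>n. LINT x|M. f x *\<^sub>R Z n x) \<longlonglongrightarrow> (LINT x|M. f x *\<^sub>R D x)"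
    by (rule bilinear_convergence[OF bounded_bilinear.flip[OF bounded_bilinear_scaleR], of Z M D C "\<lambda>n. f" f])
      (use mz m\<psi> z f in \<open>auto intro!: AE_I2\<close>)
  moreover have "(\<lambda>n. - (LINT x|M. \<zeta> n x *\<^sub>R V x)) \<longlonglongrightarrow> - (LINT x|M. \<psi> x *\<^sub>R V x)"
    by (rule tendsto_minus, rule bilinear_convergence[OF bounded_bilinear_scaleR, of \<zeta> M \<psi> C "\<lambda>n. V" V])
      (use mz m\<psi> z V in \<open>auto intro!: AE_I2\<close>)
  ultimately show "(LINT x|M. f x *\<^sub>R D x) = - (LINT x|M. \<psi> x *\<^sub>R V x)"
    unfolding eq using LIMSEQ_unique by blast
qed

lemma weak_gradient_has_weak_deriv:
  assumes w: "weak_gradient f V" and i: "i \<in> Basis"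
  shows "has_weak_deriv \<Omega> [i] f (\<lambda>x. V x \<bullet> i)"
  unfolding has_weak_deriv_def
proof (intro conjI ballI)
  note wD = weak_gradientD[OF w]
  show "locally_integrable \<Omega> f" "locally_integrable \<Omega> (\<lambda>x. V x \<bullet> i)"
    by (intro locally_integrableI integrable_inner_left wD)+
  fix \<zeta> assume z: "\<zeta> \<in> test_functions \<Omega>"
  define Z where "Z x = (\<Sum>i\<in>Basis. pderivs [i] \<zeta> x *\<^sub>R i)" for x
  have t: "C1_test \<Omega> \<zeta> Z" using test_function_C1_test[OF z] by (simp add: Z_def[abs_def])
  obtain C where C: "\<And>x. norm (Z x) \<le> C" "\<And>x. \<bar>\<zeta> x\<bar> \<le> C" using C1_test_bounded[OF t] by blast
  note mz = C1_test_measurable[OF t]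
  have s: "integrable M (\<lambda>x. f x *\<^sub>R Z x)"
    by (rule integrable_scaleR_bounded[OF wD(1) mz(2) C(1)])
  have s': "integrable M (\<lambda>x. \<zeta> x *\<^sub>R V x)"
    by (rule integrable_bounded_scaleR[OF wD(2) mz(1)]) (use C in auto)
  have "(LINT x|M. f x * pderivs [i] \<zeta> x) = (LINT x|M. f x * (Z x \<bullet> i))"
    using i by (simp add: Z_def inner_sum_left_Basis del: pderivs.simps)
  also have "\<dots> = (LINT x|M. f x *\<^sub>R Z x) \<bullet> i"
    using integral_inner_left[OF s, of i] by simp
  also have "\<dots> = - (LINT x|M. \<zeta> x *\<^sub>R V x) \<bullet> i" using wD(3)[OF t] by simp
  also have "\<dots> = - (LINT x|M. (V x \<bullet> i) * \<zeta> x)"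
    using integral_inner_left[OF s', of i] by (simp add: mult.commute)
  finally show "(LINT x|M. f x * pderivs [i] \<zeta> x) = (- 1) ^ length [i] * (LINT x|M. (V x \<bullet> i) * \<zeta> x)"
    by simp
qed

lemma has_weak_deriv_Nil: "integrable M f \<Longrightarrow> has_weak_deriv \<Omega> [] f f"
  by (simp add: has_weak_deriv_def locally_integrableI)

lemma weak_gradient_unique:
  assumes "weak_gradient f V" "weak_gradient f W"
  shows "AE x in M. V x = W x"
proof -
  have "AE x in M. \<forall>i\<in>Basis. V x \<bullet> i = W x \<bullet> i"
    by (intro AE_finite_allI finite_Basis has_weak_deriv_unique[OF weak_gradient_has_weak_deriv[OF assms(1)] weak_gradient_has_weak_deriv[OF assms(2)]])
  then show ?thesis by eventually_elim (auto intro: euclidean_eqI)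
qed

section \<open>Product and chain rules for weak gradients\<close>

text \<open>If \<open>F n\<close> are \<open>C\<^sup>1\<close> approximations of \<open>g\<close> near the support of \<open>\<psi>\<close>, then \<open>F n \<cdot> \<psi>\<close> is a
test function for \<open>f\<close>. Boundedness of both factors keeps every term in the scope of
\<open>bilinear_convergence\<close>.\<close>

lemma weak_gradient_mult:
  assumes f: "weak_gradient f V" "AE x in M. \<bar>f x\<bar> \<le> A"
    and g: "weak_gradient g W" "AE x in M. \<bar>g x\<bar> \<le> B"
  shows "weak_gradient (\<lambda>x. f x * g x) (\<lambda>x. f x *\<^sub>R W x + g x *\<^sub>R V x)"
  unfolding weak_gradient_def
proof (intro conjI allI impI)
  note fD = weak_gradientD[OF f(1)] and gD = weak_gradientD[OF g(1)]
  have [measurable]: "f \<in> borel_measurable M" "g \<in> borel_measurable M" "V \<in> borel_measurable M" "W \<in> borel_measurable M"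
    using fD gD by auto
  show "integrable M (\<lambda>x. f x * g x)"
    by (rule integrable_bounded_mult[OF gD(1) _ f(2)]) simp
  have i1: "integrable M (\<lambda>x. f x *\<^sub>R W x)" and i2: "integrable M (\<lambda>x. g x *\<^sub>R V x)"
    by (rule integrable_bounded_scaleR[OF gD(2) _ f(2)], simp, rule integrable_bounded_scaleR[OF fD(2) _ g(2)], simp)
  then show "integrable M (\<lambda>x. f x *\<^sub>R W x + g x *\<^sub>R V x)" by simp
  fix \<psi> D assume \<psi>: "C1_test \<Omega> \<psi> D"
  note m [measurable] = C1_test_measurable[OF \<psi>]
  from \<psi> obtain K where K: "compact K" "K \<subseteq> \<Omega>" "\<And>x. x \<notin> K \<Longrightarrow> \<psi> x = 0 \<and> D x = 0"
    unfolding C1_test_def by blast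
  have [measurable]: "K \<in> sets M" using K by (auto simp: sets_restrict_space_iff compact_imp_closed borel_closed)
  obtain C where C: "C \<ge> 0" "\<And>x. norm (D x) \<le> C" "\<And>x. \<bar>\<psi> x\<bar> \<le> C" using C1_test_bounded[OF \<psi>] by blast
  define B' where "B' = max 0 B"
  have B': "AE x in M. \<bar>g x\<bar> \<le> B'" "B' \<ge> 0" using g(2) by (auto simp: B'_def elim: eventually_mono)
  obtain F G where F: "\<And>n. has_C1_gradient (F n) (G n)" "\<And>n. integrable M (F n)"
    "\<And>n. integrable M (\<lambda>x. indicator K x *\<^sub>R G n x)"
    "AE x in M. (\<lambda>n. F n x) \<longlonglongrightarrow> g x"
    "(\<lambda>n. LINT x|M. norm (indicator K x *\<^sub>R G n x - indicator K x *\<^sub>R W x)) \<longlonglongrightarrow> 0"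
    "\<And>n x. \<bar>F n x\<bar> \<le> B'"
    using weak_gradient_approx[OF g(1) K(1,2)] B' by blast
  have mF [measurable]: "F n \<in> borel_measurable M" for n using F(2) by auto
  have fDi: "integrable M (\<lambda>x. f x *\<^sub>R D x)" by (rule integrable_scaleR_bounded[OF fD(1) m(2) C(2)])
  have psiV: "integrable M (\<lambda>x. \<psi> x *\<^sub>R V x)"
    by (rule integrable_bounded_scaleR[OF fD(2) m(1)]) (use C in auto)
  have fpsi: "AE x in M. \<bar>f x * \<psi> x\<bar> \<le> A * C"
    using f(2) by eventually_elim (use C in \<open>auto simp: abs_mult intro!: mult_mono order_trans[OF abs_ge_zero]\<close>)
  have KW: "integrable M (\<lambda>x. indicator K x *\<^sub>R W x)"
    by (rule integrable_bounded_scaleR[OF gD(2), where C = 1]) (auto split: split_indicator)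
  have l1: "(\<lambda>n. LINT x|M. F n x *\<^sub>R (f x *\<^sub>R D x)) \<longlonglongrightarrow> (LINT x|M. g x *\<^sub>R (f x *\<^sub>R D x))"
    by (rule bilinear_convergence[OF bounded_bilinear_scaleR, of F M g B' "\<lambda>n x. f x *\<^sub>R D x"])
      (use F fDi in auto)
  have l2: "(\<lambda>n. LINT x|M. (f x * \<psi> x) *\<^sub>R (indicator K x *\<^sub>R G n x)) \<longlonglongrightarrow> (LINT x|M. (f x * \<psi> x) *\<^sub>R (indicator K x *\<^sub>R W x))"
    by (rule bilinear_convergence[OF bounded_bilinear_scaleR, of "\<lambda>n x. f x * \<psi> x" M "\<lambda>x. f x * \<psi> x" "A * C"])
      (use F KW fpsi in auto)
  have l3: "(\<lambda>n. LINT x|M. F n x *\<^sub>R (\<psi> x *\<^sub>R V x)) \<longlonglongrightarrow> (LINT x|M. g x *\<^sub>R (\<psi> x *\<^sub>R V x))"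
    by (rule bilinear_convergence[OF bounded_bilinear_scaleR, of F M g B' "\<lambda>n x. \<psi> x *\<^sub>R V x"])
      (use F psiV in auto)
  have ia: "integrable M (\<lambda>x. F n x *\<^sub>R (f x *\<^sub>R D x))" for n
    by (rule integrable_bounded_scaleR[OF fDi mF, where C = B']) (use F(6) in simp)
  have ib: "integrable M (\<lambda>x. (f x * \<psi> x) *\<^sub>R (indicator K x *\<^sub>R G n x))" for n
    by (rule integrable_bounded_scaleR[OF F(3) _ fpsi]) simp
  have ic: "integrable M (\<lambda>x. \<psi> x *\<^sub>R (f x *\<^sub>R W x))" "integrable M (\<lambda>x. \<psi> x *\<^sub>R (g x *\<^sub>R V x))"
    by (rule integrable_bounded_scaleR[OF i1 m(1), where C = C], use C in simp)
      (rule integrable_bounded_scaleR[OF i2 m(1), where C = C], use C in simp)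
  have eq: "(LINT x|M. F n x *\<^sub>R (f x *\<^sub>R D x)) + (LINT x|M. (f x * \<psi> x) *\<^sub>R (indicator K x *\<^sub>R G n x))
      = - (LINT x|M. F n x *\<^sub>R (\<psi> x *\<^sub>R V x))" for n
  proof -
    have "(LINT x|M. F n x *\<^sub>R (f x *\<^sub>R D x)) + (LINT x|M. (f x * \<psi> x) *\<^sub>R (indicator K x *\<^sub>R G n x))
      = (LINT x|M. F n x *\<^sub>R (f x *\<^sub>R D x) + (f x * \<psi> x) *\<^sub>R (indicator K x *\<^sub>R G n x))"
      by (rule Bochner_Integration.integral_add[symmetric, OF ia ib])
    also have "\<dots> = (LINT x|M. f x *\<^sub>R (F n x *\<^sub>R D x + \<psi> x *\<^sub>R G n x))"
      by (rule arg_cong[where f = "integral\<^sup>L M"], rule ext)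
        (use K(3) in \<open>auto simp: scaleR_add_right mult_ac split: split_indicator\<close>)
    also have "\<dots> = - (LINT x|M. (F n x * \<psi> x) *\<^sub>R V x)"
      by (rule fD(3)[OF C1_test_mult[OF \<psi> F(1)]])
    finally show ?thesis by simp
  qed
  have "(LINT x|M. g x *\<^sub>R (f x *\<^sub>R D x)) + (LINT x|M. (f x * \<psi> x) *\<^sub>R (indicator K x *\<^sub>R W x))
      = - (LINT x|M. g x *\<^sub>R (\<psi> x *\<^sub>R V x))"
    using LIMSEQ_unique[OF tendsto_add[OF l1 l2, unfolded eq] tendsto_minus[OF l3]] .
  moreover have "(LINT x|M. (f x * \<psi> x) *\<^sub>R (indicator K x *\<^sub>R W x)) = (LINT x|M. \<psi> x *\<^sub>R (f x *\<^sub>R W x))"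
    by (rule arg_cong[where f = "integral\<^sup>L M"], rule ext)
      (use K(3) in \<open>auto simp: mult_ac split: split_indicator\<close>)
  moreover have "(LINT x|M. \<psi> x *\<^sub>R (f x *\<^sub>R W x + g x *\<^sub>R V x))
     = (LINT x|M. \<psi> x *\<^sub>R (f x *\<^sub>R W x)) + (LINT x|M. \<psi> x *\<^sub>R (g x *\<^sub>R V x))"
    unfolding scaleR_add_right
    by (rule Bochner_Integration.integral_add[OF ic])
  moreover have "(LINT x|M. (f x * g x) *\<^sub>R D x) = (LINT x|M. g x *\<^sub>R (f x *\<^sub>R D x))"
    unfolding scaleR_scaleR by (subst mult.commute) (rule refl)
  moreover have "(LINT x|M. \<psi> x *\<^sub>R (g x *\<^sub>R V x)) = (LINT x|M. g x *\<^sub>R (\<psi> x *\<^sub>R V x))"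
    by (subst scaleR_left_commute) (rule refl)
  ultimately show "(LINT x|M. (f x * g x) *\<^sub>R D x) = - (LINT x|M. \<psi> x *\<^sub>R (f x *\<^sub>R W x + g x *\<^sub>R V x))"
    by (simp only: eq_neg_iff_add_eq_0 add.assoc)
qed

lemma continuous_bounded_on_interval:
  fixes b :: "real \<Rightarrow> real"
  assumes "continuous_on UNIV b"
  shows "\<exists>C\<ge>0. \<forall>s. \<bar>s\<bar> \<le> B \<longrightarrow> \<bar>b s\<bar> \<le> C"
proof -
  have "bounded (b ` {-B..B})"
    by (intro compact_imp_bounded compact_continuous_image continuous_on_subset[OF assms]) auto
  then obtain C where C: "\<forall>s\<in>{-B..B}. \<bar>b s\<bar> \<le> C" unfolding bounded_iff by auto
  have "\<bar>b s\<bar> \<le> C" if "\<bar>s\<bar> \<le> B" for s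
    by (rule bspec[OF C]) (use that in auto)
  then show ?thesis by (intro exI[of _ "max 0 C"] conjI allI impI max.cobounded1 max.coboundedI2)
qed

text \<open>The approximations of \<open>f\<close> obey the same bound as \<open>f\<close>, and on a bounded interval \<open>b\<close> and \<open>b'\<close>
are bounded; hence both sides pass to the limit.\<close>

lemma weak_gradient_compose:
  assumes f: "weak_gradient f V" "AE x in M. \<bar>f x\<bar> \<le> B0"
    and b: "\<And>s. (b has_real_derivative b' s) (at s)" "continuous_on UNIV b'"
  shows "weak_gradient (\<lambda>x. b (f x)) (\<lambda>x. b' (f x) *\<^sub>R V x)"
  unfolding weak_gradient_def
proof (intro conjI allI impI)
  note fD = weak_gradientD[OF f(1)]
  define B where "B = max 0 B0"
  have B: "AE x in M. \<bar>f x\<bar> \<le> B" "B \<ge> 0" using f(2) by (auto simp: B_def elim: eventually_mono)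
  have cb: "continuous_on UNIV b" using b(1) by (meson DERIV_isCont continuous_at_imp_continuous_on)
  have [measurable]: "b \<in> borel_measurable borel" "b' \<in> borel_measurable borel"
    using cb b(2) by (auto intro: borel_measurable_continuous_onI)
  obtain C0 C1 where C0: "C0 \<ge> 0" "\<And>s. \<bar>s\<bar> \<le> B \<Longrightarrow> \<bar>b s\<bar> \<le> C0" and C1: "C1 \<ge> 0" "\<And>s. \<bar>s\<bar> \<le> B \<Longrightarrow> \<bar>b' s\<bar> \<le> C1"
    using continuous_bounded_on_interval[OF cb, of B] continuous_bounded_on_interval[OF b(2), of B] by blast
  have [measurable]: "f \<in> borel_measurable M" "V \<in> borel_measurable M" using fD by auto
  have bf: "AE x in M. \<bar>b (f x)\<bar> \<le> C0" "AE x in M. \<bar>b' (f x)\<bar> \<le> C1"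
    using B(1) C0 C1 by (auto elim: eventually_mono)
  show "integrable M (\<lambda>x. b (f x))" by (rule integrable_bounded[of _ C0]) (use bf in auto)
  show i: "integrable M (\<lambda>x. b' (f x) *\<^sub>R V x)" by (rule integrable_bounded_scaleR[OF fD(2) _ bf(2)]) simp
  fix \<psi> D assume \<psi>: "C1_test \<Omega> \<psi> D"
  note m [measurable] = C1_test_measurable[OF \<psi>]
  from \<psi> obtain K where K: "compact K" "K \<subseteq> \<Omega>" "\<And>x. x \<notin> K \<Longrightarrow> \<psi> x = 0 \<and> D x = 0"
    unfolding C1_test_def by blast
  have [measurable]: "K \<in> sets M" using K by (auto simp: sets_restrict_space_iff compact_imp_closed borel_closed)
  obtain C where C: "C \<ge> 0" "\<And>x. norm (D x) \<le> C" "\<And>x. \<bar>\<psi> x\<bar> \<le> C" using C1_test_bounded[OF \<psi>] by blast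
  obtain F G where F: "\<And>n. has_C1_gradient (F n) (G n)" "\<And>n. integrable M (F n)"
    "\<And>n. integrable M (\<lambda>x. indicator K x *\<^sub>R G n x)"
    "AE x in M. (\<lambda>n. F n x) \<longlonglongrightarrow> f x"
    "(\<lambda>n. LINT x|M. norm (indicator K x *\<^sub>R G n x - indicator K x *\<^sub>R V x)) \<longlonglongrightarrow> 0"
    "\<And>n x. \<bar>F n x\<bar> \<le> B"
    using weak_gradient_approx[OF f(1) K(1,2)] B by blast
  have mF [measurable]: "F n \<in> borel_measurable M" for n using F(2) by auto
  have bF: "\<bar>b (F n x)\<bar> \<le> C0" "\<bar>b' (F n x)\<bar> \<le> C1" for n x using C0(2) C1(2) F(6) by auto
  have KV: "integrable M (\<lambda>x. indicator K x *\<^sub>R V x)"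
    by (rule integrable_bounded_scaleR[OF fD(2), where C = 1]) (auto split: split_indicator)
  have psib: "\<bar>\<psi> x * b' (F n x)\<bar> \<le> C * C1" for n x
    unfolding abs_mult using C bF by (intro mult_mono) auto
  have l1: "(\<lambda>n. LINT x|M. b (F n x) *\<^sub>R D x) \<longlonglongrightarrow> (LINT x|M. b (f x) *\<^sub>R D x)"
  proof (rule bilinear_convergence[OF bounded_bilinear_scaleR, of "\<lambda>n x. b (F n x)" M "\<lambda>x. b (f x)" C0 "\<lambda>n. D"])
    show "AE x in M. (\<lambda>n. b (F n x)) \<longlonglongrightarrow> b (f x)"
      using F(4) by eventually_elim (rule isCont_tendsto_compose[OF DERIV_isCont[OF b(1)]])
  qed (use bF m in auto)
  have l2: "(\<lambda>n. LINT x|M. (\<psi> x * b' (F n x)) *\<^sub>R (indicator K x *\<^sub>R G n x)) \<longlonglongrightarrow> (LINT x|M. (\<psi> x * b' (f x)) *\<^sub>R (indicator K x *\<^sub>R V x))"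
  proof (rule bilinear_convergence[OF bounded_bilinear_scaleR, of "\<lambda>n x. \<psi> x * b' (F n x)" M "\<lambda>x. \<psi> x * b' (f x)" "C * C1"])
    show "AE x in M. (\<lambda>n. \<psi> x * b' (F n x)) \<longlonglongrightarrow> \<psi> x * b' (f x)"
      using F(4)
    proof eventually_elim
      case (elim x)
      have "isCont b' (f x)" using b(2) by (simp add: continuous_on_eq_continuous_at)
      from isCont_tendsto_compose[OF this elim] show ?case by (intro tendsto_mult tendsto_const)
    qed
  qed (use psib F KV in auto)
  have eq: "(LINT x|M. b (F n x) *\<^sub>R D x) = - (LINT x|M. (\<psi> x * b' (F n x)) *\<^sub>R (indicator K x *\<^sub>R G n x))" for n
  proof -
    have t: "C1_test \<Omega> (\<lambda>x. b (F n x) * \<psi> x) (\<lambda>x. b (F n x) *\<^sub>R D x + \<psi> x *\<^sub>R (b' (F n x) *\<^sub>R G n x))"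
      by (rule C1_test_mult[OF \<psi> has_C1_gradient_compose[OF F(1) b]])
    have "0 = (LINT x|M. b (F n x) *\<^sub>R D x + \<psi> x *\<^sub>R (b' (F n x) *\<^sub>R G n x))"
      using C1_test_integral_gradient[OF t] by simp
    also have "\<dots> = (LINT x|M. b (F n x) *\<^sub>R D x + (\<psi> x * b' (F n x)) *\<^sub>R (indicator K x *\<^sub>R G n x))"
      by (rule arg_cong[where f = "integral\<^sup>L M"], rule ext)
        (use K(3) in \<open>auto split: split_indicator\<close>)
    also have "\<dots> = (LINT x|M. b (F n x) *\<^sub>R D x) + (LINT x|M. (\<psi> x * b' (F n x)) *\<^sub>R (indicator K x *\<^sub>R G n x))"
    proof (rule Bochner_Integration.integral_add)
      show "integrable M (\<lambda>x. b (F n x) *\<^sub>R D x)"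
        by (rule integrable_bounded_scaleR[OF m(4), where C = C0]) (use bF in auto)
      show "integrable M (\<lambda>x. (\<psi> x * b' (F n x)) *\<^sub>R (indicator K x *\<^sub>R G n x))"
        by (rule integrable_bounded_scaleR[OF F(3), where C = "C * C1"]) (use psib in auto)
    qed
    finally show ?thesis by (simp add: eq_neg_iff_add_eq_0)
  qed
  have "(LINT x|M. b (f x) *\<^sub>R D x) = - (LINT x|M. (\<psi> x * b' (f x)) *\<^sub>R (indicator K x *\<^sub>R V x))"
    using LIMSEQ_unique[OF l1[unfolded eq] tendsto_minus[OF l2]] .
  also have "(LINT x|M. (\<psi> x * b' (f x)) *\<^sub>R (indicator K x *\<^sub>R V x)) = (LINT x|M. \<psi> x *\<^sub>R (b' (f x) *\<^sub>R V x))"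
    by (rule arg_cong[where f = "integral\<^sup>L M"], rule ext)
      (use K(3) in \<open>auto split: split_indicator\<close>)
  finally show "(LINT x|M. b (f x) *\<^sub>R D x) = - (LINT x|M. \<psi> x *\<^sub>R (b' (f x) *\<^sub>R V x))" .
qed

end

section \<open>Lebesgue and Sobolev spaces in terms of weak gradients\<close>

lemma Lp_space_2_iff: "g \<in> Lp_space 2 N \<longleftrightarrow> g \<in> borel_measurable N \<and> integrable N (\<lambda>x. (g x)\<^sup>2)"
  by (simp add: Lp_space_def)

lemma Lp_norm_2: "Lp_norm 2 N g = sqrt (LINT x|N. (g x)\<^sup>2)"
  by (simp add: Lp_norm_def powr_half_sqrt)

lemma Lp_space_infinity_AE:
  assumes "g \<in> Lp_space \<infinity> N"
  shows "AE x in N. \<bar>g x\<bar> \<le> Lp_norm \<infinity> N g"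
proof -
  have g: "g \<in> borel_measurable N" "esssup N (\<lambda>x. ereal \<bar>g x\<bar>) < \<infinity>"
    using assms by (auto simp: Lp_space_def)
  have "AE x in N. ereal \<bar>g x\<bar> \<le> esssup N (\<lambda>x. ereal \<bar>g x\<bar>)"
    by (rule esssup_AE)
  then show ?thesis
  proof eventually_elim
    case (elim x)
    then have "ereal \<bar>g x\<bar> \<le> ereal (real_of_ereal (esssup N (\<lambda>x. ereal \<bar>g x\<bar>)))"
      using g(2) by (cases "esssup N (\<lambda>x. ereal \<bar>g x\<bar>)") auto
    then show ?case by (simp add: Lp_norm_def)
  qed
qed

lemma Lp_space_infinityI:
  assumes "g \<in> borel_measurable N" "AE x in N. \<bar>g x\<bar> \<le> C"
  shows "g \<in> Lp_space \<infinity> N"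
proof -
  have "esssup N (\<lambda>x. ereal \<bar>g x\<bar>) \<le> ereal C"
    by (rule esssup_I) (use assms in auto)
  also have "\<dots> < \<infinity>" by simp
  finally show ?thesis using assms(1) by (simp add: Lp_space_def)
qed

context bounded_open_set
begin

lemma Lp_space_integrable:
  assumes "g \<in> Lp_space p M" "p = 2 \<or> p = \<infinity>"
  shows "integrable M g"
  using assms(2)
proof
  assume "p = 2"
  then show ?thesis using assms(1) by (auto simp: Lp_space_2_iff intro: integrable_of_square_integrable)
next
  assume "p = \<infinity>"
  then show ?thesis using assms(1) Lp_space_infinity_AE[of g M]
    by (intro integrable_bounded) (auto simp: Lp_space_def)
qed

lemma Lp_space_AE_cong:
  assumes "g \<in> Lp_space p M" "p = 2 \<or> p = \<infinity>" "AE x in M. g x = h x"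
  shows "h \<in> Lp_space p M"
  using assms(2)
proof
  assume p: "p = 2"
  have m: "h \<in> borel_measurable M"
    by (rule measurable_AE_cong_lebesgue[OF Omega_lebesgue _ assms(3)]) (use assms(1) p in \<open>auto simp: Lp_space_2_iff\<close>)
  have "integrable M (\<lambda>x. (h x)\<^sup>2)"
    by (rule integrable_AE_cong_lebesgue[OF Omega_lebesgue, of "\<lambda>x. (g x)\<^sup>2"])
      (use assms p in \<open>auto simp: Lp_space_2_iff elim: eventually_mono\<close>)
  with m p show ?thesis by (simp add: Lp_space_2_iff)
next
  assume p: "p = \<infinity>"
  have m: "h \<in> borel_measurable M"
    by (rule measurable_AE_cong_lebesgue[OF Omega_lebesgue _ assms(3)]) (use assms(1) p in \<open>auto simp: Lp_space_def\<close>)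
  have "AE x in M. \<bar>h x\<bar> \<le> Lp_norm \<infinity> M g"
    using Lp_space_infinity_AE[OF assms(1)[unfolded p]] assms(3) by eventually_elim simp
  then show ?thesis unfolding p by (rule Lp_space_infinityI[OF m])
qed

text \<open>\<^const>\<open>weak_deriv\<close> is a Hilbert choice among all weak derivatives; their uniqueness transfers the
integrability of the derivative provided by \<^const>\<open>sobolev\<close> to the chosen one.\<close>

lemma sobolev_weak_deriv:
  assumes f: "f \<in> sobolev k p \<Omega>" and ds: "ds \<in> lists Basis" "length ds \<le> k" and p: "p = 2 \<or> p = \<infinity>"
  shows "has_weak_deriv \<Omega> ds f (weak_deriv \<Omega> ds f)" "weak_deriv \<Omega> ds f \<in> Lp_space p M"
proof -
  obtain g where g: "g \<in> Lp_space p M" "has_weak_deriv \<Omega> ds f g"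
    using f ds unfolding sobolev_def by blast
  have "\<exists>g. has_weak_deriv \<Omega> ds f g" using g(2) by blast
  then show w: "has_weak_deriv \<Omega> ds f (weak_deriv \<Omega> ds f)"
    unfolding weak_deriv_def by (rule someI_ex)
  show "weak_deriv \<Omega> ds f \<in> Lp_space p M"
    by (rule Lp_space_AE_cong[OF g(1) p has_weak_deriv_unique[OF g(2) w]])
qed

lemma sobolev_Lp:
  assumes f: "f \<in> sobolev k p \<Omega>" and p: "p = 2 \<or> p = \<infinity>"
  shows "f \<in> Lp_space p M" "AE x in M. weak_deriv \<Omega> [] f x = f x"
proof -
  have w: "has_weak_deriv \<Omega> [] f (weak_deriv \<Omega> [] f)" "weak_deriv \<Omega> [] f \<in> Lp_space p M"
    using sobolev_weak_deriv[OF f _ _ p, of "[]"] by auto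
  have "has_weak_deriv \<Omega> [] f f" using w(1) by (simp add: has_weak_deriv_def)
  then show ae: "AE x in M. weak_deriv \<Omega> [] f x = f x" by (rule has_weak_deriv_unique[OF w(1)])
  show "f \<in> Lp_space p M" by (rule Lp_space_AE_cong[OF w(2) p ae])
qed

lemma sobolev_weak_gradient:
  assumes f: "f \<in> sobolev k p \<Omega>" and k: "k \<ge> 1" and p: "p = 2 \<or> p = \<infinity>"
  shows "weak_gradient f (wgrad \<Omega> f)"
proof (rule weak_gradientI)
  have w: "has_weak_deriv \<Omega> [i] f (weak_deriv \<Omega> [i] f)" "weak_deriv \<Omega> [i] f \<in> Lp_space p M" if "i \<in> Basis" for i
    using sobolev_weak_deriv[OF f _ _ p, of "[i]"] k that by auto
  show "integrable M f" by (rule Lp_space_integrable[OF sobolev_Lp(1)[OF f p] p])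
  show "integrable M (wgrad \<Omega> f)"
    unfolding wgrad_def by (intro Bochner_Integration.integrable_sum integrable_scaleR_left Lp_space_integrable[OF w(2) p])
  show "has_weak_deriv \<Omega> [i] f (\<lambda>x. wgrad \<Omega> f x \<bullet> i)" if "i \<in> Basis" for i
    using w(1)[OF that] that by (simp add: wgrad_def inner_sum_left_Basis)
qed

lemma norm_square_integrable_components:
  fixes V :: "'a \<Rightarrow> 'a"
  assumes "\<And>i. i \<in> Basis \<Longrightarrow> integrable M (\<lambda>x. (V x \<bullet> i)\<^sup>2)"
  shows "integrable M (\<lambda>x. (norm (V x))\<^sup>2)"
proof -
  have "(norm (V x))\<^sup>2 = (\<Sum>i\<in>Basis. (V x \<bullet> i)\<^sup>2)" for x
    using euclidean_inner[of "V x" "V x"] by (simp only: power2_norm_eq_inner) (simp only: power2_eq_square)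
  then show ?thesis using assms by simp
qed

lemma H_space_gradient:
  assumes f: "f \<in> H_space k \<Omega>" and k: "k \<ge> 1"
  shows "weak_gradient f (wgrad \<Omega> f)" "integrable M (\<lambda>x. (f x)\<^sup>2)" "integrable M (\<lambda>x. (norm (wgrad \<Omega> f x))\<^sup>2)"
    "sqrt (LINT x|M. (norm (wgrad \<Omega> f x))\<^sup>2) \<le> sobolev_norm k 2 \<Omega> f"
    "sqrt (LINT x|M. (f x)\<^sup>2) \<le> sobolev_norm k 2 \<Omega> f"
proof -
  show "weak_gradient f (wgrad \<Omega> f)" by (rule sobolev_weak_gradient[OF f k]) simp
  show "integrable M (\<lambda>x. (f x)\<^sup>2)" using sobolev_Lp(1)[OF f] by (simp add: Lp_space_2_iff)
  show "integrable M (\<lambda>x. (norm (wgrad \<Omega> f x))\<^sup>2)"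
  proof (rule norm_square_integrable_components)
    fix i :: 'a assume i: "i \<in> Basis"
    have "weak_deriv \<Omega> [i] f \<in> Lp_space 2 M" using sobolev_weak_deriv[OF f, of "[i]"] k i by auto
    then show "integrable M (\<lambda>x. (wgrad \<Omega> f x \<bullet> i)\<^sup>2)"
      using i by (simp add: Lp_space_2_iff wgrad_def inner_sum_left_Basis)
  qed
  have "sqrt (LINT x|M. (norm (wgrad \<Omega> f x))\<^sup>2) = Lp_norm 2 M (deriv_norm \<Omega> 1 f)"
    by (simp add: Lp_norm_2 norm_wgrad)
  also have "\<dots> \<le> sobolev_norm k 2 \<Omega> f"
    unfolding sobolev_norm_def
    by (rule member_le_sum[where f = "\<lambda>j. Lp_norm 2 M (deriv_norm \<Omega> j f)"]) (use k in \<open>auto intro: Lp_norm_nonneg\<close>)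
  finally show "sqrt (LINT x|M. (norm (wgrad \<Omega> f x))\<^sup>2) \<le> sobolev_norm k 2 \<Omega> f" .
  have "(LINT x|M. (f x)\<^sup>2) = (LINT x|M. (deriv_norm \<Omega> 0 f x)\<^sup>2)"
  proof (rule integral_AE_cong_lebesgue[OF Omega_lebesgue])
    have 0: "{ds \<in> lists (Basis :: 'a set). length ds = 0} = {[]}" by auto
    show "AE x in M. (f x)\<^sup>2 = (deriv_norm \<Omega> 0 f x)\<^sup>2"
      using sobolev_Lp(2)[OF f disjI1[OF refl]]
      by eventually_elim (simp add: deriv_norm_def 0 del: length_0_conv)
  qed
  then have "sqrt (LINT x|M. (f x)\<^sup>2) = Lp_norm 2 M (deriv_norm \<Omega> 0 f)" by (simp add: Lp_norm_2)
  also have "\<dots> \<le> sobolev_norm k 2 \<Omega> f"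
    unfolding sobolev_norm_def
    by (rule member_le_sum[where f = "\<lambda>j. Lp_norm 2 M (deriv_norm \<Omega> j f)"]) (auto intro: Lp_norm_nonneg)
  finally show "sqrt (LINT x|M. (f x)\<^sup>2) \<le> sobolev_norm k 2 \<Omega> f" .
qed

text \<open>The norm of \<open>L\<^sup>\<infinity>\<close> says something about a function only once the function is known to be
essentially bounded; hence the preliminary bound by the sum of the component norms.\<close>

lemma sobolev_infinity_gradient:
  assumes f: "f \<in> sobolev k \<infinity> \<Omega>" and k: "k \<ge> 1"
  shows "weak_gradient f (wgrad \<Omega> f)" "AE x in M. norm (wgrad \<Omega> f x) \<le> sobolev_norm k \<infinity> \<Omega> f"
    "\<exists>C. AE x in M. \<bar>f x\<bar> \<le> C"
proof -
  show w: "weak_gradient f (wgrad \<Omega> f)" by (rule sobolev_weak_gradient[OF f k]) simp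
  show "\<exists>C. AE x in M. \<bar>f x\<bar> \<le> C"
    using Lp_space_infinity_AE[OF sobolev_Lp(1)[OF f]] by blast
  have "AE x in M. \<forall>i\<in>Basis. \<bar>weak_deriv \<Omega> [i] f x\<bar> \<le> Lp_norm \<infinity> M (weak_deriv \<Omega> [i] f)"
    by (intro AE_finite_allI finite_Basis Lp_space_infinity_AE sobolev_weak_deriv(2)[OF f]) (use k in auto)
  then have "AE x in M. norm (wgrad \<Omega> f x) \<le> (\<Sum>i\<in>Basis. Lp_norm \<infinity> M (weak_deriv \<Omega> [i] f))"
  proof eventually_elim
    case (elim x)
    have "norm (wgrad \<Omega> f x) \<le> (\<Sum>i\<in>Basis. \<bar>wgrad \<Omega> f x \<bullet> i\<bar>)" by (rule norm_le_l1)
    also have "\<dots> \<le> (\<Sum>i\<in>Basis. Lp_norm \<infinity> M (weak_deriv \<Omega> [i] f))"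
      by (rule sum_mono) (use elim in \<open>simp add: wgrad_def inner_sum_left_Basis\<close>)
    finally show ?case .
  qed
  then have "(\<lambda>x. norm (wgrad \<Omega> f x)) \<in> Lp_space \<infinity> M"
    using weak_gradientD(2)[OF w] by (intro Lp_space_infinityI) auto
  from Lp_space_infinity_AE[OF this]
  show "AE x in M. norm (wgrad \<Omega> f x) \<le> sobolev_norm k \<infinity> \<Omega> f"
    by eventually_elim (use norm_wgrad_le_sobolev_norm[OF k, of \<Omega> f] in auto)
qed

lemma weak_gradient_H1:
  assumes w: "weak_gradient f V" and f2: "integrable M (\<lambda>x. (f x)\<^sup>2)" and V2: "integrable M (\<lambda>x. (norm (V x))\<^sup>2)"
  shows "f \<in> H_space 1 \<Omega>" "AE x in M. wgrad \<Omega> f x = V x"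
proof -
  note wD = weak_gradientD[OF w]
  have [measurable]: "f \<in> borel_measurable M" "V \<in> borel_measurable M" using wD by auto
  have Vi: "(\<lambda>x. V x \<bullet> i) \<in> Lp_space 2 M" if "i \<in> Basis" for i
  proof -
    have "integrable M (\<lambda>x. (V x \<bullet> i)\<^sup>2)"
    proof (rule Bochner_Integration.integrable_bound[OF V2])
      show "AE x in M. norm ((V x \<bullet> i)\<^sup>2) \<le> norm ((norm (V x))\<^sup>2)"
        using Basis_le_norm[OF that] by (intro AE_I2) (simp add: abs_le_square_iff[symmetric])
    qed simp
    then show ?thesis by (simp add: Lp_space_2_iff)
  qed
  show "f \<in> H_space 1 \<Omega>"
    unfolding sobolev_def
  proof (intro CollectI ballI impI)
    fix ds :: "'a list" assume ds: "ds \<in> lists Basis" "length ds \<le> 1"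
    then consider "ds = []" | i where "ds = [i]" "i \<in> Basis" by (cases ds) auto
    then show "\<exists>g\<in>Lp_space 2 M. has_weak_deriv \<Omega> ds f g"
    proof cases
      case 1
      then show ?thesis using has_weak_deriv_Nil[OF wD(1)] f2 by (auto simp: Lp_space_2_iff)
    next
      case 2
      then show ?thesis using weak_gradient_has_weak_deriv[OF w] Vi by blast
    qed
  qed
  then have "weak_gradient f (wgrad \<Omega> f)" by (rule H_space_gradient) simp
  then show "AE x in M. wgrad \<Omega> f x = V x" using w by (rule weak_gradient_unique)
qed

end

section \<open>Functions vanishing on the boundary\<close>

lemma DERIV_if_ge:
  fixes f g :: "real \<Rightarrow> real"
  assumes f: "\<And>s. s \<ge> a \<Longrightarrow> (f has_real_derivative f' s) (at s)"
    and g: "\<And>s. s \<le> a \<Longrightarrow> (g has_real_derivative g' s) (at s)"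
    and eq: "f a = g a" "f' a = g' a"
  shows "((\<lambda>s. if s \<ge> a then f s else g s) has_real_derivative (if s \<ge> a then f' s else g' s)) (at s)"
proof -
  consider "s > a" | "s < a" | "s = a" by linarith
  then show ?thesis
  proof cases
    case 1
    then show ?thesis
      by (auto intro: has_field_derivative_transform_within_open[OF f[of s], of "{a<..}"])
  next
    case 2
    then show ?thesis
      by (auto intro: has_field_derivative_transform_within_open[OF g[of s], of "{..<a}"])
  next
    case 3
    have F: "((\<lambda>h. (f (a + h) - f a) / h) \<longlongrightarrow> f' a) (at 0)"
      and G: "((\<lambda>h. (g (a + h) - g a) / h) \<longlongrightarrow> g' a) (at 0)"
      using f[of a] g[of a] by (auto simp: DERIV_def)
    let ?q = "\<lambda>h. ((if a + h \<ge> a then f (a + h) else g (a + h)) - f a) / h"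
    have "(?q \<longlongrightarrow> f' a) (at_right 0)"
      by (rule Lim_transform_eventually[OF filterlim_mono[OF F order_refl at_le]])
        (auto simp: eventually_at_filter)
    moreover have "(?q \<longlongrightarrow> f' a) (at_left 0)"
      by (rule Lim_transform_eventually[OF filterlim_mono[OF G[folded eq(2)] order_refl at_le]])
        (auto simp: eventually_at_filter eq(1))
    ultimately have "(?q \<longlongrightarrow> f' a) (at 0)" by (simp add: filterlim_split_at)
    then show ?thesis using 3 by (simp add: DERIV_def)
  qed
qed

context bounded_open_set
begin

lemma weak_gradient_const: "weak_gradient (\<lambda>x. c) (\<lambda>x. 0)"
  unfolding weak_gradient_def
proof (intro conjI allI impI)
  fix \<psi> D assume "C1_test \<Omega> \<psi> D"
  then show "(LINT x|M. c *\<^sub>R D x) = - (LINT x|M. \<psi> x *\<^sub>R (0 :: 'a))"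
    using C1_test_integral_gradient by simp
qed auto

lemma weak_gradient_C1_test:
  assumes t: "C1_test \<Omega> \<zeta> Z"
  shows "weak_gradient \<zeta> Z"
  unfolding weak_gradient_def
proof (intro conjI allI impI)
  note mz = C1_test_measurable[OF t]
  show "integrable M \<zeta>" "integrable M Z" using mz by auto
  fix \<psi> D assume p: "C1_test \<Omega> \<psi> D"
  note mp = C1_test_measurable[OF p]
  obtain C where C: "\<And>x. \<bar>\<zeta> x\<bar> \<le> C" using C1_test_bounded[OF t] by blast
  obtain B where B: "\<And>x. \<bar>\<psi> x\<bar> \<le> B" using C1_test_bounded[OF p] by blast
  have i: "integrable M (\<lambda>x. \<zeta> x *\<^sub>R D x)" "integrable M (\<lambda>x. \<psi> x *\<^sub>R Z x)"
    by (rule integrable_bounded_scaleR[OF mp(4) mz(1), where C = C], use C in simp)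
      (rule integrable_bounded_scaleR[OF mz(4) mp(1), where C = B], use B in simp)
  have "0 = (LINT x|M. \<zeta> x *\<^sub>R D x + \<psi> x *\<^sub>R Z x)"
    using C1_test_integral_gradient[OF C1_test_mult[OF p C1_test_C1[OF t]]] by simp
  also have "\<dots> = (LINT x|M. \<zeta> x *\<^sub>R D x) + (LINT x|M. \<psi> x *\<^sub>R Z x)"
    by (rule Bochner_Integration.integral_add[OF i])
  finally show "(LINT x|M. \<zeta> x *\<^sub>R D x) = - (LINT x|M. \<psi> x *\<^sub>R Z x)"
    by (simp add: eq_neg_iff_add_eq_0)
qed

lemma weak_gradient_diff:
  assumes f: "weak_gradient f V" and g: "weak_gradient g W"
  shows "weak_gradient (\<lambda>x. f x - g x) (\<lambda>x. V x - W x)"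
  unfolding weak_gradient_def
proof (intro conjI allI impI)
  note fD = weak_gradientD[OF f] and gD = weak_gradientD[OF g]
  show "integrable M (\<lambda>x. f x - g x)" "integrable M (\<lambda>x. V x - W x)" using fD gD by auto
  fix \<psi> D assume t: "C1_test \<Omega> \<psi> D"
  note m = C1_test_measurable[OF t]
  obtain C where C: "\<And>x. \<bar>\<psi> x\<bar> \<le> C" "\<And>x. norm (D x) \<le> C" using C1_test_bounded[OF t] by blast
  have i: "integrable M (\<lambda>x. f x *\<^sub>R D x)" "integrable M (\<lambda>x. g x *\<^sub>R D x)"
    by (rule integrable_scaleR_bounded[OF fD(1) m(2) C(2)], rule integrable_scaleR_bounded[OF gD(1) m(2) C(2)])
  have j: "integrable M (\<lambda>x. \<psi> x *\<^sub>R V x)" "integrable M (\<lambda>x. \<psi> x *\<^sub>R W x)"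
    by (rule integrable_bounded_scaleR[OF fD(2) m(1), where C = C], use C in simp)
      (rule integrable_bounded_scaleR[OF gD(2) m(1), where C = C], use C in simp)
  show "(LINT x|M. (f x - g x) *\<^sub>R D x) = - (LINT x|M. \<psi> x *\<^sub>R (V x - W x))"
    by (simp add: scaleR_diff_left scaleR_diff_right Bochner_Integration.integral_diff[OF i]
        Bochner_Integration.integral_diff[OF j] fD(3)[OF t] gD(3)[OF t])
qed

text \<open>With \<open>t\<close> the norm in \<open>L\<^sup>2\<close>, the inequality \<open>\<bar>h\<bar> \<le> t + \<bar>h\<bar>\<^sup>2 / t\<close> is integrated. The constant is
not the optimal one of the Cauchy--Schwarz inequality.\<close>

lemma L1_le_L2:
  fixes h :: "'a \<Rightarrow> 'b::{banach, second_countable_topology}"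
  assumes h: "h \<in> borel_measurable M" "integrable M (\<lambda>x. (norm (h x))\<^sup>2)"
  shows "(LINT x|M. norm (h x)) \<le> sqrt (LINT x|M. (norm (h x))\<^sup>2) * (measure M \<Omega> + 1)"
proof (cases "(LINT x|M. (norm (h x))\<^sup>2) = 0")
  case True
  then have "AE x in M. (norm (h x))\<^sup>2 = 0"
    by (subst (asm) integral_nonneg_eq_0_iff_AE) (use h in auto)
  then have "(LINT x|M. norm (h x)) = (LINT x|M. 0)"
    by (intro integral_AE_cong_lebesgue) auto
  then show ?thesis using True by simp
next
  case False
  define t where "t = sqrt (LINT x|M. (norm (h x))\<^sup>2)"
  have t: "t > 0" using False by (simp add: t_def order_less_le)
  have t2: "(LINT x|M. (norm (h x))\<^sup>2) = t * t" by (simp add: t_def)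
  have "(LINT x|M. norm (h x)) \<le> (LINT x|M. t + (norm (h x))\<^sup>2 / t)"
  proof (rule integral_mono)
    fix x
    have "0 \<le> (norm (h x) - t)\<^sup>2 + norm (h x) * t" using t by simp
    then have "norm (h x) * t \<le> t * t + (norm (h x))\<^sup>2" by (simp add: power2_eq_square algebra_simps)
    then show "norm (h x) \<le> t + (norm (h x))\<^sup>2 / t" using t by (simp add: field_simps)
  qed (use h integrable_of_square_integrable[OF h] in auto)
  also have "\<dots> = t * measure M \<Omega> + (t * t) / t"
    using h by (simp add: t2 measure_restrict_space mult.commute)
  also have "\<dots> = t * (measure M \<Omega> + 1)" using t by (simp add: algebra_simps)
  finally show ?thesis by (simp add: t_def)
qed

lemma test_function_H1:
  assumes z: "\<zeta> \<in> test_functions \<Omega>" and t: "C1_test \<Omega> \<zeta> Z"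
  shows "\<zeta> \<in> H_space 1 \<Omega>" "AE x in M. wgrad \<Omega> \<zeta> x = Z x"
proof -
  note mz = C1_test_measurable[OF t]
  obtain C where C: "\<And>x. \<bar>\<zeta> x\<bar> \<le> C" "\<And>x. norm (Z x) \<le> C" using C1_test_bounded[OF t] by blast
  have b: "norm ((\<zeta> x)\<^sup>2) \<le> C\<^sup>2" "norm ((norm (Z x))\<^sup>2) \<le> C\<^sup>2" for x
    using power_mono[OF C(1)[of x], of 2] power_mono[OF C(2)[of x], of 2] by auto
  have "integrable M (\<lambda>x. (\<zeta> x)\<^sup>2)" "integrable M (\<lambda>x. (norm (Z x))\<^sup>2)"
    by (rule integrable_bounded[where C = "C\<^sup>2"]; use mz b in simp)+
  then show "\<zeta> \<in> H_space 1 \<Omega>" "AE x in M. wgrad \<Omega> \<zeta> x = Z x"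
    using weak_gradient_H1[OF weak_gradient_C1_test[OF t]] by auto
qed

lemma sobolev_norm_1_2_zero: "sobolev_norm 1 2 \<Omega> (\<lambda>x. 0) = 0"
proof -
  have w: "weak_gradient (\<lambda>x. 0) (\<lambda>x. 0)" by (rule weak_gradient_const)
  have H: "(\<lambda>x. 0) \<in> H_space 1 \<Omega>" and g: "AE x in M. wgrad \<Omega> (\<lambda>x. 0) x = 0"
    using weak_gradient_H1[OF w] by auto
  have d0: "AE x in M. weak_deriv \<Omega> [] (\<lambda>x. 0) x = 0" using sobolev_Lp(2)[OF H] by simp
  have 0: "{ds \<in> lists (Basis :: 'a set). length ds = 0} = {[]}" by auto
  have "(LINT x|M. (deriv_norm \<Omega> 0 (\<lambda>x. 0) x)\<^sup>2) = (LINT x|M. 0)"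
    by (rule integral_AE_cong_lebesgue[OF Omega_lebesgue])
      (use d0 in eventually_elim, simp add: deriv_norm_def 0 del: length_0_conv)
  moreover have "(LINT x|M. (deriv_norm \<Omega> 1 (\<lambda>x. 0) x)\<^sup>2) = (LINT x|M. 0)"
    unfolding norm_wgrad[symmetric]
    by (rule integral_AE_cong_lebesgue[OF Omega_lebesgue]) (use g in eventually_elim, simp)
  ultimately show ?thesis by (simp add: sobolev_norm_def Lp_norm_2 atMost_Suc)
qed

lemma test_function_H10:
  assumes "\<zeta> \<in> test_functions \<Omega>"
  shows "\<zeta> \<in> H10 \<Omega>"
  unfolding H10_def
proof (intro CollectI conjI exI[of _ "\<lambda>n::nat. \<zeta>"] allI assms)
  show "\<zeta> \<in> H_space 1 \<Omega>" by (rule test_function_H1(1)[OF assms test_function_C1_test[OF assms]])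
  show "(\<lambda>n. sobolev_norm 1 2 \<Omega> (\<lambda>x. \<zeta> x - \<zeta> x)) \<longlonglongrightarrow> 0"
    using sobolev_norm_1_2_zero by simp
qed

lemma H_space_L1_diff:
  assumes f: "f \<in> H_space k \<Omega>" and g: "g \<in> H_space k \<Omega>" and k: "k \<ge> 1"
  shows "(LINT x|M. norm (wgrad \<Omega> f x - wgrad \<Omega> g x)) \<le> sobolev_norm k 2 \<Omega> (\<lambda>x. f x - g x) * (measure M \<Omega> + 1)"
    and "(LINT x|M. \<bar>f x - g x\<bar>) \<le> sobolev_norm k 2 \<Omega> (\<lambda>x. f x - g x) * (measure M \<Omega> + 1)"
proof -
  note F = H_space_gradient[OF f k] and G = H_space_gradient[OF g k]
  have [measurable]: "f \<in> borel_measurable M" "g \<in> borel_measurable M" "wgrad \<Omega> f \<in> borel_measurable M" "wgrad \<Omega> g \<in> borel_measurable M"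
    using weak_gradientD(1,2)[OF F(1)] weak_gradientD(1,2)[OF G(1)] by auto
  have le: "(norm (p - q))\<^sup>2 \<le> 2 * (norm p)\<^sup>2 + 2 * (norm q)\<^sup>2" for p q :: "'b::real_normed_vector"
  proof -
    have "(norm (p - q))\<^sup>2 \<le> (norm p + norm q)\<^sup>2"
      using norm_triangle_ineq4[of p q] by (intro power_mono) auto
    also have "\<dots> \<le> 2 * (norm p)\<^sup>2 + 2 * (norm q)\<^sup>2"
      using zero_le_power2[of "norm p - norm q"] by (simp add: power2_eq_square algebra_simps)
    finally show ?thesis .
  qed
  have i1: "integrable M (\<lambda>x. (f x - g x)\<^sup>2)"
  proof (rule Bochner_Integration.integrable_bound)
    show "integrable M (\<lambda>x. 2 * (f x)\<^sup>2 + 2 * (g x)\<^sup>2)" using F G by simp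
    show "AE x in M. norm ((f x - g x)\<^sup>2) \<le> norm (2 * (f x)\<^sup>2 + 2 * (g x)\<^sup>2)"
      using le[of "f _" "g _"] by (intro AE_I2) simp
  qed simp
  have i2: "integrable M (\<lambda>x. (norm (wgrad \<Omega> f x - wgrad \<Omega> g x))\<^sup>2)"
  proof (rule Bochner_Integration.integrable_bound)
    show "integrable M (\<lambda>x. 2 * (norm (wgrad \<Omega> f x))\<^sup>2 + 2 * (norm (wgrad \<Omega> g x))\<^sup>2)" using F G by simp
    show "AE x in M. norm ((norm (wgrad \<Omega> f x - wgrad \<Omega> g x))\<^sup>2) \<le> norm (2 * (norm (wgrad \<Omega> f x))\<^sup>2 + 2 * (norm (wgrad \<Omega> g x))\<^sup>2)"
      using le[of "wgrad \<Omega> f _" "wgrad \<Omega> g _"] by (intro AE_I2) simp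
  qed simp
  note d = weak_gradient_H1[OF weak_gradient_diff[OF F(1) G(1)] i1 i2]
  note D = H_space_gradient[OF d(1) order_refl]
  have mono: "sobolev_norm 1 2 \<Omega> (\<lambda>x. f x - g x) \<le> sobolev_norm k 2 \<Omega> (\<lambda>x. f x - g x)"
    unfolding sobolev_norm_def by (rule sum_mono2) (use k in \<open>auto intro: Lp_norm_nonneg\<close>)
  have "sqrt (LINT x|M. (norm (wgrad \<Omega> f x - wgrad \<Omega> g x))\<^sup>2) = sqrt (LINT x|M. (norm (wgrad \<Omega> (\<lambda>x. f x - g x) x))\<^sup>2)"
    by (rule arg_cong[where f = sqrt], rule integral_AE_cong_lebesgue[OF Omega_lebesgue]) (use d(2) in eventually_elim, simp)
  also have "\<dots> \<le> sobolev_norm k 2 \<Omega> (\<lambda>x. f x - g x)" by (rule order_trans[OF D(4) mono])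
  finally have s: "sqrt (LINT x|M. (norm (wgrad \<Omega> f x - wgrad \<Omega> g x))\<^sup>2) \<le> sobolev_norm k 2 \<Omega> (\<lambda>x. f x - g x)" .
  show "(LINT x|M. norm (wgrad \<Omega> f x - wgrad \<Omega> g x)) \<le> sobolev_norm k 2 \<Omega> (\<lambda>x. f x - g x) * (measure M \<Omega> + 1)"
    by (rule order_trans[OF L1_le_L2[OF _ i2] mult_right_mono[OF s]]) auto
  have "(LINT x|M. norm (f x - g x)) \<le> sqrt (LINT x|M. (norm (f x - g x))\<^sup>2) * (measure M \<Omega> + 1)"
    by (rule L1_le_L2) (use i1 in auto)
  also have "\<dots> \<le> sobolev_norm k 2 \<Omega> (\<lambda>x. f x - g x) * (measure M \<Omega> + 1)"
    by (rule mult_right_mono) (use order_trans[OF D(5) mono] in auto)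
  finally show "(LINT x|M. \<bar>f x - g x\<bar>) \<le> sobolev_norm k 2 \<Omega> (\<lambda>x. f x - g x) * (measure M \<Omega> + 1)" by simp
qed

text \<open>The value of this form of the approximation is that the \<open>Z n\<close> are classical gradients, which may be
inserted into the chain rule.\<close>

lemma H10_approx:
  assumes "\<phi> \<in> H10 \<Omega>"
  shows "\<exists>\<zeta> Z. (\<forall>n. \<zeta> n \<in> test_functions \<Omega> \<and> C1_test \<Omega> (\<zeta> n) (Z n)) \<and>
    (AE x in M. (\<lambda>n. \<zeta> n x) \<longlonglongrightarrow> \<phi> x) \<and>
    (\<lambda>n. LINT x|M. norm (Z n x - wgrad \<Omega> \<phi> x)) \<longlonglongrightarrow> 0"
proof -
  from assms obtain \<zeta> where \<phi>: "\<phi> \<in> H_space 1 \<Omega>" and z: "\<And>n. \<zeta> n \<in> test_functions \<Omega>"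
    and lim: "(\<lambda>n. sobolev_norm 1 2 \<Omega> (\<lambda>x. \<zeta> n x - \<phi> x)) \<longlonglongrightarrow> 0"
    unfolding H10_def by blast
  define Z where "Z n x = (\<Sum>i\<in>Basis. pderivs [i] (\<zeta> n) x *\<^sub>R i)" for n x
  have t: "C1_test \<Omega> (\<zeta> n) (Z n)" for n using test_function_C1_test[OF z] by (simp add: Z_def[abs_def])
  have phii: "integrable M \<phi>" using weak_gradientD(1)[OF H_space_gradient(1)[OF \<phi> order_refl]] .
  note mz = C1_test_measurable[OF t]
  have zH: "\<zeta> n \<in> H_space 1 \<Omega>" and zg: "AE x in M. wgrad \<Omega> (\<zeta> n) x = Z n x" for n
    using test_function_H1[OF z t] by auto
  have lim': "(\<lambda>n. sobolev_norm 1 2 \<Omega> (\<lambda>x. \<zeta> n x - \<phi> x) * (measure M \<Omega> + 1)) \<longlonglongrightarrow> 0"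
    using tendsto_mult_right[OF lim, of "measure M \<Omega> + 1"] by simp
  have l1: "(\<lambda>n. LINT x|M. \<bar>\<zeta> n x - \<phi> x\<bar>) \<longlonglongrightarrow> 0"
    by (rule tendsto_sandwich[OF _ _ tendsto_const lim'])
      (auto intro!: always_eventually H_space_L1_diff(2)[OF zH \<phi> order_refl, simplified])
  have l2: "(\<lambda>n. LINT x|M. norm (Z n x - wgrad \<Omega> \<phi> x)) \<longlonglongrightarrow> 0"
  proof (rule tendsto_sandwich[OF _ _ tendsto_const lim'])
    have "(LINT x|M. norm (Z n x - wgrad \<Omega> \<phi> x)) = (LINT x|M. norm (wgrad \<Omega> (\<zeta> n) x - wgrad \<Omega> \<phi> x))" for n
      by (rule integral_AE_cong_lebesgue[OF Omega_lebesgue]) (use zg[of n] in eventually_elim, simp)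
    then show "\<forall>\<^sub>F n in sequentially. (LINT x|M. norm (Z n x - wgrad \<Omega> \<phi> x))
        \<le> sobolev_norm 1 2 \<Omega> (\<lambda>x. \<zeta> n x - \<phi> x) * (measure M \<Omega> + 1)"
      using H_space_L1_diff(1)[OF zH \<phi> order_refl] by (intro always_eventually allI) (simp only:)
  qed auto
  obtain r where r: "strict_mono r" "AE x in M. (\<lambda>n. \<zeta> (r n) x - \<phi> x) \<longlonglongrightarrow> 0"
    using tendsto_L1_AE_subseq[of M "\<lambda>n x. \<zeta> n x - \<phi> x"] l1 mz phii by auto
  show ?thesis
  proof (intro exI[of _ "\<lambda>n. \<zeta> (r n)"] exI[of _ "\<lambda>n. Z (r n)"] conjI allI z t)
    show "AE x in M. (\<lambda>n. \<zeta> (r n) x) \<longlonglongrightarrow> \<phi> x" using r(2) by eventually_elim (simp add: LIM_zero_iff)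
    show "(\<lambda>n. LINT x|M. norm (Z (r n) x - wgrad \<Omega> \<phi> x)) \<longlonglongrightarrow> 0"
      using LIMSEQ_subseq_LIMSEQ[OF l2 r(1)] by (simp add: o_def)
  qed
qed

section \<open>Testing a divergence equation\<close>

text \<open>In this section \<open>V\<close> is a vector field whose divergence in the sense of distributions is \<open>- u\<close>, and the
class of functions against which this may be tested is enlarged step by step.\<close>

lemma divergence_C1_test:
  assumes V: "integrable M V" and u: "integrable M u"
    and eq: "\<And>\<zeta> Z. \<zeta> \<in> test_functions \<Omega> \<Longrightarrow> C1_test \<Omega> \<zeta> Z \<Longrightarrow> (LINT x|M. V x \<bullet> Z x) = (LINT x|M. u x * \<zeta> x)"
    and \<psi>: "C1_test \<Omega> \<psi> D"
  shows "(LINT x|M. V x \<bullet> D x) = (LINT x|M. u x * \<psi> x)"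
proof -
  obtain \<zeta> Z C where z: "\<And>n. \<zeta> n \<in> test_functions \<Omega>" "\<And>n. C1_test \<Omega> (\<zeta> n) (Z n)"
    "\<And>n x. \<bar>\<zeta> n x\<bar> \<le> C" "\<And>n x. norm (Z n x) \<le> C"
    "\<And>x. x \<in> \<Omega> \<Longrightarrow> (\<lambda>n. \<zeta> n x) \<longlonglongrightarrow> \<psi> x" "\<And>x. x \<in> \<Omega> \<Longrightarrow> (\<lambda>n. Z n x) \<longlonglongrightarrow> D x"
    using C1_test_approx[OF \<psi>] by blast
  note mz = C1_test_measurable[OF z(2)] and m\<psi> = C1_test_measurable[OF \<psi>]
  have "(\<lambda>n. LINT x|M. V x \<bullet> Z n x) \<longlonglongrightarrow> (LINT x|M. V x \<bullet> D x)"
    by (rule bilinear_convergence[OF bounded_bilinear.flip[OF bounded_bilinear_inner], of Z M D C "\<lambda>n. V" V])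
      (use mz m\<psi> z V in \<open>auto intro!: AE_I2\<close>)
  moreover have "(\<lambda>n. LINT x|M. u x * \<zeta> n x) \<longlonglongrightarrow> (LINT x|M. u x * \<psi> x)"
    by (rule bilinear_convergence[OF bounded_bilinear.flip[OF bounded_bilinear_mult], of \<zeta> M \<psi> C "\<lambda>n. u" u])
      (use mz m\<psi> z u in \<open>auto intro!: AE_I2\<close>)
  ultimately show ?thesis unfolding eq[OF z(1,2)] using LIMSEQ_unique by blast
qed

text \<open>A bounded function \<open>G\<close> with integrable weak gradient is allowed as a factor, because near the support
of \<open>\<theta>\<close> it is a limit of \<open>C\<^sup>1\<close> functions. On the boundary itself \<open>G\<close> may be different from \<open>0\<close>.\<close>

lemma divergence_times_C1_test:
  assumes V: "V \<in> borel_measurable M" "AE x in M. norm (V x) \<le> B"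
    and u: "integrable M u"
    and eq: "\<And>\<psi> D. C1_test \<Omega> \<psi> D \<Longrightarrow> (LINT x|M. V x \<bullet> D x) = (LINT x|M. u x * \<psi> x)"
    and G: "weak_gradient G E" "AE x in M. \<bar>G x\<bar> \<le> B1"
    and \<theta>: "C1_test \<Omega> \<theta> D"
  shows "(LINT x|M. \<theta> x * (V x \<bullet> E x) + G x * (V x \<bullet> D x)) = (LINT x|M. G x * (u x * \<theta> x))"
proof -
  note GD = weak_gradientD[OF G(1)] and m = C1_test_measurable[OF \<theta>]
  have [measurable]: "V \<in> borel_measurable M" "G \<in> borel_measurable M" "E \<in> borel_measurable M" "\<theta> \<in> borel_measurable M" "D \<in> borel_measurable M"
    using V GD m by auto
  from \<theta> obtain K where K: "compact K" "K \<subseteq> \<Omega>" "\<And>x. x \<notin> K \<Longrightarrow> \<theta> x = 0 \<and> D x = 0"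
    unfolding C1_test_def by blast
  have [measurable]: "K \<in> sets M" using K by (auto simp: sets_restrict_space_iff compact_imp_closed borel_closed)
  obtain C where C: "C \<ge> 0" "\<And>x. norm (D x) \<le> C" "\<And>x. \<bar>\<theta> x\<bar> \<le> C" using C1_test_bounded[OF \<theta>] by blast
  define B' where "B' = max 0 B1"
  have B': "AE x in M. \<bar>G x\<bar> \<le> B'" "B' \<ge> 0" using G(2) by (auto simp: B'_def elim: eventually_mono)
  obtain F H where F: "\<And>n. has_C1_gradient (F n) (H n)" "\<And>n. integrable M (F n)"
    "\<And>n. integrable M (\<lambda>x. indicator K x *\<^sub>R H n x)"
    "AE x in M. (\<lambda>n. F n x) \<longlonglongrightarrow> G x"
    "(\<lambda>n. LINT x|M. norm (indicator K x *\<^sub>R H n x - indicator K x *\<^sub>R E x)) \<longlonglongrightarrow> 0"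
    "\<And>n x. \<bar>F n x\<bar> \<le> B'"
    using weak_gradient_approx[OF G(1) K(1,2)] B' by blast
  have mF [measurable]: "F n \<in> borel_measurable M" for n using F(2) by auto
  have KE: "integrable M (\<lambda>x. indicator K x *\<^sub>R E x)"
    by (rule integrable_bounded_scaleR[OF GD(2), where C = 1]) (auto split: split_indicator)
  have VD: "integrable M (\<lambda>x. V x \<bullet> D x)" by (rule integrable_bounded_inner[OF V m(4)])
  have uth: "integrable M (\<lambda>x. u x * \<theta> x)"
    using integrable_bounded_mult[OF u m(1), where C = C] C by (simp add: mult.commute)
  have VK: "AE x in M. norm (\<theta> x *\<^sub>R V x) \<le> C * B"
    using V(2) by eventually_elim (use C in \<open>auto intro!: mult_mono\<close>)
  have l1: "(\<lambda>n. LINT x|M. F n x * (V x \<bullet> D x)) \<longlonglongrightarrow> (LINT x|M. G x * (V x \<bullet> D x))"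
    by (rule bilinear_convergence[OF bounded_bilinear_mult, of F M G B' "\<lambda>n x. V x \<bullet> D x"]) (use F VD in auto)
  have l2: "(\<lambda>n. LINT x|M. (\<theta> x *\<^sub>R V x) \<bullet> (indicator K x *\<^sub>R H n x)) \<longlonglongrightarrow> (LINT x|M. (\<theta> x *\<^sub>R V x) \<bullet> (indicator K x *\<^sub>R E x))"
    by (rule bilinear_convergence[OF bounded_bilinear_inner, of "\<lambda>n x. \<theta> x *\<^sub>R V x" M "\<lambda>x. \<theta> x *\<^sub>R V x" "C * B"])
      (use F KE VK in auto)
  have l3: "(\<lambda>n. LINT x|M. F n x * (u x * \<theta> x)) \<longlonglongrightarrow> (LINT x|M. G x * (u x * \<theta> x))"
    by (rule bilinear_convergence[OF bounded_bilinear_mult, of F M G B' "\<lambda>n x. u x * \<theta> x"]) (use F uth in auto)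
  have inner_int: "integrable M (\<lambda>x. (\<theta> x *\<^sub>R V x) \<bullet> c x)" if c: "integrable M c" for c
    by (rule integrable_bounded_inner[OF _ VK c]) measurable
  have eqn: "(LINT x|M. F n x * (V x \<bullet> D x)) + (LINT x|M. (\<theta> x *\<^sub>R V x) \<bullet> (indicator K x *\<^sub>R H n x)) = (LINT x|M. F n x * (u x * \<theta> x))" for n
  proof -
    have "(LINT x|M. F n x * (V x \<bullet> D x)) + (LINT x|M. (\<theta> x *\<^sub>R V x) \<bullet> (indicator K x *\<^sub>R H n x))
       = (LINT x|M. F n x * (V x \<bullet> D x) + (\<theta> x *\<^sub>R V x) \<bullet> (indicator K x *\<^sub>R H n x))"
      by (rule Bochner_Integration.integral_add[symmetric, OF integrable_bounded_mult[OF VD mF AE_I2, of _ B'] inner_int[OF F(3)]])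
        (rule F(6))
    also have "\<dots> = (LINT x|M. V x \<bullet> (F n x *\<^sub>R D x + \<theta> x *\<^sub>R H n x))"
      by (rule arg_cong[where f = "integral\<^sup>L M"], rule ext)
        (use K(3) in \<open>auto simp: inner_add_right split: split_indicator\<close>)
    also have "\<dots> = (LINT x|M. u x * (F n x * \<theta> x))"
      by (rule eq[OF C1_test_mult[OF \<theta> F(1)]])
    also have "\<dots> = (LINT x|M. F n x * (u x * \<theta> x))" by (simp add: mult_ac)
    finally show ?thesis .
  qed
  have "(LINT x|M. G x * (V x \<bullet> D x)) + (LINT x|M. (\<theta> x *\<^sub>R V x) \<bullet> (indicator K x *\<^sub>R E x)) = (LINT x|M. G x * (u x * \<theta> x))"
    using LIMSEQ_unique[OF tendsto_add[OF l1 l2, unfolded eqn] l3] .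
  moreover have "(LINT x|M. (\<theta> x *\<^sub>R V x) \<bullet> (indicator K x *\<^sub>R E x)) = (LINT x|M. \<theta> x * (V x \<bullet> E x))"
    by (rule arg_cong[where f = "integral\<^sup>L M"], rule ext) (use K(3) in \<open>auto split: split_indicator\<close>)
  moreover have "integrable M (\<lambda>x. \<theta> x * (V x \<bullet> E x))" using inner_int[OF GD(2)] by simp
  moreover have "integrable M (\<lambda>x. G x * (V x \<bullet> D x))" by (rule integrable_bounded_mult[OF VD _ G(2)]) simp
  ultimately show ?thesis by simp
qed

text \<open>The factor \<open>h \<circ> \<phi>\<close> vanishes on the boundary, being the limit of the test functions \<open>h \<circ> \<zeta> n\<close>;
this is where \<open>h 0 = 0\<close> enters. Boundedness of \<open>h\<close> and \<open>h'\<close> keeps the limits in the scope of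
\<open>bilinear_convergence\<close>.\<close>

lemma divergence_times_H10:
  assumes V: "V \<in> borel_measurable M" "AE x in M. norm (V x) \<le> B"
    and u: "integrable M u"
    and eq: "\<And>\<psi> D. C1_test \<Omega> \<psi> D \<Longrightarrow> (LINT x|M. V x \<bullet> D x) = (LINT x|M. u x * \<psi> x)"
    and G: "weak_gradient G E" "AE x in M. \<bar>G x\<bar> \<le> B1"
    and \<phi>: "\<phi> \<in> H10 \<Omega>"
    and h: "\<And>s. (h has_real_derivative h' s) (at s)" "continuous_on UNIV h'" "h 0 = 0" "\<And>s. \<bar>h s\<bar> \<le> C" "\<And>s. \<bar>h' s\<bar> \<le> C"
  shows "(LINT x|M. h (\<phi> x) * (V x \<bullet> E x) + G x * (h' (\<phi> x) * (V x \<bullet> wgrad \<Omega> \<phi> x))) = (LINT x|M. G x * (u x * h (\<phi> x)))"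
proof -
  obtain \<zeta> Z where z: "\<And>n. \<zeta> n \<in> test_functions \<Omega>" "\<And>n. C1_test \<Omega> (\<zeta> n) (Z n)"
    "AE x in M. (\<lambda>n. \<zeta> n x) \<longlonglongrightarrow> \<phi> x" "(\<lambda>n. LINT x|M. norm (Z n x - wgrad \<Omega> \<phi> x)) \<longlonglongrightarrow> 0"
    using H10_approx[OF \<phi>] by blast
  have "\<phi> \<in> H_space 1 \<Omega>" using \<phi> by (simp add: H10_def)
  note phiD = weak_gradientD[OF H_space_gradient(1)[OF this order_refl]]
  note GD = weak_gradientD[OF G(1)]
  define P where "P = wgrad \<Omega> \<phi>"
  have Pi: "integrable M P" and phii: "integrable M \<phi>" using phiD by (auto simp: P_def)
  have ch: "continuous_on UNIV h" using h(1) by (meson DERIV_isCont continuous_at_imp_continuous_on)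
  have [measurable]: "h \<in> borel_measurable borel" "h' \<in> borel_measurable borel"
    using ch h(2) by (auto intro: borel_measurable_continuous_onI)
  have mz [measurable]: "\<zeta> n \<in> borel_measurable M" "Z n \<in> borel_measurable M" and Zi: "integrable M (Z n)" for n
    using C1_test_measurable[OF z(2)] by auto
  have [measurable]: "V \<in> borel_measurable M" "G \<in> borel_measurable M" "E \<in> borel_measurable M" "\<phi> \<in> borel_measurable M"
      "P \<in> borel_measurable M" "u \<in> borel_measurable M"
    using V GD Pi phii u by auto
  have t: "C1_test \<Omega> (\<lambda>x. h (\<zeta> n x)) (\<lambda>x. h' (\<zeta> n x) *\<^sub>R Z n x)" for n
  proof -
    from z(2)[of n] obtain K where K: "compact K" "K \<subseteq> \<Omega>" "\<And>x. x \<notin> K \<Longrightarrow> \<zeta> n x = 0 \<and> Z n x = 0"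
      unfolding C1_test_def by blast
    show ?thesis
      by (rule C1_testI[OF has_C1_gradient_compose[OF C1_test_C1[OF z(2)] h(1,2)] K(1,2)]) (simp add: K(3) h(3))
  qed
  have VE: "integrable M (\<lambda>x. V x \<bullet> E x)" by (rule integrable_bounded_inner[OF V GD(2)])
  have GV: "AE x in M. norm (G x *\<^sub>R V x) \<le> B1 * B"
    using G(2) V(2) by eventually_elim (auto intro!: mult_mono intro: order_trans[OF abs_ge_zero])
  have GVc: "integrable M (\<lambda>x. (G x *\<^sub>R V x) \<bullet> c x)" "(LINT x|M. norm ((G x *\<^sub>R V x) \<bullet> c x)) \<le> (B1 * B) * (LINT x|M. norm (c x))" if c: "integrable M c" for c
  proof -
    have b: "AE x in M. norm ((G x *\<^sub>R V x) \<bullet> c x) \<le> (B1 * B) * norm (c x)"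
      using GV
    proof eventually_elim
      case (elim x)
      have "norm ((G x *\<^sub>R V x) \<bullet> c x) \<le> norm (G x *\<^sub>R V x) * norm (c x)" unfolding real_norm_def by (rule Cauchy_Schwarz_ineq2)
      also have "\<dots> \<le> (B1 * B) * norm (c x)" by (intro mult_right_mono elim) simp
      finally show ?case .
    qed
    have [measurable]: "c \<in> borel_measurable M" using c by auto
    show i: "integrable M (\<lambda>x. (G x *\<^sub>R V x) \<bullet> c x)"
      by (rule Bochner_Integration.integrable_bound[of M "\<lambda>x. (B1 * B) * norm (c x)"])
        (use c b in \<open>auto elim!: eventually_mono intro: order_trans[OF _ abs_ge_self]\<close>)
    have "(LINT x|M. norm ((G x *\<^sub>R V x) \<bullet> c x)) \<le> (LINT x|M. (B1 * B) * norm (c x))"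
      by (rule integral_mono_AE[OF _ _ b]) (use i c in auto)
    then show "(LINT x|M. norm ((G x *\<^sub>R V x) \<bullet> c x)) \<le> (B1 * B) * (LINT x|M. norm (c x))" by simp
  qed
  have uG: "integrable M (\<lambda>x. G x * u x)" by (rule integrable_bounded_mult[OF u _ G(2)]) simp
  have hz: "AE x in M. (\<lambda>n. h (\<zeta> n x)) \<longlonglongrightarrow> h (\<phi> x)"
    using z(3) by eventually_elim (rule isCont_tendsto_compose[OF DERIV_isCont[OF h(1)]])
  have h'z: "AE x in M. (\<lambda>n. h' (\<zeta> n x)) \<longlonglongrightarrow> h' (\<phi> x)"
    using z(3)
  proof eventually_elim
    case (elim x)
    have "isCont h' (\<phi> x)" using h(2) by (simp add: continuous_on_eq_continuous_at)
    from isCont_tendsto_compose[OF this elim] show ?case .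
  qed
  have l1: "(\<lambda>n. LINT x|M. h (\<zeta> n x) * (V x \<bullet> E x)) \<longlonglongrightarrow> (LINT x|M. h (\<phi> x) * (V x \<bullet> E x))"
    by (rule bilinear_convergence[OF bounded_bilinear_mult, of "\<lambda>n x. h (\<zeta> n x)" M "\<lambda>x. h (\<phi> x)" C "\<lambda>n x. V x \<bullet> E x"])
      (use hz VE h in auto)
  have l2: "(\<lambda>n. LINT x|M. h' (\<zeta> n x) * ((G x *\<^sub>R V x) \<bullet> Z n x)) \<longlonglongrightarrow> (LINT x|M. h' (\<phi> x) * ((G x *\<^sub>R V x) \<bullet> P x))"
  proof (rule bilinear_convergence[OF bounded_bilinear_mult, of "\<lambda>n x. h' (\<zeta> n x)" M "\<lambda>x. h' (\<phi> x)" C "\<lambda>n x. (G x *\<^sub>R V x) \<bullet> Z n x" "\<lambda>x. (G x *\<^sub>R V x) \<bullet> P x"])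
    have lim: "(\<lambda>n. (B1 * B) * (LINT x|M. norm (Z n x - P x))) \<longlonglongrightarrow> 0"
      using tendsto_mult_left[OF z(4), of "B1 * B"] by (simp add: P_def)
    show "(\<lambda>n. LINT x|M. norm ((G x *\<^sub>R V x) \<bullet> Z n x - (G x *\<^sub>R V x) \<bullet> P x)) \<longlonglongrightarrow> 0"
    proof (rule tendsto_sandwich[OF _ _ tendsto_const lim])
      have "(LINT x|M. norm ((G x *\<^sub>R V x) \<bullet> Z n x - (G x *\<^sub>R V x) \<bullet> P x)) \<le> (B1 * B) * (LINT x|M. norm (Z n x - P x))" for n
        using GVc(2)[of "\<lambda>x. Z n x - P x"] Zi Pi by (simp add: inner_diff_right)
      then show "\<forall>\<^sub>F n in sequentially. (LINT x|M. norm ((G x *\<^sub>R V x) \<bullet> Z n x - (G x *\<^sub>R V x) \<bullet> P x)) \<le> (B1 * B) * (LINT x|M. norm (Z n x - P x))"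
        by (intro always_eventually allI)
    qed auto
  qed (use h'z h GVc(1) Zi Pi in auto)
  have l3: "(\<lambda>n. LINT x|M. h (\<zeta> n x) * (G x * u x)) \<longlonglongrightarrow> (LINT x|M. h (\<phi> x) * (G x * u x))"
    by (rule bilinear_convergence[OF bounded_bilinear_mult, of "\<lambda>n x. h (\<zeta> n x)" M "\<lambda>x. h (\<phi> x)" C "\<lambda>n x. G x * u x"])
      (use hz uG h in auto)
  have i1: "integrable M (\<lambda>x. h (f x) * (V x \<bullet> E x))" if "f \<in> borel_measurable M" for f
    by (rule integrable_bounded_mult[OF VE, where C = C]) (use that h in auto)
  have i2: "integrable M (\<lambda>x. h' (f x) * ((G x *\<^sub>R V x) \<bullet> c x))" if "f \<in> borel_measurable M" "integrable M c" for f c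
    by (rule integrable_bounded_mult[OF GVc(1)[OF that(2)], where C = C]) (use that h in auto)
  have eqn: "(LINT x|M. h (\<zeta> n x) * (V x \<bullet> E x)) + (LINT x|M. h' (\<zeta> n x) * ((G x *\<^sub>R V x) \<bullet> Z n x)) = (LINT x|M. h (\<zeta> n x) * (G x * u x))" for n
  proof -
    have "(LINT x|M. h (\<zeta> n x) * (V x \<bullet> E x)) + (LINT x|M. h' (\<zeta> n x) * ((G x *\<^sub>R V x) \<bullet> Z n x))
      = (LINT x|M. h (\<zeta> n x) * (V x \<bullet> E x) + h' (\<zeta> n x) * ((G x *\<^sub>R V x) \<bullet> Z n x))"
      by (rule Bochner_Integration.integral_add[symmetric, OF i1[OF mz(1)] i2[OF mz(1) Zi]])
    also have "\<dots> = (LINT x|M. h (\<zeta> n x) * (V x \<bullet> E x) + G x * (V x \<bullet> (h' (\<zeta> n x) *\<^sub>R Z n x)))"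
      by (simp add: mult_ac)
    also have "\<dots> = (LINT x|M. G x * (u x * h (\<zeta> n x)))"
      by (rule divergence_times_C1_test[OF V u eq G t])
    finally show ?thesis by (simp add: mult_ac)
  qed
  have "(LINT x|M. h (\<phi> x) * (V x \<bullet> E x)) + (LINT x|M. h' (\<phi> x) * ((G x *\<^sub>R V x) \<bullet> P x)) = (LINT x|M. h (\<phi> x) * (G x * u x))"
    using LIMSEQ_unique[OF tendsto_add[OF l1 l2, unfolded eqn] l3] .
  moreover have "(LINT x|M. h (\<phi> x) * (V x \<bullet> E x)) + (LINT x|M. h' (\<phi> x) * ((G x *\<^sub>R V x) \<bullet> P x))
     = (LINT x|M. h (\<phi> x) * (V x \<bullet> E x) + h' (\<phi> x) * ((G x *\<^sub>R V x) \<bullet> P x))"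
    by (rule Bochner_Integration.integral_add[symmetric, OF i1 i2[OF _ Pi]]) auto
  ultimately show ?thesis by (simp add: P_def mult_ac)
qed

end

section \<open>The one-sided bound for the Laplacian of the potential\<close>

lemma abs_inner_le: "\<bar>x \<bullet> y\<bar> \<le> A * B" if "norm x \<le> A" "norm y \<le> B"
  using order_trans[OF Cauchy_Schwarz_ineq2 mult_mono[OF that]] that order_trans[OF norm_ge_zero that(1)] by simp

text \<open>The function \<open>s - sqrt (s\<^sup>2 + e\<^sup>2) + e\<close> is increasing, stays below \<open>e\<close>, and has slope at least
\<open>1\<close> for negative \<open>s\<close>; composing it with \<open>arctan\<close> makes it bounded. As \<open>e\<close> tends to \<open>0\<close>, testing
with it isolates the region where its argument is negative.\<close>

lemma arctan_cutoff:
  fixes e :: real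
  assumes e: "e > 0"
  shows "\<exists>h h'. (\<forall>s. (h has_real_derivative h' s) (at s)) \<and> continuous_on UNIV h' \<and> h 0 = 0 \<and>
    (\<forall>s. \<bar>h s\<bar> \<le> pi \<and> \<bar>h' s\<bar> \<le> 2 \<and> h s \<le> e \<and> 0 \<le> h' s \<and> (s \<le> 0 \<longrightarrow> 1 / (1 + 4 * s\<^sup>2) \<le> h' s))"
proof -
  define k where "k s = s - sqrt (s\<^sup>2 + e\<^sup>2) + e" for s
  define k' where "k' s = 1 - s / sqrt (s\<^sup>2 + e\<^sup>2)" for s
  define h where "h s = arctan (k s)" for s
  define h' where "h' s = k' s / (1 + (k s)\<^sup>2)" for s
  have pos: "s\<^sup>2 + e\<^sup>2 > 0" for s using e by (simp add: add_nonneg_pos)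
  have kd: "(k has_real_derivative k' s) (at s)" for s
    unfolding k_def[abs_def] k'_def using pos[of s]
    by (auto intro!: derivative_eq_intros simp: field_simps power2_eq_square)
  have hd: "(h has_real_derivative h' s) (at s)" for s
    unfolding h_def[abs_def] h'_def
    by (rule derivative_eq_intros kd refl)+ (simp add: field_simps)
  have nz1: "sqrt (s\<^sup>2 + e\<^sup>2) \<noteq> 0" for s
    using pos[of s] real_sqrt_gt_zero[of "s\<^sup>2 + e\<^sup>2"] by linarith
  have nz2: "1 + (k s)\<^sup>2 \<noteq> 0" for s
    using zero_le_power2[of "k s"] by linarith
  have ck: "continuous_on UNIV k" unfolding k_def by (intro continuous_intros)
  have c': "continuous_on UNIV h'"
    unfolding h'_def
  proof (rule continuous_on_divide)
    show "continuous_on UNIV k'"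
      unfolding k'_def by (intro continuous_on_diff continuous_on_const continuous_on_divide continuous_on_id continuous_intros ballI nz1)
    show "continuous_on UNIV (\<lambda>s. 1 + (k s)\<^sup>2)" by (intro continuous_intros ck)
  qed (use nz2 in blast)
  have h0: "h 0 = 0" using e by (simp add: h_def k_def)
  have sq: "\<bar>s\<bar> \<le> sqrt (s\<^sup>2 + e\<^sup>2)" for s
    by (rule real_le_rsqrt) simp
  have k'b: "0 \<le> k' s" "k' s \<le> 2" "s \<le> 0 \<Longrightarrow> 1 \<le> k' s" for s
  proof -
    have r: "sqrt (s\<^sup>2 + e\<^sup>2) > 0" using pos by simp
    have "\<bar>s / sqrt (s\<^sup>2 + e\<^sup>2)\<bar> \<le> 1" using sq[of s] r by (simp add: abs_divide)
    then show "0 \<le> k' s" "k' s \<le> 2" unfolding k'_def by linarith+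
    show "1 \<le> k' s" if "s \<le> 0" using that r by (simp add: k'_def divide_nonpos_pos)
  qed
  have kle: "k s \<le> e" "s \<le> 0 \<Longrightarrow> \<bar>k s\<bar> \<le> 2 * \<bar>s\<bar>" for s
  proof -
    show "k s \<le> e" using sq[of s] by (simp add: k_def)
    assume s: "s \<le> 0"
    have "sqrt (s\<^sup>2 + e\<^sup>2) \<le> \<bar>s\<bar> + e"
      by (rule real_le_lsqrt) (use e in \<open>auto simp: power2_sum\<close>)
    moreover have "sqrt (s\<^sup>2 + e\<^sup>2) \<ge> e" by (rule real_le_rsqrt) simp
    ultimately show "\<bar>k s\<bar> \<le> 2 * \<bar>s\<bar>" unfolding k_def using s by linarith
  qed
  have hb: "\<bar>h s\<bar> \<le> pi" "\<bar>h' s\<bar> \<le> 2" for s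
  proof -
    show "\<bar>h s\<bar> \<le> pi" unfolding h_def using arctan_bounded[of "k s"] pi_gt_zero by linarith
    have "k' s / (1 + (k s)\<^sup>2) \<le> 2 / 1" by (intro frac_le) (use k'b in auto)
    then show "\<bar>h' s\<bar> \<le> 2" using k'b(1)[of s] by (simp add: h'_def)
  qed
  have hle: "h s \<le> e" for s
  proof (cases "k s \<le> 0")
    case False
    then have "arctan (k s) \<le> k s" by (intro arctan_le_self) auto
    then show ?thesis using kle(1)[of s] by (simp add: h_def)
  qed (use e in \<open>auto simp: h_def intro: order_trans[of _ 0]\<close>)
  have h'0: "0 \<le> h' s" for s using k'b(1)[of s] by (simp add: h'_def)
  have "1 / (1 + 4 * s\<^sup>2) \<le> h' s" if s: "s \<le> 0" for s
  proof -
    have "(k s)\<^sup>2 \<le> (2 * \<bar>s\<bar>)\<^sup>2" using power_mono[OF kle(2)[OF s] abs_ge_zero, of 2] by simp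
    then have "1 + (k s)\<^sup>2 \<le> 1 + 4 * s\<^sup>2" by (simp add: power_mult_distrib)
    then show ?thesis
      unfolding h'_def using k'b(3)[OF s] by (intro frac_le) (auto intro: add_pos_nonneg)
  qed
  with hd c' h0 hb hle h'0 show ?thesis by blast
qed

lemma arctan_tendsto_scaled:
  assumes "s > 0"
  shows "(\<lambda>n. 2 / pi * arctan (real n * s)) \<longlonglongrightarrow> 1"
proof -
  have "filterlim (\<lambda>n. real n * s) at_top sequentially"
    by (rule filterlim_at_top_mult_tendsto_pos[OF tendsto_const assms filterlim_real_sequentially])
  from tendsto_mult_left[OF filterlim_compose[OF tendsto_arctan_at_top this], of "2 / pi"]
  show ?thesis by simp
qed

context bounded_open_set
begin

text \<open>The weak form of \<open>- \<Delta> \<phi> \<le> (Mc \<cdot> L + C) / a\<close> in \<open>\<Omega>\<close> together with \<open>\<partial>\<phi>/\<partial>\<nu> \<le> 0\<close> on the boundary.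
The test function \<open>g\<close> need not vanish on the boundary, while the equation for \<open>\<phi>\<close> admits only
functions that do. Therefore \<open>(g / \<alpha>) \<cdot> h (\<phi>)\<close> is inserted, with \<open>h\<close> increasing, bounded by \<open>1\<close> and
\<open>h 0 = 0\<close>. With \<open>V = \<alpha> \<nabla>\<phi>\<close> this gives

\<open>\<integral> h(\<phi>) \<nabla>\<phi> \<bullet> \<nabla>g + \<integral> g h'(\<phi>) \<bar>\<nabla>\<phi>\<bar>\<^sup>2 = \<integral> (g / \<alpha>) h(\<phi>) (u + \<nabla>\<alpha> \<bullet> \<nabla>\<phi>)\<close>.

The second integral has a favourable sign and is dropped, and the right-hand side is at most
\<open>(C + Mc \<cdot> L) / a\<close> times the integral of \<open>g\<close>. Letting \<open>h\<close> increase to \<open>1\<close> on \<open>{\<phi> > 0}\<close> recovers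
\<open>\<integral> \<nabla>\<phi> \<bullet> \<nabla>g\<close>, because \<open>\<nabla>\<phi>\<close> vanishes almost everywhere on \<open>{\<phi> \<le> 0}\<close>: this is the weak maximum
principle for \<open>\<phi>\<close>.\<close>

lemma elliptic_gradient_inequality:
  assumes a: "a > 0" and \<alpha>: "weak_gradient \<alpha> A" "AE x in M. a \<le> \<alpha> x" "AE x in M. \<bar>\<alpha> x\<bar> \<le> B\<alpha>" "AE x in M. norm (A x) \<le> Mc"
    and u: "u \<in> borel_measurable M" "AE x in M. 0 \<le> u x \<and> u x \<le> C"
    and \<phi>: "\<phi> \<in> H10 \<Omega>" "AE x in M. norm (wgrad \<Omega> \<phi> x) \<le> L"
    and eq: "\<And>w. w \<in> H10 \<Omega> \<Longrightarrow> (LINT x|M. \<alpha> x * (wgrad \<Omega> \<phi> x \<bullet> wgrad \<Omega> w x)) = (LINT x|M. u x * w x)"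
    and g: "weak_gradient g W" "AE x in M. 0 \<le> g x \<and> g x \<le> Bg"
    and L: "L \<ge> 0" and Mc: "Mc \<ge> 0" and C: "C \<ge> 0"
  shows "(LINT x|M. wgrad \<Omega> \<phi> x \<bullet> W x) \<le> 1 / a * (Mc * L + C) * (LINT x|M. g x)"
proof -
  define P where "P = wgrad \<Omega> \<phi>"
  have "\<phi> \<in> H_space 1 \<Omega>" using \<phi>(1) by (simp add: H10_def)
  note phiD = weak_gradientD[OF H_space_gradient(1)[OF this order_refl]]
  note aD = weak_gradientD[OF \<alpha>(1)] and gD = weak_gradientD[OF g(1)]
  have [measurable]: "P \<in> borel_measurable M" "\<phi> \<in> borel_measurable M" "\<alpha> \<in> borel_measurable M" "A \<in> borel_measurable M"
    "g \<in> borel_measurable M" "W \<in> borel_measurable M" "u \<in> borel_measurable M"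
    using phiD aD gD u by (auto simp: P_def)
  have PL: "AE x in M. norm (P x) \<le> L" using \<phi>(2) by (simp add: P_def)
  have ui: "integrable M u" by (rule integrable_bounded[of _ C]) (use u in \<open>auto elim: eventually_mono\<close>)
  define V where "V x = \<alpha> x *\<^sub>R P x" for x
  have Vm [measurable]: "V \<in> borel_measurable M" unfolding V_def by measurable
  have VB: "AE x in M. norm (V x) \<le> B\<alpha> * L"
    using \<alpha>(3) PL by eventually_elim (auto simp: V_def intro!: mult_mono intro: order_trans[OF abs_ge_zero])
  have Vi: "integrable M V" by (rule integrable_bounded[OF Vm VB])
  have eqt: "(LINT x|M. V x \<bullet> Z x) = (LINT x|M. u x * \<zeta> x)" if "\<zeta> \<in> test_functions \<Omega>" "C1_test \<Omega> \<zeta> Z" for \<zeta> Z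
  proof -
    have "(LINT x|M. V x \<bullet> Z x) = (LINT x|M. \<alpha> x * (wgrad \<Omega> \<phi> x \<bullet> wgrad \<Omega> \<zeta> x))"
      by (rule integral_AE_cong_lebesgue[OF Omega_lebesgue])
        (use test_function_H1(2)[OF that] in eventually_elim, simp add: V_def P_def)
    then show ?thesis using eq[OF test_function_H10[OF that(1)]] by simp
  qed
  have eqC: "(LINT x|M. V x \<bullet> D x) = (LINT x|M. u x * \<psi> x)" if "C1_test \<Omega> \<psi> D" for \<psi> D
    by (rule divergence_C1_test[OF Vi ui eqt that])
  have ident: "(LINT x|M. h (\<phi> x) * (V x \<bullet> E x) + G x * (h' (\<phi> x) * (V x \<bullet> P x))) = (LINT x|M. G x * (u x * h (\<phi> x)))"
    if "weak_gradient G E" "AE x in M. \<bar>G x\<bar> \<le> B1" "\<And>s. (h has_real_derivative h' s) (at s)" "continuous_on UNIV h'"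
      "h 0 = 0" "\<And>s. \<bar>h s\<bar> \<le> c" "\<And>s. \<bar>h' s\<bar> \<le> c" for G E B1 h h' c
    unfolding P_def by (rule divergence_times_H10[OF Vm VB ui _ that(1,2) \<phi>(1) that(3-7)]) (rule eqC)
  have [measurable]: "arctan \<in> borel_measurable borel"
    by (intro borel_measurable_continuous_onI continuous_intros) 
  \<comment> \<open>testing with functions of \<open>\<phi>\<close> that stay below \<open>e\<close>: the energy over \<open>{\<phi> \<le> 0}\<close> is at most a multiple of \<open>e\<close>\<close>
  have P0: "AE x in M. \<phi> x \<le> 0 \<longrightarrow> P x = 0"
  proof -
    define I where "I = (LINT x|M. indicator {..0} (\<phi> x) * (a * (norm (P x))\<^sup>2 / (1 + 4 * (\<phi> x)\<^sup>2)))"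
    have bd: "AE x in M. norm (indicator {..0} (\<phi> x) * (a * (norm (P x))\<^sup>2 / (1 + 4 * (\<phi> x)\<^sup>2))) \<le> a * L\<^sup>2"
      using PL
    proof eventually_elim
      case (elim x)
      have "(norm (P x))\<^sup>2 / (1 + 4 * (\<phi> x)\<^sup>2) \<le> L\<^sup>2 / 1"
        using elim L by (intro frac_le power_mono) auto
      then have "a * ((norm (P x))\<^sup>2 / (1 + 4 * (\<phi> x)\<^sup>2)) \<le> a * L\<^sup>2" using a by (intro mult_left_mono) auto
      moreover have "0 \<le> a * ((norm (P x))\<^sup>2 / (1 + 4 * (\<phi> x)\<^sup>2))" using a by simp
      ultimately show ?case using a by (auto split: split_indicator)
    qed
    have Ii: "integrable M (\<lambda>x. indicator {..0} (\<phi> x) * (a * (norm (P x))\<^sup>2 / (1 + 4 * (\<phi> x)\<^sup>2)))"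
      by (rule integrable_bounded[OF _ bd]) simp
    have Ile: "I \<le> e * (C * measure M \<Omega>)" if e: "e > 0" for e
    proof -
      obtain h h' where hd: "\<And>s. (h has_real_derivative h' s) (at s)" and c': "continuous_on UNIV h'" and h0: "h 0 = 0"
        and hb: "\<And>s. \<bar>h s\<bar> \<le> pi" "\<And>s. \<bar>h' s\<bar> \<le> 2" and hle: "\<And>s. h s \<le> e" and h'0: "\<And>s. 0 \<le> h' s"
        and h'neg: "\<And>s. s \<le> 0 \<Longrightarrow> 1 / (1 + 4 * s\<^sup>2) \<le> h' s"
        using arctan_cutoff[OF e] by metis
      have [measurable]: "h \<in> borel_measurable borel" "h' \<in> borel_measurable borel"
        using DERIV_isCont[OF hd] c' by (auto intro!: borel_measurable_continuous_onI continuous_at_imp_continuous_on)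
      have id: "(LINT x|M. h' (\<phi> x) * (V x \<bullet> P x)) = (LINT x|M. u x * h (\<phi> x))"
        using ident[OF weak_gradient_const[of 1], of 1 h h' "max pi 2"] hd c' h0 hb
        by (simp add: max.coboundedI1 max.coboundedI2)
      have "I \<le> (LINT x|M. h' (\<phi> x) * (V x \<bullet> P x))"
        unfolding I_def
      proof (rule integral_mono_AE[OF Ii])
        show "AE x in M. indicator {..0} (\<phi> x) * (a * (norm (P x))\<^sup>2 / (1 + 4 * (\<phi> x)\<^sup>2)) \<le> h' (\<phi> x) * (V x \<bullet> P x)"
          using \<alpha>(2)
        proof eventually_elim
          case (elim x)
          have VP: "V x \<bullet> P x = \<alpha> x * (norm (P x))\<^sup>2" by (simp add: V_def power2_norm_eq_inner)
          have up: "a * (norm (P x))\<^sup>2 \<le> V x \<bullet> P x" unfolding VP using elim by (intro mult_right_mono) auto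
          show ?case
          proof (cases "\<phi> x \<le> 0")
            case True
            have "1 / (1 + 4 * (\<phi> x)\<^sup>2) \<le> h' (\<phi> x)" by (rule h'neg[OF True])
            then have "1 / (1 + 4 * (\<phi> x)\<^sup>2) * (a * (norm (P x))\<^sup>2) \<le> h' (\<phi> x) * (V x \<bullet> P x)"
              using up a h'0 by (intro mult_mono) auto
            then show ?thesis using True by simp
          next
            case False
            have "0 \<le> V x \<bullet> P x" using up a by (meson less_imp_le mult_nonneg_nonneg order_trans zero_le_power2)
            then show ?thesis using False h'0 by simp
          qed
        qed
        have "AE x in M. norm (h' (\<phi> x) * (V x \<bullet> P x)) \<le> 2 * ((B\<alpha> * L) * L)"
          using VB PL
        proof eventually_elim
          case (elim x)
          have "\<bar>V x \<bullet> P x\<bar> \<le> (B\<alpha> * L) * L" by (rule abs_inner_le[OF elim])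
          then show ?case unfolding real_norm_def abs_mult using hb by (intro mult_mono) auto
        qed
        then show "integrable M (\<lambda>x. h' (\<phi> x) * (V x \<bullet> P x))" by (rule integrable_bounded[rotated]) simp
      qed
      also have "\<dots> = (LINT x|M. u x * h (\<phi> x))" by (rule id)
      also have "\<dots> \<le> (LINT x|M. C * e)"
      proof (rule integral_mono_AE)
        show "AE x in M. u x * h (\<phi> x) \<le> C * e"
          using u(2)
        proof eventually_elim
          case (elim x)
          have "u x * h (\<phi> x) \<le> u x * e" using elim hle by (intro mult_left_mono) auto
          also have "\<dots> \<le> C * e" using elim e by (intro mult_right_mono) auto
          finally show ?case .
        qed
        have "AE x in M. norm (u x * h (\<phi> x)) \<le> C * pi"
          using u(2) by eventually_elim (use hb in \<open>auto simp: abs_mult intro!: mult_mono\<close>)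
        then show "integrable M (\<lambda>x. u x * h (\<phi> x))" by (rule integrable_bounded[rotated]) simp
      qed simp
      also have "\<dots> = e * (C * measure M \<Omega>)" by simp
      finally show ?thesis .
    qed
    have "I \<le> 0"
    proof (rule field_le_epsilon)
      fix d :: real assume d: "d > 0"
      define m where "m = C * measure M \<Omega>"
      have m: "m \<ge> 0" using C by (simp add: m_def)
      have "I \<le> d / (m + 1) * m" using Ile[of "d / (m + 1)"] d m by (simp add: m_def)
      also have "\<dots> \<le> 0 + d" using d m by (simp add: field_simps)
      finally show "I \<le> 0 + d" .
    qed
    moreover have "I \<ge> 0" unfolding I_def by (rule integral_nonneg_AE) (use a in \<open>auto split: split_indicator\<close>)
    ultimately have "I = 0" by linarith
    then have "AE x in M. indicator {..0} (\<phi> x) * (a * (norm (P x))\<^sup>2 / (1 + 4 * (\<phi> x)\<^sup>2)) = 0"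
      unfolding I_def by (subst (asm) integral_nonneg_eq_0_iff_AE[OF Ii]) (use a in \<open>auto split: split_indicator\<close>)
    then show ?thesis
    proof eventually_elim
      case (elim x)
      have "1 + 4 * (\<phi> x)\<^sup>2 > 0" by (simp add: add_pos_nonneg)
      then show ?case using elim a by (auto split: split_indicator)
    qed
  qed
  \<comment> \<open>the reciprocal, continued linearly below \<open>a\<close> to be continuously differentiable everywhere; only values at least \<open>a\<close> matter\<close>
  define q where "q s = (if s \<ge> a then 1 / s else 2 / a - s / a\<^sup>2)" for s
  define q' where "q' s = (if s \<ge> a then - 1 / s\<^sup>2 else - 1 / a\<^sup>2)" for s
  have qd: "(q has_real_derivative q' s) (at s)" for s
    unfolding q_def[abs_def] q'_def
    by (rule DERIV_if_ge) (use a in \<open>auto intro!: derivative_eq_intros simp: power2_eq_square field_simps\<close>)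
  have cq': "continuous_on UNIV q'"
  proof -
    have "q' = (\<lambda>s. - 1 / (max a s)\<^sup>2)" by (auto simp: q'_def max_def fun_eq_iff)
    moreover have "(max a s)\<^sup>2 \<noteq> 0" for s using a by (auto simp: max_def)
    ultimately show ?thesis
      by (simp only:) (intro continuous_on_divide continuous_intros ballI)
  qed
  have qa: "weak_gradient (\<lambda>x. q (\<alpha> x)) (\<lambda>x. q' (\<alpha> x) *\<^sub>R A x)"
    by (rule weak_gradient_compose[OF \<alpha>(1,3) qd cq'])
  have qb: "AE x in M. \<bar>q (\<alpha> x)\<bar> \<le> 1 / a"
    using \<alpha>(2) by eventually_elim (use a in \<open>auto simp: q_def intro!: divide_left_mono\<close>)
  have gb: "AE x in M. \<bar>g x\<bar> \<le> Bg" using g(2) by eventually_elim auto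
  define G where "G x = g x * q (\<alpha> x)" for x
  define E where "E x = g x *\<^sub>R (q' (\<alpha> x) *\<^sub>R A x) + q (\<alpha> x) *\<^sub>R W x" for x
  have GE: "weak_gradient G E" unfolding G_def[abs_def] E_def[abs_def] by (rule weak_gradient_mult[OF g(1) gb qa qb])
  note GED = weak_gradientD[OF GE]
  have [measurable]: "G \<in> borel_measurable M" "E \<in> borel_measurable M" using GED by auto
  have Gb: "AE x in M. \<bar>G x\<bar> \<le> Bg * (1 / a)"
    using gb qb by eventually_elim (auto simp: G_def abs_mult intro!: mult_mono simp del: mult_1_right times_divide_eq_right intro: order_trans[OF abs_ge_zero])
  have PWi: "integrable M (\<lambda>x. P x \<bullet> W x)" by (rule integrable_bounded_inner[OF _ PL gD(2)]) simp
  \<comment> \<open>increasing in \<open>s\<close>, zero at \<open>0\<close>, and tending to \<open>1\<close> for positive \<open>s\<close> as \<open>n\<close> grows\<close>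
  define h where "h n s = 2 / pi * arctan (real n * s)" for n s
  have hb: "\<bar>h n s\<bar> \<le> 1" for n s
  proof -
    have "\<bar>arctan (real n * s)\<bar> \<le> pi / 2" using arctan_bounded[of "real n * s"] by linarith
    then show ?thesis by (simp add: h_def abs_mult field_simps)
  qed
  have hm [measurable]: "h n \<in> borel_measurable borel" for n unfolding h_def by measurable
  have le: "(LINT x|M. h n (\<phi> x) * (P x \<bullet> W x)) \<le> (LINT x|M. 1 / a * (Mc * L + C) * g x)" for n
  proof -
    define h' where "h' s = 2 / pi * (real n / (1 + (real n * s)\<^sup>2))" for s
    have nz: "1 + (real n * s)\<^sup>2 \<noteq> 0" for s
      using zero_le_power2[of "real n * s"] by linarith
    have hd: "(h n has_real_derivative h' s) (at s)" for s
      unfolding h_def[abs_def] h'_def by (rule DERIV_cmult) (auto intro!: derivative_eq_intros simp: field_simps)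
    have c': "continuous_on UNIV h'" unfolding h'_def by (intro continuous_intros) (use nz in auto)
    have h'0: "0 \<le> h' s" for s unfolding h'_def by (intro mult_nonneg_nonneg divide_nonneg_nonneg) auto
    have h'b: "\<bar>h' s\<bar> \<le> 2 / pi * real n" for s
    proof -
      have "real n / (1 + (real n * s)\<^sup>2) \<le> real n / 1" by (intro frac_le) auto
      then have "h' s \<le> 2 / pi * real n" unfolding h'_def by (intro mult_left_mono) auto
      then show ?thesis using h'0[of s] by simp
    qed
    define B where "B = max 1 (2 / pi * real n)"
    have id: "(LINT x|M. h n (\<phi> x) * (V x \<bullet> E x) + G x * (h' (\<phi> x) * (V x \<bullet> P x))) = (LINT x|M. G x * (u x * h n (\<phi> x)))"
      by (rule ident[OF GE Gb, of "h n" h' B]) (use hd c' hb h'b in \<open>auto simp: h_def B_def intro: max.coboundedI1 max.coboundedI2\<close>)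
    have [measurable]: "h' \<in> borel_measurable borel" using c' by (rule borel_measurable_continuous_onI)
    have i1: "integrable M (\<lambda>x. h n (\<phi> x) * (V x \<bullet> E x))"
      by (rule integrable_bounded_mult[OF integrable_bounded_inner[OF Vm VB GED(2)], where C = 1]) (use hb in auto)
    have i2: "integrable M (\<lambda>x. G x * (h' (\<phi> x) * (V x \<bullet> P x)))"
    proof (rule integrable_bounded[where C = "(Bg * (1 / a)) * ((2 / pi * real n) * ((B\<alpha> * L) * L))"])
      show "AE x in M. norm (G x * (h' (\<phi> x) * (V x \<bullet> P x))) \<le> (Bg * (1 / a)) * ((2 / pi * real n) * ((B\<alpha> * L) * L))"
        using Gb VB PL
      proof eventually_elim
        case (elim x)
        show ?case unfolding real_norm_def abs_mult
          by (intro mult_mono elim(1) h'b abs_inner_le[OF elim(2,3)]) (use elim in \<open>auto intro: order_trans[OF abs_ge_zero]\<close>)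
      qed
    qed simp
    have i3: "integrable M (\<lambda>x. G x * (u x * h n (\<phi> x)))"
    proof (rule integrable_bounded[where C = "(Bg * (1 / a)) * (C * 1)"])
      show "AE x in M. norm (G x * (u x * h n (\<phi> x))) \<le> (Bg * (1 / a)) * (C * 1)"
        using Gb u(2)
      proof eventually_elim
        case (elim x)
        show ?case unfolding real_norm_def abs_mult
          by (intro mult_mono elim(1) hb) (use elim in \<open>auto intro: order_trans[OF abs_ge_zero]\<close>)
      qed
    qed simp
    have i4: "integrable M (\<lambda>x. h n (\<phi> x) * (P x \<bullet> W x))"
      by (rule integrable_bounded_mult[OF PWi, where C = 1]) (use hb in auto)
    have gi: "integrable M (\<lambda>x. 1 / a * (Mc * L + C) * g x)" using gD by simp
    have "(LINT x|M. h n (\<phi> x) * (P x \<bullet> W x)) \<le> (LINT x|M. ((h n (\<phi> x) * (V x \<bullet> E x) + G x * (h' (\<phi> x) * (V x \<bullet> P x)))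
        - G x * (u x * h n (\<phi> x))) + 1 / a * (Mc * L + C) * g x)"
    proof (rule integral_mono_AE[OF i4])
      show "AE x in M. h n (\<phi> x) * (P x \<bullet> W x) \<le> ((h n (\<phi> x) * (V x \<bullet> E x) + G x * (h' (\<phi> x) * (V x \<bullet> P x)))
        - G x * (u x * h n (\<phi> x))) + 1 / a * (Mc * L + C) * g x"
        using \<alpha>(2,4) PL u(2) g(2)
      proof eventually_elim
        case (elim x)
        have ax: "\<alpha> x > 0" using elim a by linarith
        have ia: "1 / \<alpha> x \<le> 1 / a" using elim a by (intro divide_left_mono) auto
        have Gx: "G x = g x / \<alpha> x" using elim by (simp add: G_def q_def)
        have "V x \<bullet> E x = \<alpha> x * (g x * (q' (\<alpha> x) * (P x \<bullet> A x)) + q (\<alpha> x) * (P x \<bullet> W x))"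
          by (simp add: V_def E_def inner_add_right distrib_left mult_ac)
        also have "\<dots> = P x \<bullet> W x - g x * (P x \<bullet> A x) / \<alpha> x"
          using elim ax by (simp add: q_def q'_def power2_eq_square field_simps)
        finally have VE: "h n (\<phi> x) * (V x \<bullet> E x) = h n (\<phi> x) * (P x \<bullet> W x) - h n (\<phi> x) * (g x * (P x \<bullet> A x) / \<alpha> x)"
          by (simp add: right_diff_distrib)
        have G0: "G x \<ge> 0" using Gx elim ax by simp
        have Gle: "G x \<le> 1 / a * g x" using Gx mult_right_mono[OF ia, of "g x"] elim by simp
        have "0 \<le> G x * (h' (\<phi> x) * (V x \<bullet> P x))"
          unfolding V_def inner_scaleR_left by (intro mult_nonneg_nonneg G0 h'0 less_imp_le[OF ax] inner_ge_zero)
        moreover have "G x * (u x * h n (\<phi> x)) \<le> (1 / a * g x) * (C * 1)"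
        proof -
          have "u x * h n (\<phi> x) \<le> u x * 1"
            using hb[of n "\<phi> x"] elim by (intro mult_left_mono) auto
          also have "\<dots> \<le> C * 1" using elim by simp
          finally have "G x * (u x * h n (\<phi> x)) \<le> G x * (C * 1)" using G0 by (rule mult_left_mono)
          also have "\<dots> \<le> (1 / a * g x) * (C * 1)" using Gle C by (intro mult_right_mono) auto
          finally show ?thesis .
        qed
        moreover have "h n (\<phi> x) * (g x * (P x \<bullet> A x) / \<alpha> x) \<le> (1 / a * g x) * (L * Mc)"
        proof -
          have "h n (\<phi> x) * (g x * (P x \<bullet> A x) / \<alpha> x) = G x * (h n (\<phi> x) * (P x \<bullet> A x))" by (simp add: Gx)
          also have "\<dots> \<le> G x * (1 * (L * Mc))"
          proof (rule mult_left_mono[OF _ G0])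
            have "\<bar>h n (\<phi> x)\<bar> * \<bar>P x \<bullet> A x\<bar> \<le> 1 * (L * Mc)"
              by (rule mult_mono[OF hb abs_inner_le]) (use elim in auto)
            then show "h n (\<phi> x) * (P x \<bullet> A x) \<le> 1 * (L * Mc)"
              using abs_ge_self[of "h n (\<phi> x) * (P x \<bullet> A x)"] unfolding abs_mult by linarith
          qed
          also have "\<dots> \<le> (1 / a * g x) * (1 * (L * Mc))" using Gle L Mc by (intro mult_right_mono) auto
          finally show ?thesis by simp
        qed
        moreover have "1 / a * (Mc * L + C) * g x = (1 / a * g x) * (C * 1) + (1 / a * g x) * (L * Mc)"
          by (simp add: algebra_simps add_divide_distrib)
        ultimately show ?case unfolding VE by linarith
      qed
    qed (intro Bochner_Integration.integrable_add Bochner_Integration.integrable_diff i1 i2 i3 gi)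
    also have "\<dots> = ((LINT x|M. h n (\<phi> x) * (V x \<bullet> E x) + G x * (h' (\<phi> x) * (V x \<bullet> P x)))
        - (LINT x|M. G x * (u x * h n (\<phi> x)))) + (LINT x|M. 1 / a * (Mc * L + C) * g x)"
      by (simp only: Bochner_Integration.integral_add[OF Bochner_Integration.integrable_diff[OF Bochner_Integration.integrable_add[OF i1 i2] i3] gi]
          Bochner_Integration.integral_diff[OF Bochner_Integration.integrable_add[OF i1 i2] i3])
    also have "\<dots> = (LINT x|M. 1 / a * (Mc * L + C) * g x)" by (simp only: id)
    finally show ?thesis .
  qed
  have "(\<lambda>n. LINT x|M. h n (\<phi> x) * (P x \<bullet> W x)) \<longlonglongrightarrow> (LINT x|M. P x \<bullet> W x)"
  proof (rule integral_dominated_convergence[where w = "\<lambda>x. \<bar>P x \<bullet> W x\<bar>"])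
    show "AE x in M. (\<lambda>n. h n (\<phi> x) * (P x \<bullet> W x)) \<longlonglongrightarrow> P x \<bullet> W x"
      using P0
    proof eventually_elim
      case (elim x)
      show ?case
      proof (cases "\<phi> x > 0")
        case True
        then have "(\<lambda>n. h n (\<phi> x)) \<longlonglongrightarrow> 1" unfolding h_def by (rule arctan_tendsto_scaled)
        from tendsto_mult_right[OF this] show ?thesis by simp
      qed (use elim in simp)
    qed
    show "AE x in M. norm (h n (\<phi> x) * (P x \<bullet> W x)) \<le> \<bar>P x \<bullet> W x\<bar>" for n
      using hb by (intro AE_I2) (simp add: abs_mult mult_left_le_one_le)
  qed (use PWi in auto)
  then have "(LINT x|M. P x \<bullet> W x) \<le> (LINT x|M. 1 / a * (Mc * L + C) * g x)"
    by (rule LIMSEQ_le_const2) (use le in blast)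
  then show ?thesis by (simp add: P_def)
qed

end

section \<open>Jointly measurable gradients\<close>

lemma convergent_if_summable_norm_diff:
  fixes x :: "nat \<Rightarrow> 'b::banach"
  assumes "summable (\<lambda>k. norm (x (Suc k) - x k))"
  shows "convergent x"
proof -
  have "summable (\<lambda>k. x (Suc k) - x k)" by (rule summable_norm_cancel[OF assms])
  then have "(\<lambda>n. \<Sum>k<n. x (Suc k) - x k) \<longlonglongrightarrow> (\<Sum>k. x (Suc k) - x k)" by (rule summable_LIMSEQ)
  then have "(\<lambda>n. x n - x 0) \<longlonglongrightarrow> (\<Sum>k. x (Suc k) - x k)" by (simp add: sum_lessThan_telescope)
  from tendsto_add[OF this tendsto_const[of "x 0"]] show ?thesis by (auto simp: convergent_def)
qed

lemma AE_summable_of_integral_bound: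
  fixes m :: "nat \<Rightarrow> 'b \<Rightarrow> real"
  assumes m: "\<And>k. integrable N (m k)" "\<And>k p. 0 \<le> m k p" and b: "\<And>k. (LINT p|N. m k p) \<le> (1 / 2) ^ k"
  shows "AE p in N. summable (\<lambda>k. m k p)"
proof -
  have [measurable]: "m k \<in> borel_measurable N" for k using m by auto
  have "(\<integral>\<^sup>+p. (\<Sum>k. ennreal (m k p)) \<partial>N) = (\<Sum>k. \<integral>\<^sup>+p. ennreal (m k p) \<partial>N)"
    by (rule nn_integral_suminf) simp
  also have "\<dots> = (\<Sum>k. ennreal (LINT p|N. m k p))"
    by (intro suminf_cong nn_integral_eq_integral m) (auto simp: m)
  also have "\<dots> \<le> (\<Sum>k. ennreal ((1 / 2) ^ k))"
    by (intro suminf_le ennreal_leI b) auto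
  also have "\<dots> < \<infinity>"
    by (subst suminf_ennreal2) (auto intro: summable_geometric)
  finally have "(\<integral>\<^sup>+p. (\<Sum>k. ennreal (m k p)) \<partial>N) \<noteq> \<infinity>" by simp
  then have "AE p in N. (\<Sum>k. ennreal (m k p)) \<noteq> \<infinity>"
    by (intro nn_integral_PInf_AE) auto
  then show ?thesis
    by eventually_elim (auto intro!: summable_suminf_not_top simp: m)
qed

context bounded_open_set
begin

text \<open>Convergence in \<open>L\<^sup>1\<close> on almost every fibre makes \<open>D n\<close> a Cauchy sequence in measure on the product;
the truncated distance \<open>m\<close> metrizes this notion and is integrable on the product. A rapidly
converging subsequence converges almost everywhere, and its measurable limit agrees with the given one
on almost every fibre.\<close>

lemma jointly_measurable_limit:
  fixes D :: "nat \<Rightarrow> 'c \<times> 'a \<Rightarrow> 'b::{banach, second_countable_topology}" and w :: "'c \<Rightarrow> 'a \<Rightarrow> 'b"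
  assumes N: "finite_measure N" and D: "\<And>n. D n \<in> borel_measurable (N \<Otimes>\<^sub>M M)"
    and w: "AE t in N. (\<forall>n. integrable M (\<lambda>x. D n (t, x) - w t x)) \<and> (\<lambda>n. LINT x|M. norm (D n (t, x) - w t x)) \<longlonglongrightarrow> 0"
  shows "\<exists>U. U \<in> borel_measurable (N \<Otimes>\<^sub>M M) \<and> (AE t in N. AE x in M. U (t, x) = w t x)"
proof -
  interpret N: finite_measure N by (rule N)
  interpret NM: pair_sigma_finite N M ..
  interpret P: finite_measure "N \<Otimes>\<^sub>M M" by (rule finite_measure_pair_measure[OF finite_measure_axioms N])
  note [measurable] = D
  define m where "m n j p = min 1 (norm (D n p - D j p))" for n j p
  have mm [measurable]: "m n j \<in> borel_measurable (N \<Otimes>\<^sub>M M)" for n j unfolding m_def by measurable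
  have mb: "0 \<le> m n j p" "m n j p \<le> 1" for n j p by (auto simp: m_def)
  have mi: "integrable (N \<Otimes>\<^sub>M M) (m n j)" for n j
    by (rule P.integrable_const_bound[where B = 1]) (use mb in auto)
  define J where "J n j = (LINT p|(N \<Otimes>\<^sub>M M). m n j p)" for n j
  have Jlim: "(\<lambda>k. J (n k) (j k)) \<longlonglongrightarrow> 0" if nj: "filterlim n sequentially sequentially" "filterlim j sequentially sequentially" for n j :: "nat \<Rightarrow> nat"
  proof -
    have Jeq: "J n j = (LINT t|N. LINT x|M. m n j (t, x))" for n j
      unfolding J_def using NM.integral_fst'[OF mi] by simp
    have "(\<lambda>k. LINT t|N. LINT x|M. m (n k) (j k) (t, x)) \<longlonglongrightarrow> (LINT t|N. 0)"
    proof (rule integral_dominated_convergence[where w = "\<lambda>t. measure M \<Omega>"])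
      show "AE t in N. (\<lambda>k. LINT x|M. m (n k) (j k) (t, x)) \<longlonglongrightarrow> 0"
        using w AE_space
      proof eventually_elim
        case (elim t)
        note [simp] = elim(2)
        have i: "integrable M (\<lambda>x. norm (D n (t, x) - w t x))" for n using elim(1) by auto
        have lim: "(\<lambda>k. (LINT x|M. norm (D (n k) (t, x) - w t x)) + (LINT x|M. norm (D (j k) (t, x) - w t x))) \<longlonglongrightarrow> 0 + 0"
          using elim(1) by (intro tendsto_add filterlim_compose[OF _ nj(1)] filterlim_compose[OF _ nj(2)]) auto
        show ?case
        proof (rule tendsto_sandwich[OF _ _ tendsto_const lim[simplified]])
          have "(LINT x|M. m (n k) (j k) (t, x)) \<le> (LINT x|M. norm (D (n k) (t, x) - w t x) + norm (D (j k) (t, x) - w t x))" for k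
          proof (rule integral_mono)
            show "integrable M (\<lambda>x. m (n k) (j k) (t, x))"
              by (rule integrable_bounded[where C = 1]) (use mb in auto)
            fix x
            have "norm (D (n k) (t, x) - D (j k) (t, x)) \<le> norm (D (n k) (t, x) - w t x) + norm (D (j k) (t, x) - w t x)"
              using norm_triangle_ineq4[of "D (n k) (t, x) - w t x" "D (j k) (t, x) - w t x"] by simp
            then show "m (n k) (j k) (t, x) \<le> norm (D (n k) (t, x) - w t x) + norm (D (j k) (t, x) - w t x)"
              unfolding m_def by linarith
          qed (use i in auto)
          then show "\<forall>\<^sub>F k in sequentially. (LINT x|M. m (n k) (j k) (t, x)) \<le> (LINT x|M. norm (D (n k) (t, x) - w t x)) + (LINT x|M. norm (D (j k) (t, x) - w t x))"
            by (intro always_eventually allI) (simp add: Bochner_Integration.integral_add[OF i i])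
        qed (use mb in \<open>auto intro!: always_eventually\<close>)
      qed
      show "AE t in N. norm (LINT x|M. m (n k) (j k) (t, x)) \<le> measure M \<Omega>" for k
        using AE_space
      proof eventually_elim
        case (elim t)
        note [simp] = elim
        have "norm (LINT x|M. m (n k) (j k) (t, x)) \<le> (LINT x|M. 1)"
          by (rule integral_norm_le_AE) (use mb in \<open>auto intro!: integrable_bounded[where C = 1]\<close>)
        then show ?case by simp
      qed
    qed auto
    then show ?thesis by (simp add: Jeq)
  qed
  have "\<exists>K. \<forall>n\<ge>K. \<forall>j\<ge>K. J n j \<le> e" if e: "e > 0" for e
  proof (rule ccontr)
    assume "\<not> ?thesis"
    then have "\<forall>K. \<exists>n j. n \<ge> K \<and> j \<ge> K \<and> J n j > e" by (metis not_le)
    then obtain n j where nj: "\<And>K. n K \<ge> K" "\<And>K. j K \<ge> K" "\<And>K. J (n K) (j K) > e" by metis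
    have "filterlim n sequentially sequentially" "filterlim j sequentially sequentially"
      by (rule filterlim_at_top_mono[OF filterlim_ident], use nj(1,2) in \<open>auto intro!: always_eventually\<close>)+
    from Jlim[OF this] have "(\<lambda>k. J (n k) (j k)) \<longlonglongrightarrow> 0" .
    then have "0 \<ge> e" by (rule LIMSEQ_le_const) (use nj(3) less_imp_le in blast)
    with e show False by simp
  qed
  then have "\<forall>k. \<exists>K. \<forall>n\<ge>K. \<forall>j\<ge>K. J n j \<le> (1 / 2) ^ k" by simp
  then obtain K where K: "\<And>k n j. n \<ge> K k \<Longrightarrow> j \<ge> K k \<Longrightarrow> J n j \<le> (1 / 2) ^ k" by metis
  \<comment> \<open>monotone, at least \<open>K k\<close>, and at least \<open>k\<close>\<close>
  define r where "r k = k + (\<Sum>i\<le>k. K i)" for k :: nat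
  have rK: "r k \<ge> K k" "r (Suc k) \<ge> r k" for k
    using member_le_sum[of k "{..k}" K] by (auto simp: r_def)
  have rk: "r k \<ge> k" for k by (simp add: r_def)
  have "AE p in N \<Otimes>\<^sub>M M. summable (\<lambda>k. m (r (Suc k)) (r k) p)"
  proof (rule AE_summable_of_integral_bound[OF mi mb(1)])
    show "(LINT p|(N \<Otimes>\<^sub>M M). m (r (Suc k)) (r k) p) \<le> (1 / 2) ^ k" for k
      using K[of k "r (Suc k)" "r k"] rK[of k] by (simp add: J_def)
  qed
  then have "AE p in N \<Otimes>\<^sub>M M. convergent (\<lambda>k. D (r k) p)"
  proof eventually_elim
    case (elim p)
    have "eventually (\<lambda>k. m (r (Suc k)) (r k) p < 1) sequentially"
      using summable_LIMSEQ_zero[OF elim] by (rule order_tendstoD) simp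
    then have "eventually (\<lambda>k. m (r (Suc k)) (r k) p = norm (D (r (Suc k)) p - D (r k) p)) sequentially"
      by eventually_elim (auto simp: m_def min_def split: if_splits)
    from summable_cong[OF this] elim have "summable (\<lambda>k. norm (D (r (Suc k)) p - D (r k) p))" by simp
    then show ?case by (rule convergent_if_summable_norm_diff)
  qed
  then have conv: "AE t in N. AE x in M. convergent (\<lambda>k. D (r k) (t, x))" by (rule NM.AE_pair)
  define U where "U p = lim (\<lambda>k. D (r k) p)" for p
  have Um [measurable]: "U \<in> borel_measurable (N \<Otimes>\<^sub>M M)"
    unfolding U_def by (rule borel_measurable_lim_metric) simp
  have rlim: "filterlim r sequentially sequentially"
    by (rule filterlim_at_top_mono[OF filterlim_ident]) (use rk in \<open>auto intro!: always_eventually\<close>)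
  have "AE t in N. AE x in M. U (t, x) = w t x"
    using conv w AE_space
  proof eventually_elim
    case (elim t)
    note [simp] = elim(3)
    have i: "integrable M (\<lambda>x. D n (t, x) - w t x)" for n using elim(2) by auto
    have [measurable]: "(\<lambda>x. D n (t, x) - w t x) \<in> borel_measurable M" for n using i by auto
    have "(\<lambda>x. D 0 (t, x) - (D 0 (t, x) - w t x)) \<in> borel_measurable M" by measurable
    then have [measurable]: "w t \<in> borel_measurable M" by simp
    have l1: "(\<lambda>k. LINT x|M. min 1 (norm (D (r k) (t, x) - w t x))) \<longlonglongrightarrow> 0"
    proof (rule tendsto_sandwich[OF _ _ tendsto_const filterlim_compose[OF _ rlim]])
      show "(\<lambda>n. LINT x|M. norm (D n (t, x) - w t x)) \<longlonglongrightarrow> 0" using elim(2) by auto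
      have "(LINT x|M. min 1 (norm (D (r k) (t, x) - w t x))) \<le> (LINT x|M. norm (D (r k) (t, x) - w t x))" for k
        by (rule integral_mono) (use i in \<open>auto intro!: integrable_bounded[where C = 1]\<close>)
      then show "\<forall>\<^sub>F k in sequentially. (LINT x|M. min 1 (norm (D (r k) (t, x) - w t x))) \<le> (LINT x|M. norm (D (r k) (t, x) - w t x))"
        by (intro always_eventually allI)
    qed (auto intro!: always_eventually)
    have l2: "(\<lambda>k. LINT x|M. min 1 (norm (D (r k) (t, x) - w t x))) \<longlonglongrightarrow> (LINT x|M. min 1 (norm (U (t, x) - w t x)))"
    proof (rule integral_dominated_convergence[where w = "\<lambda>x. 1"])
      show "AE x in M. (\<lambda>k. min 1 (norm (D (r k) (t, x) - w t x))) \<longlonglongrightarrow> min 1 (norm (U (t, x) - w t x))"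
        using elim(1) unfolding U_def by eventually_elim (intro tendsto_intros, simp add: convergent_LIMSEQ_iff)
    qed auto
    have "(LINT x|M. min 1 (norm (U (t, x) - w t x))) = 0" by (rule LIMSEQ_unique[OF l2 l1])
    then have "AE x in M. min 1 (norm (U (t, x) - w t x)) = 0"
      by (subst (asm) integral_nonneg_eq_0_iff_AE) (auto intro!: integrable_bounded[where C = 1])
    then show ?case by eventually_elim (auto simp: min_def split: if_splits)
  qed
  with Um show ?thesis by blast
qed

text \<open>\<^const>\<open>wgrad\<close> picks a representative separately for each \<open>t\<close>, so that the map
\<open>(t, x) \<mapsto> wgrad \<Omega> (v t) x\<close> has no measurability of its own and Fubini's theorem does not apply to it.
Strong measurability of \<open>v\<close> provides a jointly measurable representative: for simple functions of time
the gradient is a finite sum of products.\<close>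

lemma jointly_measurable_gradient:
  assumes v: "v \<in> bochner_Lp p T (H_space k \<Omega>) (sobolev_norm k 2 \<Omega>)" and k: "k \<ge> 1"
  shows "\<exists>U. U \<in> borel_measurable (lebesgue_on {0..T} \<Otimes>\<^sub>M M) \<and>
    (AE t in lebesgue_on {0..T}. AE x in M. U (t, x) = wgrad \<Omega> (v t) x)"
proof -
  from v have vX: "AE t in lebesgue_on {0..T}. v t \<in> H_space k \<Omega>"
    and sm: "strongly_measurable T (H_space k \<Omega>) (sobolev_norm k 2 \<Omega>) v"
    by (auto simp: bochner_Lp_def time_Lp_def)
  from sm obtain s :: "nat \<Rightarrow> real \<Rightarrow> 'a \<Rightarrow> real" where
    s: "\<And>n. simple_function (lebesgue_on {0..T}) (s n)" "\<And>n. s n ` {0..T} \<subseteq> H_space k \<Omega>"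
    and lim: "AE t in lebesgue_on {0..T}. (\<lambda>n. sobolev_norm k 2 \<Omega> (\<lambda>x. s n t x - v t x)) \<longlonglongrightarrow> 0"
    unfolding strongly_measurable_def by blast
  have sp: "space (lebesgue_on {0..T}) = {0..T}" by simp
  show ?thesis
  proof (rule jointly_measurable_limit[where D = "\<lambda>n p. wgrad \<Omega> (s n (fst p)) (snd p)" and w = "\<lambda>t. wgrad \<Omega> (v t)", simplified fst_conv snd_conv])
    show "finite_measure (lebesgue_on {0..T})" by (rule finite_measure_lebesgue_on) auto
    show "(\<lambda>p. wgrad \<Omega> (s n (fst p)) (snd p)) \<in> borel_measurable (lebesgue_on {0..T} \<Otimes>\<^sub>M M)" for n
    proof -
      define R where "R = s n ` {0..T}"
      have fin: "finite R" using s(1)[of n] by (simp add: simple_function_def R_def)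
      have pre: "s n -` {f} \<inter> {0..T} \<in> sets (lebesgue_on {0..T})" if "f \<in> R" for f
        using s(1)[of n] that by (auto simp: simple_function_def R_def)
      have wm: "wgrad \<Omega> f \<in> borel_measurable M" if "f \<in> R" for f
        using weak_gradientD(2)[OF H_space_gradient(1)[OF _ k]] s(2)[of n] that by (auto simp: R_def)
      have "(\<lambda>p. \<Sum>f\<in>R. indicator (s n -` {f} \<inter> {0..T}) (fst p) *\<^sub>R wgrad \<Omega> f (snd p)) \<in> borel_measurable (lebesgue_on {0..T} \<Otimes>\<^sub>M M)"
      proof (rule borel_measurable_sum)
        fix f assume f: "f \<in> R"
        note [measurable] = pre[OF f] wm[OF f]
        show "(\<lambda>p. indicator (s n -` {f} \<inter> {0..T}) (fst p) *\<^sub>R wgrad \<Omega> f (snd p)) \<in> borel_measurable (lebesgue_on {0..T} \<Otimes>\<^sub>M M)"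
          by measurable
      qed
      then show ?thesis
      proof (rule measurable_cong[THEN iffD1, rotated])
        fix p assume "p \<in> space (lebesgue_on {0..T} \<Otimes>\<^sub>M M)"
        then have t: "fst p \<in> {0..T}" by (auto simp: space_pair_measure)
        then have "s n (fst p) \<in> R" by (simp add: R_def)
        have "(\<Sum>f\<in>R. indicator (s n -` {f} \<inter> {0..T}) (fst p) *\<^sub>R wgrad \<Omega> f (snd p))
          = (\<Sum>f\<in>R. if f = s n (fst p) then wgrad \<Omega> f (snd p) else 0)"
          by (rule sum.cong) (use t in \<open>auto split: split_indicator\<close>)
        also have "\<dots> = wgrad \<Omega> (s n (fst p)) (snd p)"
          using fin \<open>s n (fst p) \<in> R\<close> by simp
        finally show "(\<Sum>f\<in>R. indicator (s n -` {f} \<inter> {0..T}) (fst p) *\<^sub>R wgrad \<Omega> f (snd p)) = wgrad \<Omega> (s n (fst p)) (snd p)" .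
      qed
    qed
    show "AE t in lebesgue_on {0..T}. (\<forall>n. integrable M (\<lambda>x. wgrad \<Omega> (s n t) x - wgrad \<Omega> (v t) x)) \<and>
       (\<lambda>n. LINT x|M. norm (wgrad \<Omega> (s n t) x - wgrad \<Omega> (v t) x)) \<longlonglongrightarrow> 0"
      using vX lim AE_space
    proof eventually_elim
      case (elim t)
      have sX: "s n t \<in> H_space k \<Omega>" for n using s(2)[of n] elim(3) by auto
      have i: "integrable M (\<lambda>x. wgrad \<Omega> (s n t) x - wgrad \<Omega> (v t) x)" for n
        using weak_gradientD(2)[OF H_space_gradient(1)[OF sX k]] weak_gradientD(2)[OF H_space_gradient(1)[OF elim(1) k]] by auto
      have "(\<lambda>n. sobolev_norm k 2 \<Omega> (\<lambda>x. s n t x - v t x) * (measure M \<Omega> + 1)) \<longlonglongrightarrow> 0"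
        using tendsto_mult_right[OF elim(2), of "measure M \<Omega> + 1"] by simp
      then have "(\<lambda>n. LINT x|M. norm (wgrad \<Omega> (s n t) x - wgrad \<Omega> (v t) x)) \<longlonglongrightarrow> 0"
        by (rule tendsto_sandwich[OF _ _ tendsto_const, rotated 2])
          (auto intro!: always_eventually H_space_L1_diff(1) sX elim(1) k)
      with i show ?case by blast
    qed
  qed
qed

end

section \<open>From the weak formulation in time to a balance law\<close>

text \<open>Density of the good points, used first in space for almost every time and then in time.\<close>

lemma AE_in_closed_imp_everywhere:
  fixes f :: "real \<Rightarrow> 'a::euclidean_space \<Rightarrow> real"
  assumes T: "T > 0" and Om: "open \<Omega>" and f: "continuous_on ({0..T} \<times> \<Omega>) (\<lambda>(t, x). f t x)" and S: "closed S"
    and ae: "AE t in lebesgue_on {0..T}. AE x in lebesgue_on \<Omega>. f t x \<in> S"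
    and t: "t \<in> {0..T}" and x: "x \<in> \<Omega>"
  shows "f t x \<in> S"
proof -
  have space: "continuous_on \<Omega> (f s)" if "s \<in> {0..T}" for s
    by (rule continuous_on_compose2[OF f, of _ "\<lambda>x. (s, x)", simplified]) (use that in \<open>auto intro!: continuous_intros\<close>)
  have time: "continuous_on {0..T} (\<lambda>s. f s x)"
    by (rule continuous_on_compose2[OF f, of _ "\<lambda>s. (s, x)", simplified]) (use x in \<open>auto intro!: continuous_intros\<close>)
  have "AE s in lebesgue_on {0<..<T}. AE y in lebesgue_on \<Omega>. f s y \<in> S"
    using ae by (simp add: AE_restrict_space_iff) (auto elim: eventually_mono)
  then have ae': "AE s in lebesgue_on {0<..<T}. f s x \<in> S"
    using AE_space
  proof eventually_elim
    case (elim s)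
    show ?case by (rule AE_continuous_imp_everywhere[OF Om space S elim(1) x]) (use elim(2) in auto)
  qed
  have "f s x \<in> S" if s: "s \<in> {0<..<T}" for s
    by (rule AE_continuous_imp_everywhere[OF open_greaterThanLessThan continuous_on_subset[OF time] S ae' s]) auto
  then have "(\<lambda>s. f s x) ` closure {0<..<T} \<subseteq> S"
    by (intro image_closure_subset S) (use time T in \<open>auto simp: closure_greaterThanLessThan\<close>)
  then show ?thesis using t T by (auto simp: closure_greaterThanLessThan)
qed

lemma integral_closed_open_interval:
  fixes f :: "real \<Rightarrow> real"
  shows "(LINT s|lebesgue_on {a..b}. f s) = (LINT s|lebesgue_on {a<..<b}. f s)"
proof -
  have "(LINT s|lebesgue_on {a..b}. f s) = (LINT s|lebesgue. indicator {a..b} s *\<^sub>R f s)"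
    by (rule integral_restrict_space) auto
  also have "\<dots> = (LINT s|lebesgue_on UNIV. indicator {a..b} s *\<^sub>R f s)" by (simp add: lebesgue_on_UNIV_eq)
  also have "\<dots> = (LINT s|lebesgue_on UNIV. indicator {a<..<b} s *\<^sub>R f s)"
  proof (rule integral_AE_cong_lebesgue)
    have "{a, b} \<in> null_sets lebesgue" using negligible_finite[of "{a, b}"] by (simp add: negligible_iff_null_sets)
    then have "AE s in lebesgue. s \<notin> {a, b}" by (rule AE_not_in)
    then show "AE s in lebesgue_on UNIV. indicator {a..b} s *\<^sub>R f s = indicator {a<..<b} s *\<^sub>R f s"
      unfolding lebesgue_on_UNIV_eq by eventually_elim (auto split: split_indicator)
  qed simp
  also have "\<dots> = (LINT s|lebesgue_on {a<..<b}. f s)"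
    by (subst integral_restrict_space) (auto simp: lebesgue_on_UNIV_eq)
  finally show ?thesis .
qed

lemma integral_lebesgue_on_indicator:
  fixes f :: "real \<Rightarrow> real"
  assumes "S \<in> sets lebesgue" "A \<in> sets lebesgue" "A \<subseteq> S"
  shows "(LINT s|lebesgue_on S. indicator A s * f s) = (LINT s|lebesgue_on A. f s)"
proof -
  have "(LINT s|lebesgue_on S. indicator A s * f s) = (LINT s|lebesgue. indicator S s *\<^sub>R (indicator A s * f s))"
    by (rule integral_restrict_space) (use assms in auto)
  also have "\<dots> = (LINT s|lebesgue. indicator A s *\<^sub>R f s)"
    by (rule arg_cong[where f = "integral\<^sup>L lebesgue"], rule ext) (use assms(3) in \<open>auto split: split_indicator\<close>)
  also have "\<dots> = (LINT s|lebesgue_on A. f s)"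
    by (rule integral_restrict_space[symmetric]) (use assms in auto)
  finally show ?thesis .
qed

lemma moll_grad_real_integral:
  fixes s t :: real
  assumes s: "s \<ge> 0" and t: "t > 0"
  shows "(LINT y|lebesgue_on {-1<..<t}. moll_grad n (s - y)) = - moll n (s - t)"
proof -
  have der: "((\<lambda>y. - moll n (s - y)) has_real_derivative moll_grad n (s - y)) (at y)" for y
  proof -
    have "((\<lambda>y. moll n (s - y)) has_derivative (\<lambda>h. (- moll_grad n (s - y)) \<bullet> h)) (at y)"
      using has_C1_gradient_reflect[OF moll_grad_C1[of n], of s] by (simp add: has_C1_gradient_def)
    then have "((\<lambda>y. moll n (s - y)) has_real_derivative (- moll_grad n (s - y))) (at y)"
      unfolding has_field_derivative_def by (rule has_derivative_eq_rhs) (simp add: fun_eq_iff)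
    from DERIV_minus[OF this] show ?thesis by simp
  qed
  have FTC: "((\<lambda>y. moll_grad n (s - y)) has_integral (- moll n (s - t)) - (- moll n (s - (- 1)))) {-1..t}"
    by (rule fundamental_theorem_of_calculus)
      (use t der in \<open>auto simp: has_real_derivative_iff_has_vector_derivative[symmetric] intro: has_field_derivative_at_within\<close>)
  have "continuous_on {-1..t} (\<lambda>y. moll_grad n (s - y))"
    by (rule continuous_on_compose2[OF moll_grad_continuous]) (auto intro!: continuous_intros)
  then have "integrable (lebesgue_on {-1..t}) (\<lambda>y. moll_grad n (s - y))" by (rule continuous_imp_integrable_real)
  then have "(LINT y|lebesgue_on {-1..t}. moll_grad n (s - y)) = integral {-1..t} (\<lambda>y. moll_grad n (s - y))"
    by (rule lebesgue_integral_eq_integral) simp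
  also have "\<dots> = - moll n (s - t) + moll n (s + 1)" using integral_unique[OF FTC] by simp
  also have "moll n (s + 1) = 0" using s by (intro moll_eq_0) (simp add: field_simps)
  finally show ?thesis by (simp add: integral_closed_open_interval)
qed

text \<open>For interior \<open>t\<close> the test functions are mollifications of the indicator of the interval from \<open>-1\<close> to
\<open>t\<close>. They are \<open>1\<close> at time \<open>0\<close>, vanish shortly after \<open>t\<close>, and their derivative at nonnegative
times is minus the mollifier centred at \<open>t\<close>; the left end point \<open>-1\<close> is far enough from \<open>0\<close> not to
contribute. The end points \<open>0\<close> and \<open>T\<close> follow by continuity, and the initial value is attained
because the test functions need not vanish at time \<open>0\<close>.\<close>

lemma weak_ode_integrated:
  fixes P Q :: "real \<Rightarrow> real"
  assumes T: "T > 0" and P: "continuous_on {0..T} P" and Q: "integrable (lebesgue_on {0..T}) Q"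
    and eq: "\<And>\<eta>. smooth_on UNIV \<eta> \<Longrightarrow> \<exists>s<T. \<forall>t\<ge>s. \<eta> t = 0 \<Longrightarrow>
      - (LINT t|lebesgue_on {0..T}. P t * deriv \<eta> t) + (LINT t|lebesgue_on {0..T}. Q t * \<eta> t) = P0 * \<eta> 0"
    and t: "t \<in> {0..T}"
  shows "P t + (LINT s|lebesgue_on {0..T}. indicator {0..t} s * Q s) = P0"
proof -
  have inner: "P t + (LINT s|lebesgue_on {0..T}. indicator {0..t} s * Q s) = P0" if t: "0 < t" "t < T" for t
  proof -
    interpret A: bounded_open_set "{-1<..<t}" by standard auto
    interpret B: bounded_open_set "{0<..<T}" by standard auto
    have one: "integrable (lebesgue_on {-1<..<t}) (\<lambda>y. 1)" by simp
    define \<eta> where "\<eta> n = conv {-1<..<t} (moll n) (\<lambda>y. 1)" for n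
    have sm: "smooth_on UNIV (\<eta> n)" for n unfolding \<eta>_def by (rule smooth_on_conv[OF moll_bumps one])
    have \<eta>1: "\<bar>\<eta> n s\<bar> \<le> 1" for n s
      unfolding \<eta>_def by (rule A.mollify_bound[OF one]) auto
    have \<eta>0: "\<eta> n s = 0" if "s \<ge> t + 1 / real (Suc n)" for n s
    proof -
      have "(LINT y|lebesgue_on {-1<..<t}. moll n (s - y) * 1) = (LINT y|lebesgue_on {-1<..<t}. 0)"
        by (rule Bochner_Integration.integral_cong) (use that in \<open>auto intro!: moll_eq_0\<close>)
      then show ?thesis by (simp add: \<eta>_def conv_def)
    qed
    have \<eta>': "deriv (\<eta> n) s = - moll n (s - t)" if "s \<ge> 0" for n s
    proof -
      have "(\<eta> n has_derivative (\<lambda>h. (LINT y|lebesgue_on {-1<..<t}. 1 *\<^sub>R moll_grad n (s - y)) \<bullet> h)) (at s)"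
        using A.mollify_C1[OF one, of n] by (simp add: has_C1_gradient_def \<eta>_def)
      then have "(\<eta> n has_real_derivative - moll n (s - t)) (at s)"
        unfolding has_field_derivative_def
        by (rule has_derivative_eq_rhs) (use moll_grad_real_integral[OF that t(1), of n] in \<open>simp add: fun_eq_iff\<close>)
      then show ?thesis by (rule DERIV_imp_deriv)
    qed
    have ev: "eventually (\<lambda>n. 1 / real (Suc n) < e) sequentially" if "e > 0" for e
      using order_tendstoD(2)[OF LIMSEQ_Suc[OF lim_1_over_n] that] by simp
    have PB: "integrable (lebesgue_on {0<..<T}) P"
    proof -
      have "integrable (lebesgue_on {0..T}) P" by (rule continuous_imp_integrable_real[OF P])
      then have "set_integrable lebesgue {0..T} P" by (subst set_integrable_eq) auto
      then have "set_integrable lebesgue {0<..<T} P" by (rule set_integrable_subset) auto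
      then show ?thesis by (subst (asm) set_integrable_eq) auto
    qed
    have l1: "(\<lambda>n. conv {0<..<T} (moll n) P t) \<longlonglongrightarrow> P t"
    proof (rule B.mollify_pointwise[OF PB])
      show "isCont P t" using P t by (intro continuous_on_interior[OF P]) (auto simp: interior_atLeastAtMost_real)
    qed (use t in auto)
    have l2: "(\<lambda>n. LINT s|lebesgue_on {0..T}. Q s * \<eta> n s) \<longlonglongrightarrow> (LINT s|lebesgue_on {0..T}. indicator {0..t} s * Q s)"
    proof (rule integral_dominated_convergence[where w = "\<lambda>s. \<bar>Q s\<bar>"])
      have "{t} \<in> null_sets lebesgue" using negligible_finite[of "{t}"] by (simp add: negligible_iff_null_sets)
      then have "AE s in lebesgue. s \<notin> {t}" by (rule AE_not_in)
      then have "AE s in lebesgue_on {0..T}. s \<noteq> t" by (subst AE_restrict_space_iff) (auto elim: eventually_mono)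
      then show "AE s in lebesgue_on {0..T}. (\<lambda>n. Q s * \<eta> n s) \<longlonglongrightarrow> indicator {0..t} s * Q s"
        using AE_space
      proof eventually_elim
        case (elim s)
        then have s: "0 \<le> s" "s \<le> T" "s \<noteq> t" by auto
        have "(\<lambda>n. \<eta> n s) \<longlonglongrightarrow> indicator {0..t} s"
        proof (cases "s < t")
          case True
          have "(\<lambda>n. \<eta> n s) \<longlonglongrightarrow> 1" unfolding \<eta>_def
            by (rule A.mollify_pointwise[OF one]) (use True s in auto)
          then show ?thesis using True s by simp
        next
          case False
          have "eventually (\<lambda>n. 1 / real (Suc n) < s - t) sequentially" by (rule ev) (use False s in auto)
          then have "eventually (\<lambda>n. \<eta> n s = 0) sequentially" by eventually_elim (auto intro!: \<eta>0)
          then show ?thesis using False s by (auto intro: tendsto_eventually)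
        qed
        from tendsto_mult_left[OF this, of "Q s"] show ?case by (simp add: mult.commute)
      qed
      show "AE s in lebesgue_on {0..T}. norm (Q s * \<eta> n s) \<le> \<bar>Q s\<bar>" for n
        using \<eta>1 by (intro AE_I2) (simp add: abs_mult mult_left_le)
      show "(\<lambda>s. Q s * \<eta> n s) \<in> borel_measurable (lebesgue_on {0..T})" for n
        using Q A.mollify_continuous[OF one, of UNIV n, folded \<eta>_def]
        by (rule borel_measurable_times[OF borel_measurable_integrable continuous_imp_measurable_lebesgue_on])
      have "indicat_real {0..t} \<in> borel_measurable (lebesgue_on {0..T})"
        by (intro measurable_restrict_space1 borel_measurable_indicator) auto
      then show "(\<lambda>s. indicator {0..t} s * Q s) \<in> borel_measurable (lebesgue_on {0..T})" using Q by auto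
    qed (use Q in auto)
    have tp: "0 < T - t" "0 < min 1 t" using t by auto
    have "eventually (\<lambda>n. conv {0<..<T} (moll n) P t + (LINT s|lebesgue_on {0..T}. Q s * \<eta> n s) = P0) sequentially"
      using ev[OF tp(1)] ev[OF tp(2)]
    proof (eventually_elim)
      case (elim n)
      have "\<exists>s<T. \<forall>r\<ge>s. \<eta> n r = 0" using elim t \<eta>0[of n] by (intro exI[of _ "t + 1 / real (Suc n)"]) auto
      from eq[OF sm this] have e: "- (LINT s|lebesgue_on {0..T}. P s * deriv (\<eta> n) s) + (LINT s|lebesgue_on {0..T}. Q s * \<eta> n s) = P0 * \<eta> n 0" .
      have "\<eta> n 0 = 1"
      proof -
        have q: "1 / real (Suc n) < 1" "1 / real (Suc n) < t" using elim(2) by (simp_all only: min_less_iff_conj)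
        have "ball 0 (1 / real (Suc n)) \<subseteq> {-1<..<t}"
        proof
          fix x :: real assume "x \<in> ball 0 (1 / real (Suc n))"
          then have "\<bar>x\<bar> < 1 / real (Suc n)" by (simp only: mem_ball dist_real_def diff_0 abs_minus_cancel)
          then show "x \<in> {-1<..<t}" using q unfolding greaterThanLessThan_iff by linarith
        qed
        then show ?thesis using A.moll_M_integral_eq[of 0 n] by (simp add: \<eta>_def conv_def)
      qed
      moreover have "(LINT s|lebesgue_on {0..T}. P s * deriv (\<eta> n) s) = - conv {0<..<T} (moll n) P t"
      proof -
        have "(LINT s|lebesgue_on {0..T}. P s * deriv (\<eta> n) s) = (LINT s|lebesgue_on {0<..<T}. P s * deriv (\<eta> n) s)"
          by (rule integral_closed_open_interval)
        also have "\<dots> = (LINT s|lebesgue_on {0<..<T}. - (moll n (t - s) * P s))"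
          by (rule Bochner_Integration.integral_cong) (auto simp: \<eta>' moll_minus[of n t])
        finally show ?thesis by (simp add: conv_def)
      qed
      ultimately show ?case using e by simp
    qed
    then have "(\<lambda>n. conv {0<..<T} (moll n) P t + (LINT s|lebesgue_on {0..T}. Q s * \<eta> n s)) \<longlonglongrightarrow> P0"
      by (rule tendsto_eventually)
    from LIMSEQ_unique[OF tendsto_add[OF l1 l2] this] show ?thesis .
  qed
  have Qeq: "(LINT s|lebesgue_on {0..T}. indicator {0..t} s * Q s) = (LINT s|lebesgue_on {0..t}. Q s)" if "t \<in> {0..T}" for t
    by (rule integral_lebesgue_on_indicator) (use that in auto)
  have "continuous_on {0..T} (\<lambda>t. P t + (LINT s|lebesgue_on {0..t}. Q s))"
    by (intro continuous_on_add P indefinite_integral_continuous_real Q)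
  then have c: "continuous_on (closure {0<..<T}) (\<lambda>t. P t + (LINT s|lebesgue_on {0..t}. Q s))"
    using T by (simp add: closure_greaterThanLessThan)
  have "P t + (LINT s|lebesgue_on {0..t}. Q s) = P0"
    by (rule continuous_constant_on_closure[OF c])
      (use inner Qeq t T in \<open>auto simp: closure_greaterThanLessThan\<close>)
  then show ?thesis using Qeq[OF t] by simp
qed

section \<open>Averages in time and the flux against the deficit\<close>

lemma integrable_inner_of_squares:
  fixes F G :: "'b \<Rightarrow> 'c::euclidean_space"
  assumes "F \<in> borel_measurable N" "G \<in> borel_measurable N"
    "integrable N (\<lambda>x. (norm (F x))\<^sup>2)" "integrable N (\<lambda>x. (norm (G x))\<^sup>2)"
  shows "integrable N (\<lambda>x. F x \<bullet> G x)"
proof (rule Bochner_Integration.integrable_bound)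
  show "integrable N (\<lambda>x. (norm (F x))\<^sup>2 + (norm (G x))\<^sup>2)" using assms by simp
  show "AE x in N. norm (F x \<bullet> G x) \<le> norm ((norm (F x))\<^sup>2 + (norm (G x))\<^sup>2)"
  proof (rule AE_I2)
    fix x
    have "norm (F x \<bullet> G x) \<le> norm (F x) * norm (G x)" unfolding real_norm_def by (rule Cauchy_Schwarz_ineq2)
    also have "\<dots> \<le> (norm (F x))\<^sup>2 + (norm (G x))\<^sup>2"
    proof -
      have "0 \<le> (norm (F x) - norm (G x))\<^sup>2 + norm (F x) * norm (G x)" by simp
      then show ?thesis by (simp add: power2_eq_square algebra_simps)
    qed
    finally show "norm (F x \<bullet> G x) \<le> norm ((norm (F x))\<^sup>2 + (norm (G x))\<^sup>2)" by simp
  qed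
qed (use assms(1,2) in measurable)

text \<open>The variance with respect to the probability density \<open>k\<close> is nonnegative.\<close>

lemma norm_average_square_le:
  fixes f :: "'b \<Rightarrow> 'c::euclidean_space"
  assumes k: "integrable N k" "\<And>s. 0 \<le> k s" "(LINT s|N. k s) = (1::real)"
    and f: "integrable N (\<lambda>s. k s *\<^sub>R f s)" "integrable N (\<lambda>s. k s * (norm (f s))\<^sup>2)"
  shows "(norm (LINT s|N. k s *\<^sub>R f s))\<^sup>2 \<le> (LINT s|N. k s * (norm (f s))\<^sup>2)"
proof -
  define m where "m = (LINT s|N. k s *\<^sub>R f s)"
  have i: "integrable N (\<lambda>s. (k s *\<^sub>R f s) \<bullet> m)" using f(1) by (rule integrable_inner_left)
  have e: "(LINT s|N. (k s *\<^sub>R f s) \<bullet> m) = m \<bullet> m"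
    unfolding m_def by (rule integral_inner_left[OF f(1)])
  have "0 \<le> (LINT s|N. k s * (norm (f s - m))\<^sup>2)" using k(2) by (intro integral_nonneg_AE) auto
  also have "\<dots> = (LINT s|N. k s * (norm (f s))\<^sup>2 - 2 * ((k s *\<^sub>R f s) \<bullet> m) + k s * (m \<bullet> m))"
    by (rule arg_cong[where f = "integral\<^sup>L N"], rule ext)
      (simp add: power2_norm_eq_inner inner_diff inner_commute algebra_simps)
  also have "\<dots> = (LINT s|N. k s * (norm (f s))\<^sup>2) - m \<bullet> m"
    using f i k(1,3) e by simp
  finally show ?thesis by (simp add: m_def power2_norm_eq_inner)
qed

lemma Young_weighted:
  fixes r n m :: real
  assumes r: "r > 0"
  shows "2 * n * m \<le> r * n\<^sup>2 + m\<^sup>2 / r"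
proof -
  have "0 \<le> (r * n - m)\<^sup>2 / r" using r by simp
  also have "\<dots> = r * n\<^sup>2 + m\<^sup>2 / r - 2 * n * m"
    using r by (simp add: power2_eq_square field_simps)
  finally show ?thesis by simp
qed

text \<open>The energy below is the integral of the third power of the positive part. Its derivative, the square,
is still continuously differentiable and hence allowed in the chain rule for weak gradients, which
would not hold for the usual choice of the square as energy.\<close>

lemma DERIV_max0_cube: "((\<lambda>s. (max 0 s) ^ 3) has_real_derivative 3 * (max 0 s)\<^sup>2) (at (s::real))"
  and DERIV_max0_square: "((\<lambda>s. (max 0 s)\<^sup>2) has_real_derivative 2 * max 0 s) (at (s::real))"
proof -
  have "((\<lambda>s. if s \<ge> 0 then s ^ 3 else 0) has_real_derivative (if s \<ge> 0 then 3 * s\<^sup>2 else 0)) (at s)"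
    by (rule DERIV_if_ge) (auto intro!: derivative_eq_intros)
  moreover have "(\<lambda>s::real. if s \<ge> 0 then s ^ 3 else 0) = (\<lambda>s. (max 0 s) ^ 3)" by (auto simp: max_def fun_eq_iff)
  ultimately show "((\<lambda>s. (max 0 s) ^ 3) has_real_derivative 3 * (max 0 s)\<^sup>2) (at s)"
    by (cases "s \<ge> 0") (simp_all add: max_def)
  have "((\<lambda>s. if s \<ge> 0 then s\<^sup>2 else 0) has_real_derivative (if s \<ge> 0 then 2 * s else 0)) (at s)"
    by (rule DERIV_if_ge) (auto intro!: derivative_eq_intros)
  moreover have "(\<lambda>s::real. if s \<ge> 0 then s\<^sup>2 else 0) = (\<lambda>s. (max 0 s)\<^sup>2)" by (auto simp: max_def fun_eq_iff)
  ultimately show "((\<lambda>s. (max 0 s)\<^sup>2) has_real_derivative 2 * max 0 s) (at s)"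
    by (cases "s \<ge> 0") (simp_all add: max_def)
qed

text \<open>\<open>U\<close> is a jointly measurable representative of the spatial gradient of \<open>u\<close>, and \<open>N\<close> is the measure on
the time interval.\<close>

locale evolution = bounded_open_set \<Omega> + N: finite_measure N
  for \<Omega> :: "'a::euclidean_space set" and N :: "real measure" +
  fixes u :: "real \<Rightarrow> 'a \<Rightarrow> real" and U :: "real \<times> 'a \<Rightarrow> 'a" and C :: real
  assumes u_measurable: "(\<lambda>p. u (fst p) (snd p)) \<in> borel_measurable (N \<Otimes>\<^sub>M lebesgue_on \<Omega>)"
    and u_bounds: "\<And>s x. s \<in> space N \<Longrightarrow> x \<in> \<Omega> \<Longrightarrow> 0 \<le> u s x \<and> u s x \<le> C"
    and U_measurable: "U \<in> borel_measurable (N \<Otimes>\<^sub>M lebesgue_on \<Omega>)"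
    and U_square: "integrable (N \<Otimes>\<^sub>M lebesgue_on \<Omega>) (\<lambda>p. (norm (U p))\<^sup>2)"
    and u_gradient: "AE s in N. weak_gradient (u s) (\<lambda>x. U (s, x))"
begin

sublocale NM: pair_sigma_finite N M ..

sublocale P: finite_measure "N \<Otimes>\<^sub>M M"
  by (rule finite_measure_pair_measure[OF finite_measure_axioms N.finite_measure_axioms])

lemmas [measurable] = u_measurable U_measurable

lemma u_swap_measurable [measurable]: "(\<lambda>p. u (snd p) (fst p)) \<in> borel_measurable (M \<Otimes>\<^sub>M N)"
  using measurable_compose[OF measurable_pair_swap' u_measurable] by (simp add: case_prod_beta')

lemma U_integrable: "integrable (N \<Otimes>\<^sub>M M) U"
  by (rule P.integrable_of_square_integrable[OF U_measurable U_square])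

lemma u_section: "x \<in> \<Omega> \<Longrightarrow> (\<lambda>s. u s x) \<in> borel_measurable N"
proof -
  assume "x \<in> \<Omega>"
  then have "x \<in> space M" by simp
  from measurable_compose[OF measurable_Pair2'[OF this] u_measurable] show ?thesis by simp
qed

lemma u_time_section: "s \<in> space N \<Longrightarrow> u s \<in> borel_measurable M"
proof -
  assume "s \<in> space N"
  from measurable_compose[OF measurable_Pair1'[OF this] u_measurable] show ?thesis by simp
qed

lemma snd_integrable:
  fixes f :: "'a \<Rightarrow> real"
  assumes "integrable M f"
  shows "integrable (N \<Otimes>\<^sub>M M) (\<lambda>p. f (snd p))"
  by (rule NM.Fubini_integrable) (use assms in auto)

lemma U_inner_integrable:
  assumes W: "W \<in> borel_measurable M" "integrable M (\<lambda>x. (norm (W x))\<^sup>2)"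
  shows "integrable (N \<Otimes>\<^sub>M M) (\<lambda>p. U p \<bullet> W (snd p))"
  by (rule integrable_inner_of_squares[OF U_measurable _ U_square]) (use W snd_integrable[OF W(2)] in auto)

lemma flux_integrable:
  assumes W: "W \<in> borel_measurable M" "integrable M (\<lambda>x. (norm (W x))\<^sup>2)"
    and \<Phi>: "\<Phi> \<in> borel_measurable (N \<Otimes>\<^sub>M M)" "AE p in N \<Otimes>\<^sub>M M. norm (\<Phi> p) \<le> L"
  shows "integrable (N \<Otimes>\<^sub>M M) (\<lambda>p. (r *\<^sub>R U p + u (fst p) (snd p) *\<^sub>R \<Phi> p) \<bullet> W (snd p))"
proof -
  note [measurable] = \<Phi>(1) W(1)
  have "integrable (N \<Otimes>\<^sub>M M) (\<lambda>p. (u (fst p) (snd p) *\<^sub>R \<Phi> p) \<bullet> W (snd p))"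
  proof (rule integrable_inner_of_squares)
    show "integrable (N \<Otimes>\<^sub>M M) (\<lambda>p. (norm (u (fst p) (snd p) *\<^sub>R \<Phi> p))\<^sup>2)"
    proof (rule P.integrable_const_bound[where B = "(C * L)\<^sup>2"])
      show "AE p in N \<Otimes>\<^sub>M M. norm ((norm (u (fst p) (snd p) *\<^sub>R \<Phi> p))\<^sup>2) \<le> (C * L)\<^sup>2"
        using \<Phi>(2) AE_space
      proof eventually_elim
        case (elim p)
        have b: "0 \<le> u (fst p) (snd p) \<and> u (fst p) (snd p) \<le> C" using elim(2) by (intro u_bounds) (auto simp: space_pair_measure)
        have "norm (u (fst p) (snd p) *\<^sub>R \<Phi> p) \<le> C * L" unfolding norm_scaleR
          using b elim(1) by (intro mult_mono) auto
        then have "(norm (u (fst p) (snd p) *\<^sub>R \<Phi> p))\<^sup>2 \<le> (C * L)\<^sup>2" by (intro power_mono) auto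
        then show ?case by simp
      qed
    qed simp
  qed (use snd_integrable[OF W(2)] in auto)
  moreover have "integrable (N \<Otimes>\<^sub>M M) (\<lambda>p. r * (U p \<bullet> W (snd p)))" using U_inner_integrable[OF W] by simp
  ultimately have "integrable (N \<Otimes>\<^sub>M M) (\<lambda>p. r * (U p \<bullet> W (snd p)) + (u (fst p) (snd p) *\<^sub>R \<Phi> p) \<bullet> W (snd p))"
    by (rule Bochner_Integration.integrable_add[rotated])
  then show ?thesis by (simp add: inner_add_left)
qed

definition avg :: "(real \<Rightarrow> real) \<Rightarrow> 'a \<Rightarrow> real" where "avg k x = (LINT s|N. k s * u s x)"
definition avg_grad :: "(real \<Rightarrow> real) \<Rightarrow> 'a \<Rightarrow> 'a" where "avg_grad k x = (LINT s|N. k s *\<^sub>R U (s, x))"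

context
  fixes k :: "real \<Rightarrow> real" and B :: real
  assumes k_measurable [measurable]: "k \<in> borel_measurable N"
    and k_bounds: "\<And>s. 0 \<le> k s" "\<And>s. k s \<le> B" and k_integral: "(LINT s|N. k s) = 1"
begin

lemma k_abs: "\<bar>k s\<bar> \<le> B" using k_bounds[of s] by simp

lemma k_integrable: "integrable N k"
  by (rule N.integrable_const_bound[where B = B]) (use k_abs in auto)

lemma ku_integrable: "x \<in> \<Omega> \<Longrightarrow> integrable N (\<lambda>s. k s * u s x)"
  by (rule integrable_bounded_mult[OF N.integrable_const_bound[where B = C] k_measurable, where C = B])
    (use u_section[of x] u_bounds k_abs in auto)

lemma avg_bounds: "x \<in> \<Omega> \<Longrightarrow> 0 \<le> avg k x \<and> avg k x \<le> C"
proof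
  assume x: "x \<in> \<Omega>"
  show "0 \<le> avg k x" unfolding avg_def
    by (rule Bochner_Integration.integral_nonneg) (use u_bounds x k_bounds in auto)
  have "avg k x \<le> (LINT s|N. k s * C)" unfolding avg_def
    by (rule integral_mono[OF ku_integrable[OF x]]) (use u_bounds x k_bounds k_integrable in \<open>auto intro!: mult_left_mono\<close>)
  then show "avg k x \<le> C" by (simp add: k_integral)
qed

lemma avg_measurable [measurable]: "avg k \<in> borel_measurable M"
  unfolding avg_def[abs_def]
  by (rule N.borel_measurable_lebesgue_integral) (use u_swap_measurable in \<open>simp add: case_prod_beta'\<close>)

lemma kU_integrable: "integrable (N \<Otimes>\<^sub>M M) (\<lambda>p. k (fst p) *\<^sub>R U p)"
  by (rule integrable_bounded_scaleR[OF U_integrable, where C = B]) (use k_abs in auto)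

lemma avg_grad_integrable: "integrable M (avg_grad k)"
  using NM.integrable_snd[of "\<lambda>s x. k s *\<^sub>R U (s, x)"] kU_integrable
  by (simp add: avg_grad_def[abs_def] case_prod_beta')

lemma avg_grad_measurable [measurable]: "avg_grad k \<in> borel_measurable M" using avg_grad_integrable by auto

lemma avg_integrable: "integrable M (avg k)"
  by (rule integrable_bounded[of _ C]) (use avg_bounds in \<open>auto intro!: AE_I2\<close>)

lemma kU2_integrable: "integrable (N \<Otimes>\<^sub>M M) (\<lambda>p. k (fst p) * (norm (U p))\<^sup>2)"
  by (rule integrable_bounded_mult[OF U_square, where C = B]) (use k_abs in auto)

lemma avg_grad_square: "integrable M (\<lambda>x. (norm (avg_grad k x))\<^sup>2)"
proof (rule Bochner_Integration.integrable_bound)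
  show "integrable M (\<lambda>x. LINT s|N. k s * (norm (U (s, x)))\<^sup>2)"
    using NM.integrable_snd[of "\<lambda>s x. k s * (norm (U (s, x)))\<^sup>2"] kU2_integrable by (simp add: case_prod_beta')
  have "AE x in M. integrable N (\<lambda>s. k s *\<^sub>R U (s, x))"
    using NM.AE_integrable_snd[of "\<lambda>s x. k s *\<^sub>R U (s, x)"] kU_integrable by (simp add: case_prod_beta')
  moreover have "AE x in M. integrable N (\<lambda>s. k s * (norm (U (s, x)))\<^sup>2)"
    using NM.AE_integrable_snd[of "\<lambda>s x. k s * (norm (U (s, x)))\<^sup>2"] kU2_integrable by (simp add: case_prod_beta')
  ultimately show "AE x in M. norm ((norm (avg_grad k x))\<^sup>2) \<le> norm (LINT s|N. k s * (norm (U (s, x)))\<^sup>2)"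
  proof eventually_elim
    case (elim x)
    have "(norm (avg_grad k x))\<^sup>2 \<le> (LINT s|N. k s * (norm (U (s, x)))\<^sup>2)"
      unfolding avg_grad_def by (rule norm_average_square_le[OF k_integrable k_bounds(1) k_integral elim])
    then show ?case by simp
  qed
qed simp

text \<open>Averaging in time commutes with the weak gradient in space, by Fubini's theorem.\<close>

lemma weak_gradient_avg: "weak_gradient (avg k) (avg_grad k)"
  unfolding weak_gradient_def
proof (intro conjI allI impI avg_integrable avg_grad_integrable)
  fix \<psi> D assume t: "C1_test \<Omega> \<psi> D"
  note m [measurable] = C1_test_measurable[OF t]
  obtain K where K: "\<And>x. \<bar>\<psi> x\<bar> \<le> K" "\<And>x. norm (D x) \<le> K" using C1_test_bounded[OF t] by blast
  have i1: "integrable (N \<Otimes>\<^sub>M M) (\<lambda>(s, x). (k s * u s x) *\<^sub>R D x)"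
  proof (rule P.integrable_const_bound[where B = "(B * C) * K"])
    show "AE p in N \<Otimes>\<^sub>M M. norm (case p of (s, x) \<Rightarrow> (k s * u s x) *\<^sub>R D x) \<le> (B * C) * K"
    proof (rule AE_I2)
      fix p assume "p \<in> space (N \<Otimes>\<^sub>M M)"
      then obtain s x where p: "p = (s, x)" "s \<in> space N" "x \<in> \<Omega>" by (auto simp: space_pair_measure)
      have "\<bar>k s\<bar> * \<bar>u s x\<bar> * norm (D x) \<le> (B * C) * K"
        using k_abs u_bounds[OF p(2,3)] K(2) k_bounds[of s] by (intro mult_mono) auto
      then show "norm (case p of (s, x) \<Rightarrow> (k s * u s x) *\<^sub>R D x) \<le> (B * C) * K" by (simp add: p abs_mult)
    qed
  qed (simp add: case_prod_beta')
  have i2: "integrable (N \<Otimes>\<^sub>M M) (\<lambda>(s, x). \<psi> x *\<^sub>R (k s *\<^sub>R U (s, x)))"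
    using integrable_bounded_scaleR[OF kU_integrable, of "\<lambda>p. \<psi> (snd p)" K] K by (simp add: case_prod_beta')
  have "(LINT x|M. avg k x *\<^sub>R D x) = (LINT x|M. LINT s|N. (k s * u s x) *\<^sub>R D x)"
    by (rule Bochner_Integration.integral_cong) (use ku_integrable in \<open>auto simp: avg_def\<close>)
  also have "\<dots> = (LINT s|N. LINT x|M. (k s * u s x) *\<^sub>R D x)"
    by (rule NM.Fubini_integral[OF i1])
  also have "\<dots> = (LINT s|N. - (LINT x|M. \<psi> x *\<^sub>R (k s *\<^sub>R U (s, x))))"
  proof (rule integral_cong_AE)
    show "AE s in N. (LINT x|M. (k s * u s x) *\<^sub>R D x) = - (LINT x|M. \<psi> x *\<^sub>R (k s *\<^sub>R U (s, x)))"
      using u_gradient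
    proof eventually_elim
      case (elim s)
      have "(LINT x|M. (k s * u s x) *\<^sub>R D x) = k s *\<^sub>R (LINT x|M. u s x *\<^sub>R D x)"
        by (simp only: scaleR_scaleR[symmetric] integral_scaleR_right)
      also have "\<dots> = - (k s *\<^sub>R (LINT x|M. \<psi> x *\<^sub>R U (s, x)))"
        using weak_gradientD(3)[OF elim t] by simp
      also have "\<dots> = - (LINT x|M. \<psi> x *\<^sub>R (k s *\<^sub>R U (s, x)))"
        by (simp only: scaleR_left_commute[of "\<psi> _"] integral_scaleR_right)
      finally show ?case .
    qed
  qed (use NM.integrable_fst[OF i1] NM.integrable_fst[OF i2] in auto)
  also have "\<dots> = - (LINT x|M. LINT s|N. \<psi> x *\<^sub>R (k s *\<^sub>R U (s, x)))"
    using NM.Fubini_integral[OF i2] by simp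
  also have "\<dots> = - (LINT x|M. \<psi> x *\<^sub>R avg_grad k x)" by (simp only: avg_grad_def integral_scaleR_right)
  finally show "(LINT x|M. avg k x *\<^sub>R D x) = - (LINT x|M. \<psi> x *\<^sub>R avg_grad k x)" .
qed

text \<open>The spatial heart of the comparison argument. With \<open>v\<close> the average of \<open>u\<close>, \<open>Y = max 0 (c - v)\<close> and
\<open>g = c Y\<^sup>2 - (2/3) Y\<^sup>3\<close> one has \<open>\<nabla>(Y\<^sup>2) = - 2 Y \<nabla>v\<close> and \<open>\<nabla>g = v \<nabla>(Y\<^sup>2)\<close>. Hence the averaged
diffusive flux against \<open>\<nabla>(Y\<^sup>2)\<close> is \<open>- 2 \<sigma>\<^sup>2 \<integral> Y \<bar>\<nabla>v\<bar>\<^sup>2\<close>. In the drift \<open>u \<Phi> \<bullet> \<nabla>(Y\<^sup>2)\<close> the factor \<open>u\<close> is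
split into \<open>v\<close>, which yields \<open>\<Phi> \<bullet> \<nabla>g\<close> and is controlled by the one-sided bound for \<open>\<Phi>\<close>, and
\<open>u - v\<close>. The latter part is bounded by Young's inequality, with the gradient absorbed exactly by
diffusion; only the variance of \<open>u\<close> over the averaging window remains.\<close>

lemma averaged_flux_estimate:
  assumes \<sigma>: "\<sigma> > 0" and c: "c > 0" and L: "L \<ge> 0"
    and \<Phi>: "\<Phi> \<in> borel_measurable (N \<Otimes>\<^sub>M M)" "AE p in N \<Otimes>\<^sub>M M. norm (\<Phi> p) \<le> L"
    and ell: "AE s in N. \<forall>g W Bg. weak_gradient g W \<longrightarrow> (AE x in M. 0 \<le> g x \<and> g x \<le> Bg) \<longrightarrow>
      (LINT x|M. \<Phi> (s, x) \<bullet> W x) \<le> \<Lambda> * (LINT x|M. g x)"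
  defines "Y x \<equiv> max 0 (c - avg k x)"
  shows "(\<lambda>x. (Y x)\<^sup>2) \<in> H_space 1 \<Omega>"
    and "(LINT s|N. k s * (LINT x|M. (\<sigma>\<^sup>2 *\<^sub>R U (s, x) + u s x *\<^sub>R \<Phi> (s, x)) \<bullet> wgrad \<Omega> (\<lambda>x. (Y x)\<^sup>2) x))
      \<le> \<Lambda> * (LINT x|M. c * (Y x)\<^sup>2 - 2 / 3 * (Y x) ^ 3)
        + c * L\<^sup>2 / (2 * \<sigma>\<^sup>2) * (LINT x|M. LINT s|N. k s * (u s x - avg k x)\<^sup>2)"
proof -
  note [measurable] = \<Phi>(1)
  define W where "W x = (- 2 * Y x) *\<^sub>R avg_grad k x" for x
  define g where "g x = c * (Y x)\<^sup>2 - 2 / 3 * (Y x) ^ 3" for x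
  define K where "K = c * L\<^sup>2 / (2 * \<sigma>\<^sup>2)"
  have K: "K \<ge> 0" using c by (simp add: K_def)
  have Ym [measurable]: "Y \<in> borel_measurable M" unfolding Y_def by measurable
  have Wm [measurable]: "W \<in> borel_measurable M" unfolding W_def by measurable
  have Y0: "0 \<le> Y x" for x by (simp add: Y_def)
  have Yc: "Y x \<le> c" if "x \<in> \<Omega>" for x using avg_bounds[OF that] c by (simp add: Y_def)
  have avgC: "AE x in M. \<bar>avg k x\<bar> \<le> C" using avg_bounds by (intro AE_I2) auto
  have d2: "((\<lambda>s. (max 0 (c - s))\<^sup>2) has_real_derivative - 2 * max 0 (c - s)) (at s)"
    and d3: "((\<lambda>s. (max 0 (c - s)) ^ 3) has_real_derivative - 3 * (max 0 (c - s))\<^sup>2) (at s)" for s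
  proof -
    have d: "((\<lambda>s. c - s) has_real_derivative - 1) (at s)" by (auto intro!: derivative_eq_intros)
    show "((\<lambda>s. (max 0 (c - s))\<^sup>2) has_real_derivative - 2 * max 0 (c - s)) (at s)"
      using DERIV_chain2[OF DERIV_max0_square d] by simp
    show "((\<lambda>s. (max 0 (c - s)) ^ 3) has_real_derivative - 3 * (max 0 (c - s))\<^sup>2) (at s)"
      using DERIV_chain2[OF DERIV_max0_cube d] by simp
  qed
  have wY: "weak_gradient (\<lambda>x. (Y x)\<^sup>2) W"
    unfolding Y_def W_def
    by (rule weak_gradient_compose[OF weak_gradient_avg avgC d2]) (intro continuous_intros)
  have wg: "weak_gradient g (\<lambda>x. avg k x *\<^sub>R W x)"
  proof -
    have "weak_gradient (\<lambda>x. c * (max 0 (c - avg k x))\<^sup>2 - 2 / 3 * (max 0 (c - avg k x)) ^ 3)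
      (\<lambda>x. (c * (- 2 * max 0 (c - avg k x)) - 2 / 3 * (- 3 * (max 0 (c - avg k x))\<^sup>2)) *\<^sub>R avg_grad k x)"
      by (rule weak_gradient_compose[OF weak_gradient_avg avgC DERIV_diff[OF DERIV_cmult[OF d2] DERIV_cmult[OF d3]]])
        (intro continuous_intros)
    moreover have "(c * (- 2 * max 0 (c - avg k x)) - 2 / 3 * (- 3 * (max 0 (c - avg k x))\<^sup>2)) *\<^sub>R avg_grad k x = avg k x *\<^sub>R W x" for x
      by (cases "avg k x \<le> c") (auto simp: W_def Y_def max_def power2_eq_square algebra_simps)
    ultimately show ?thesis unfolding g_def Y_def by simp
  qed
  have g0: "AE x in M. 0 \<le> g x \<and> g x \<le> c * c\<^sup>2"
  proof (rule AE_I2)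
    fix x assume "x \<in> space M"
    then have y: "0 \<le> Y x" "Y x \<le> c" using Y0 Yc by auto
    have e: "g x = (Y x)\<^sup>2 * (c - 2 / 3 * Y x)" by (simp add: g_def power2_eq_square power3_eq_cube algebra_simps)
    have "0 \<le> c - 2 / 3 * Y x" "c - 2 / 3 * Y x \<le> c" using y by auto
    then have "(Y x)\<^sup>2 * (c - 2 / 3 * Y x) \<le> c\<^sup>2 * c" using y by (intro mult_mono power_mono) auto
    then show "0 \<le> g x \<and> g x \<le> c * c\<^sup>2" using \<open>0 \<le> c - 2 / 3 * Y x\<close> unfolding e by (simp add: mult.commute)
  qed
  have nW: "norm (W x) = 2 * Y x * norm (avg_grad k x)" for x using Y0[of x] by (simp add: W_def)
  have W2: "integrable M (\<lambda>x. (norm (W x))\<^sup>2)"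
  proof (rule Bochner_Integration.integrable_bound)
    show "integrable M (\<lambda>x. (2 * c)\<^sup>2 * (norm (avg_grad k x))\<^sup>2)" using avg_grad_square by simp
    show "AE x in M. norm ((norm (W x))\<^sup>2) \<le> norm ((2 * c)\<^sup>2 * (norm (avg_grad k x))\<^sup>2)"
    proof (rule AE_I2)
      fix x assume "x \<in> space M"
      then have "norm (W x) \<le> (2 * c) * norm (avg_grad k x)" unfolding nW using Yc by (intro mult_right_mono) auto
      then have "(norm (W x))\<^sup>2 \<le> ((2 * c) * norm (avg_grad k x))\<^sup>2" by (intro power_mono) auto
      then show "norm ((norm (W x))\<^sup>2) \<le> norm ((2 * c)\<^sup>2 * (norm (avg_grad k x))\<^sup>2)" by (simp add: power_mult_distrib)
    qed
  qed simp
  have Y4: "integrable M (\<lambda>x. ((Y x)\<^sup>2)\<^sup>2)"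
    by (rule integrable_bounded[where C = "(c\<^sup>2)\<^sup>2"]) (use Y0 Yc in \<open>auto intro!: AE_I2 power_mono\<close>)
  show H: "(\<lambda>x. (Y x)\<^sup>2) \<in> H_space 1 \<Omega>" by (rule weak_gradient_H1(1)[OF wY Y4 W2])
  have aeW: "AE x in M. wgrad \<Omega> (\<lambda>x. (Y x)\<^sup>2) x = W x" by (rule weak_gradient_H1(2)[OF wY Y4 W2])
  have Wi: "integrable M W" using weak_gradientD(2)[OF wY] .
  define q where "q s = (LINT x|M. (\<sigma>\<^sup>2 *\<^sub>R U (s, x) + u s x *\<^sub>R \<Phi> (s, x)) \<bullet> W x)" for s
  have qeq: "(LINT x|M. (\<sigma>\<^sup>2 *\<^sub>R U (s, x) + u s x *\<^sub>R \<Phi> (s, x)) \<bullet> wgrad \<Omega> (\<lambda>x. (Y x)\<^sup>2) x) = q s" for s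
    unfolding q_def by (rule integral_AE_cong_lebesgue[OF Omega_lebesgue]) (use aeW in eventually_elim, simp)
  define E where "E = (LINT x|M. Y x * (norm (avg_grad k x))\<^sup>2)"
  define G where "G = (LINT x|M. g x)"
  define R where "R s = (LINT x|M. (u s x - avg k x)\<^sup>2)" for s
  define A where "A s = (LINT x|M. U (s, x) \<bullet> W x)" for s
  have EI: "integrable M (\<lambda>x. Y x * (norm (avg_grad k x))\<^sup>2)"
    by (rule integrable_bounded_mult[OF avg_grad_square, where C = c]) (use Y0 Yc in \<open>auto intro!: AE_I2\<close>)
  have est: "AE s in N. q s \<le> \<sigma>\<^sup>2 * A s + (2 * \<sigma>\<^sup>2 * E + K * R s) + \<Lambda> * G"
  proof -
    have "AE s in N. integrable M (\<lambda>x. U (s, x) \<bullet> W x)"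
      using NM.AE_integrable_fst'[OF U_inner_integrable[OF Wm W2]] by simp
    moreover have "AE s in N. AE x in M. norm (\<Phi> (s, x)) \<le> L" using NM.AE_pair[OF \<Phi>(2)] by simp
    ultimately show ?thesis using ell AE_space
    proof eventually_elim
      case (elim s)
      note s = elim(4)
      have [measurable]: "u s \<in> borel_measurable M" by (rule u_time_section[OF s])
      have [measurable]: "(\<lambda>x. \<Phi> (s, x)) \<in> borel_measurable M"
        using measurable_compose[OF measurable_Pair1'[OF s] \<Phi>(1)] .
      have ub: "\<bar>u s x - avg k x\<bar> \<le> C" if "x \<in> \<Omega>" for x
        using u_bounds[OF s that] avg_bounds[OF that] by auto
      have PW: "AE x in M. \<bar>\<Phi> (s, x) \<bullet> W x\<bar> \<le> L * norm (W x)"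
        using elim(2) by eventually_elim (rule abs_inner_le, auto)
      have PWi: "integrable M (\<lambda>x. \<Phi> (s, x) \<bullet> W x)" by (rule integrable_bounded_inner[OF _ elim(2) Wi]) simp
      have i2: "integrable M (\<lambda>x. (u s x - avg k x) * (\<Phi> (s, x) \<bullet> W x))"
        by (rule integrable_bounded_mult[OF PWi, where C = C]) (use ub in \<open>auto intro!: AE_I2\<close>)
      have i3: "integrable M (\<lambda>x. avg k x * (\<Phi> (s, x) \<bullet> W x))"
        by (rule integrable_bounded_mult[OF PWi, where C = C]) (use avgC in auto)
      have iR: "integrable M (\<lambda>x. (u s x - avg k x)\<^sup>2)"
      proof (rule integrable_bounded[where C = "C\<^sup>2"])
        show "AE x in M. norm ((u s x - avg k x)\<^sup>2) \<le> C\<^sup>2"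
          using power_mono[OF ub, of _ 2] by (intro AE_I2) auto
      qed simp
      have "q s = (LINT x|M. \<sigma>\<^sup>2 * (U (s, x) \<bullet> W x) + ((u s x - avg k x) * (\<Phi> (s, x) \<bullet> W x) + avg k x * (\<Phi> (s, x) \<bullet> W x)))"
        unfolding q_def by (rule arg_cong[where f = "integral\<^sup>L M"], rule ext) (simp add: inner_add_left algebra_simps)
      also have "\<dots> = \<sigma>\<^sup>2 * A s + ((LINT x|M. (u s x - avg k x) * (\<Phi> (s, x) \<bullet> W x)) + (LINT x|M. avg k x * (\<Phi> (s, x) \<bullet> W x)))"
        using elim(1) i2 i3 by (simp add: A_def)
      also have "(LINT x|M. avg k x * (\<Phi> (s, x) \<bullet> W x)) \<le> \<Lambda> * G"
        using elim(3)[rule_format, OF wg g0] by (simp add: G_def)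
      also have "(LINT x|M. (u s x - avg k x) * (\<Phi> (s, x) \<bullet> W x)) \<le> (LINT x|M. 2 * \<sigma>\<^sup>2 * (Y x * (norm (avg_grad k x))\<^sup>2) + K * (u s x - avg k x)\<^sup>2)"
      proof (rule integral_mono_AE[OF i2])
        show "integrable M (\<lambda>x. 2 * \<sigma>\<^sup>2 * (Y x * (norm (avg_grad k x))\<^sup>2) + K * (u s x - avg k x)\<^sup>2)"
          using EI iR by simp
        show "AE x in M. (u s x - avg k x) * (\<Phi> (s, x) \<bullet> W x) \<le> 2 * \<sigma>\<^sup>2 * (Y x * (norm (avg_grad k x))\<^sup>2) + K * (u s x - avg k x)\<^sup>2"
          using PW AE_space
        proof eventually_elim
          case (elim x)
          define d where "d = \<bar>u s x - avg k x\<bar>"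
          define n where "n = norm (avg_grad k x)"
          have y: "0 \<le> Y x" "Y x \<le> c" using elim(2) Y0 Yc by auto
          have s2: "\<sigma>\<^sup>2 > 0" using \<sigma> by simp
          have "(u s x - avg k x) * (\<Phi> (s, x) \<bullet> W x) \<le> d * \<bar>\<Phi> (s, x) \<bullet> W x\<bar>"
            unfolding d_def by (metis abs_ge_self abs_mult)
          also have "\<dots> \<le> d * (L * norm (W x))" by (rule mult_left_mono[OF elim(1)]) (simp add: d_def)
          also have "\<dots> = Y x * (2 * n * (L * d))" by (simp add: nW n_def)
          \<comment> \<open>the weight \<open>2 \<sigma>\<^sup>2\<close> makes the gradient term cancel the diffusive one\<close>
          also have "\<dots> \<le> Y x * (2 * \<sigma>\<^sup>2 * n\<^sup>2 + (L * d)\<^sup>2 / (2 * \<sigma>\<^sup>2))"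
          proof (rule mult_left_mono[OF _ y(1)])
            show "2 * n * (L * d) \<le> 2 * \<sigma>\<^sup>2 * n\<^sup>2 + (L * d)\<^sup>2 / (2 * \<sigma>\<^sup>2)"
              by (rule Young_weighted) (use s2 in simp)
          qed
          also have "\<dots> = 2 * \<sigma>\<^sup>2 * (Y x * n\<^sup>2) + Y x * ((L * d)\<^sup>2 / (2 * \<sigma>\<^sup>2))" by (simp add: algebra_simps)
          also have "Y x * ((L * d)\<^sup>2 / (2 * \<sigma>\<^sup>2)) \<le> c * ((L * d)\<^sup>2 / (2 * \<sigma>\<^sup>2))" by (rule mult_right_mono[OF y(2)]) simp
          also have "c * ((L * d)\<^sup>2 / (2 * \<sigma>\<^sup>2)) = K * (u s x - avg k x)\<^sup>2" by (simp add: K_def d_def power_mult_distrib)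
          finally show ?case by (simp add: n_def)
        qed
      qed
      also have "(LINT x|M. 2 * \<sigma>\<^sup>2 * (Y x * (norm (avg_grad k x))\<^sup>2) + K * (u s x - avg k x)\<^sup>2) = 2 * \<sigma>\<^sup>2 * E + K * R s"
        using EI iR by (simp add: E_def R_def)
      finally show ?case by simp
    qed
  qed
  have kA: "integrable (N \<Otimes>\<^sub>M M) (\<lambda>(s, x). k s * (U (s, x) \<bullet> W x))"
    using integrable_bounded_mult[OF U_inner_integrable[OF Wm W2], of "\<lambda>p. k (fst p)" B] k_abs by (simp add: case_prod_beta')
  have kq: "integrable (N \<Otimes>\<^sub>M M) (\<lambda>(s, x). k s * ((\<sigma>\<^sup>2 *\<^sub>R U (s, x) + u s x *\<^sub>R \<Phi> (s, x)) \<bullet> W x))"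
    using integrable_bounded_mult[OF flux_integrable[OF Wm W2 \<Phi>], of "\<lambda>p. k (fst p)" B] k_abs by (simp add: case_prod_beta')
  have kR: "integrable (N \<Otimes>\<^sub>M M) (\<lambda>(s, x). k s * (u s x - avg k x)\<^sup>2)"
  proof (rule P.integrable_const_bound[where B = "B * C\<^sup>2"])
    show "AE p in N \<Otimes>\<^sub>M M. norm (case p of (s, x) \<Rightarrow> k s * (u s x - avg k x)\<^sup>2) \<le> B * C\<^sup>2"
    proof (rule AE_I2)
      fix p assume "p \<in> space (N \<Otimes>\<^sub>M M)"
      then obtain s x where p: "p = (s, x)" "s \<in> space N" "x \<in> \<Omega>" by (auto simp: space_pair_measure)
      have "\<bar>u s x - avg k x\<bar> \<le> C" using u_bounds[OF p(2,3)] avg_bounds[OF p(3)] by auto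
      from power_mono[OF this, of 2] have "(u s x - avg k x)\<^sup>2 \<le> C\<^sup>2" by simp
      then have "k s * (u s x - avg k x)\<^sup>2 \<le> B * C\<^sup>2" using k_bounds[of s] by (intro mult_mono) auto
      then show "norm (case p of (s, x) \<Rightarrow> k s * (u s x - avg k x)\<^sup>2) \<le> B * C\<^sup>2" using k_bounds(1)[of s] by (simp add: p)
    qed
  qed (simp add: case_prod_beta')
  have iA: "integrable N (\<lambda>s. k s * A s)" using NM.integrable_fst[OF kA] by (simp add: A_def)
  have iq: "integrable N (\<lambda>s. k s * q s)" using NM.integrable_fst[OF kq] by (simp add: q_def)
  have iR: "integrable N (\<lambda>s. k s * R s)" using NM.integrable_fst[OF kR] by (simp add: R_def)
  have "(LINT s|N. k s * q s) \<le> (LINT s|N. \<sigma>\<^sup>2 * (k s * A s) + (2 * \<sigma>\<^sup>2 * E + \<Lambda> * G) * k s + K * (k s * R s))"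
  proof (rule integral_mono_AE[OF iq])
    show "integrable N (\<lambda>s. \<sigma>\<^sup>2 * (k s * A s) + (2 * \<sigma>\<^sup>2 * E + \<Lambda> * G) * k s + K * (k s * R s))"
      using iA iR k_integrable by simp
    show "AE s in N. k s * q s \<le> \<sigma>\<^sup>2 * (k s * A s) + (2 * \<sigma>\<^sup>2 * E + \<Lambda> * G) * k s + K * (k s * R s)"
      using est
    proof eventually_elim
      case (elim s)
      from mult_left_mono[OF this k_bounds(1)[of s]] show ?case by (simp add: algebra_simps)
    qed
  qed
  also have "\<dots> = \<sigma>\<^sup>2 * (LINT s|N. k s * A s) + (2 * \<sigma>\<^sup>2 * E + \<Lambda> * G) + K * (LINT s|N. k s * R s)"
    using iA iR k_integrable k_integral by simp
  also have "(LINT s|N. k s * A s) = - 2 * E"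
  proof -
    have "(LINT s|N. k s * A s) = (LINT s|N. LINT x|M. k s * (U (s, x) \<bullet> W x))" by (simp add: A_def)
    also have "\<dots> = (LINT x|M. LINT s|N. k s * (U (s, x) \<bullet> W x))" by (rule NM.Fubini_integral[OF kA, symmetric])
    also have "\<dots> = (LINT x|M. avg_grad k x \<bullet> W x)"
    proof (rule integral_AE_cong_lebesgue[OF Omega_lebesgue])
      have "AE x in M. integrable N (\<lambda>s. k s *\<^sub>R U (s, x))"
        using NM.AE_integrable_snd[of "\<lambda>s x. k s *\<^sub>R U (s, x)"] kU_integrable by (simp add: case_prod_beta')
      then show "AE x in M. (LINT s|N. k s * (U (s, x) \<bullet> W x)) = avg_grad k x \<bullet> W x"
      proof eventually_elim
        case (elim x)
        from integral_inner_left[OF this, of "W x"] show ?case by (simp add: avg_grad_def)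
      qed
    qed
    also have "\<dots> = (LINT x|M. - 2 * (Y x * (norm (avg_grad k x))\<^sup>2))"
      by (simp add: W_def power2_norm_eq_inner mult.assoc)
    also have "\<dots> = - 2 * E" by (simp add: E_def)
    finally show ?thesis .
  qed
  also have "(LINT s|N. k s * R s) = (LINT x|M. LINT s|N. k s * (u s x - avg k x)\<^sup>2)"
    using NM.Fubini_integral[OF kR] by (simp add: R_def)
  finally have "(LINT s|N. k s * q s) \<le> \<Lambda> * G + K * (LINT x|M. LINT s|N. k s * (u s x - avg k x)\<^sup>2)" by simp
  then show "(LINT s|N. k s * (LINT x|M. (\<sigma>\<^sup>2 *\<^sub>R U (s, x) + u s x *\<^sub>R \<Phi> (s, x)) \<bullet> wgrad \<Omega> (\<lambda>x. (Y x)\<^sup>2) x))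
      \<le> \<Lambda> * (LINT x|M. c * (Y x)\<^sup>2 - 2 / 3 * (Y x) ^ 3)
        + c * L\<^sup>2 / (2 * \<sigma>\<^sup>2) * (LINT x|M. LINT s|N. k s * (u s x - avg k x)\<^sup>2)"
    unfolding qeq G_def g_def K_def .
qed

end

end

section \<open>Comparison with an exponential barrier\<close>

lemma measurable_pair_identity:
  "(\<lambda>p. p) \<in> lebesgue_on S \<Otimes>\<^sub>M lebesgue_on R \<rightarrow>\<^sub>M (borel :: ('a::euclidean_space \<times> 'b::euclidean_space) measure)"
proof -
  have "(\<lambda>x. x) \<in> lebesgue_on S \<rightarrow>\<^sub>M borel" "(\<lambda>x. x) \<in> lebesgue_on R \<rightarrow>\<^sub>M borel"
    by (intro continuous_imp_measurable_lebesgue_on continuous_on_id)+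
  then have "(\<lambda>p. (fst p, snd p)) \<in> lebesgue_on S \<Otimes>\<^sub>M lebesgue_on R \<rightarrow>\<^sub>M borel \<Otimes>\<^sub>M borel"
    by (intro measurable_Pair measurable_compose[OF measurable_fst] measurable_compose[OF measurable_snd])
  then show ?thesis by (simp add: borel_prod)
qed

lemma continuous_on_Times_measurable:
  fixes f :: "'a::euclidean_space \<times> 'b::euclidean_space \<Rightarrow> real"
  assumes S: "S \<in> sets borel" "R \<in> sets borel" and f: "continuous_on (S \<times> R) f"
  shows "f \<in> borel_measurable (lebesgue_on S \<Otimes>\<^sub>M lebesgue_on R)"
proof -
  have "S \<times> R \<in> sets (borel \<Otimes>\<^sub>M borel)" using S by simp
  then have "S \<times> R \<in> sets borel" by (simp only: borel_prod)
  then have "(\<lambda>p. indicator (S \<times> R) p *\<^sub>R f p) \<in> borel_measurable borel"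
    by (rule borel_measurable_continuous_on_indicator[OF _ f])
  from measurable_compose[OF measurable_pair_identity this]
  have "(\<lambda>p. indicator (S \<times> R) p *\<^sub>R f p) \<in> borel_measurable (lebesgue_on S \<Otimes>\<^sub>M lebesgue_on R)" .
  then show ?thesis
    by (rule measurable_cong[THEN iffD1, rotated]) (auto simp: space_pair_measure)
qed

text \<open>What the comparison argument needs to know about a solution: the drift \<open>\<Phi>\<close> satisfies the one-sided
bound on its divergence in weak form, and the equation for \<open>u\<close> holds integrated over \<open>{0..t}\<close> against
every \<open>w\<close> in \<open>H\<^sup>1\<close>, where \<open>P0 w\<close> is the integral of the initial datum against \<open>w\<close>.\<close>

locale time_evolution = evolution \<Omega> "lebesgue_on {0..T}" u U C
  for \<Omega> :: "'a::euclidean_space set" and T :: real and u :: "real \<Rightarrow> 'a \<Rightarrow> real" and U :: "real \<times> 'a \<Rightarrow> 'a" and C :: real +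
  fixes \<Phi> :: "real \<times> 'a \<Rightarrow> 'a" and \<sigma> b \<Lambda> L :: real and P0 :: "('a \<Rightarrow> real) \<Rightarrow> real"
  assumes T: "T > 0" and \<sigma>: "\<sigma> > 0" and b: "b > 0" and \<Lambda>: "\<Lambda> \<ge> 0" and L: "L \<ge> 0"
    and u_continuous: "continuous_on ({0..T} \<times> \<Omega>) (\<lambda>(t, x). u t x)"
    and \<Phi>_measurable: "\<Phi> \<in> borel_measurable (lebesgue_on {0..T} \<Otimes>\<^sub>M lebesgue_on \<Omega>)"
    and \<Phi>_bound: "AE p in lebesgue_on {0..T} \<Otimes>\<^sub>M lebesgue_on \<Omega>. norm (\<Phi> p) \<le> L"
    and elliptic: "AE s in lebesgue_on {0..T}. \<forall>g W Bg. weak_gradient g W \<longrightarrow> (AE x in lebesgue_on \<Omega>. 0 \<le> g x \<and> g x \<le> Bg) \<longrightarrow>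
      (LINT x|lebesgue_on \<Omega>. \<Phi> (s, x) \<bullet> W x) \<le> \<Lambda> * (LINT x|lebesgue_on \<Omega>. g x)"
    and balance: "\<And>w t. w \<in> H_space 1 \<Omega> \<Longrightarrow> t \<in> {0..T} \<Longrightarrow>
      (LINT x|lebesgue_on \<Omega>. u t x * w x) + (LINT s|lebesgue_on {0..T}. indicator {0..t} s *
        (LINT x|lebesgue_on \<Omega>. (\<sigma>\<^sup>2 *\<^sub>R U (s, x) + u s x *\<^sub>R \<Phi> (s, x)) \<bullet> wgrad \<Omega> w x)) = P0 w"
    and initial: "\<And>x. x \<in> \<Omega> \<Longrightarrow> b \<le> u 0 x"
begin

abbreviation I :: "real measure" where "I \<equiv> lebesgue_on {0..T}"

lemma id_time_measurable [measurable]: "(\<lambda>t. t) \<in> borel_measurable (lebesgue_on S)" for S :: "real set"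
  by (intro continuous_imp_measurable_lebesgue_on continuous_on_id)

definition barrier :: "real \<Rightarrow> real" where "barrier t = b * exp (- \<Lambda> * t)"

lemma barrier_pos: "0 < barrier t" using b by (simp add: barrier_def)
lemma barrier_le: "0 \<le> t \<Longrightarrow> barrier t \<le> b" using b \<Lambda> by (simp add: barrier_def)
lemma barrier_DERIV: "(barrier has_real_derivative - \<Lambda> * barrier t) (at t within S)"
  unfolding barrier_def[abs_def] by (auto intro!: derivative_eq_intros)
lemma barrier_continuous: "continuous_on S barrier"
  unfolding barrier_def[abs_def] by (intro continuous_intros)
lemma barrier_measurable [measurable]: "barrier \<in> borel_measurable borel"
  by (rule borel_measurable_continuous_onI[OF barrier_continuous])

text \<open>The window is half open, so that integration against it is an exact difference quotient of integrals
over \<open>{0..t}\<close>. It looks ahead in time, which keeps time \<open>0\<close> available.\<close>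

definition time_kernel :: "real \<Rightarrow> real \<Rightarrow> real \<Rightarrow> real" where
  "time_kernel h t s = (if t < s \<and> s \<le> t + h then 1 / h else 0)"

lemma u_continuous_time: "x \<in> \<Omega> \<Longrightarrow> continuous_on {0..T} (\<lambda>t. u t x)"
  by (rule continuous_on_compose2[OF u_continuous, of _ "\<lambda>t. (t, x)", simplified]) (auto intro!: continuous_intros)

lemma time_kernel_measurable [measurable]: "time_kernel h t \<in> borel_measurable I"
  unfolding time_kernel_def[abs_def] by measurable

lemma time_kernel_bounds: "h > 0 \<Longrightarrow> 0 \<le> time_kernel h t s" "h > 0 \<Longrightarrow> time_kernel h t s \<le> 1 / h"
  by (auto simp: time_kernel_def)

lemma time_kernel_indicator: "s \<in> {0..T} \<Longrightarrow> 0 \<le> t \<Longrightarrow> h > 0 \<Longrightarrow> time_kernel h t s = (indicator {0..t + h} s - indicator {0..t} s) / h"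
  by (auto simp: time_kernel_def split: split_indicator)

lemma indicator_integrable:
  assumes "integrable I f"
  shows "integrable I (\<lambda>s. indicator {0..t} s * f s :: real)"
proof (rule integrable_bounded_mult[OF assms, where C = 1])
  show "indicat_real {0..t} \<in> borel_measurable I"
    by (intro measurable_restrict_space1 borel_measurable_indicator) auto
qed (auto split: split_indicator)

lemma time_kernel_integral_eq:
  assumes h: "h > 0" "0 \<le> t" "t + h \<le> T" and f: "integrable I f"
  shows "(LINT s|I. time_kernel h t s * f s) = ((LINT s|I. indicator {0..t + h} s * f s) - (LINT s|I. indicator {0..t} s * f s)) / h"
proof -
  have "(LINT s|I. time_kernel h t s * f s) = (LINT s|I. (indicator {0..t + h} s * f s - indicator {0..t} s * f s) / h)"
    by (rule Bochner_Integration.integral_cong) (use h in \<open>auto simp: time_kernel_indicator left_diff_distrib\<close>)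
  also have "\<dots> = ((LINT s|I. indicator {0..t + h} s * f s) - (LINT s|I. indicator {0..t} s * f s)) / h"
    by (simp add: Bochner_Integration.integral_diff[OF indicator_integrable[OF f] indicator_integrable[OF f]])
  finally show ?thesis .
qed

lemma indicator_integral: "0 \<le> t \<Longrightarrow> t \<le> T \<Longrightarrow> (LINT s|I. indicator {0..t} s * f s) = (LINT s|lebesgue_on {0..t}. f s :: real)"
  by (rule integral_lebesgue_on_indicator) auto

lemma time_kernel_integral:
  assumes h: "h > 0" "0 \<le> t" "t + h \<le> T"
  shows "(LINT s|I. time_kernel h t s) = 1"
proof -
  have "(LINT s|I. time_kernel h t s) = (LINT s|I. time_kernel h t s * 1)" by simp
  also have "\<dots> = ((t + h) - t) / h"
    using time_kernel_integral_eq[OF h, of "\<lambda>s. 1"] h by (simp add: indicator_integral measure_restrict_space)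
  finally show ?thesis using h by simp
qed

definition steklov :: "real \<Rightarrow> real \<Rightarrow> 'a \<Rightarrow> real" where "steklov h t x = avg (time_kernel h t) x"
definition deficit :: "real \<Rightarrow> real \<Rightarrow> 'a \<Rightarrow> real" where "deficit h t x = max 0 (barrier t - steklov h t x)"
definition fluctuation :: "real \<Rightarrow> real \<Rightarrow> 'a \<Rightarrow> real" where "fluctuation h t x = (LINT s|I. time_kernel h t s * (u s x - steklov h t x)\<^sup>2)"

lemma steklov_bounds:
  assumes "h > 0" "0 \<le> t" "t + h \<le> T" "x \<in> \<Omega>"
  shows "0 \<le> steklov h t x" "steklov h t x \<le> C"
  using avg_bounds[OF time_kernel_measurable time_kernel_bounds[OF assms(1)] time_kernel_integral[OF assms(1-3)] assms(4)] by (auto simp: steklov_def)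

lemma deficit_bounds:
  assumes "h > 0" "0 \<le> t" "t + h \<le> T" "x \<in> \<Omega>"
  shows "0 \<le> deficit h t x" "deficit h t x \<le> b"
  using steklov_bounds[OF assms] barrier_le[OF assms(2)] b by (auto simp: deficit_def)

text \<open>The difference quotient of \<open>u\<close> is the time derivative of its Steklov average, so the left-hand side
is the time derivative of \<open>\<integral> (deficit h t)\<^sup>3 / 3\<close>. The balance law turns it into the averaged flux
against the gradient of the squared deficit. The decay rate of the barrier cancels the contribution
\<open>\<Lambda> c Y\<^sup>2\<close> of the drift, and the leftover \<open>- (2/3) \<Lambda> Y\<^sup>3\<close> has a favourable sign.\<close>

lemma energy_rate:
  assumes h: "h > 0" "0 \<le> t" "t + h \<le> T"
  shows "(LINT x|M. (deficit h t x)\<^sup>2 * (- \<Lambda> * barrier t - (u (t + h) x - u t x) / h)) \<le> b * L\<^sup>2 / (2 * \<sigma>\<^sup>2) * (LINT x|M. fluctuation h t x)"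
proof -
  define w where "w x = (deficit h t x)\<^sup>2" for x
  note kf = time_kernel_measurable[of h t] time_kernel_bounds[OF h(1), of t] time_kernel_integral[OF h]
  note est = averaged_flux_estimate[OF kf \<sigma> barrier_pos[of t] L \<Phi>_measurable \<Phi>_bound elliptic, folded steklov_def, folded deficit_def]
  have H: "w \<in> H_space 1 \<Omega>" using est(1) by (simp add: w_def[abs_def])
  note Hg = H_space_gradient[OF H order_refl]
  have [measurable]: "w \<in> borel_measurable M" "wgrad \<Omega> w \<in> borel_measurable M" using weak_gradientD(1,2)[OF Hg(1)] by auto
  have wi: "integrable M w" using weak_gradientD(1)[OF Hg(1)] .
  define q where "q s = (LINT x|M. (\<sigma>\<^sup>2 *\<^sub>R U (s, x) + u s x *\<^sub>R \<Phi> (s, x)) \<bullet> wgrad \<Omega> w x)" for s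
  have qi: "integrable I q"
    using NM.integrable_fst'[OF flux_integrable[OF _ Hg(3) \<Phi>_measurable \<Phi>_bound, of "\<sigma>\<^sup>2"]] by (simp add: q_def[abs_def])
  have tI: "t \<in> {0..T}" "t + h \<in> {0..T}" using h by auto
  have uw: "integrable M (\<lambda>x. u s x * w x)" if "s \<in> {0..T}" for s
    by (rule integrable_bounded_mult[OF wi u_time_section, where C = C]) (use u_bounds that in \<open>auto intro!: AE_I2\<close>)
  have diff: "(LINT x|M. u (t + h) x * w x) - (LINT x|M. u t x * w x) = - (h * (LINT s|I. time_kernel h t s * q s))"
  proof -
    have "h * (LINT s|I. time_kernel h t s * q s) = (LINT s|I. indicator {0..t + h} s * q s) - (LINT s|I. indicator {0..t} s * q s)"
      using time_kernel_integral_eq[OF h qi] h(1) by simp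
    then show ?thesis
      using balance[OF H tI(1), folded q_def] balance[OF H tI(2), folded q_def] by linarith
  qed
  have K: "(LINT s|I. time_kernel h t s * q s) \<le> \<Lambda> * (LINT x|M. barrier t * (deficit h t x)\<^sup>2 - 2 / 3 * (deficit h t x) ^ 3)
        + barrier t * L\<^sup>2 / (2 * \<sigma>\<^sup>2) * (LINT x|M. fluctuation h t x)"
    using est(2) by (simp add: q_def w_def[abs_def] fluctuation_def)
  have r0: "0 \<le> (LINT x|M. fluctuation h t x)"
    by (intro Bochner_Integration.integral_nonneg) (auto simp: fluctuation_def intro!: Bochner_Integration.integral_nonneg mult_nonneg_nonneg time_kernel_bounds h)
  have Yb: "AE x in M. 0 \<le> deficit h t x \<and> deficit h t x \<le> b" using deficit_bounds[OF h] by (intro AE_I2) auto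
  have am [measurable]: "steklov h t \<in> borel_measurable M" unfolding steklov_def[abs_def] by (rule avg_measurable[OF kf])
  have Ym [measurable]: "deficit h t \<in> borel_measurable M" unfolding deficit_def[abs_def] by measurable
  have Y3: "integrable M (\<lambda>x. (deficit h t x) ^ 3)"
    by (rule integrable_bounded[where C = "b ^ 3"]) (use deficit_bounds[OF h] in \<open>auto intro!: AE_I2 power_mono\<close>)
  have Y30: "0 \<le> (LINT x|M. (deficit h t x) ^ 3)" by (intro Bochner_Integration.integral_nonneg) (auto simp: deficit_def)
  have "(LINT x|M. (deficit h t x)\<^sup>2 * (- \<Lambda> * barrier t - (u (t + h) x - u t x) / h))
      = (LINT x|M. - \<Lambda> * barrier t * w x - (u (t + h) x * w x - u t x * w x) / h)"
    by (rule arg_cong[where f = "integral\<^sup>L M"], rule ext) (simp add: w_def field_simps)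
  also have "\<dots> = - \<Lambda> * barrier t * (LINT x|M. w x) - ((LINT x|M. u (t + h) x * w x) - (LINT x|M. u t x * w x)) / h"
    using wi uw[OF tI(1)] uw[OF tI(2)] by simp
  also have "\<dots> = - \<Lambda> * barrier t * (LINT x|M. w x) + (LINT s|I. time_kernel h t s * q s)"
    unfolding diff using h(1) by simp
  also have "\<dots> \<le> - \<Lambda> * barrier t * (LINT x|M. w x) + (\<Lambda> * (LINT x|M. barrier t * (deficit h t x)\<^sup>2 - 2 / 3 * (deficit h t x) ^ 3)
        + barrier t * L\<^sup>2 / (2 * \<sigma>\<^sup>2) * (LINT x|M. fluctuation h t x))"
    using K by simp
  also have "(LINT x|M. barrier t * (deficit h t x)\<^sup>2 - 2 / 3 * (deficit h t x) ^ 3) = barrier t * (LINT x|M. w x) - 2 / 3 * (LINT x|M. (deficit h t x) ^ 3)"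
    using wi Y3 by (simp add: w_def[symmetric])
  also have "- \<Lambda> * barrier t * (LINT x|M. w x) + (\<Lambda> * (barrier t * (LINT x|M. w x) - 2 / 3 * (LINT x|M. (deficit h t x) ^ 3))
        + barrier t * L\<^sup>2 / (2 * \<sigma>\<^sup>2) * (LINT x|M. fluctuation h t x))
      = barrier t * L\<^sup>2 / (2 * \<sigma>\<^sup>2) * (LINT x|M. fluctuation h t x) - \<Lambda> * (2 / 3 * (LINT x|M. (deficit h t x) ^ 3))"
    by (simp add: algebra_simps)
  also have "\<dots> \<le> barrier t * L\<^sup>2 / (2 * \<sigma>\<^sup>2) * (LINT x|M. fluctuation h t x)"
    using \<Lambda> Y30 by simp
  also have "\<dots> \<le> b * L\<^sup>2 / (2 * \<sigma>\<^sup>2) * (LINT x|M. fluctuation h t x)"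
    using barrier_le[OF h(2)] r0 by (intro mult_right_mono divide_right_mono) auto
  finally show ?thesis .
qed

lemma steklov_eq: "steklov h t x = (LINT s|I. time_kernel h t s * u s x)"
  by (simp add: steklov_def avg_def)

lemma time_kernel_pair_measurable:
  "(\<lambda>q. time_kernel h (fst (fst q)) (snd q)) \<in> borel_measurable ((lebesgue_on S \<Otimes>\<^sub>M M) \<Otimes>\<^sub>M I)"
proof -
  have [measurable]: "(\<lambda>q. fst (fst q)) \<in> borel_measurable ((lebesgue_on S \<Otimes>\<^sub>M M) \<Otimes>\<^sub>M I)"
    by (rule measurable_compose[OF measurable_fst measurable_compose[OF measurable_fst id_time_measurable]])
  have [measurable]: "(\<lambda>q. snd q) \<in> borel_measurable ((lebesgue_on S \<Otimes>\<^sub>M M) \<Otimes>\<^sub>M I)"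
    by (rule measurable_compose[OF measurable_snd id_time_measurable])
  show ?thesis unfolding time_kernel_def by measurable
qed

lemma u_pair_measurable:
  "(\<lambda>q. u (snd q) (snd (fst q))) \<in> borel_measurable ((lebesgue_on S \<Otimes>\<^sub>M M) \<Otimes>\<^sub>M I)"
proof -
  have "(\<lambda>q. (snd q, snd (fst q))) \<in> (lebesgue_on S \<Otimes>\<^sub>M M) \<Otimes>\<^sub>M I \<rightarrow>\<^sub>M I \<Otimes>\<^sub>M M" by measurable
  from measurable_compose[OF this u_measurable] show ?thesis by simp
qed

lemma steklov_pair_measurable: "(\<lambda>p. steklov h (fst p) (snd p)) \<in> borel_measurable (lebesgue_on S \<Otimes>\<^sub>M M)"
  unfolding steklov_eq
  by (rule N.borel_measurable_lebesgue_integral)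
    (use borel_measurable_times[OF time_kernel_pair_measurable u_pair_measurable] in \<open>simp add: case_prod_beta'\<close>)

lemma fluctuation_pair_measurable: "(\<lambda>p. fluctuation h (fst p) (snd p)) \<in> borel_measurable (lebesgue_on S \<Otimes>\<^sub>M M)"
  unfolding fluctuation_def
proof (rule N.borel_measurable_lebesgue_integral)
  have "(\<lambda>q. steklov h (fst (fst q)) (snd (fst q))) \<in> borel_measurable ((lebesgue_on S \<Otimes>\<^sub>M M) \<Otimes>\<^sub>M I)"
    using measurable_compose[OF measurable_fst steklov_pair_measurable] .
  note [measurable] = this time_kernel_pair_measurable u_pair_measurable
  have "(\<lambda>q. time_kernel h (fst (fst q)) (snd q) * (u (snd q) (snd (fst q)) - steklov h (fst (fst q)) (snd (fst q)))\<^sup>2)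
    \<in> borel_measurable ((lebesgue_on S \<Otimes>\<^sub>M M) \<Otimes>\<^sub>M I)" by measurable
  then show "(\<lambda>(p, s). time_kernel h (fst p) s * (u s (snd p) - steklov h (fst p) (snd p))\<^sup>2)
    \<in> borel_measurable ((lebesgue_on S \<Otimes>\<^sub>M M) \<Otimes>\<^sub>M I)" by (simp add: case_prod_beta')
qed

lemma fluctuation_bounds:
  assumes h: "h > 0" "0 \<le> t" "t + h \<le> T" and x: "x \<in> \<Omega>" and d: "\<And>s. t < s \<Longrightarrow> s \<le> t + h \<Longrightarrow> \<bar>u s x - steklov h t x\<bar> \<le> d"
  shows "0 \<le> fluctuation h t x" "fluctuation h t x \<le> d\<^sup>2"
proof -
  have um [measurable]: "(\<lambda>s. u s x) \<in> borel_measurable I" by (rule u_section[OF x])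
  have le: "time_kernel h t s * (u s x - steklov h t x)\<^sup>2 \<le> time_kernel h t s * d\<^sup>2" for s
  proof (cases "t < s \<and> s \<le> t + h")
    case True
    then have "(u s x - steklov h t x)\<^sup>2 \<le> d\<^sup>2" using power_mono[OF d abs_ge_zero, of s 2] by simp
    then show ?thesis using time_kernel_bounds[OF h(1)] by (intro mult_left_mono)
  qed (auto simp: time_kernel_def)
  have ki: "integrable I (\<lambda>s. time_kernel h t s * d\<^sup>2)"
    by (rule N.integrable_const_bound[where B = "1 / h * d\<^sup>2"])
      (use mult_right_mono[OF time_kernel_bounds(2)[OF h(1)] zero_le_power2[of d]] time_kernel_bounds[OF h(1)] in \<open>auto simp: abs_mult\<close>)
  show "0 \<le> fluctuation h t x" unfolding fluctuation_def
    by (intro Bochner_Integration.integral_nonneg mult_nonneg_nonneg time_kernel_bounds h) auto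
  have "fluctuation h t x \<le> (LINT s|I. time_kernel h t s * d\<^sup>2)"
    unfolding fluctuation_def
  proof (rule integral_mono[OF _ ki le])
    show "integrable I (\<lambda>s. time_kernel h t s * (u s x - steklov h t x)\<^sup>2)"
    proof (rule Bochner_Integration.integrable_bound[OF ki])
      show "AE s in I. norm (time_kernel h t s * (u s x - steklov h t x)\<^sup>2) \<le> norm (time_kernel h t s * d\<^sup>2)"
        using le time_kernel_bounds[OF h(1)] by (intro AE_I2) simp
    qed measurable
  qed
  also have "\<dots> = d\<^sup>2" using time_kernel_integral[OF h] by simp
  finally show "fluctuation h t x \<le> d\<^sup>2" .
qed

lemma steklov_close:
  assumes h: "h > 0" "0 \<le> t" "t + h \<le> T" and x: "x \<in> \<Omega>" and d: "\<And>s. t < s \<Longrightarrow> s \<le> t + h \<Longrightarrow> \<bar>u s x - u t x\<bar> \<le> d"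
  shows "\<bar>steklov h t x - u t x\<bar> \<le> d" "0 \<le> fluctuation h t x" "fluctuation h t x \<le> (2 * d)\<^sup>2"
proof -
  note kf = time_kernel_measurable[of h t] time_kernel_bounds[OF h(1), of t] time_kernel_integral[OF h]
  have ku: "integrable I (\<lambda>s. time_kernel h t s * u s x)" by (rule ku_integrable[OF kf x])
  have ki: "integrable I (time_kernel h t)" by (rule k_integrable[OF kf])
  have "steklov h t x - u t x = (LINT s|I. time_kernel h t s * u s x - time_kernel h t s * u t x)"
    using ku ki kf(4) by (simp add: steklov_eq)
  also have "norm \<dots> \<le> (LINT s|I. time_kernel h t s * d)"
  proof (rule integral_norm_le_AE)
    show "AE s in I. norm (time_kernel h t s * u s x - time_kernel h t s * u t x) \<le> time_kernel h t s * d"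
    proof (rule AE_I2)
      fix s
      show "norm (time_kernel h t s * u s x - time_kernel h t s * u t x) \<le> time_kernel h t s * d"
        using d[of s] h by (auto simp: time_kernel_def diff_divide_distrib[symmetric] divide_right_mono)
    qed
  qed (use ku ki in auto)
  also have "\<dots> = d" using kf(4) by simp
  finally show c: "\<bar>steklov h t x - u t x\<bar> \<le> d" by simp
  have "\<bar>u s x - steklov h t x\<bar> \<le> 2 * d" if "t < s" "s \<le> t + h" for s
    using c d[OF that] by linarith
  then show "0 \<le> fluctuation h t x" "fluctuation h t x \<le> (2 * d)\<^sup>2" using fluctuation_bounds[OF h x] by blast+
qed

lemma fluctuation_bounded:
  assumes h: "h > 0" "0 \<le> t" "t + h \<le> T" and x: "x \<in> \<Omega>"
  shows "0 \<le> fluctuation h t x" "fluctuation h t x \<le> C\<^sup>2"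
proof -
  have "\<bar>u s x - steklov h t x\<bar> \<le> C" if "t < s" "s \<le> t + h" for s
    using u_bounds[of s x] steklov_bounds[OF h x] that h x by auto
  then show "0 \<le> fluctuation h t x" "fluctuation h t x \<le> C\<^sup>2" using fluctuation_bounds[OF h x] by blast+
qed

text \<open>At a fixed point \<open>x\<close> everything is classical: \<open>u\<close> is continuous in time, so its Steklov average is
continuously differentiable.\<close>

lemma energy_identity_pointwise:
  assumes h: "h > 0" "0 \<le> \<tau>" "\<tau> + h \<le> T" and x: "x \<in> \<Omega>"
  shows "(LINT t|lebesgue_on {0..\<tau>}. (deficit h t x)\<^sup>2 * (- \<Lambda> * barrier t - (u (t + h) x - u t x) / h))
    = (deficit h \<tau> x) ^ 3 / 3 - (deficit h 0 x) ^ 3 / 3"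
proof -
  \<comment> \<open>an antiderivative of \<open>u\<close> in time; the Steklov average is its difference quotient\<close>
  define V where "V s = integral {0..s} (\<lambda>s. u s x)" for s
  have cu: "continuous_on {0..T} (\<lambda>s. u s x)" by (rule u_continuous_time[OF x])
  have ui: "integrable I (\<lambda>s. u s x)" by (rule continuous_imp_integrable_real[OF cu])
  have aV: "steklov h t x = (V (t + h) - V t) / h" if t: "t \<in> {0..\<tau>}" for t
  proof -
    have V: "(LINT s|I. indicator {0..s'} s * u s x) = V s'" if "s' \<in> {0..T}" for s'
    proof -
      have "integrable (lebesgue_on {0..s'}) (\<lambda>s. u s x)"
        by (rule continuous_imp_integrable_real[OF continuous_on_subset[OF cu]]) (use that in auto)
      then show ?thesis unfolding V_def using that by (simp add: indicator_integral lebesgue_integral_eq_integral)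
    qed
    show ?thesis
      unfolding steklov_eq using t h by (subst time_kernel_integral_eq[OF h(1) _ _ ui]) (auto simp: V)
  qed
  have dV: "(V has_real_derivative u t x) (at t within {0..T})" if "t \<in> {0..T}" for t
    unfolding V_def[abs_def] by (rule integral_has_real_derivative[OF cu that])
  have dVh: "((\<lambda>t. V (t + h)) has_real_derivative u (t + h) x) (at t within {0..\<tau>})" if t: "t \<in> {0..\<tau>}" for t
  proof -
    have "(V has_real_derivative u (t + h) x) (at (t + h) within (\<lambda>t. t + h) ` {0..\<tau>})"
      by (rule has_field_derivative_subset[OF dV]) (use t h in auto)
    moreover have "((\<lambda>t. t + h) has_real_derivative 1) (at t within {0..\<tau>})" by (auto intro!: derivative_eq_intros)
    ultimately have "(V \<circ> (\<lambda>t. t + h) has_real_derivative u (t + h) x * 1) (at t within {0..\<tau>})"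
      by (rule DERIV_image_chain)
    then show ?thesis by (simp add: o_def)
  qed
  have da: "((\<lambda>t. barrier t - (V (t + h) - V t) / h) has_real_derivative (- \<Lambda> * barrier t - (u (t + h) x - u t x) / h)) (at t within {0..\<tau>})"
    if t: "t \<in> {0..\<tau>}" for t
    by (intro DERIV_diff barrier_DERIV DERIV_cdivide dVh t has_field_derivative_subset[OF dV]) (use t h in auto)
  define F where "F t = (max 0 (barrier t - (V (t + h) - V t) / h)) ^ 3 / 3" for t
  have F: "F t = (deficit h t x) ^ 3 / 3" if "t \<in> {0..\<tau>}" for t using aV[OF that] by (simp add: F_def deficit_def)
  define f where "f t = (max 0 (barrier t - (V (t + h) - V t) / h))\<^sup>2 * (- \<Lambda> * barrier t - (u (t + h) x - u t x) / h)" for t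
  have dF: "(F has_real_derivative f t) (at t within {0..\<tau>})" if t: "t \<in> {0..\<tau>}" for t
  proof -
    have "((\<lambda>t. (max 0 (barrier t - (V (t + h) - V t) / h)) ^ 3) has_real_derivative
      3 * (max 0 (barrier t - (V (t + h) - V t) / h))\<^sup>2 * (- \<Lambda> * barrier t - (u (t + h) x - u t x) / h)) (at t within {0..\<tau>})"
      by (rule DERIV_chain2[OF DERIV_max0_cube da[OF t]])
    from DERIV_cdivide[OF this, of 3] show ?thesis
      by (simp add: F_def[abs_def] f_def mult.assoc)
  qed
  have "(f has_integral F \<tau> - F 0) {0..\<tau>}"
    by (rule fundamental_theorem_of_calculus[OF h(2)])
      (use dF in \<open>auto simp: has_real_derivative_iff_has_vector_derivative[symmetric]\<close>)
  then have i: "integral {0..\<tau>} f = F \<tau> - F 0" by (rule integral_unique)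
  have cV: "continuous_on {0..T} V" using dV by (meson DERIV_continuous_on)
  have cf: "continuous_on {0..\<tau>} f"
    unfolding f_def
    by (intro continuous_intros barrier_continuous continuous_on_subset[OF cV] continuous_on_compose2[OF cV]
        continuous_on_compose2[OF cu] continuous_on_subset[OF cu]) (use h in auto)
  have "(LINT t|lebesgue_on {0..\<tau>}. (deficit h t x)\<^sup>2 * (- \<Lambda> * barrier t - (u (t + h) x - u t x) / h)) = (LINT t|lebesgue_on {0..\<tau>}. f t)"
    by (rule Bochner_Integration.integral_cong) (auto simp: f_def deficit_def aV)
  also have "\<dots> = integral {0..\<tau>} f"
    by (rule lebesgue_integral_eq_integral[OF continuous_imp_integrable_real[OF cf]]) simp
  finally show ?thesis using i F[of 0] F[of \<tau>] h by simp
qed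

lemma energy_inequality:
  assumes h: "h > 0" "0 \<le> \<tau>" "\<tau> + h \<le> T"
  shows "(LINT x|M. (deficit h \<tau> x) ^ 3 / 3) \<le> (LINT x|M. (deficit h 0 x) ^ 3 / 3)
    + b * L\<^sup>2 / (2 * \<sigma>\<^sup>2) * (LINT p|(lebesgue_on {0..\<tau>} \<Otimes>\<^sub>M M). fluctuation h (fst p) (snd p))"
proof -
  define J where "J = lebesgue_on {0..\<tau>}"
  interpret J: finite_measure J unfolding J_def by (rule finite_measure_lebesgue_on) auto
  interpret JM: pair_sigma_finite J M ..
  interpret JP: finite_measure "J \<Otimes>\<^sub>M M" by (rule finite_measure_pair_measure[OF finite_measure_axioms J.finite_measure_axioms])
  have space_J: "space J = {0..\<tau>}" by (simp add: J_def)
  have am: "(\<lambda>p. steklov h (fst p) (snd p)) \<in> borel_measurable (J \<Otimes>\<^sub>M M)" unfolding J_def by (rule steklov_pair_measurable)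
  have rm: "(\<lambda>p. fluctuation h (fst p) (snd p)) \<in> borel_measurable (J \<Otimes>\<^sub>M M)" unfolding J_def by (rule fluctuation_pair_measurable)
  have um: "(\<lambda>p. u (fst p) (snd p)) \<in> borel_measurable (J \<Otimes>\<^sub>M M)"
    unfolding J_def
    by (rule continuous_on_Times_measurable) (use u_continuous h open_Omega in \<open>auto simp: case_prod_beta' borel_open intro: continuous_on_subset\<close>)
  have uhm: "(\<lambda>p. u (fst p + h) (snd p)) \<in> borel_measurable (J \<Otimes>\<^sub>M M)"
    unfolding J_def
  proof (rule continuous_on_Times_measurable)
    have "continuous_on ({0..\<tau>} \<times> \<Omega>) (\<lambda>p. (\<lambda>(t, x). u t x) (fst p + h, snd p))"
      by (rule continuous_on_compose2[OF u_continuous]) (use h in \<open>auto intro!: continuous_intros\<close>)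
    then show "continuous_on ({0..\<tau>} \<times> \<Omega>) (\<lambda>p. u (fst p + h) (snd p))" by simp
  qed (use open_Omega in \<open>auto simp: borel_open\<close>)
  have tm: "(\<lambda>p. fst p) \<in> borel_measurable (J \<Otimes>\<^sub>M M)"
    unfolding J_def by (rule measurable_compose[OF measurable_fst id_time_measurable])
  note [measurable] = am rm um uhm tm
  define f where "f t x = (deficit h t x)\<^sup>2 * (- \<Lambda> * barrier t - (u (t + h) x - u t x) / h)" for t x
  have fm: "(\<lambda>p. f (fst p) (snd p)) \<in> borel_measurable (J \<Otimes>\<^sub>M M)"
    unfolding f_def deficit_def by measurable
  have pJ: "fst p \<in> {0..\<tau>}" "snd p \<in> \<Omega>" if "p \<in> space (J \<Otimes>\<^sub>M M)" for p
    using that by (auto simp: space_pair_measure space_J)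
  have fi: "integrable (J \<Otimes>\<^sub>M M) (\<lambda>p. f (fst p) (snd p))"
  proof (rule JP.integrable_const_bound[OF _ fm, where B = "b\<^sup>2 * (\<Lambda> * b + C / h)"])
    show "AE p in J \<Otimes>\<^sub>M M. norm (f (fst p) (snd p)) \<le> b\<^sup>2 * (\<Lambda> * b + C / h)"
    proof (rule AE_I2)
      fix p assume "p \<in> space (J \<Otimes>\<^sub>M M)"
      note p = pJ[OF this]
      have Yb: "0 \<le> deficit h (fst p) (snd p)" "deficit h (fst p) (snd p) \<le> b" using deficit_bounds[OF h(1), of "fst p" "snd p"] p h by auto
      have uu: "\<bar>u (fst p + h) (snd p) - u (fst p) (snd p)\<bar> \<le> C"
        using u_bounds[of "fst p + h" "snd p"] u_bounds[of "fst p" "snd p"] p h by auto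
      have bb: "0 \<le> \<Lambda> * barrier (fst p)" "\<Lambda> * barrier (fst p) \<le> \<Lambda> * b"
        using barrier_le[of "fst p"] barrier_pos[of "fst p"] p \<Lambda> by (auto intro: mult_left_mono)
      have "\<bar>(u (fst p + h) (snd p) - u (fst p) (snd p)) / h\<bar> \<le> C / h"
        using uu h by (simp add: divide_right_mono)
      then have "\<bar>- \<Lambda> * barrier (fst p) - (u (fst p + h) (snd p) - u (fst p) (snd p)) / h\<bar> \<le> \<Lambda> * b + C / h"
        using bb by linarith
      then show "norm (f (fst p) (snd p)) \<le> b\<^sup>2 * (\<Lambda> * b + C / h)"
        unfolding f_def real_norm_def abs_mult using Yb by (intro mult_mono) (auto intro: power_mono)
    qed
  qed
  then have fi': "integrable (J \<Otimes>\<^sub>M M) (\<lambda>(t, x). f t x)" by (simp add: case_prod_beta')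
  have ri: "integrable (J \<Otimes>\<^sub>M M) (\<lambda>p. fluctuation h (fst p) (snd p))"
  proof (rule JP.integrable_const_bound[OF _ rm, where B = "C\<^sup>2"])
    show "AE p in J \<Otimes>\<^sub>M M. norm (fluctuation h (fst p) (snd p)) \<le> C\<^sup>2"
    proof (rule AE_I2)
      fix p assume "p \<in> space (J \<Otimes>\<^sub>M M)"
      note p = pJ[OF this]
      show "norm (fluctuation h (fst p) (snd p)) \<le> C\<^sup>2" using fluctuation_bounded[OF h(1), of "fst p" "snd p"] p h by auto
    qed
  qed
  have Yi: "integrable M (\<lambda>x. (deficit h t x) ^ 3 / 3)" if "0 \<le> t" "t \<le> \<tau>" for t
  proof (rule integrable_bounded[where C = "b ^ 3 / 3"])
    have "t \<in> space J" using that by (simp add: space_J)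
    from measurable_compose[OF measurable_Pair1'[OF this] am] have [measurable]: "steklov h t \<in> borel_measurable M" by simp
    show "(\<lambda>x. (deficit h t x) ^ 3 / 3) \<in> borel_measurable M" unfolding deficit_def by measurable
    show "AE x in M. norm ((deficit h t x) ^ 3 / 3) \<le> b ^ 3 / 3"
      using deficit_bounds[OF h(1) that(1)] that h by (intro AE_I2) (auto intro!: power_mono divide_right_mono)
  qed
  have "(LINT x|M. (deficit h \<tau> x) ^ 3 / 3) - (LINT x|M. (deficit h 0 x) ^ 3 / 3) = (LINT x|M. (deficit h \<tau> x) ^ 3 / 3 - (deficit h 0 x) ^ 3 / 3)"
    by (rule Bochner_Integration.integral_diff[symmetric]) (use Yi h in auto)
  also have "\<dots> = (LINT x|M. LINT t|J. f t x)"
    by (rule Bochner_Integration.integral_cong) (use energy_identity_pointwise[OF h] in \<open>auto simp: f_def J_def\<close>)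
  also have "\<dots> = (LINT t|J. LINT x|M. f t x)" by (rule JM.Fubini_integral[OF fi'])
  also have "\<dots> \<le> (LINT t|J. b * L\<^sup>2 / (2 * \<sigma>\<^sup>2) * (LINT x|M. fluctuation h t x))"
  proof (rule integral_mono)
    show "integrable J (\<lambda>t. LINT x|M. f t x)" using JM.integrable_fst[OF fi'] .
    show "integrable J (\<lambda>t. b * L\<^sup>2 / (2 * \<sigma>\<^sup>2) * (LINT x|M. fluctuation h t x))"
      using JM.integrable_fst'[OF ri] by simp
    show "(LINT x|M. f t x) \<le> b * L\<^sup>2 / (2 * \<sigma>\<^sup>2) * (LINT x|M. fluctuation h t x)" if "t \<in> space J" for t
      unfolding f_def by (rule energy_rate) (use that h in \<open>auto simp: space_J\<close>)
  qed
  also have "\<dots> = b * L\<^sup>2 / (2 * \<sigma>\<^sup>2) * (LINT p|(J \<Otimes>\<^sub>M M). fluctuation h (fst p) (snd p))"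
    using JM.integral_fst'[OF ri] by simp
  finally show ?thesis by (simp add: J_def)
qed

text \<open>As the window shrinks, Steklov averages converge to \<open>u\<close> and fluctuations to \<open>0\<close>, pointwise by
continuity and boundedly; the energy inequality becomes \<open>\<integral> (max 0 (barrier \<tau> - u \<tau>))\<^sup>3 \<le> 0\<close>. The strict
inequality \<open>\<tau> < T\<close> leaves room for the window.\<close>

lemma above_barrier_before_end:
  assumes \<tau>: "0 \<le> \<tau>" "\<tau> < T" and x0: "x0 \<in> \<Omega>"
  shows "barrier \<tau> \<le> u \<tau> x0"
proof -
  define h where "h n = (T - \<tau>) / real (Suc n)" for n
  have h: "h n > 0" "\<tau> + h n \<le> T" for n
  proof -
    show "h n > 0" using \<tau> by (simp add: h_def)
    have "h n \<le> (T - \<tau>) / 1" unfolding h_def using \<tau> by (intro divide_left_mono) auto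
    then show "\<tau> + h n \<le> T" by simp
  qed
  have h0: "h \<longlonglongrightarrow> 0"
    using tendsto_mult_left[OF LIMSEQ_Suc[OF lim_1_over_n], of "T - \<tau>"] by (simp add: h_def[abs_def])
  have small: "eventually (\<lambda>n. \<forall>s. t < s \<longrightarrow> s \<le> t + h n \<longrightarrow> \<bar>u s x - u t x\<bar> \<le> d) sequentially"
    if t: "0 \<le> t" "t \<le> \<tau>" and x: "x \<in> \<Omega>" and d: "d > 0" for t x d
  proof -
    obtain e where e: "e > 0" "\<And>s. s \<in> {0..T} \<Longrightarrow> dist s t < e \<Longrightarrow> dist (u s x) (u t x) < d"
      using u_continuous_time[OF x] t \<tau> d unfolding continuous_on_iff by (metis atLeastAtMost_iff less_imp_le order_trans)
    have "eventually (\<lambda>n. h n < e) sequentially" by (rule order_tendstoD(2)[OF h0 e(1)])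
    then show ?thesis
    proof eventually_elim
      case (elim n)
      show ?case
      proof (intro allI impI)
        fix s assume s: "t < s" "s \<le> t + h n"
        then have "dist (u s x) (u t x) < d" using elim h(2)[of n] t by (intro e(2)) (auto simp: dist_real_def)
        then show "\<bar>u s x - u t x\<bar> \<le> d" by (simp add: dist_real_def)
      qed
    qed
  qed
  have a_lim: "(\<lambda>n. steklov (h n) t x) \<longlonglongrightarrow> u t x" and r_lim: "(\<lambda>n. fluctuation (h n) t x) \<longlonglongrightarrow> 0"
    if t: "0 \<le> t" "t \<le> \<tau>" and x: "x \<in> \<Omega>" for t x
  proof -
    have hT: "t + h n \<le> T" for n using h(2)[of n] t by linarith
    show "(\<lambda>n. steklov (h n) t x) \<longlonglongrightarrow> u t x"
    proof (rule tendstoI)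
      fix e :: real assume e: "e > 0"
      then have "e / 2 > 0" by simp
      from small[OF t x this] show "\<forall>\<^sub>F n in sequentially. dist (steklov (h n) t x) (u t x) < e"
      proof eventually_elim
        case (elim n)
        have "\<bar>steklov (h n) t x - u t x\<bar> \<le> e / 2" by (rule steklov_close(1)[OF h(1) t(1) hT x]) (use elim in blast)
        then show ?case using e by (simp add: dist_real_def)
      qed
    qed
    show "(\<lambda>n. fluctuation (h n) t x) \<longlonglongrightarrow> 0"
    proof (rule tendstoI)
      fix e :: real assume e: "e > 0"
      define d where "d = sqrt (e / 2) / 2"
      have d: "d > 0" "(2 * d)\<^sup>2 = e / 2" using e by (auto simp: d_def)
      from small[OF t x d(1)] show "\<forall>\<^sub>F n in sequentially. dist (fluctuation (h n) t x) 0 < e"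
      proof eventually_elim
        case (elim n)
        have "0 \<le> fluctuation (h n) t x" "fluctuation (h n) t x \<le> (2 * d)\<^sup>2"
          using steklov_close(2,3)[OF h(1) t(1) hT x, where d = d] elim by blast+
        then show ?case using e d(2) by (simp add: dist_real_def)
      qed
    qed
  qed
  have Yl: "(\<lambda>n. LINT x|M. (deficit (h n) t x) ^ 3 / 3) \<longlonglongrightarrow> (LINT x|M. (max 0 (barrier t - u t x)) ^ 3 / 3)"
    if t: "0 \<le> t" "t \<le> \<tau>" for t
  proof (rule integral_dominated_convergence[where w = "\<lambda>x. b ^ 3 / 3"])
    have hT: "t + h n \<le> T" for n using h(2)[of n] t by linarith
    have tT: "t \<in> {0..T}" using t \<tau> by auto
    show "AE x in M. (\<lambda>n. (deficit (h n) t x) ^ 3 / 3) \<longlonglongrightarrow> (max 0 (barrier t - u t x)) ^ 3 / 3"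
      unfolding deficit_def using a_lim[OF t] by (intro AE_I2 tendsto_intros) auto
    show "AE x in M. norm ((deficit (h n) t x) ^ 3 / 3) \<le> b ^ 3 / 3" for n
      using deficit_bounds[OF h(1) t(1) hT] by (intro AE_I2) (auto intro!: power_mono divide_right_mono)
    have [measurable]: "u t \<in> borel_measurable M" by (rule u_time_section) (use tT in simp)
    show "(\<lambda>x. (max 0 (barrier t - u t x)) ^ 3 / 3) \<in> borel_measurable M" by measurable
    fix n
    have "t \<in> space (lebesgue_on {0..T})" using tT by simp
    from measurable_compose[OF measurable_Pair1'[OF this] steklov_pair_measurable] have [measurable]: "steklov (h n) t \<in> borel_measurable M" by simp
    show "(\<lambda>x. (deficit (h n) t x) ^ 3 / 3) \<in> borel_measurable M" unfolding deficit_def by measurable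
  qed simp
  have Rl: "(\<lambda>n. LINT p|(lebesgue_on {0..\<tau>} \<Otimes>\<^sub>M M). fluctuation (h n) (fst p) (snd p)) \<longlonglongrightarrow> (LINT p|(lebesgue_on {0..\<tau>} \<Otimes>\<^sub>M M). 0)"
  proof (rule integral_dominated_convergence[where w = "\<lambda>p. C\<^sup>2"])
    interpret JP: finite_measure "lebesgue_on {0..\<tau>} \<Otimes>\<^sub>M M"
      by (rule finite_measure_pair_measure[OF finite_measure_axioms finite_measure_lebesgue_on]) auto
    show "integrable (lebesgue_on {0..\<tau>} \<Otimes>\<^sub>M M) (\<lambda>p. C\<^sup>2)" by simp
    show "AE p in lebesgue_on {0..\<tau>} \<Otimes>\<^sub>M M. (\<lambda>n. fluctuation (h n) (fst p) (snd p)) \<longlonglongrightarrow> 0"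
      by (rule AE_I2, rule r_lim) (auto simp: space_pair_measure)
    show "AE p in lebesgue_on {0..\<tau>} \<Otimes>\<^sub>M M. norm (fluctuation (h n) (fst p) (snd p)) \<le> C\<^sup>2" for n
    proof (rule AE_I2)
      fix p assume "p \<in> space (lebesgue_on {0..\<tau>} \<Otimes>\<^sub>M M)"
      then have p: "0 \<le> fst p" "fst p \<le> \<tau>" "snd p \<in> \<Omega>" by (auto simp: space_pair_measure)
      then have "fst p + h n \<le> T" using h(2)[of n] by linarith
      from fluctuation_bounded[OF h(1) p(1) this p(3)] show "norm (fluctuation (h n) (fst p) (snd p)) \<le> C\<^sup>2" by simp
    qed
  qed (auto intro: fluctuation_pair_measurable)
  have lim: "(\<lambda>n. (LINT x|M. (deficit (h n) 0 x) ^ 3 / 3)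
      + b * L\<^sup>2 / (2 * \<sigma>\<^sup>2) * (LINT p|(lebesgue_on {0..\<tau>} \<Otimes>\<^sub>M M). fluctuation (h n) (fst p) (snd p)))
    \<longlonglongrightarrow> (LINT x|M. (max 0 (barrier 0 - u 0 x)) ^ 3 / 3) + b * L\<^sup>2 / (2 * \<sigma>\<^sup>2) * (LINT p|(lebesgue_on {0..\<tau>} \<Otimes>\<^sub>M M). 0)"
    by (intro tendsto_add tendsto_mult_left Yl Rl) (use \<tau> in auto)
  have start: "(LINT x|M. (max 0 (barrier 0 - u 0 x)) ^ 3 / 3) = (LINT x|M. 0)"
  proof (rule Bochner_Integration.integral_cong[OF refl])
    fix x assume "x \<in> space M"
    then have "max 0 (barrier 0 - u 0 x) = 0" using initial[of x] by (simp add: barrier_def)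
    then show "(max 0 (barrier 0 - u 0 x)) ^ 3 / 3 = 0" by simp
  qed
  have "(LINT x|M. (max 0 (barrier \<tau> - u \<tau> x)) ^ 3 / 3)
     \<le> (LINT x|M. (max 0 (barrier 0 - u 0 x)) ^ 3 / 3) + b * L\<^sup>2 / (2 * \<sigma>\<^sup>2) * (LINT p|(lebesgue_on {0..\<tau>} \<Otimes>\<^sub>M M). 0)"
    by (rule LIMSEQ_le[OF Yl[OF \<tau>(1) order_refl] lim]) (use energy_inequality[OF h(1) \<tau>(1) h(2)] in blast)
  also have "\<dots> = 0" unfolding start by simp
  finally have le: "(LINT x|M. (max 0 (barrier \<tau> - u \<tau> x)) ^ 3 / 3) \<le> 0" .
  have \<tau>T: "\<tau> \<in> {0..T}" using \<tau> by auto
  have [measurable]: "u \<tau> \<in> borel_measurable M" by (rule u_time_section) (use \<tau>T in simp)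
  have i: "integrable M (\<lambda>x. (max 0 (barrier \<tau> - u \<tau> x)) ^ 3 / 3)"
  proof (rule integrable_bounded[where C = "b ^ 3 / 3"])
    show "AE x in M. norm ((max 0 (barrier \<tau> - u \<tau> x)) ^ 3 / 3) \<le> b ^ 3 / 3"
    proof (rule AE_I2)
      fix x assume "x \<in> space M"
      then have "0 \<le> u \<tau> x" using u_bounds[of \<tau> x] \<tau>T by simp
      then have "max 0 (barrier \<tau> - u \<tau> x) \<le> b" using barrier_le[OF \<tau>(1)] b by auto
      then show "norm ((max 0 (barrier \<tau> - u \<tau> x)) ^ 3 / 3) \<le> b ^ 3 / 3"
        by (auto intro!: power_mono divide_right_mono)
    qed
  qed measurable
  have "(LINT x|M. (max 0 (barrier \<tau> - u \<tau> x)) ^ 3 / 3) = 0"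
    using le by (intro antisym Bochner_Integration.integral_nonneg) auto
  then have "AE x in M. (max 0 (barrier \<tau> - u \<tau> x)) ^ 3 / 3 = 0"
    by (subst (asm) integral_nonneg_eq_0_iff_AE[OF i]) auto
  then have ae: "AE x in M. u \<tau> x \<in> {barrier \<tau>..}"
    by eventually_elim (auto simp: max_def split: if_splits)
  have "continuous_on \<Omega> (u \<tau>)"
    by (rule continuous_on_compose2[OF u_continuous, of _ "\<lambda>x. (\<tau>, x)", simplified]) (use \<tau>T in \<open>auto intro!: continuous_intros\<close>)
  from AE_continuous_imp_everywhere[OF open_Omega this closed_atLeast ae x0] show ?thesis by simp
qed

lemma above_barrier:
  assumes t: "t \<in> {0..T}" and x: "x \<in> \<Omega>"
  shows "b * exp (- \<Lambda> * t) \<le> u t x"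
proof -
  have c: "continuous_on (closure {0<..<T}) (\<lambda>t. u t x - barrier t)"
    using u_continuous_time[OF x] T by (auto intro!: continuous_on_diff barrier_continuous simp: closure_greaterThanLessThan)
  have "0 \<le> u t x - barrier t"
    by (rule continuous_ge_on_closure[OF c]) (use t T above_barrier_before_end[OF _ _ x] in \<open>auto simp: closure_greaterThanLessThan\<close>)
  then show ?thesis by (simp add: barrier_def)
qed

end

section \<open>The lower bound for weak solutions\<close>

lemma time_Lp_infinity_AE:
  assumes v: "v \<in> time_Lp \<infinity> T X N" and K: "time_Lp_norm \<infinity> T N v \<le> K"
  shows "AE t in lebesgue_on {0..T}. v t \<in> X \<and> N (v t) \<le> K"
proof -
  have "AE t in lebesgue_on {0..T}. v t \<in> X" and "(\<lambda>t. N (v t)) \<in> Lp_space \<infinity> (lebesgue_on {0..T})"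
    using v by (auto simp: time_Lp_def)
  from this(1) Lp_space_infinity_AE[OF this(2)] show ?thesis
    by eventually_elim (use K in \<open>auto simp: time_Lp_norm_def\<close>)
qed

context bounded_open_set
begin

lemma weak_gradient_cong:
  assumes w: "weak_gradient f V" and eq: "AE x in M. V x = W x"
  shows "weak_gradient f W"
proof -
  have "(LINT x|M. \<psi> x *\<^sub>R V x) = (LINT x|M. \<psi> x *\<^sub>R W x)" for \<psi>
    by (rule integral_AE_cong_lebesgue[OF Omega_lebesgue]) (use eq in eventually_elim, simp)
  then show ?thesis
    using w integrable_AE_cong_lebesgue[OF Omega_lebesgue _ eq] by (auto simp: weak_gradient_def)
qed

lemma square_integrable_gradient_on_product:
  assumes v: "v \<in> bochner_Lp 2 T (H_space 1 \<Omega>) (sobolev_norm 1 2 \<Omega>)"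
    and U: "U \<in> borel_measurable (lebesgue_on {0..T} \<Otimes>\<^sub>M M)"
      "AE t in lebesgue_on {0..T}. AE x in M. U (t, x) = wgrad \<Omega> (v t) x"
  shows "integrable (lebesgue_on {0..T} \<Otimes>\<^sub>M M) (\<lambda>p. (norm (U p))\<^sup>2)"
proof -
  interpret I: finite_measure "lebesgue_on {0..T}" by (rule finite_measure_lebesgue_on) auto
  interpret IM: pair_sigma_finite "lebesgue_on {0..T}" M ..
  note [measurable] = U(1)
  have vt: "AE t in lebesgue_on {0..T}. v t \<in> H_space 1 \<Omega>"
    and sq: "integrable (lebesgue_on {0..T}) (\<lambda>t. (sobolev_norm 1 2 \<Omega> (v t))\<^sup>2)"
    using v by (auto simp: bochner_Lp_def time_Lp_def Lp_space_2_iff)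
  have fibre: "AE t in lebesgue_on {0..T}. integrable M (\<lambda>x. (norm (U (t, x)))\<^sup>2) \<and>
      (LINT x|M. (norm (U (t, x)))\<^sup>2) \<le> (sobolev_norm 1 2 \<Omega> (v t))\<^sup>2"
    using vt U(2)
  proof eventually_elim
    case (elim t)
    have eq: "AE x in M. (norm (wgrad \<Omega> (v t) x))\<^sup>2 = (norm (U (t, x)))\<^sup>2"
      using elim(2) by eventually_elim simp
    have "integrable M (\<lambda>x. (norm (U (t, x)))\<^sup>2)"
      by (rule integrable_AE_cong_lebesgue[OF Omega_lebesgue H_space_gradient(3)[OF elim(1) order_refl] eq])
    moreover have "(LINT x|M. (norm (wgrad \<Omega> (v t) x))\<^sup>2) \<le> (sobolev_norm 1 2 \<Omega> (v t))\<^sup>2"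
      by (rule sqrt_le_D[OF H_space_gradient(4)[OF elim(1) order_refl]])
    ultimately show ?case
      using integral_AE_cong_lebesgue[OF Omega_lebesgue eq] by simp
  qed
  show ?thesis
  proof (rule IM.Fubini_integrable)
    show "AE t in lebesgue_on {0..T}. integrable M (\<lambda>x. (norm (U (t, x)))\<^sup>2)"
      using fibre by eventually_elim simp
    show "integrable (lebesgue_on {0..T}) (\<lambda>t. LINT x|M. norm ((norm (U (t, x)))\<^sup>2))"
    proof (rule Bochner_Integration.integrable_bound[OF sq])
      show "(\<lambda>t. LINT x|M. norm ((norm (U (t, x)))\<^sup>2)) \<in> borel_measurable (lebesgue_on {0..T})"
        by measurable
      show "AE t in lebesgue_on {0..T}. norm (LINT x|M. norm ((norm (U (t, x)))\<^sup>2)) \<le> norm ((sobolev_norm 1 2 \<Omega> (v t))\<^sup>2)"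
        using fibre by eventually_elim (simp add: abs_of_nonneg)
    qed
  qed measurable
qed

lemma AE_bound_on_product:
  fixes U :: "real \<times> 'a \<Rightarrow> 'a"
  assumes U: "U \<in> borel_measurable (lebesgue_on {0..T} \<Otimes>\<^sub>M M)"
    and ae: "AE t in lebesgue_on {0..T}. AE x in M. norm (U (t, x)) \<le> (L :: real)"
  shows "AE p in lebesgue_on {0..T} \<Otimes>\<^sub>M M. norm (U p) \<le> L"
proof -
  interpret I: finite_measure "lebesgue_on {0..T}" by (rule finite_measure_lebesgue_on) auto
  interpret IM: pair_sigma_finite "lebesgue_on {0..T}" M ..
  note [measurable] = U
  show ?thesis
    by (rule IM.AE_pair_measure) (use ae in auto)
qed

text \<open>A weak solution with bounds \<open>C\<close> on \<open>u\<close> and \<open>L\<close> on the gradient of \<open>\<phi>\<close> satisfies the hypotheses of the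
comparison argument. The decay rate \<open>(K \<cdot> L + C) / a\<close> is the one of \<open>elliptic_gradient_inequality\<close>, with
\<open>K\<close> bounding the gradient of \<open>\<alpha>\<close>.\<close>

lemma weak_solution_lower_bound:
  fixes u \<phi> :: "real \<Rightarrow> 'a \<Rightarrow> real" and \<sigma> a b C K L T :: real
  assumes pos: "T > 0" "\<sigma> > 0" "a > 0" "b > 0" "C \<ge> 0" "K \<ge> 0" "L \<ge> 0" and l: "l \<ge> 1"
    and \<alpha>: "\<alpha> \<in> admissible_set \<Omega> a K l"
    and sol: "weak_solution \<Omega> \<sigma> \<alpha> u\<^sub>0 T u \<phi>" and cont: "continuous_on ({0..T} \<times> \<Omega>) (\<lambda>(t, x). u t x)"
    and u_infinity: "AE t in lebesgue_on {0..T}. u t \<in> Lp_space \<infinity> M \<and> Lp_norm \<infinity> M (u t) \<le> C"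
    and \<phi>_infinity: "AE t in lebesgue_on {0..T}. \<phi> t \<in> sobolev 1 \<infinity> \<Omega> \<and> sobolev_norm 1 \<infinity> \<Omega> (\<phi> t) \<le> L"
    and u0: "continuous_on \<Omega> u\<^sub>0" "\<And>x. x \<in> \<Omega> \<Longrightarrow> b \<le> u\<^sub>0 x \<and> u\<^sub>0 x \<le> B"
    and t: "t \<in> {0..T}" and x: "x \<in> \<Omega>"
  shows "b * exp (- (1 / a * (K * L + C)) * t) \<le> u t x"
proof -
  define I where "I = lebesgue_on {0..T}"
  have Is: "{0..T} \<in> sets lebesgue" by simp
  interpret I: finite_measure I unfolding I_def by (rule finite_measure_lebesgue_on) auto
  interpret IM: pair_sigma_finite I M ..
  have space_I: "space I = {0..T}" by (simp add: I_def)
  from sol have u_H1: "u \<in> bochner_Lp 2 T (H_space 1 \<Omega>) (sobolev_norm 1 2 \<Omega>)"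
    and \<phi>_H2: "\<phi> \<in> bochner_Lp \<infinity> T (H_space 2 \<Omega>) (sobolev_norm 2 2 \<Omega>)"
    and u_nonneg: "AE t in I. AE x in M. 0 \<le> u t x"
    and \<phi>_eq: "AE t in I. \<phi> t \<in> H10 \<Omega> \<and>
        (\<forall>w\<in>H10 \<Omega>. (LINT x|M. \<alpha> x * (wgrad \<Omega> (\<phi> t) x \<bullet> wgrad \<Omega> w x)) = (LINT x|M. u t x * w x))"
    and u_eq: "\<And>w \<eta>. w \<in> H_space 1 \<Omega> \<Longrightarrow> smooth_on UNIV \<eta> \<Longrightarrow> \<exists>s<T. \<forall>t\<ge>s. \<eta> t = 0 \<Longrightarrow>
        - (LINT t|I. (LINT x|M. u t x * w x) * deriv \<eta> t)
        + (LINT t|I. (LINT x|M. (\<sigma>\<^sup>2 *\<^sub>R wgrad \<Omega> (u t) x + u t x *\<^sub>R wgrad \<Omega> (\<phi> t) x) \<bullet> wgrad \<Omega> w x) * \<eta> t)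
        = (LINT x|M. u\<^sub>0 x * w x) * \<eta> 0"
    unfolding weak_solution_def I_def by auto
  have u_ae: "AE t in I. AE x in M. u t x \<in> {0..C}"
    using u_infinity[folded I_def] u_nonneg
  proof eventually_elim
    case (elim t)
    from Lp_space_infinity_AE[of "u t" M] elim have "AE x in M. \<bar>u t x\<bar> \<le> Lp_norm \<infinity> M (u t)" by blast
    with elim(2) show ?case by eventually_elim (use elim(1) in auto)
  qed
  have u_bounds: "0 \<le> u s y \<and> u s y \<le> C" if "s \<in> {0..T}" "y \<in> \<Omega>" for s y
    using AE_in_closed_imp_everywhere[OF pos(1) open_Omega cont closed_atLeastAtMost u_ae[unfolded I_def] that] by simp
  have cont_s: "continuous_on \<Omega> (u s)" if "s \<in> {0..T}" for s
    by (rule continuous_on_compose2[OF cont, of _ "\<lambda>x. (s, x)", simplified]) (use that in \<open>auto intro!: continuous_intros\<close>)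
  have u_measurable: "u s \<in> borel_measurable M" if "s \<in> {0..T}" for s
    by (rule continuous_imp_measurable_on_sets_lebesgue[OF cont_s[OF that] Omega_lebesgue])
  have u_joint: "(\<lambda>p. u (fst p) (snd p)) \<in> borel_measurable (I \<Otimes>\<^sub>M M)"
    unfolding I_def using continuous_on_Times_measurable[OF _ _ cont] open_Omega by (simp add: case_prod_beta')
  obtain U where U: "U \<in> borel_measurable (I \<Otimes>\<^sub>M M)" "AE t in I. AE x in M. U (t, x) = wgrad \<Omega> (u t) x"
    using jointly_measurable_gradient[OF u_H1 order_refl] unfolding I_def by blast
  obtain \<Phi> where \<Phi>: "\<Phi> \<in> borel_measurable (I \<Otimes>\<^sub>M M)" "AE t in I. AE x in M. \<Phi> (t, x) = wgrad \<Omega> (\<phi> t) x"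
    using jointly_measurable_gradient[OF \<phi>_H2] unfolding I_def by auto
  have U_square: "integrable (I \<Otimes>\<^sub>M M) (\<lambda>p. (norm (U p))\<^sup>2)"
    using square_integrable_gradient_on_product[OF u_H1] U unfolding I_def by blast
  have u_gradient: "AE t in I. weak_gradient (u t) (\<lambda>x. U (t, x))"
  proof -
    have "AE t in I. u t \<in> H_space 1 \<Omega>" using u_H1 unfolding bochner_Lp_def time_Lp_def I_def by blast
    then show ?thesis using U(2)
    proof eventually_elim
      case (elim t)
      have "AE x in M. wgrad \<Omega> (u t) x = U (t, x)" using elim(2) by eventually_elim simp
      then show ?case by (rule weak_gradient_cong[OF H_space_gradient(1)[OF elim(1) order_refl]])
    qed
  qed
  have \<phi>_bound: "AE t in I. AE x in M. norm (wgrad \<Omega> (\<phi> t) x) \<le> L"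
    using \<phi>_infinity[folded I_def]
  proof eventually_elim
    case (elim t)
    then have "AE x in M. norm (wgrad \<Omega> (\<phi> t) x) \<le> sobolev_norm 1 \<infinity> \<Omega> (\<phi> t)"
      using sobolev_infinity_gradient(2)[of "\<phi> t" 1] by simp
    then show ?case by eventually_elim (use elim in auto)
  qed
  have "AE t in I. AE x in M. norm (\<Phi> (t, x)) \<le> L"
    using \<phi>_bound \<Phi>(2)
  proof eventually_elim
    case (elim t)
    then show ?case by eventually_elim simp
  qed
  then have \<Phi>_bound: "AE p in I \<Otimes>\<^sub>M M. norm (\<Phi> p) \<le> L"
    using AE_bound_on_product \<Phi>(1) unfolding I_def by blast
  have evo: "evolution \<Omega> I u U C"
    using bounded_open_set_axioms I.finite_measure_axioms u_joint u_bounds U(1) U_square u_gradient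
    unfolding evolution_def evolution_axioms_def space_I by blast
  interpret E: evolution \<Omega> I u U C by (rule evo)

  have \<alpha>_sob: "\<alpha> \<in> sobolev l \<infinity> \<Omega>" "AE x in M. a \<le> \<alpha> x" "sobolev_norm l \<infinity> \<Omega> \<alpha> \<le> K"
    using \<alpha> by (auto simp: admissible_set_def)
  obtain B\<alpha> where B\<alpha>: "AE x in M. \<bar>\<alpha> x\<bar> \<le> B\<alpha>" using sobolev_infinity_gradient(3)[OF \<alpha>_sob(1) l] by blast
  have \<alpha>_grad: "AE x in M. norm (wgrad \<Omega> \<alpha> x) \<le> K"
    using sobolev_infinity_gradient(2)[OF \<alpha>_sob(1) l] by eventually_elim (use \<alpha>_sob(3) in auto)
  have space_ae: "AE t in I. t \<in> {0..T}" by (rule AE_I2) (simp add: space_I)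
  have elliptic: "AE s in I. \<forall>g W Bg. weak_gradient g W \<longrightarrow> (AE x in M. 0 \<le> g x \<and> g x \<le> Bg) \<longrightarrow>
      (LINT x|M. \<Phi> (s, x) \<bullet> W x) \<le> 1 / a * (K * L + C) * (LINT x|M. g x)"
    using space_ae \<phi>_eq \<phi>_bound \<Phi>(2)
  proof eventually_elim
    case (elim s)
    show ?case
    proof (intro allI impI)
      fix g W Bg assume g: "weak_gradient g W" "AE x in M. 0 \<le> g x \<and> g x \<le> Bg"
      have us: "AE x in M. 0 \<le> u s x \<and> u s x \<le> C" by (rule AE_I2) (use u_bounds elim(1) in auto)
      have eq: "(LINT x|M. \<alpha> x * (wgrad \<Omega> (\<phi> s) x \<bullet> wgrad \<Omega> w x)) = (LINT x|M. u s x * w x)" if "w \<in> H10 \<Omega>" for w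
        using elim(2) that by blast
      have "(LINT x|M. \<Phi> (s, x) \<bullet> W x) = (LINT x|M. wgrad \<Omega> (\<phi> s) x \<bullet> W x)"
        by (rule integral_AE_cong_lebesgue[OF Omega_lebesgue]) (use elim(4) in eventually_elim, simp)
      also have "\<dots> \<le> 1 / a * (K * L + C) * (LINT x|M. g x)"
        by (rule elliptic_gradient_inequality[OF pos(3) sobolev_infinity_gradient(1)[OF \<alpha>_sob(1) l] \<alpha>_sob(2) B\<alpha> \<alpha>_grad
              u_measurable[OF elim(1)] us conjunct1[OF elim(2)] elim(3) eq g pos(7,6,5)])
      finally show "(LINT x|M. \<Phi> (s, x) \<bullet> W x) \<le> 1 / a * (K * L + C) * (LINT x|M. g x)" .
    qed
  qed

  \<comment> \<open>the flux is integrable in time because it is expressed by jointly measurable representatives\<close>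
  have balance: "(LINT x|M. u t x * w x) + (LINT s|I. indicator {0..t} s *
        (LINT x|M. (\<sigma>\<^sup>2 *\<^sub>R U (s, x) + u s x *\<^sub>R \<Phi> (s, x)) \<bullet> wgrad \<Omega> w x)) = (LINT x|M. u\<^sub>0 x * w x)"
    if w: "w \<in> H_space 1 \<Omega>" and t: "t \<in> {0..T}" for w t
    unfolding I_def
  proof (rule weak_ode_integrated[OF pos(1) _ _ _ t])
    note w_grad = H_space_gradient[OF w order_refl]
    have wi: "integrable M w" by (rule weak_gradientD(1)[OF w_grad(1)])
    have Wm: "wgrad \<Omega> w \<in> borel_measurable M" using weak_gradientD(2)[OF w_grad(1)] by simp
    show "continuous_on {0..T} (\<lambda>t. LINT x|M. u t x * w x)"
      unfolding continuous_on_sequentially comp_def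
    proof (intro allI ballI impI)
      fix s :: "nat \<Rightarrow> real" and r assume r: "r \<in> {0..T}" and s: "(\<forall>n. s n \<in> {0..T}) \<and> s \<longlonglongrightarrow> r"
      show "(\<lambda>n. LINT x|M. u (s n) x * w x) \<longlonglongrightarrow> (LINT x|M. u r x * w x)"
      proof (rule integral_dominated_convergence[where w = "\<lambda>x. C * norm (w x)"])
        show "integrable M (\<lambda>x. C * norm (w x))" using wi by simp
        show "AE x in M. (\<lambda>n. u (s n) x * w x) \<longlonglongrightarrow> u r x * w x"
        proof (rule AE_I2)
          fix x assume x: "x \<in> space M"
          have "(\<lambda>n. (\<lambda>(t, x). u t x) (s n, x)) \<longlonglongrightarrow> (\<lambda>(t, x). u t x) (r, x)"
            by (rule continuous_on_tendsto_compose[OF cont]) (use r s x in \<open>auto intro!: tendsto_intros\<close>)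
          then show "(\<lambda>n. u (s n) x * w x) \<longlonglongrightarrow> u r x * w x" by (intro tendsto_mult_right) simp
        qed
        show "AE x in M. norm (u (s n) x * w x) \<le> C * norm (w x)" for n
        proof (rule AE_I2)
          fix x assume "x \<in> space M"
          then have "0 \<le> u (s n) x \<and> u (s n) x \<le> C" using u_bounds s by simp
          then show "norm (u (s n) x * w x) \<le> C * norm (w x)" by (simp add: abs_mult mult_right_mono)
        qed
      qed (use u_measurable r s wi in auto)
    qed
    show "integrable (lebesgue_on {0..T}) (\<lambda>s. LINT x|M. (\<sigma>\<^sup>2 *\<^sub>R U (s, x) + u s x *\<^sub>R \<Phi> (s, x)) \<bullet> wgrad \<Omega> w x)"
      using IM.integrable_fst'[OF E.flux_integrable[OF Wm w_grad(3) \<Phi>(1) \<Phi>_bound, of "\<sigma>\<^sup>2"]] by (simp add: I_def)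
    fix \<eta> :: "real \<Rightarrow> real" assume \<eta>: "smooth_on UNIV \<eta>" "\<exists>s<T. \<forall>t\<ge>s. \<eta> t = 0"
    have "AE s in I. (LINT x|M. (\<sigma>\<^sup>2 *\<^sub>R U (s, x) + u s x *\<^sub>R \<Phi> (s, x)) \<bullet> wgrad \<Omega> w x) * \<eta> s
        = (LINT x|M. (\<sigma>\<^sup>2 *\<^sub>R wgrad \<Omega> (u s) x + u s x *\<^sub>R wgrad \<Omega> (\<phi> s) x) \<bullet> wgrad \<Omega> w x) * \<eta> s"
      using U(2) \<Phi>(2)
    proof eventually_elim
      case (elim s)
      have "AE x in M. (\<sigma>\<^sup>2 *\<^sub>R U (s, x) + u s x *\<^sub>R \<Phi> (s, x)) \<bullet> wgrad \<Omega> w x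
          = (\<sigma>\<^sup>2 *\<^sub>R wgrad \<Omega> (u s) x + u s x *\<^sub>R wgrad \<Omega> (\<phi> s) x) \<bullet> wgrad \<Omega> w x"
        using elim by eventually_elim simp
      from integral_AE_cong_lebesgue[OF Omega_lebesgue this] show ?case by simp
    qed
    from integral_AE_cong_lebesgue[OF Is this[unfolded I_def]]
    show "- (LINT t|lebesgue_on {0..T}. (LINT x|M. u t x * w x) * deriv \<eta> t)
        + (LINT t|lebesgue_on {0..T}. (LINT x|M. (\<sigma>\<^sup>2 *\<^sub>R U (t, x) + u t x *\<^sub>R \<Phi> (t, x)) \<bullet> wgrad \<Omega> w x) * \<eta> t)
        = (LINT x|M. u\<^sub>0 x * w x) * \<eta> 0"
      using u_eq[OF w \<eta>] by (simp add: I_def)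
  qed

  have initial: "b \<le> u 0 x" if x: "x \<in> \<Omega>" for x
  proof -
    have T0: "0 \<in> {0..T}" using pos(1) by simp
    have u0m: "u\<^sub>0 \<in> borel_measurable M"
      by (rule continuous_imp_measurable_on_sets_lebesgue[OF u0(1) Omega_lebesgue])
    have "AE x in M. norm (u\<^sub>0 x) \<le> B" by (rule AE_I2) (use u0(2) pos(4) in force)
    from integrable_bounded[OF u0m this] have u0i: "integrable M u\<^sub>0" .
    have "AE x in M. norm (u 0 x) \<le> C" by (rule AE_I2) (use u_bounds[OF T0] in auto)
    from integrable_bounded[OF u_measurable[OF T0] this] have ui: "integrable M (u 0)" .
    \<comment> \<open>at time \<open>0\<close> the flux term of the balance law is an integral over a null set\<close>
    have "(LINT x|M. (u 0 x - u\<^sub>0 x) * \<zeta> x) = 0" if z: "\<zeta> \<in> test_functions \<Omega>" for \<zeta>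
    proof -
      have "AE s in I. indicator {0..0} s *
          (LINT x|M. (\<sigma>\<^sup>2 *\<^sub>R U (s, x) + u s x *\<^sub>R \<Phi> (s, x)) \<bullet> wgrad \<Omega> \<zeta> x) = 0"
      proof -
        have "AE s in lebesgue. s \<noteq> (0::real)"
          by (rule AE_completion) (rule AE_lborel_singleton)
        then have "AE s in I. s \<noteq> 0" unfolding I_def by (subst AE_restrict_space_iff) auto
        then show ?thesis by eventually_elim (auto simp: indicator_def)
      qed
      from integral_AE_cong_lebesgue[OF Is this[unfolded I_def]]
      have "(LINT s|I. indicator {0..0} s *
          (LINT x|M. (\<sigma>\<^sup>2 *\<^sub>R U (s, x) + u s x *\<^sub>R \<Phi> (s, x)) \<bullet> wgrad \<Omega> \<zeta> x)) = 0"
        by (simp add: I_def)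
      with balance[OF test_function_H1(1)[OF z test_function_C1_test[OF z]] T0]
      have "(LINT x|M. u 0 x * \<zeta> x) = (LINT x|M. u\<^sub>0 x * \<zeta> x)" by linarith
      then show ?thesis
        using integral_locally_integrable_test[OF locally_integrableI[OF ui] z]
          integral_locally_integrable_test[OF locally_integrableI[OF u0i] z]
        by (simp add: left_diff_distrib)
    qed
    from orthogonal_to_test_functions[OF locally_integrableI this] ui u0i
    have "AE x in M. u 0 x - u\<^sub>0 x = 0" by simp
    moreover have "AE x in M. b \<le> u\<^sub>0 x" by (rule AE_I2) (use u0(2) in auto)
    ultimately have "AE x in M. u 0 x \<in> {b..}" by eventually_elim simp
    from AE_continuous_imp_everywhere[OF open_Omega cont_s[OF T0] closed_atLeast this x] show ?thesis by simp
  qed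

  have "time_evolution \<Omega> T u U C \<Phi> \<sigma> b (1 / a * (K * L + C)) L (\<lambda>w. LINT x|M. u\<^sub>0 x * w x)"
    unfolding time_evolution_def time_evolution_axioms_def
    using evo pos cont \<Phi>(1) \<Phi>_bound elliptic balance initial unfolding I_def by simp
  from time_evolution.above_barrier[OF this t x] show ?thesis .
qed

end

theorem proposition3p8:
  fixes \<Omega> :: "'a::euclidean_space set"
    and \<sigma> a b B M T Tstar Cinf \<Lambda>\<^sub>1 \<Lambda>\<^sub>2 c\<^sub>0 :: real
    and l :: nat
    and u\<^sub>0 :: "'a \<Rightarrow> real"
  assumes "DIM('a) \<in> {1, 2, 3}"
    and "open \<Omega>" and "connected \<Omega>" and "\<Omega> \<noteq> {}" and "bounded \<Omega>" and "smooth_boundary \<Omega>"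
    and "\<sigma> > 0" and "a > 0" and "b > 0" and "B > 0" and "M > 0" and "l \<ge> 4"
    and "smooth_up_to_boundary \<Omega> u\<^sub>0"
    and "\<forall>x\<in>closure \<Omega>. b \<le> u\<^sub>0 x \<and> u\<^sub>0 x \<le> B"
    and "Lp_norm 1 (lebesgue_on \<Omega>) u\<^sub>0 = 1"
    and "existence_time \<Omega> \<sigma> a M l u\<^sub>0 Tstar" and "0 < T" and "T \<le> Tstar"
    and "Cinf > 0" and "\<Lambda>\<^sub>1 > 0" and "uniform_bounds \<Omega> \<sigma> a M l u\<^sub>0 T Cinf \<Lambda>\<^sub>1"
    and "\<Lambda>\<^sub>2 = 1 / a * (M * \<Lambda>\<^sub>1 + Cinf)"
    and "c\<^sub>0 = b * exp (- \<Lambda>\<^sub>2 * T)"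
  shows "c\<^sub>0 > 0 \<and>
    (\<forall>\<alpha>\<in>admissible_set \<Omega> a M l. \<forall>u \<phi>.
       weak_solution \<Omega> \<sigma> \<alpha> u\<^sub>0 T u \<phi> \<and> continuous_on ({0..T} \<times> \<Omega>) (\<lambda>(t, x). u t x) \<longrightarrow>
       (\<forall>x\<in>\<Omega>. \<forall>t\<in>{0..T}. u t x \<ge> c\<^sub>0))"
proof (intro conjI ballI allI impI)
  show "c\<^sub>0 > 0" using \<open>b > 0\<close> \<open>c\<^sub>0 = _\<close> by simp
  interpret bounded_open_set \<Omega> by unfold_locales (fact \<open>open \<Omega>\<close> \<open>bounded \<Omega>\<close>)+
  fix \<alpha> u \<phi> x t
  assume \<alpha>: "\<alpha> \<in> admissible_set \<Omega> a M l"
    and "weak_solution \<Omega> \<sigma> \<alpha> u\<^sub>0 T u \<phi> \<and> continuous_on ({0..T} \<times> \<Omega>) (\<lambda>(t, x). u t x)"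
    and x: "x \<in> \<Omega>" and t: "t \<in> {0..T}"
  then have sol: "weak_solution \<Omega> \<sigma> \<alpha> u\<^sub>0 T u \<phi>" and cont: "continuous_on ({0..T} \<times> \<Omega>) (\<lambda>(t, x). u t x)"
    by auto
  note bounds = \<open>uniform_bounds \<Omega> \<sigma> a M l u\<^sub>0 T Cinf \<Lambda>\<^sub>1\<close>[unfolded uniform_bounds_def, rule_format, OF \<alpha> sol]
  have ub: "AE t in lebesgue_on {0..T}. u t \<in> Lp_space \<infinity> (lebesgue_on \<Omega>) \<and> Lp_norm \<infinity> (lebesgue_on \<Omega>) (u t) \<le> Cinf"
    by (rule time_Lp_infinity_AE) (use bounds in blast)+
  have \<phi>b: "AE t in lebesgue_on {0..T}. \<phi> t \<in> sobolev 1 \<infinity> \<Omega> \<and> sobolev_norm 1 \<infinity> \<Omega> (\<phi> t) \<le> \<Lambda>\<^sub>1"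
    by (rule time_Lp_infinity_AE) (use bounds in blast)+
  have u0: "continuous_on \<Omega> u\<^sub>0" "\<And>x. x \<in> \<Omega> \<Longrightarrow> b \<le> u\<^sub>0 x \<and> u\<^sub>0 x \<le> B"
    using \<open>smooth_up_to_boundary \<Omega> u\<^sub>0\<close> \<open>\<forall>x\<in>closure \<Omega>. b \<le> u\<^sub>0 x \<and> u\<^sub>0 x \<le> B\<close> closure_subset[of \<Omega>]
    by (auto simp: smooth_up_to_boundary_def intro: continuous_on_subset)
  have nn: "0 \<le> \<Lambda>\<^sub>2" unfolding \<open>\<Lambda>\<^sub>2 = _\<close> using \<open>a > 0\<close> \<open>M > 0\<close> \<open>\<Lambda>\<^sub>1 > 0\<close> \<open>Cinf > 0\<close> by simp
  have "c\<^sub>0 \<le> b * exp (- \<Lambda>\<^sub>2 * t)"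
    unfolding \<open>c\<^sub>0 = _\<close> using nn t \<open>b > 0\<close> by (simp add: mult_left_mono)
  also have "\<dots> \<le> u t x"
    unfolding \<open>\<Lambda>\<^sub>2 = _\<close>
    by (rule weak_solution_lower_bound[OF _ _ _ _ _ _ _ _ \<alpha> sol cont ub \<phi>b u0 t x])
      (use \<open>0 < T\<close> \<open>\<sigma> > 0\<close> \<open>a > 0\<close> \<open>b > 0\<close> \<open>Cinf > 0\<close> \<open>M > 0\<close> \<open>\<Lambda>\<^sub>1 > 0\<close> \<open>l \<ge> 4\<close> in auto)
  finally show "u t x \<ge> c\<^sub>0" .
qed

end
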